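(* Let $\mathcal Q_I$ be the decorated quiver with frozen vertices $0$ (type $-$), $3$ (type $+$), unfrozen vertices $1,2$ and arrows $0\to1$ (label $1$), $1\to3$ (label $q_3$), $3\to2$ (label $1$), $2\to0$ (label $q_2^{-1}$), $1\to2$ (label $1$), $2\to1$ (label $q_1$). Let $\mathcal P_+:X_0\to X_1\to X_3$ and $\mathcal P_-:X_3\to X_2\to X_0$. The assignment $$(q-q^{-1})E(z)=\Sigma[\mathcal P_+](z),\quad \psi^-(z)=\Psi[\mathcal P_+](q^{-\mathsf k/2}z),\quad (q-q^{-1})F(z)=-\Sigma[\mathcal P_-](q^{2+\mathsf k}z),\quad \psi^+(z)=\Psi[\mathcal P_-](q^{2+\mathsf k/2}z)$$ defines a free field realization of the quantum affine algebra $U_q(\widehat{\mathfrak{sl}(2)})$ at level $q^{\mathsf k}=q_3^{1/2}q_2^{-1/2}$, i.e. $(q_1,q_2,q_3)=(q^{-2\mathsf k-4},q^2,q^{2\mathsf k+2})$. Moreover these currents commute or anticommute with the screening charges associated with the unfrozen vertices $1,2$.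
   Context: **Parameters.** $q_1,q_2,q_3\in\mathbb C^\times$ with $q_1q_2q_3=1$, otherwise generic; $q=q_2^{1/2}$. $f^{[n]}$: replace $q$, $q_c$, labels by their $n$-th powers. $\delta(x)=\sum_{n\in\mathbb Z}x^n$. **Seeds.** For a decorated quiver (vertices unfrozen or frozen of type $\pm$, arrows $a$ with labels $\kappa_a$) put $\epsilon_{ii}=0$, $\epsilon_{ij}=\#(i\to j)-\#(j\to i)$, $C_{ij}=(q-q^{-1})c_{ij}$ with $c_{ii}=(q-q^{-1})-\sum_{\ell:i\to i}(q\kappa_\ell-q^{-1}\kappa_\ell^{-1})$ ($i$ unfrozen), $c_{ii}=\mp q^{\mp1}$ ($i$ frozen of type $\pm$), $c_{ij}=\sum_{a:i\to j}q^{-1}\kappa_a^{-1}-\sum_{a:j\to i}q\kappa_a$ ($i\neq j$). $\mathcal A_{\mathcal Q}$: (completed) algebra generated by $X_i^{\pm1},x_{i,n}$ ($n\neq0$), $X_iX_j=q^{2\epsilon_{ij}}X_jX_i$, $[X_i,x_{j,n}]=0$, $[x_{i,n},x_{j,m}]=\frac{\delta_{n+m,0}}nC^{[n]}_{ij}$ for $n>0$ (modes of the same sign commute). $X_i(z)=X_ie^{\sum_{n>0}z^nx_{i,-n}}e^{\sum_{n>0}z^{-n}x_{i,n}}$; $:\ :$ puts $x_{i,n}$, $n>0$, to the right, and $X_i:\prod_jX_j^{n_j}:=q^{\sum_j\epsilon_{ij}n_j}:X_i\prod_jX_j^{n_j}:$. Here one works modulo the central elements: $x_{0,n}+x_{1,n}+q_3^{-n}x_{3,n}=0$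 and $x_{3,-n}+x_{2,-n}+q_2^{-n}x_{0,-n}=0$ for $n>0$, and $:X_0^2X_1X_2X_3^2:=1$. **Paths.** For a path $Z_0\to\cdots\to Z_n$ along arrows with labels $\kappa_1,\dots,\kappa_n$: $\Sigma[\mathcal P](z)=\sum_{j=0}^{n-1}:Z_0(z)Z_1(\kappa_1z)\cdots Z_j(\kappa_1\cdots\kappa_jz):$, $\Psi[\mathcal P](z)=:Z_0(z)Z_1(\kappa_1z)\cdots Z_n(\kappa_1\cdots\kappa_nz):$. Thus $\Sigma[\mathcal P_+](z)=X_0(z)+:X_0(z)X_1(z):$, $\Psi[\mathcal P_+](z)=:X_0(z)X_1(z)X_3(q_3z):$, $\Sigma[\mathcal P_-](z)=X_3(z)+:X_3(z)X_2(z):$, $\Psi[\mathcal P_-](z)=:X_3(z)X_2(z)X_0(q_2^{-1}z):$. **$U_q(\widehat{\mathfrak{sl}(2)})$.** Generated by the modes of $E(z)=\sum_{n\in\mathbb Z}z^{-n}E_n$, $F(z)=\sum_{n\in\mathbb Z}z^{-n}F_n$, $\psi^+(z)$ (series in $z^{-1}$), $\psi^-(z)$ (series in $z$), with invertible leading coefficients $\psi_0^\pm$, and central $q^{\mathsf k}$, with, for $G(z)=\frac{q^2z-1}{z-q^2}$: $[\psi^\pm(z),\psi^\pm(w)]=0$, $\psi^+(z)\psi^-(w)=\frac{G(q^{\mathsf k}z/w)}{G(q^{-\mathsf k}z/w)}\psi^-(w)\psi^+(z)$, $\psi_0^+\psi_0^-=\psi_0^-\psi_0^+=1$, $\psi^\pm(z)E(w)=G(q^{\pm\mathsf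 k/2}z/w)E(w)\psi^\pm(z)$, $\psi^\pm(z)F(w)=G(q^{\mp\mathsf k/2}z/w)^{-1}F(w)\psi^\pm(z)$, $(z-q^2w)E(z)E(w)=(q^2z-w)E(w)E(z)$, $(z-q^{-2}w)F(z)F(w)=(q^{-2}z-w)F(w)F(z)$, $(q-q^{-1})[E(z),F(w)]=\delta(q^{-\mathsf k}z/w)\psi^+(q^{\mathsf k/2}w)-\delta(q^{\mathsf k}z/w)\psi^-(q^{-\mathsf k/2}w)$. A free field realization is an algebra homomorphism given by currents in (the quotient of) $\mathcal A_{\mathcal Q}$. **Screening charges** (unfrozen vertex $k$ without loop). Write $X_k=-q^{-2J}$, adjoin $\hat q$ with $[J,\hat q]=1$, set $\Psi^*_k(z)=:e^{-\hat q}z^{-J}:e^{\sum_{n>0}z^n\frac{x_{k,-n}}{q^n-q^{-n}}}e^{-\sum_{n>0}z^{-n}\frac{x_{k,n}}{q^n-q^{-n}}}$ and $\Psi_k(z)$ the same with all exponents negated. They satisfy $\{\Psi_k(z),\Psi_k^*(w)\}=\delta(z/w)$, $\{\Psi_k,\Psi_k\}=\{\Psi_k^*,\Psi_k^*\}=0$, $X_k(z)=-:\Psi_k(q^{-1}z)\Psi_k^*(qz):$. Zero modes are extended (allowing $X_j(z)$ to contain $z$ to the power of an operator commuting with all $X_i$) so that for $j\ne k$, $X_j(z)=:\prod_{a:j\to k}\Psi_k(q\kappa_az)\prod_{b:k\to j}\Psi_k^*(q^{-1}\kappa_b^{-1}z):V_j(z)$ with $V_j$ commuting with $\Psi_k,\Psi_k^*$;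 $J$ has integer spectrum. The charge is $Q_k=\oint\Psi^*_k(z)\frac{dz}z$. *)

theory Defs
  imports
    "HOL-Library.Poly_Mapping"
    "HOL-Computational_Algebra.Formal_Power_Series"
    "HOL-Algebra.QuotRing"
begin

section \<open>Algebras given by generators and relations\<close>

text \<open>The free complex algebra on the type of letters \<open>'g\<close> is the algebra of finitely supported
  functions on words; \<open>+\<close> on words is concatenation, as \<^type>\<open>poly_mapping\<close> requires an
  additively written monoid.\<close>

datatype 'g word = Word (letters: "'g list")

instantiation word :: (type) monoid_add
begin
definition zero_word :: "'a word" where "zero_word = Word []"
definition plus_word :: "'a word \<Rightarrow> 'a word \<Rightarrow> 'a word" where
  "plus_word u v = Word (letters u @ letters v)"
instance by standard (simp_all add: zero_word_def plus_word_def)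
end

type_synonym 'g falg = "'g word \<Rightarrow>\<^sub>0 complex"

definition gen :: "'g \<Rightarrow> 'g falg" where
  "gen g = Poly_Mapping.single (Word [g]) 1"

definition cst :: "complex \<Rightarrow> 'g falg" where
  "cst c = Poly_Mapping.single 0 c"

definition free_ring :: "'g falg ring" where
  "free_ring = \<lparr>carrier = UNIV, monoid.mult = (*), one = 1, ring.zero = 0, add = (+)\<rparr>"

definition presented :: "'g falg set \<Rightarrow> 'g falg set ring" where
  "presented rels = free_ring Quot (Idl\<^bsub>free_ring\<^esub> rels)"

definition pcls :: "'g falg set \<Rightarrow> 'g falg \<Rightarrow> 'g falg set" where
  "pcls rels a = (Idl\<^bsub>free_ring\<^esub> rels) +>\<^bsub>free_ring\<^esub> a"

lemma ring_free_ring: "ring (free_ring :: 'g falg ring)"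
proof (rule ringI)
  show "abelian_group (free_ring :: 'g falg ring)"
  proof (rule abelian_groupI, goal_cases)
    case (6 x)
    show ?case by (rule bexI[of _ "- x"]) (simp_all add: free_ring_def)
  qed (simp_all add: free_ring_def algebra_simps)
  show "monoid (free_ring :: 'g falg ring)"
    by (rule monoidI) (simp_all add: free_ring_def algebra_simps)
qed (simp_all add: free_ring_def algebra_simps)

lemma ring_presented: "ring (presented rels)"
  unfolding presented_def
  by (rule ideal.quotient_is_ring, rule ring.genideal_ideal[OF ring_free_ring])
    (simp add: free_ring_def)

section \<open>Completion\<close>

text \<open>Completion of a ring with respect to a decreasing sequence of left ideals \<open>L N\<close> such that
  for all \<open>b\<close>, \<open>N\<close> there is \<open>K\<close> with \<open>L K b \<subseteq> L N\<close>: Cauchy sequences modulo null sequences.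
  (This condition makes Cauchy sequences a ring and null sequences an ideal in it.)\<close>

definition left_ideal_gen :: "('a, 'm) ring_scheme \<Rightarrow> 'a set \<Rightarrow> 'a set" where
  "left_ideal_gen R S = \<Inter>{L. additive_subgroup L R
     \<and> (\<forall>r\<in>carrier R. \<forall>l\<in>L. r \<otimes>\<^bsub>R\<^esub> l \<in> L) \<and> S \<subseteq> L}"

definition cauchy_ring :: "('a, 'm) ring_scheme \<Rightarrow> (nat \<Rightarrow> 'a set) \<Rightarrow> (nat \<Rightarrow> 'a) ring" where
  "cauchy_ring R L =
    \<lparr>carrier = {f. (\<forall>n. f n \<in> carrier R) \<and>
                   (\<forall>N. \<exists>M. \<forall>m\<ge>M. \<forall>n\<ge>M. f m \<ominus>\<^bsub>R\<^esub> f n \<in> L N)},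
     monoid.mult = (\<lambda>f g n. f n \<otimes>\<^bsub>R\<^esub> g n), one = (\<lambda>n. \<one>\<^bsub>R\<^esub>),
     ring.zero = (\<lambda>n. \<zero>\<^bsub>R\<^esub>), add = (\<lambda>f g n. f n \<oplus>\<^bsub>R\<^esub> g n)\<rparr>"

definition null_seqs :: "('a, 'm) ring_scheme \<Rightarrow> (nat \<Rightarrow> 'a set) \<Rightarrow> (nat \<Rightarrow> 'a) set" where
  "null_seqs R L = {f \<in> carrier (cauchy_ring R L). \<forall>N. \<exists>M. \<forall>n\<ge>M. f n \<in> L N}"

definition completion :: "('a, 'm) ring_scheme \<Rightarrow> (nat \<Rightarrow> 'a set) \<Rightarrow> (nat \<Rightarrow> 'a) set ring" where
  "completion R L = cauchy_ring R L Quot null_seqs R L"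

text \<open>\<open>nbh N\<close> is a set of representatives of generators of the left ideal \<open>L N\<close>;
  \<open>ccls\<close> sends a sequence of representatives (partial sums, below) to its limit.\<close>

definition nbh_ideal :: "'g falg set \<Rightarrow> (nat \<Rightarrow> 'g falg set) \<Rightarrow> nat \<Rightarrow> 'g falg set set" where
  "nbh_ideal rels nbh N = left_ideal_gen (presented rels) (pcls rels ` nbh N)"

definition completed :: "'g falg set \<Rightarrow> (nat \<Rightarrow> 'g falg set) \<Rightarrow> (nat \<Rightarrow> 'g falg set) set ring" where
  "completed rels nbh = completion (presented rels) (nbh_ideal rels nbh)"

definition ccls :: "'g falg set \<Rightarrow> (nat \<Rightarrow> 'g falg set) \<Rightarrow> (nat \<Rightarrow> 'g falg)
    \<Rightarrow> (nat \<Rightarrow> 'g falg set) set" where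
  "ccls rels nbh f =
     null_seqs (presented rels) (nbh_ideal rels nbh)
       +>\<^bsub>cauchy_ring (presented rels) (nbh_ideal rels nbh)\<^esub> (\<lambda>N. pcls rels (f N))"

section \<open>The quantum affine algebra\<close>

text \<open>\<open>Kh\<close> is the central element $q^{\mathsf k/2}$; \<open>PsiP n\<close> and \<open>PsiM n\<close> are the coefficients
  of $z^{-n}$ in $\psi^+(z)$ and of $z^n$ in $\psi^-(z)$. A current is represented by the function
  sending \<open>m\<close> to its coefficient of $z^m$.\<close>

datatype uq_gen = E int | F int | PsiP nat | PsiM nat | Kh | KhInv

datatype current_name = CurE | CurF | CurPsiP | CurPsiM

fun uq_current :: "current_name \<Rightarrow> int \<Rightarrow> uq_gen falg" where
  "uq_current CurE m = gen (E (- m))"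
| "uq_current CurF m = gen (F (- m))"
| "uq_current CurPsiP m = (if m \<le> 0 then gen (PsiP (nat (- m))) else 0)"
| "uq_current CurPsiM m = (if m \<ge> 0 then gen (PsiM (nat m)) else 0)"

definition Kpow :: "int \<Rightarrow> uq_gen falg" where
  "Kpow i = (if i \<ge> 0 then gen Kh ^ nat i else gen KhInv ^ nat (- i))"

text \<open>$G(x)$ expanded in powers of $x$, and in powers of $x^{-1}$ (as a series in $X = x^{-1}$).\<close>

definition G_zero :: "complex \<Rightarrow> complex fps" where
  "G_zero q = (fps_const (q^2) * fps_X - 1) / (fps_X - fps_const (q^2))"

definition G_infty :: "complex \<Rightarrow> complex fps" where
  "G_infty q = (fps_const (q^2) - fps_X) / (1 - fps_const (q^2) * fps_X)"

text \<open>Each set below consists of the coefficients of $z^m w^n$ of the defining relations. Since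
  $\psi^+$ is a series in $z^{-1}$ and $\psi^-$ a series in $z$, the sums over \<open>j\<close> are the full
  expansions: the omitted terms vanish.\<close>

definition uq_rels :: "complex \<Rightarrow> uq_gen falg set" where
  "uq_rels q = (let E = uq_current CurE; F = uq_current CurF;
       psip = uq_current CurPsiP; psim = uq_current CurPsiM;
       g0 = (\<lambda>j. cst (fps_nth (G_zero q) j)); g0' = (\<lambda>j. cst (fps_nth (inverse (G_zero q)) j));
       gi = (\<lambda>j. cst (fps_nth (G_infty q) j)); gi' = (\<lambda>j. cst (fps_nth (inverse (G_infty q)) j))
     in
       {gen Kh * gen KhInv - 1, gen KhInv * gen Kh - 1}
     \<union> {gen Kh * gen g - gen g * gen Kh | g. True}
     \<union> {psip m * psip n - psip n * psip m | m n. True}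
     \<union> {psim m * psim n - psim n * psim m | m n. True}
     \<union> {psip m * psim n
          - (\<Sum>i\<le>nat n. \<Sum>j\<le>nat n. gi i * Kpow (- 2 * int i) * gi' j * Kpow (2 * int j)
               * psim (n - int i - int j) * psip (m + int i + int j)) | m n. True}
     \<union> {psip 0 * psim 0 - 1, psim 0 * psip 0 - 1}
     \<union> {psip m * E n
          - (\<Sum>j\<le>nat (- m). gi j * Kpow (- int j) * E (n - int j) * psip (m + int j)) | m n. True}
     \<union> {psim m * E n
          - (\<Sum>j\<le>nat m. g0 j * Kpow (- int j) * E (n + int j) * psim (m - int j)) | m n. True}
     \<union> {psip m * F n
          - (\<Sum>j\<le>nat (- m). gi' j * Kpow (int j) * F (n - int j) * psip (m + int j)) | m n. True}
     \<union> {psim m * F n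
          - (\<Sum>j\<le>nat m. g0' j * Kpow (int j) * F (n + int j) * psim (m - int j)) | m n. True}
     \<union> {(E (m - 1) * E n - cst (q^2) * E m * E (n - 1))
          - (cst (q^2) * E n * E (m - 1) - E (n - 1) * E m) | m n. True}
     \<union> {(F (m - 1) * F n - cst (1 / q^2) * F m * F (n - 1))
          - (cst (1 / q^2) * F n * F (m - 1) - F (n - 1) * F m) | m n. True}
     \<union> {cst (q - 1 / q) * (E m * F n - F n * E m)
          - (Kpow (- 2 * m) * Kpow (m + n) * psip (m + n)
             - Kpow (2 * m) * Kpow (- (m + n)) * psim (m + n)) | m n. True})"

section \<open>Decorated quivers and their algebras\<close>

text \<open>All elements of the type \<open>'v\<close> are vertices; an arrow is (source, target, label).\<close>

datatype vkind = Unfrozen | FrozenPlus | FrozenMinus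

type_synonym 'v arrow = "'v \<times> 'v \<times> complex"

record 'v quiver =
  vkind :: "'v \<Rightarrow> vkind"
  arrows :: "'v arrow list"

definition labels :: "'v quiver \<Rightarrow> 'v \<Rightarrow> 'v \<Rightarrow> complex list" where
  "labels Q i j = map (\<lambda>(s, t, \<kappa>). \<kappa>) (filter (\<lambda>(s, t, \<kappa>). s = i \<and> t = j) (arrows Q))"

definition eps :: "'v quiver \<Rightarrow> 'v \<Rightarrow> 'v \<Rightarrow> int" where
  "eps Q i j = (if i = j then 0 else int (length (labels Q i j)) - int (length (labels Q j i)))"

definition cmat :: "complex \<Rightarrow> 'v quiver \<Rightarrow> 'v \<Rightarrow> 'v \<Rightarrow> complex" where
  "cmat q Q i j =
     (if i = j then
        (case vkind Q i of
           Unfrozen \<Rightarrow> (q - 1 / q) - (\<Sum>\<kappa>\<leftarrow>labels Q i i. q * \<kappa> - 1 / (q * \<kappa>))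
         | FrozenPlus \<Rightarrow> - (1 / q)
         | FrozenMinus \<Rightarrow> q)
      else (\<Sum>\<kappa>\<leftarrow>labels Q i j. 1 / (q * \<kappa>)) - (\<Sum>\<kappa>\<leftarrow>labels Q j i. q * \<kappa>))"

definition Cmat :: "complex \<Rightarrow> 'v quiver \<Rightarrow> 'v \<Rightarrow> 'v \<Rightarrow> complex" where
  "Cmat q Q i j = (q - 1 / q) * cmat q Q i j"

text \<open>$C^{[n]}_{ij}$\<close>
definition Cmat_pow :: "nat \<Rightarrow> complex \<Rightarrow> 'v quiver \<Rightarrow> 'v \<Rightarrow> 'v \<Rightarrow> complex" where
  "Cmat_pow n q Q = Cmat (q ^ n) (Q\<lparr>arrows := map (\<lambda>(s, t, \<kappa>). (s, t, \<kappa> ^ n)) (arrows Q)\<rparr>)"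

text \<open>\<open>X i\<close>, \<open>Xinv i\<close>, \<open>Osc i n\<close> are $X_i$, $X_i^{-1}$, $x_{i,n}$; the spurious \<open>Osc i 0\<close> is set
  to zero by the relations. The definitions take an embedding \<open>emb\<close> of the generators into a free
  algebra, as they are used both for the algebra itself and for its extension by zero modes.\<close>

datatype 'v aq_gen = X 'v | Xinv 'v | Osc 'v int

definition aq_rels :: "complex \<Rightarrow> 'v quiver \<Rightarrow> ('v aq_gen \<Rightarrow> 'g falg) \<Rightarrow> 'g falg set" where
  "aq_rels q Q emb =
       {emb (X i) * emb (Xinv i) - 1 | i. True}
     \<union> {emb (Xinv i) * emb (X i) - 1 | i. True}
     \<union> {emb (X i) * emb (X j) - cst (q powi (2 * eps Q i j)) * emb (X j) * emb (X i) | i j. True}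
     \<union> {emb (X i) * emb (Osc j n) - emb (Osc j n) * emb (X i) | i j n. True}
     \<union> {emb (Osc i 0) | i. True}
     \<union> {emb (Osc i n) * emb (Osc j m) - emb (Osc j m) * emb (Osc i n)
          - cst (if n + m = 0 then Cmat_pow (nat n) q Q i j / of_int n else 0) | i j n m. n > 0}
     \<union> {emb (Osc i n) * emb (Osc j m) - emb (Osc j m) * emb (Osc i n) | i j n m. n < 0 \<and> m < 0}"

text \<open>Products of modes $x_{i,n}$, $n>0$, of total degree at least \<open>N\<close>.\<close>

definition aq_nbh :: "('v aq_gen \<Rightarrow> 'g falg) \<Rightarrow> nat \<Rightarrow> 'g falg set" where
  "aq_nbh emb N = {prod_list (map (\<lambda>(i, n). emb (Osc i n)) ps) | ps.
      (\<forall>(i, n)\<in>set ps. n > 0) \<and> (\<Sum>(i, n)\<leftarrow>ps. n) \<ge> int N}"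

section \<open>Currents\<close>

text \<open>\<open>exp_coeff y m\<close> is the coefficient of $t^m$ in $\exp(\sum_{n>0} t^n y_n)$.\<close>

definition exp_coeff :: "(nat \<Rightarrow> 'g falg) \<Rightarrow> nat \<Rightarrow> 'g falg" where
  "exp_coeff y m = (\<Sum>r\<le>m. cst (1 / fact r) *
     fps_nth (Abs_fps (\<lambda>n. if n = 0 then 0 else y n) ^ r) m)"

text \<open>Partial sums, over annihilation degree at most \<open>N\<close>, for the coefficient of $z^m$ in
  $\exp(\sum_{n>0} z^n a_n) \exp(\sum_{n>0} z^{-n} b_n)$.\<close>

definition osc_exp :: "(nat \<Rightarrow> 'g falg) \<Rightarrow> (nat \<Rightarrow> 'g falg) \<Rightarrow> int \<Rightarrow> nat \<Rightarrow> 'g falg" where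
  "osc_exp a b m N =
     (\<Sum>j\<le>N. if m + int j \<ge> 0 then exp_coeff a (nat (m + int j)) * exp_coeff b j else 0)"

text \<open>The normally ordered product $:\prod_i X_i:$ over a list.\<close>

fun zero_mode :: "complex \<Rightarrow> 'v quiver \<Rightarrow> ('v aq_gen \<Rightarrow> 'g falg) \<Rightarrow> 'v list \<Rightarrow> 'g falg" where
  "zero_mode q Q emb [] = 1"
| "zero_mode q Q emb (i # is) =
     cst (q powi (- (\<Sum>j\<leftarrow>is. eps Q i j))) * emb (X i) * zero_mode q Q emb is"

text \<open>$:\prod_{(i,c)} X_i(c z):$ over a list of pairs $(i,c)$: coefficient of $z^m$, partial sums.\<close>

definition nord :: "complex \<Rightarrow> 'v quiver \<Rightarrow> ('v aq_gen \<Rightarrow> 'g falg) \<Rightarrow> ('v \<times> complex) list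
    \<Rightarrow> int \<Rightarrow> nat \<Rightarrow> 'g falg" where
  "nord q Q emb ps m N =
     zero_mode q Q emb (map fst ps) *
     osc_exp (\<lambda>n. \<Sum>(i, c)\<leftarrow>ps. cst (c ^ n) * emb (Osc i (- int n)))
             (\<lambda>n. \<Sum>(i, c)\<leftarrow>ps. cst (1 / c ^ n) * emb (Osc i (int n))) m N"

text \<open>A path is given by its (nonempty, composable) list of arrows; \<open>path_points\<close> lists the
  factors $(Z_j, \kappa_1\cdots\kappa_j)$.\<close>

fun path_points_from :: "'v \<Rightarrow> complex \<Rightarrow> 'v arrow list \<Rightarrow> ('v \<times> complex) list" where
  "path_points_from v c [] = [(v, c)]"
| "path_points_from v c ((s, t, \<kappa>) # as) = (v, c) # path_points_from t (c * \<kappa>) as"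

definition path_points :: "'v arrow list \<Rightarrow> ('v \<times> complex) list" where
  "path_points P = path_points_from (fst (hd P)) 1 P"

text \<open>Here \<open>V\<close> is \<open>nord\<close>, or its version with extended zero modes below.\<close>

definition Sigma_path :: "(('v \<times> complex) list \<Rightarrow> int \<Rightarrow> nat \<Rightarrow> 'g falg) \<Rightarrow> 'v arrow list
    \<Rightarrow> int \<Rightarrow> nat \<Rightarrow> 'g falg" where
  "Sigma_path V P m N = (\<Sum>j<length P. V (take (Suc j) (path_points P)) m N)"

definition Psi_path :: "(('v \<times> complex) list \<Rightarrow> int \<Rightarrow> nat \<Rightarrow> 'g falg) \<Rightarrow> 'v arrow list
    \<Rightarrow> int \<Rightarrow> nat \<Rightarrow> 'g falg" where
  "Psi_path V P = V (path_points P)"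

text \<open>$f(cz)$ from $f(z)$\<close>
definition rescale :: "complex \<Rightarrow> (int \<Rightarrow> nat \<Rightarrow> 'g falg) \<Rightarrow> int \<Rightarrow> nat \<Rightarrow> 'g falg" where
  "rescale c f m N = cst (c powi m) * f m N"

section \<open>The quiver and the free field currents\<close>

datatype vertex = V0 | V1 | V2 | V3

definition QI :: "complex \<Rightarrow> complex \<Rightarrow> complex \<Rightarrow> vertex quiver" where
  "QI q1 q2 q3 =
    \<lparr>vkind = (\<lambda>v. case v of V0 \<Rightarrow> FrozenMinus | V1 \<Rightarrow> Unfrozen | V2 \<Rightarrow> Unfrozen | V3 \<Rightarrow> FrozenPlus),
     arrows = [(V0, V1, 1), (V1, V3, q3), (V3, V2, 1), (V2, V0, 1 / q2), (V1, V2, 1), (V2, V1, q1)]\<rparr>"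

definition path_plus :: "complex \<Rightarrow> vertex arrow list" where
  "path_plus q3 = [(V0, V1, 1), (V1, V3, q3)]"

definition path_minus :: "complex \<Rightarrow> vertex arrow list" where
  "path_minus q2 = [(V3, V2, 1), (V2, V0, 1 / q2)]"

text \<open>\<open>h\<close> is the value of $q^{\mathsf k/2}$.\<close>

fun free_field :: "((vertex \<times> complex) list \<Rightarrow> int \<Rightarrow> nat \<Rightarrow> 'g falg) \<Rightarrow> complex \<Rightarrow> complex
    \<Rightarrow> complex \<Rightarrow> complex \<Rightarrow> current_name \<Rightarrow> int \<Rightarrow> nat \<Rightarrow> 'g falg" where
  "free_field V q2 q3 q h CurE m N = cst (1 / (q - 1 / q)) * Sigma_path V (path_plus q3) m N"
| "free_field V q2 q3 q h CurF m N =
     - (cst (1 / (q - 1 / q)) * rescale (q^2 * h^2) (Sigma_path V (path_minus q2)) m N)"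
| "free_field V q2 q3 q h CurPsiM m N = rescale (1 / h) (Psi_path V (path_plus q3)) m N"
| "free_field V q2 q3 q h CurPsiP m N = rescale (q^2 * h) (Psi_path V (path_minus q2)) m N"

definition central_osc_rels :: "complex \<Rightarrow> complex \<Rightarrow> (vertex aq_gen \<Rightarrow> 'g falg) \<Rightarrow> 'g falg set" where
  "central_osc_rels q2 q3 emb =
       {emb (Osc V0 n) + emb (Osc V1 n) + cst (q3 powi (- n)) * emb (Osc V3 n) | n. n > 0}
     \<union> {emb (Osc V3 (- n)) + emb (Osc V2 (- n)) + cst (q2 powi (- n)) * emb (Osc V0 (- n)) | n. n > 0}"

definition central_zero_mode :: "complex \<Rightarrow> vertex quiver \<Rightarrow> (vertex aq_gen \<Rightarrow> 'g falg) \<Rightarrow> 'g falg" where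
  "central_zero_mode q Q emb = zero_mode q Q emb [V0, V0, V1, V2, V3, V3]"

definition I_rels :: "complex \<Rightarrow> complex \<Rightarrow> complex \<Rightarrow> complex \<Rightarrow> vertex aq_gen falg set" where
  "I_rels q1 q2 q3 q = aq_rels q (QI q1 q2 q3) gen \<union> central_osc_rels q2 q3 gen
     \<union> {central_zero_mode q (QI q1 q2 q3) gen - 1}"

definition alg_I :: "complex \<Rightarrow> complex \<Rightarrow> complex \<Rightarrow> complex
    \<Rightarrow> (nat \<Rightarrow> vertex aq_gen falg set) set ring" where
  "alg_I q1 q2 q3 q = completed (I_rels q1 q2 q3 q) (aq_nbh gen)"

definition cls_I :: "complex \<Rightarrow> complex \<Rightarrow> complex \<Rightarrow> complex \<Rightarrow> (nat \<Rightarrow> vertex aq_gen falg)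
    \<Rightarrow> (nat \<Rightarrow> vertex aq_gen falg set) set" where
  "cls_I q1 q2 q3 q = ccls (I_rels q1 q2 q3 q) (aq_nbh gen)"

text \<open>Homomorphisms of unital complex algebras from the quantum affine algebra that send each current
  to the corresponding free field current, at level $q^{\mathsf k} = h^2$.\<close>

definition is_free_field_realization :: "complex \<Rightarrow> complex \<Rightarrow> complex \<Rightarrow> complex \<Rightarrow> complex
    \<Rightarrow> (uq_gen falg set \<Rightarrow> (nat \<Rightarrow> vertex aq_gen falg set) set) \<Rightarrow> bool" where
  "is_free_field_realization q1 q2 q3 q h \<phi> \<longleftrightarrow>
     \<phi> \<in> ring_hom (presented (uq_rels q)) (alg_I q1 q2 q3 q)
   \<and> (\<forall>c. \<phi> (pcls (uq_rels q) (cst c)) = cls_I q1 q2 q3 q (\<lambda>N. cst c))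
   \<and> \<phi> (pcls (uq_rels q) (gen Kh)) = cls_I q1 q2 q3 q (\<lambda>N. cst h)
   \<and> (\<forall>cur m. \<phi> (pcls (uq_rels q) (uq_current cur m)) =
        cls_I q1 q2 q3 q (free_field (nord q (QI q1 q2 q3) gen) q2 q3 q h cur m))"

section \<open>Zero mode extension and screening charges\<close>

text \<open>Fix an unfrozen vertex \<open>k\<close>. \<open>Eq\<close>, \<open>Eqinv\<close> are $e^{\pm\hat q}$. The diagonalizable operators
  $J$ and $P$ are given by their spectral idempotents, $J = \sum_a \frac a2\,$\<open>PJ a\<close> and
  $P = \sum_l l\,$\<open>PP l\<close>, so that $z^{-J} = \sum_a z^{-a/2}\,$\<open>PJ a\<close>, $z^P = \sum_l z^l\,$\<open>PP l\<close>.

  The normal ordering of $e^{-\hat q}z^{-J}$ is the symmetric one, like that of the $X_i$: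
  $:e^{-\hat q}z^{-J}: = e^{-\hat q - J\log z} = e^{-\hat q}z^{1/2-J}$, so that
  $X_k = -q^{-2J}$ agrees with $X_k(z) = -:\Psi_k(q^{-1}z)\Psi^*_k(qz):$. Then
  $\Psi^*_k(z)$ is single valued exactly where $J - \frac12$ is an integer. As $J$ may have any
  spectrum in $\frac12\mathbb Z$ here, both integer $J$ (where the charge vanishes) and integer
  $J - \frac12$ are covered.

  $P$ is the operator commuting with all $X_i$: $X_j(z)$ contains $z^{\epsilon_{jk}P}$ and
  $[P, \hat q] = 1$. The zero mode of
  $:\prod_{a:j\to k}\Psi_k(q\kappa_a z)\prod_{b:k\to j}\Psi^*_k(q^{-1}\kappa_b^{-1}z):$
  is $:e^{\epsilon_{jk}\hat q}(c_j z^{\epsilon_{jk}})^J:$ with $c_j$ given by \<open>shift_const\<close>, so that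
  the remaining factor $V_j(z)$ of $X_j(z)$ commutes with $e^{\hat q}$ and $J$ if and only if
  $X_j e^{\hat q} = c_j e^{\hat q} X_j$, $[P, \hat q] = 1$ and $J X_j = X_j (J + \epsilon_{jk})$;
  for the oscillators this is automatic.\<close>

datatype 'v ext_gen = Base "'v aq_gen" | Eq | Eqinv | PJ int | PP int

abbreviation ext_emb :: "'v aq_gen \<Rightarrow> 'v ext_gen falg" where
  "ext_emb g \<equiv> gen (Base g)"

definition shift_const :: "complex \<Rightarrow> 'v quiver \<Rightarrow> 'v \<Rightarrow> 'v \<Rightarrow> complex" where
  "shift_const q Q k j = prod_list (map ((*) q) (labels Q j k)) * prod_list (map ((*) q) (labels Q k j))"

definition ext_rels :: "complex \<Rightarrow> 'v quiver \<Rightarrow> 'v \<Rightarrow> 'v ext_gen falg set" where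
  "ext_rels q Q k =
       aq_rels q Q ext_emb
     \<union> {gen Eq * gen Eqinv - 1, gen Eqinv * gen Eq - 1}
     \<union> {gen Eq * ext_emb (Osc i n) - ext_emb (Osc i n) * gen Eq | i n. True}
     \<union> {ext_emb (X j) * gen Eq - cst (shift_const q Q k j) * gen Eq * ext_emb (X j) | j. j \<noteq> k}
     \<union> {gen (PJ a) * gen (PJ b) - (if a = b then gen (PJ a) else 0) | a b. True}
     \<union> {ext_emb (X k) * gen (PJ a) + cst (q powi (- a)) * gen (PJ a) | a. True}
     \<union> {gen (PJ (a + 2)) * gen Eq - gen Eq * gen (PJ a) | a. True}
     \<union> {gen (PJ (a + 2 * eps Q j k)) * ext_emb (X j) - ext_emb (X j) * gen (PJ a) | a j. True}
     \<union> {gen (PJ a) * ext_emb (Osc i n) - ext_emb (Osc i n) * gen (PJ a) | a i n. True}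
     \<union> {gen (PP l) * gen (PP r) - (if l = r then gen (PP l) else 0) | l r. True}
     \<union> {gen (PP (l + 1)) * gen Eq - gen Eq * gen (PP l) | l. True}
     \<union> {gen (PP l) * ext_emb g - ext_emb g * gen (PP l) | l g. True}
     \<union> {gen (PP l) * gen (PJ a) - gen (PJ a) * gen (PP l) | l a. True}"

text \<open>The second and third set make the idempotents sum up to 1 in the completion.\<close>

definition ext_nbh :: "nat \<Rightarrow> 'v ext_gen falg set" where
  "ext_nbh N = aq_nbh ext_emb N
     \<union> {1 - (\<Sum>a\<in>{- int M..int M}. gen (PJ a)) | M. M \<ge> N}
     \<union> {1 - (\<Sum>l\<in>{- int M..int M}. gen (PP l)) | M. M \<ge> N}"

text \<open>$:\prod_{(i,c)} X_i(c z):$ with $X_i(z)$ containing $z^{\epsilon_{ik}P}$.\<close>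

definition nord_ext :: "complex \<Rightarrow> 'v quiver \<Rightarrow> 'v \<Rightarrow> ('v \<times> complex) list \<Rightarrow> int \<Rightarrow> nat
    \<Rightarrow> 'v ext_gen falg" where
  "nord_ext q Q k ps m N =
     (\<Sum>l\<in>{- int N..int N}. cst (prod_list (map (\<lambda>(i, c). c powi eps Q i k) ps) powi l) * gen (PP l)
        * nord q Q ext_emb ps (m - l * (\<Sum>(i, c)\<leftarrow>ps. eps Q i k)) N)"

text \<open>Coefficient of $z^{s/2}$ in $\Psi^*_k(z)$, partial sums: \<open>PJ a\<close> contributes $z^{(1-a)/2}$.\<close>

definition Psi_star :: "complex \<Rightarrow> 'v \<Rightarrow> int \<Rightarrow> nat \<Rightarrow> 'v ext_gen falg" where
  "Psi_star q k s N =
     (\<Sum>a\<in>{- int N..int N}. if even (s - 1 + a) then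
        gen Eqinv * gen (PJ a) *
        osc_exp (\<lambda>n. cst (1 / (q ^ n - 1 / q ^ n)) * ext_emb (Osc k (- int n)))
                (\<lambda>n. - (cst (1 / (q ^ n - 1 / q ^ n)) * ext_emb (Osc k (int n))))
                ((s - 1 + a) div 2) N
      else 0)"

text \<open>$Q_k = \oint \Psi^*_k(z) \frac{dz}{z}$ is the coefficient of $z^0$.\<close>

definition screening :: "complex \<Rightarrow> 'v \<Rightarrow> nat \<Rightarrow> 'v ext_gen falg" where
  "screening q k = Psi_star q k 0"

text \<open>With the extended zero modes the scalar $\psi^+_0\psi^-_0$ set to 1 is
  $:X_0^2X_1X_2X_3^2:\, q_3^{\epsilon_{3k}P} q_2^{-\epsilon_{0k}P}
   = \,:X_0^2X_1X_2X_3^2:\, q_1^{\epsilon_{0k}P}$,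
  which is central in the extended algebra, while $:X_0^2X_1X_2X_3^2:$ does not commute with
  $e^{\hat q}$.\<close>

definition I_ext_rels :: "complex \<Rightarrow> complex \<Rightarrow> complex \<Rightarrow> complex \<Rightarrow> vertex
    \<Rightarrow> vertex ext_gen falg set" where
  "I_ext_rels q1 q2 q3 q k = ext_rels q (QI q1 q2 q3) k \<union> central_osc_rels q2 q3 ext_emb
     \<union> {(cst (q1 powi (l * eps (QI q1 q2 q3) V0 k)) * central_zero_mode q (QI q1 q2 q3) ext_emb - 1)
          * gen (PP l) | l. True}"

definition alg_I_ext :: "complex \<Rightarrow> complex \<Rightarrow> complex \<Rightarrow> complex \<Rightarrow> vertex
    \<Rightarrow> (nat \<Rightarrow> vertex ext_gen falg set) set ring" where
  "alg_I_ext q1 q2 q3 q k = completed (I_ext_rels q1 q2 q3 q k) ext_nbh"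

definition cls_I_ext :: "complex \<Rightarrow> complex \<Rightarrow> complex \<Rightarrow> complex \<Rightarrow> vertex
    \<Rightarrow> (nat \<Rightarrow> vertex ext_gen falg) \<Rightarrow> (nat \<Rightarrow> vertex ext_gen falg set) set" where
  "cls_I_ext q1 q2 q3 q k = ccls (I_ext_rels q1 q2 q3 q k) ext_nbh"

definition commutes_with_screening :: "complex \<Rightarrow> complex \<Rightarrow> complex \<Rightarrow> complex \<Rightarrow> complex \<Rightarrow> vertex
    \<Rightarrow> current_name \<Rightarrow> bool" where
  "commutes_with_screening q1 q2 q3 q h k cur \<longleftrightarrow>
     (let A = alg_I_ext q1 q2 q3 q k;
          f = (\<lambda>m. cls_I_ext q1 q2 q3 q k (free_field (nord_ext q (QI q1 q2 q3) k) q2 q3 q h cur m));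
          s = cls_I_ext q1 q2 q3 q k (screening q k)
      in \<forall>m. f m \<otimes>\<^bsub>A\<^esub> s = s \<otimes>\<^bsub>A\<^esub> f m)"

definition anticommutes_with_screening :: "complex \<Rightarrow> complex \<Rightarrow> complex \<Rightarrow> complex \<Rightarrow> complex \<Rightarrow> vertex
    \<Rightarrow> current_name \<Rightarrow> bool" where
  "anticommutes_with_screening q1 q2 q3 q h k cur \<longleftrightarrow>
     (let A = alg_I_ext q1 q2 q3 q k;
          f = (\<lambda>m. cls_I_ext q1 q2 q3 q k (free_field (nord_ext q (QI q1 q2 q3) k) q2 q3 q h cur m));
          s = cls_I_ext q1 q2 q3 q k (screening q k)
      in \<forall>m. f m \<otimes>\<^bsub>A\<^esub> s \<oplus>\<^bsub>A\<^esub> s \<otimes>\<^bsub>A\<^esub> f m = \<zero>\<^bsub>A\<^esub>)"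

end

theory Submission imports Defs begin

text \<open>A product of two vertex operators is their normally ordered product times a scalar series
  $c(w/z)$ whose logarithm is read off the commutators of the oscillators. For the paths in question
  every $c$ is a constant times $(1 - \alpha x) / (1 - \beta x)$, so each relation of
  $U_q(\widehat{\mathfrak{sl}(2)})$ reduces to an identity between Laurent coefficients of such
  functions; the delta functions in $[E, F]$ arise as differences of their two expansions. In the
  completion this is made precise with truncated sums modulo sequences tending to zero. The screening
  charge is compared with the currents after multiplication by the idempotents that fix the spectrum
  of $J$ and of the exponents of $z$ in the extended zero modes; there $X_k$ becomes a scalar and the
  same contraction argument applies.\<close>

text \<open>All identities are derived on representatives in the free algebra, modulo the ideal of
  relations (\<open>\<approx>\<close>) and then modulo null sequences (\<open>\<sim>\<close>). The
  neighbourhoods are left ideals, so continuity of right multiplication has to be proved, and a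
  truncated product equals its truncated normal form only up to a null sequence. Both orders of a
  product are brought to one normal form \<open>Wp\<close>, which is linear in a two-sided scalar
  series; this is what turns operator relations into coefficient identities. The central relations
  remove the creators of psi^+ and the annihilators of psi^-, so an exchange relation for these
  currents has to be checked on half of the exponents only. In [E, F] the mixed terms survive: the
  shift q^(2+k) in F puts one pole at z = q^k w, the level puts the other at z = q^(-k) w, and there
  the products complete to Psi[P_-] and Psi[P_+], that is to psi^+ and psi^-. With a screening
  charge E and F anticommute while psi^+ and psi^- commute; epsilon with the screened vertex sums to
  1 or -1 over each term of E and F and to 0 over each psi.\<close>

lemma cst_add: "cst (c + d) = cst c + cst d"
  and cst_diff: "cst (c - d) = cst c - cst d"
  and cst_uminus: "cst (- c) = - cst c"
  and cst_mult: "cst (c * d) = cst c * cst d"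
  and cst_0 [simp]: "cst 0 = 0" and cst_1 [simp]: "cst 1 = 1"
  by (simp_all add: cst_def single_add single_diff single_uminus mult_single)

lemma cst_sum: "cst (sum f A) = (\<Sum>x\<in>A. cst (f x))"
  by (induction A rule: infinite_finite_induct) (simp_all add: cst_add)

lemma falg_induct [case_names cst gen add mult]:
  fixes x :: "'g falg"
  assumes "\<And>c. P (cst c)" "\<And>g. P (gen g)"
    and "\<And>x y. P x \<Longrightarrow> P y \<Longrightarrow> P (x + y)" "\<And>x y. P x \<Longrightarrow> P y \<Longrightarrow> P (x * y)"
  shows "P x"
proof -
  have word: "P (Poly_Mapping.single (Word gs) 1)" for gs :: "'g list"
  proof (induction gs)
    case Nil
    then show ?case using assms(1)[of 1] by (simp add: cst_def zero_word_def)
  next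
    case (Cons g gs)
    have "Poly_Mapping.single (Word (g # gs)) (1 :: complex) = gen g * Poly_Mapping.single (Word gs) 1"
      by (simp add: gen_def mult_single plus_word_def)
    then show ?case using Cons assms(2,4) by simp
  qed
  have mono: "P (Poly_Mapping.single w c)" for w c
  proof -
    have "Poly_Mapping.single w c = cst c * Poly_Mapping.single w 1"
      by (simp add: cst_def mult_single)
    then show ?thesis using word[of "letters w"] assms(1,4) by simp
  qed
  have fin: "P (\<Sum>w\<in>A. Poly_Mapping.single w (f w))" if "finite A" for A f
    using that by (induction A) (use assms(1)[of 0] mono assms(3) in auto)
  have "x = (\<Sum>w\<in>Poly_Mapping.keys x. Poly_Mapping.single w (Poly_Mapping.lookup x w))"
    by (rule poly_mapping_eqI)
      (simp add: lookup_sum lookup_single when_def in_keys_iff sum.delta)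
  then show ?thesis using fin[OF finite_keys] by metis
qed

lemma cst_comm: "x * cst c = cst c * x"
proof (induction x rule: falg_induct)
  case (cst d)
  then show ?case by (simp add: cst_def mult_single add.commute mult.commute)
next
  case (gen g)
  then show ?case by (simp add: cst_def gen_def mult_single)
next
  case (mult x y)
  then show ?case by (metis mult.assoc)
qed (simp add: algebra_simps)

lemma cst_comm_assoc: "x * (cst c * y) = cst c * (x * y)"
  by (metis cst_comm mult.assoc)

lemma cst_power: "cst c ^ n = cst (c ^ n)"
  by (induction n) (simp_all add: cst_mult)

section \<open>Cosets of representatives\<close>

definition rel_ideal :: "'g falg set \<Rightarrow> 'g falg set" where
  "rel_ideal S = Idl\<^bsub>free_ring\<^esub> S"

text \<open>The preimage of the left ideal in the free algebra: smallness is tested on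
  representatives, and quotient rings are met only when the completed ring is assembled.\<close>

definition nbhL :: "'g falg set \<Rightarrow> (nat \<Rightarrow> 'g falg set) \<Rightarrow> nat \<Rightarrow> 'g falg set" where
  "nbhL rels nbh N = {a. pcls rels a \<in> nbh_ideal rels nbh N}"

lemma free_ring_simps [simp]:
  "carrier free_ring = UNIV" "x \<otimes>\<^bsub>free_ring\<^esub> y = x * y" "x \<oplus>\<^bsub>free_ring\<^esub> y = x + y"
  "\<one>\<^bsub>free_ring\<^esub> = 1" "\<zero>\<^bsub>free_ring\<^esub> = 0"
  by (simp_all add: free_ring_def)

lemma ideal_rel_ideal: "ideal (rel_ideal S) free_ring"
  unfolding rel_ideal_def by (rule ring.genideal_ideal[OF ring_free_ring]) simp

lemma rel_ideal_lmult: "a \<in> rel_ideal S \<Longrightarrow> x * a \<in> rel_ideal S"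
  and rel_ideal_rmult: "a \<in> rel_ideal S \<Longrightarrow> a * x \<in> rel_ideal S"
  using ideal.I_l_closed[OF ideal_rel_ideal, of a S x] ideal.I_r_closed[OF ideal_rel_ideal, of a S x]
  by auto

lemma rel_ideal_add: "a \<in> rel_ideal S \<Longrightarrow> b \<in> rel_ideal S \<Longrightarrow> a + b \<in> rel_ideal S"
  using additive_subgroup.a_closed[OF ideal.axioms(1)[OF ideal_rel_ideal], of a S b] by simp

lemma rel_ideal_0 [simp]: "0 \<in> rel_ideal S"
  using additive_subgroup.zero_closed[OF ideal.axioms(1)[OF ideal_rel_ideal], of S] by simp

lemma rel_ideal_uminus: "a \<in> rel_ideal S \<Longrightarrow> - a \<in> rel_ideal S"
  using rel_ideal_lmult[of a S "- 1"] by simp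

lemma rel_ideal_diff: "a \<in> rel_ideal S \<Longrightarrow> b \<in> rel_ideal S \<Longrightarrow> a - b \<in> rel_ideal S"
  using rel_ideal_add[OF _ rel_ideal_uminus, of a S b] by simp

lemma rel_idealI: "a \<in> S \<Longrightarrow> a \<in> rel_ideal S"
  using ring.genideal_self[OF ring_free_ring, of S] by (auto simp: rel_ideal_def)

text \<open>Serves as an induction principle: a property of the relations that is stable under sums
  and two-sided multiples holds on the whole ideal. Negatives come from multiplication by
  -1.\<close>

lemma rel_ideal_minimal:
  assumes "S \<subseteq> J" "0 \<in> J" "\<And>a b. a \<in> J \<Longrightarrow> b \<in> J \<Longrightarrow> a + b \<in> J"
    and "\<And>x a. a \<in> J \<Longrightarrow> x * a \<in> J" "\<And>x a. a \<in> J \<Longrightarrow> a * x \<in> J"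
  shows "rel_ideal S \<subseteq> J"
proof -
  have "ideal J (free_ring :: 'a falg ring)"
  proof (rule idealI[OF ring_free_ring])
    show "subgroup J (add_monoid (free_ring :: 'a falg ring))"
    proof (rule group.subgroupI)
      show "group (add_monoid (free_ring :: 'a falg ring))"
        using ring.is_abelian_group[OF ring_free_ring] abelian_group.a_group by blast
      fix a assume a: "a \<in> J"
      have "inv\<^bsub>add_monoid (free_ring :: 'a falg ring)\<^esub> a = - a"
        by (rule group.inv_equality[OF \<open>group (add_monoid free_ring)\<close>]) (simp_all add: free_ring_def)
      then show "inv\<^bsub>add_monoid (free_ring :: 'a falg ring)\<^esub> a \<in> J"
        using assms(4)[OF a, of "- 1"] by simp
    qed (use assms in auto)
  qed (use assms in auto)
  then show ?thesis using assms(1) by (auto simp: rel_ideal_def genideal_def)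
qed

lemma pcls_def': "pcls S a = {i + a | i. i \<in> rel_ideal S}"
  by (auto simp: pcls_def rel_ideal_def a_r_coset_def r_coset_def)

lemma pcls_eq_iff: "pcls S a = pcls S b \<longleftrightarrow> a - b \<in> rel_ideal S"
proof
  assume "pcls S a = pcls S b"
  moreover have "a \<in> pcls S a" by (auto simp: pcls_def' intro!: exI[of _ 0])
  ultimately show "a - b \<in> rel_ideal S" by (auto simp: pcls_def')
next
  assume *: "a - b \<in> rel_ideal S"
  have "i + a \<in> pcls S b" if "i \<in> rel_ideal S" for i
    using rel_ideal_add[OF that *] by (auto simp: pcls_def' intro!: exI[of _ "i + (a - b)"])
  moreover have "i + b \<in> pcls S a" if "i \<in> rel_ideal S" for i
    using rel_ideal_diff[OF that *] by (auto simp: pcls_def' intro!: exI[of _ "i - (a - b)"])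
  ultimately show "pcls S a = pcls S b" by (auto simp: pcls_def')
qed

lemma ring_hom_pcls: "pcls S \<in> ring_hom free_ring (presented S)"
  using ideal.rcos_ring_hom[OF ideal_rel_ideal, of S]
  by (simp add: presented_def rel_ideal_def pcls_def[abs_def])

lemma carrier_presented: "carrier (presented S) = range (pcls S)"
  by (auto simp: presented_def FactRing_def A_RCOSETS_def RCOSETS_def pcls_def a_r_coset_def)

lemma presented_simps:
  "pcls S a \<otimes>\<^bsub>presented S\<^esub> pcls S b = pcls S (a * b)"
  "pcls S a \<oplus>\<^bsub>presented S\<^esub> pcls S b = pcls S (a + b)"
  "\<one>\<^bsub>presented S\<^esub> = pcls S 1"
  using ring_hom_mult[OF ring_hom_pcls, of a b S] ring_hom_add[OF ring_hom_pcls, of a b S]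
    ring_hom_one[OF ring_hom_pcls, of S] by auto

lemma presented_zero: "\<zero>\<^bsub>presented S\<^esub> = pcls S 0"
  using ring_hom_zero[OF ring_hom_pcls ring_free_ring ring_presented, of S] by simp

lemma presented_uminus: "\<ominus>\<^bsub>presented S\<^esub> pcls S a = pcls S (- a)"
proof -
  interpret ring "presented S" by (rule ring_presented)
  show ?thesis
    by (rule minus_equality) (auto simp: presented_simps presented_zero carrier_presented)
qed

lemma presented_diff: "pcls S a \<ominus>\<^bsub>presented S\<^esub> pcls S b = pcls S (a - b)"
  by (simp add: a_minus_def presented_uminus presented_simps)

lemma additive_subgroup_pclsI:
  assumes "0 \<in> J" "\<And>a b. a \<in> J \<Longrightarrow> b \<in> J \<Longrightarrow> a + b \<in> J" "\<And>a. a \<in> J \<Longrightarrow> - a \<in> J"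
  shows "additive_subgroup (pcls S ` J) (presented S)"
proof (rule additive_subgroupI, rule group.subgroupI)
  interpret ring "presented S" by (rule ring_presented)
  show "group (add_monoid (presented S))" by (rule a_group)
  show "pcls S ` J \<subseteq> carrier (add_monoid (presented S))" by (auto simp: carrier_presented)
  show "pcls S ` J \<noteq> {}" using assms by auto
  fix x assume "x \<in> pcls S ` J"
  then obtain a where a: "a \<in> J" "x = pcls S a" by auto
  have "inv\<^bsub>add_monoid (presented S)\<^esub> x = pcls S (- a)"
    using presented_uminus[of S a] a by (simp add: a_inv_def)
  then show "inv\<^bsub>add_monoid (presented S)\<^esub> x \<in> pcls S ` J" using assms a by auto
  fix y assume "y \<in> pcls S ` J"
  then show "x \<otimes>\<^bsub>add_monoid (presented S)\<^esub> y \<in> pcls S ` J"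
    using a assms(2) by (auto simp: presented_simps)
qed

lemma nbhL_nbh: "a \<in> nbh N \<Longrightarrow> a \<in> nbhL S nbh N"
  by (auto simp: nbhL_def nbh_ideal_def left_ideal_gen_def)

lemma nbhL_lmult: "a \<in> nbhL S nbh N \<Longrightarrow> x * a \<in> nbhL S nbh N"
  by (auto simp: nbhL_def nbh_ideal_def left_ideal_gen_def presented_simps[symmetric] carrier_presented)

lemma nbhL_add: "a \<in> nbhL S nbh N \<Longrightarrow> b \<in> nbhL S nbh N \<Longrightarrow> a + b \<in> nbhL S nbh N"
  by (auto simp: nbhL_def nbh_ideal_def left_ideal_gen_def presented_simps[symmetric]
      intro: additive_subgroup.a_closed)

lemma nbhL_I: "a \<in> rel_ideal S \<Longrightarrow> a \<in> nbhL S nbh N"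
proof -
  assume "a \<in> rel_ideal S"
  then have "pcls S a = \<zero>\<^bsub>presented S\<^esub>" by (simp add: presented_zero pcls_eq_iff)
  then show ?thesis
    by (auto simp: nbhL_def nbh_ideal_def left_ideal_gen_def intro: additive_subgroup.zero_closed)
qed

lemma nbhL_0 [simp]: "0 \<in> nbhL S nbh N"
  by (simp add: nbhL_I)

lemma nbhL_uminus: "a \<in> nbhL S nbh N \<Longrightarrow> - a \<in> nbhL S nbh N"
  using nbhL_lmult[of a S nbh N "- 1"] by simp

lemma nbhL_diff: "a \<in> nbhL S nbh N \<Longrightarrow> b \<in> nbhL S nbh N \<Longrightarrow> a - b \<in> nbhL S nbh N"
  using nbhL_add[OF _ nbhL_uminus, of a S nbh N b] by simp

text \<open>The induction principle for neighbourhoods. Since \<open>nbhL\<close> consists of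
  representatives, \<open>J\<close> must contain the relation ideal besides the generators.\<close>

lemma nbhL_minimal:
  assumes "nbh N \<subseteq> J" "rel_ideal S \<subseteq> J" "\<And>a b. a \<in> J \<Longrightarrow> b \<in> J \<Longrightarrow> a + b \<in> J"
    and lm: "\<And>x a. a \<in> J \<Longrightarrow> x * a \<in> J"
  shows "nbhL S nbh N \<subseteq> J"
proof
  fix a assume a: "a \<in> nbhL S nbh N"
  have "- a \<in> J" if "a \<in> J" for a using lm[OF that, of "- 1"] by simp
  moreover have "0 \<in> J" using assms(2) by auto
  ultimately have "additive_subgroup (pcls S ` J) (presented S)"
    using assms(3) by (intro additive_subgroup_pclsI) auto
  moreover have "\<forall>r\<in>carrier (presented S). \<forall>l\<in>pcls S ` J. r \<otimes>\<^bsub>presented S\<^esub> l \<in> pcls S ` J"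
    using lm by (auto simp: carrier_presented presented_simps)
  moreover have "pcls S ` nbh N \<subseteq> pcls S ` J" using assms(1) by blast
  ultimately have "pcls S a \<in> pcls S ` J"
    using a unfolding nbhL_def nbh_ideal_def left_ideal_gen_def by blast
  then obtain b where b: "b \<in> J" "a - b \<in> rel_ideal S" by (auto simp: pcls_eq_iff)
  then have "(a - b) + b \<in> J" using assms(2,3) by blast
  then show "a \<in> J" by simp
qed

section \<open>The completed ring\<close>

locale presentation_cong =
  fixes rels :: "'g falg set"
begin

abbreviation II :: "'g falg set" where "II \<equiv> rel_ideal rels"

definition cg :: "'g falg \<Rightarrow> 'g falg \<Rightarrow> bool" (infix \<open>\<approx>\<close> 50) where
  "a \<approx> b \<longleftrightarrow> a - b \<in> II"

lemma cg_refl [simp]: "a \<approx> a"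
  by (simp add: cg_def)

lemma cg_eq: "a = b \<Longrightarrow> a \<approx> b"
  by simp

lemma cg_sym: "a \<approx> b \<Longrightarrow> b \<approx> a"
  using rel_ideal_uminus[of "a - b"] by (simp add: cg_def)

lemma cg_trans [trans]: "a \<approx> b \<Longrightarrow> b \<approx> c \<Longrightarrow> a \<approx> c"
  using rel_ideal_add[of "a - b" _ "b - c"] by (simp add: cg_def)

lemma cg_eq_trans [trans]: "a \<approx> b \<Longrightarrow> b = c \<Longrightarrow> a \<approx> c" "a = b \<Longrightarrow> b \<approx> c \<Longrightarrow> a \<approx> c"
  by simp_all

lemma cg_add: "a \<approx> b \<Longrightarrow> c \<approx> d \<Longrightarrow> a + c \<approx> b + d"
  using rel_ideal_add[of "a - b" _ "c - d"] by (simp add: cg_def algebra_simps)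

lemma cg_uminus: "a \<approx> b \<Longrightarrow> - a \<approx> - b"
  using rel_ideal_uminus[of "a - b"] by (simp add: cg_def)

lemma cg_diff: "a \<approx> b \<Longrightarrow> c \<approx> d \<Longrightarrow> a - c \<approx> b - d"
  using cg_add[OF _ cg_uminus, of a b c d] by simp

lemma cg_lmult: "a \<approx> b \<Longrightarrow> x * a \<approx> x * b"
  using rel_ideal_lmult[of "a - b" _ x] by (simp add: cg_def algebra_simps)

lemma cg_rmult: "a \<approx> b \<Longrightarrow> a * x \<approx> b * x"
  using rel_ideal_rmult[of "a - b" _ x] by (simp add: cg_def algebra_simps)

lemma cg_mult: "a \<approx> b \<Longrightarrow> c \<approx> d \<Longrightarrow> a * c \<approx> b * d"
  using cg_lmult cg_rmult cg_trans by blast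

lemma cg_sum: "(\<And>i. i \<in> A \<Longrightarrow> f i \<approx> g i) \<Longrightarrow> sum f A \<approx> sum g A"
  by (induction A rule: infinite_finite_induct) (auto intro: cg_add)

lemma cg_0_iff: "a \<approx> 0 \<longleftrightarrow> a \<in> II"
  by (simp add: cg_def)

lemma cg_rel: "a - b \<in> rels \<Longrightarrow> a \<approx> b"
  by (simp add: cg_def rel_idealI)

lemma cg_cst_cancel:
  assumes "cst c * a \<approx> cst c * b" "c \<noteq> 0"
  shows "a \<approx> b"
proof -
  have "cst (1 / c) * (cst c * x) = x" for x :: "'g falg"
    using assms(2) by (simp add: mult.assoc[symmetric] cst_mult[symmetric])
  then show ?thesis using cg_lmult[OF assms(1), of "cst (1 / c)"] by simp
qed

end

locale filtered_presentation = presentation_cong rels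
  for rels :: "'g falg set" +
  fixes nbh :: "nat \<Rightarrow> 'g falg set"
  assumes nbh_Suc: "nbh (Suc N) \<subseteq> nbh N"
    and cont: "\<exists>K. \<forall>a\<in>nbhL rels nbh K. a * b \<in> nbhL rels nbh N"
begin

abbreviation LL :: "nat \<Rightarrow> 'g falg set" where "LL \<equiv> nbhL rels nbh"
abbreviation ccl :: "(nat \<Rightarrow> 'g falg) \<Rightarrow> (nat \<Rightarrow> 'g falg set) set" where "ccl \<equiv> ccls rels nbh"
abbreviation AA :: "(nat \<Rightarrow> 'g falg set) set ring" where "AA \<equiv> completed rels nbh"

definition null :: "(nat \<Rightarrow> 'g falg) \<Rightarrow> bool" where
  "null f \<longleftrightarrow> (\<forall>N. \<exists>M. \<forall>n\<ge>M. f n \<in> LL N)"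

definition cauchy :: "(nat \<Rightarrow> 'g falg) \<Rightarrow> bool" where
  "cauchy f \<longleftrightarrow> (\<forall>N. \<exists>M. \<forall>m\<ge>M. \<forall>n\<ge>M. f m - f n \<in> LL N)"

lemma LL_antimono: "N \<le> N' \<Longrightarrow> LL N' \<subseteq> LL N"
proof -
  assume "N \<le> N'"
  then have "nbh N' \<subseteq> nbh N"
    using nbh_Suc by (rule lift_Suc_antimono_le[of nbh, rotated])
  then show ?thesis
    by (intro nbhL_minimal) (auto intro: nbhL_nbh nbhL_I nbhL_add nbhL_lmult)
qed

lemma LL_sum: "(\<And>i. i \<in> A \<Longrightarrow> f i \<in> LL N) \<Longrightarrow> sum f A \<in> LL N"
  by (induction A rule: infinite_finite_induct) (auto intro: nbhL_add)

lemma null_add: "null f \<Longrightarrow> null g \<Longrightarrow> null (\<lambda>n. f n + g n)"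
  unfolding null_def
proof
  fix N assume "\<forall>N. \<exists>M. \<forall>n\<ge>M. f n \<in> LL N" "\<forall>N. \<exists>M. \<forall>n\<ge>M. g n \<in> LL N"
  then obtain M M' where "\<forall>n\<ge>M. f n \<in> LL N" "\<forall>n\<ge>M'. g n \<in> LL N" by blast
  then show "\<exists>M. \<forall>n\<ge>M. f n + g n \<in> LL N"
    by (intro exI[of _ "max M M'"]) (auto intro: nbhL_add)
qed

lemma null_lmult: "null f \<Longrightarrow> null (\<lambda>n. x n * f n)"
  unfolding null_def using nbhL_lmult by meson

lemma null_uminus: "null f \<Longrightarrow> null (\<lambda>n. - f n)"
  using null_lmult[of f "\<lambda>_. - 1"] by simp

lemma null_I: "(\<And>n. f n \<in> II) \<Longrightarrow> null f"
  unfolding null_def using nbhL_I by blast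

lemma null_0 [simp]: "null (\<lambda>n. 0)"
  by (simp add: null_I)

lemma null_sum: "(\<And>i. i \<in> A \<Longrightarrow> null (\<lambda>n. f i n)) \<Longrightarrow> null (\<lambda>n. \<Sum>i\<in>A. f i n)"
  by (induction A rule: infinite_finite_induct) (auto intro: null_add)

text \<open>The right factor varies with \<open>n\<close>, while continuity concerns a fixed one.
  Freezing it at \<open>g M\<close> leaves the difference \<open>g n - g M\<close>, which is small,
  and small elements absorb any left factor.\<close>

lemma null_rmult:
  assumes "null f" "cauchy g"
  shows "null (\<lambda>n. f n * g n)"
  unfolding null_def
proof
  fix N
  obtain M where M: "\<And>m n. m \<ge> M \<Longrightarrow> n \<ge> M \<Longrightarrow> g m - g n \<in> LL N"
    using assms(2) unfolding cauchy_def by meson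
  obtain K where K: "\<And>a. a \<in> LL K \<Longrightarrow> a * g M \<in> LL N" using cont by blast
  obtain M' where M': "\<And>n. n \<ge> M' \<Longrightarrow> f n \<in> LL K" using assms(1) unfolding null_def by meson
  have "f n * g n \<in> LL N" if "n \<ge> max M M'" for n
  proof -
    have "f n * g n = f n * (g n - g M) + f n * g M" by (simp add: algebra_simps)
    also have "\<dots> \<in> LL N" using that by (intro nbhL_add nbhL_lmult M K M') auto
    finally show ?thesis .
  qed
  then show "\<exists>M. \<forall>n\<ge>M. f n * g n \<in> LL N" by blast
qed

lemma cauchy_const [simp]: "cauchy (\<lambda>n. c)"
  by (simp add: cauchy_def)

lemma cauchy_add:
  assumes "cauchy f" "cauchy g"
  shows "cauchy (\<lambda>n. f n + g n)"
  unfolding cauchy_def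
proof
  fix N
  obtain M M' where M: "\<And>m n. m \<ge> M \<Longrightarrow> n \<ge> M \<Longrightarrow> f m - f n \<in> LL N"
    "\<And>m n. m \<ge> M' \<Longrightarrow> n \<ge> M' \<Longrightarrow> g m - g n \<in> LL N"
    using assms unfolding cauchy_def by meson
  have "f m + g m - (f n + g n) \<in> LL N" if "m \<ge> max M M'" "n \<ge> max M M'" for m n
    using nbhL_add[OF M(1)[of m n] M(2)[of m n]] that by (simp add: algebra_simps)
  then show "\<exists>M. \<forall>m\<ge>M. \<forall>n\<ge>M. f m + g m - (f n + g n) \<in> LL N" by blast
qed

lemma cauchy_mult:
  assumes "cauchy f" "cauchy g"
  shows "cauchy (\<lambda>n. f n * g n)"
  unfolding cauchy_def
proof
  fix N
  obtain M where M: "\<And>m n. m \<ge> M \<Longrightarrow> n \<ge> M \<Longrightarrow> g m - g n \<in> LL N"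
    using assms(2) unfolding cauchy_def by meson
  obtain K where K: "\<And>a. a \<in> LL K \<Longrightarrow> a * g M \<in> LL N" using cont by blast
  obtain M' where M': "\<And>m n. m \<ge> M' \<Longrightarrow> n \<ge> M' \<Longrightarrow> f m - f n \<in> LL K"
    using assms(1) unfolding cauchy_def by meson
  have "f m * g m - f n * g n \<in> LL N" if "m \<ge> max M M'" "n \<ge> max M M'" for m n
  proof -
    have "f m * g m - f n * g n
      = f m * (g m - g n) + ((f m - f n) * (g n - g M) + (f m - f n) * g M)"
      by (simp add: algebra_simps)
    also have "\<dots> \<in> LL N" using that by (intro nbhL_add nbhL_lmult M K M') auto
    finally show ?thesis .
  qed
  then show "\<exists>M. \<forall>m\<ge>M. \<forall>n\<ge>M. f m * g m - f n * g n \<in> LL N" by blast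
qed

lemma cauchy_uminus: "cauchy f \<Longrightarrow> cauchy (\<lambda>n. - f n)"
  using cauchy_mult[of "\<lambda>_. - 1" f] by simp

abbreviation CR :: "(nat \<Rightarrow> 'g falg set) ring" where
  "CR \<equiv> cauchy_ring (presented rels) (nbh_ideal rels nbh)"

abbreviation cl :: "(nat \<Rightarrow> 'g falg) \<Rightarrow> nat \<Rightarrow> 'g falg set" where
  "cl f \<equiv> (\<lambda>n. pcls rels (f n))"

lemma pcls_in_nbh: "pcls rels a \<in> nbh_ideal rels nbh N \<longleftrightarrow> a \<in> LL N"
  by (simp add: nbhL_def)

lemma carrier_CR: "carrier CR = cl ` Collect cauchy"
proof
  show "carrier CR \<subseteq> cl ` Collect cauchy"
  proof
    fix f assume f: "f \<in> carrier CR"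
    then have "\<forall>n. \<exists>a. f n = pcls rels a" by (auto simp: cauchy_ring_def carrier_presented image_iff)
    then obtain a where a: "f = cl a" by metis
    have "cauchy a"
      using f unfolding cauchy_ring_def cauchy_def a by (simp add: presented_diff pcls_in_nbh)
    then show "f \<in> cl ` Collect cauchy" using a by blast
  qed
  show "cl ` Collect cauchy \<subseteq> carrier CR"
    by (auto simp: cauchy_ring_def cauchy_def presented_diff pcls_in_nbh carrier_presented)
qed

lemma CR_simps:
  "cl f \<otimes>\<^bsub>CR\<^esub> cl g = cl (\<lambda>n. f n * g n)" "cl f \<oplus>\<^bsub>CR\<^esub> cl g = cl (\<lambda>n. f n + g n)"
  "\<one>\<^bsub>CR\<^esub> = cl (\<lambda>_. 1)" "\<zero>\<^bsub>CR\<^esub> = cl (\<lambda>_. 0)"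
  by (simp_all add: cauchy_ring_def presented_simps presented_zero)

lemma ring_CR: "ring CR"
proof (rule ringI)
  show "abelian_group CR"
  proof (rule abelian_groupI)
    fix x assume "x \<in> carrier CR"
    then obtain f where "cauchy f" "x = cl f" by (auto simp: carrier_CR)
    then show "\<exists>y\<in>carrier CR. y \<oplus>\<^bsub>CR\<^esub> x = \<zero>\<^bsub>CR\<^esub>"
      by (intro bexI[of _ "cl (\<lambda>n. - f n)"]) (auto simp: CR_simps carrier_CR cauchy_uminus)
  qed (auto simp: carrier_CR CR_simps algebra_simps intro!: imageI cauchy_add)
  show "monoid CR"
    by (rule monoidI) (auto simp: carrier_CR CR_simps algebra_simps intro!: imageI cauchy_mult)
qed (auto simp: carrier_CR CR_simps algebra_simps)

abbreviation NN :: "(nat \<Rightarrow> 'g falg set) set" where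
  "NN \<equiv> null_seqs (presented rels) (nbh_ideal rels nbh)"

lemma null_cauchy: "null f \<Longrightarrow> cauchy f"
  unfolding null_def cauchy_def using nbhL_diff by meson

lemma NN_eq: "NN = cl ` Collect null"
  unfolding null_seqs_def carrier_CR
  by (auto simp: null_def pcls_in_nbh intro!: imageI null_cauchy)

lemma ideal_NN: "ideal NN CR"
proof (rule idealI[OF ring_CR])
  interpret ring CR by (rule ring_CR)
  show "subgroup NN (add_monoid CR)"
  proof (rule group.subgroupI[OF a_group])
    show "NN \<subseteq> carrier (add_monoid CR)" by (auto simp: null_seqs_def)
    have "cl (\<lambda>_. 0) \<in> NN" by (auto simp: NN_eq)
    then show "NN \<noteq> {}" by blast
    fix x assume "x \<in> NN"
    then obtain f where f: "null f" "x = cl f" by (auto simp: NN_eq)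
    have "\<ominus>\<^bsub>CR\<^esub> x = cl (\<lambda>n. - f n)"
      by (rule minus_equality)
        (use f in \<open>auto simp: CR_simps carrier_CR null_cauchy null_uminus intro!: imageI\<close>)
    then show "inv\<^bsub>add_monoid CR\<^esub> x \<in> NN"
      using f null_uminus by (auto simp: NN_eq a_inv_def)
    fix y assume "y \<in> NN"
    then show "x \<otimes>\<^bsub>add_monoid CR\<^esub> y \<in> NN"
      using f null_add by (auto simp: NN_eq CR_simps)
  qed
next
  fix a x assume "a \<in> NN" "x \<in> carrier CR"
  then obtain f g where "null f" "a = cl f" "cauchy g" "x = cl g" by (auto simp: NN_eq carrier_CR)
  then show "x \<otimes>\<^bsub>CR\<^esub> a \<in> NN" "a \<otimes>\<^bsub>CR\<^esub> x \<in> NN"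
    using null_lmult[of f g] null_rmult[of f g] by (auto simp: NN_eq CR_simps)
qed

lemma ccl_def': "ccl f = NN +>\<^bsub>CR\<^esub> cl f"
  by (simp add: ccls_def)

lemma ring_AA: "ring AA"
  unfolding completed_def completion_def by (rule ideal.quotient_is_ring[OF ideal_NN])

lemma hom_CR_AA: "(\<lambda>x. NN +>\<^bsub>CR\<^esub> x) \<in> ring_hom CR AA"
  unfolding completed_def completion_def by (rule ideal.rcos_ring_hom[OF ideal_NN])

lemma ccl_mult: "cauchy f \<Longrightarrow> cauchy g \<Longrightarrow> ccl f \<otimes>\<^bsub>AA\<^esub> ccl g = ccl (\<lambda>n. f n * g n)"
  and ccl_add: "cauchy f \<Longrightarrow> cauchy g \<Longrightarrow> ccl f \<oplus>\<^bsub>AA\<^esub> ccl g = ccl (\<lambda>n. f n + g n)"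
  using ring_hom_mult[OF hom_CR_AA, of "cl f" "cl g"] ring_hom_add[OF hom_CR_AA, of "cl f" "cl g"]
  by (auto simp: ccl_def' CR_simps carrier_CR)

lemma ccl_one: "\<one>\<^bsub>AA\<^esub> = ccl (\<lambda>_. 1)"
  using ring_hom_one[OF hom_CR_AA] by (simp add: ccl_def' CR_simps)

lemma ccl_zero: "\<zero>\<^bsub>AA\<^esub> = ccl (\<lambda>_. 0)"
  using ring_hom_zero[OF hom_CR_AA ring_CR ring_AA] by (simp add: ccl_def' CR_simps)

lemma ccl_carrier: "cauchy f \<Longrightarrow> ccl f \<in> carrier AA"
  using ring_hom_closed[OF hom_CR_AA, of "cl f"] by (auto simp: ccl_def' carrier_CR)

lemma ccl_eqI:
  assumes "cauchy f" "cauchy g" "null (\<lambda>n. f n - g n)"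
  shows "ccl f = ccl g"
proof -
  interpret I: ideal NN CR by (rule ideal_NN)
  have "cl f = cl (\<lambda>n. f n - g n) \<oplus>\<^bsub>CR\<^esub> cl g" by (simp add: CR_simps)
  moreover have "cl (\<lambda>n. f n - g n) \<in> NN" using assms(3) by (auto simp: NN_eq)
  ultimately have "cl f \<in> NN +>\<^bsub>CR\<^esub> cl g" by (auto simp: a_r_coset_def r_coset_def)
  then show ?thesis
    unfolding ccl_def' using I.a_repr_independence'[of "cl f" "cl g"] I.is_additive_subgroup
      assms(1,2) by (auto simp: carrier_CR I.is_additive_subgroup additive_subgroup.a_subgroup)
qed

definition sim :: "(nat \<Rightarrow> 'g falg) \<Rightarrow> (nat \<Rightarrow> 'g falg) \<Rightarrow> bool" (infix \<open>\<sim>\<close> 50) where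
  "f \<sim> g \<longleftrightarrow> null (\<lambda>n. f n - g n)"

lemma sim_refl [simp]: "f \<sim> f"
  by (simp add: sim_def)

lemma sim_sym: "f \<sim> g \<Longrightarrow> g \<sim> f"
  using null_uminus[of "\<lambda>n. f n - g n"] by (simp add: sim_def)

lemma sim_trans [trans]: "f \<sim> g \<Longrightarrow> g \<sim> k \<Longrightarrow> f \<sim> k"
  using null_add[of "\<lambda>n. f n - g n" "\<lambda>n. g n - k n"] by (simp add: sim_def)

lemma sim_eq_trans [trans]: "f \<sim> g \<Longrightarrow> g = k \<Longrightarrow> f \<sim> k" "f = g \<Longrightarrow> g \<sim> k \<Longrightarrow> f \<sim> k"
  by simp_all

lemma sim_I: "(\<And>n. f n \<approx> g n) \<Longrightarrow> f \<sim> g"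
  unfolding sim_def cg_def by (rule null_I)

lemma sim_add: "f \<sim> g \<Longrightarrow> f' \<sim> g' \<Longrightarrow> (\<lambda>n. f n + f' n) \<sim> (\<lambda>n. g n + g' n)"
  using null_add[of "\<lambda>n. f n - g n" "\<lambda>n. f' n - g' n"] by (simp add: sim_def algebra_simps)

text \<open>The asymmetry between this rule and \<open>sim_rmult\<close> reflects the left ideals: a
  left factor may be any sequence, a right factor has to be Cauchy.\<close>

lemma sim_lmult: "f \<sim> g \<Longrightarrow> (\<lambda>n. x n * f n) \<sim> (\<lambda>n. x n * g n)"
  using null_lmult[of "\<lambda>n. f n - g n" x] by (simp add: sim_def algebra_simps)

lemma sim_rmult: "f \<sim> g \<Longrightarrow> cauchy x \<Longrightarrow> (\<lambda>n. f n * x n) \<sim> (\<lambda>n. g n * x n)"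
  using null_rmult[of "\<lambda>n. f n - g n" x] by (simp add: sim_def algebra_simps)

lemma sim_uminus: "f \<sim> g \<Longrightarrow> (\<lambda>n. - f n) \<sim> (\<lambda>n. - g n)"
  using null_uminus[of "\<lambda>n. f n - g n"] by (simp add: sim_def)

lemma sim_diff: "f \<sim> g \<Longrightarrow> f' \<sim> g' \<Longrightarrow> (\<lambda>n. f n - f' n) \<sim> (\<lambda>n. g n - g' n)"
  using sim_add[OF _ sim_uminus, of f g f' g'] by simp

lemma sim_sum: "(\<And>i. i \<in> A \<Longrightarrow> f i \<sim> g i) \<Longrightarrow> (\<lambda>n. \<Sum>i\<in>A. f i n) \<sim> (\<lambda>n. \<Sum>i\<in>A. g i n)"
  by (induction A rule: infinite_finite_induct) (auto intro: sim_add)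

lemma sim_0_iff: "f \<sim> (\<lambda>n. 0) \<longleftrightarrow> null f"
  by (simp add: sim_def)

lemma cauchy_sim:
  assumes "f \<sim> g" "cauchy g"
  shows "cauchy f"
  using cauchy_add[OF null_cauchy assms(2), of "\<lambda>n. f n - g n"] assms(1) by (simp add: sim_def)

end

text \<open>The elements with continuous right multiplication form a subalgebra containing the
  constants, so generators suffice; for each of them it is enough to test the generators of the left
  ideals.\<close>

lemma cont_from_gens:
  assumes Suc: "\<And>N. nbh (Suc N) \<subseteq> nbh N"
    and gens: "\<And>g N. \<exists>K. \<forall>a\<in>nbh K. a * gen g \<in> nbhL rels nbh N"
  shows "filtered_presentation rels nbh"
proof
  show "nbh (Suc N) \<subseteq> nbh N" for N by (rule Suc)
  have anti: "nbhL rels nbh N' \<subseteq> nbhL rels nbh N" if "N \<le> N'" for N N'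
  proof -
    have "nbh N' \<subseteq> nbh N" using Suc that by (rule lift_Suc_antimono_le[of nbh])
    then show ?thesis
      by (intro nbhL_minimal) (auto intro: nbhL_nbh nbhL_I nbhL_add nbhL_lmult)
  qed
  show "\<exists>K. \<forall>a\<in>nbhL rels nbh K. a * b \<in> nbhL rels nbh N" for b N
  proof (induction b arbitrary: N rule: falg_induct)
    case (cst c)
    then show ?case by (auto simp: cst_comm intro!: exI[of _ N] nbhL_lmult)
  next
    case (gen g)
    obtain K where "\<forall>a\<in>nbh K. a * gen g \<in> nbhL rels nbh N" using gens by blast
    then have "nbhL rels nbh K \<subseteq> {a. a * gen g \<in> nbhL rels nbh N}"
      by (intro nbhL_minimal)
        (auto simp: distrib_right mult.assoc intro: nbhL_I rel_ideal_rmult nbhL_add nbhL_lmult)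
    then show ?case by blast
  next
    case (add x y)
    obtain K K' where "\<forall>a\<in>nbhL rels nbh K. a * x \<in> nbhL rels nbh N"
      "\<forall>a\<in>nbhL rels nbh K'. a * y \<in> nbhL rels nbh N" using add by meson
    moreover have "nbhL rels nbh (max K K') \<subseteq> nbhL rels nbh K" "nbhL rels nbh (max K K') \<subseteq> nbhL rels nbh K'"
      by (auto intro!: anti)
    ultimately show ?case
      by (intro exI[of _ "max K K'"]) (auto simp: distrib_left intro!: nbhL_add)
  next
    case (mult x y)
    \<comment> \<open>The factor \<open>x\<close> meets the small element first, so its bound
      \<open>K'\<close> is chosen after the bound \<open>K\<close> that serves
      \<open>y\<close>.\<close>
    obtain K where K: "\<forall>a\<in>nbhL rels nbh K. a * y \<in> nbhL rels nbh N" using mult by meson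
    obtain K' where "\<forall>a\<in>nbhL rels nbh K'. a * x \<in> nbhL rels nbh K" using mult by meson
    then show ?case using K by (intro exI[of _ K']) (auto simp: mult.assoc[symmetric])
  qed
qed

section \<open>Oscillators\<close>

lemma sum2_reindex:
  fixes f :: "'a \<Rightarrow> 'b \<Rightarrow> 'e::comm_monoid_add"
  assumes "finite A" "\<And>x. x \<in> A \<Longrightarrow> finite (B x)" "finite C" "\<And>u. u \<in> C \<Longrightarrow> finite (D u)"
    and "\<And>x y. x \<in> A \<Longrightarrow> y \<in> B x \<Longrightarrow> h1 x y \<in> C \<and> h2 x y \<in> D (h1 x y)
      \<and> k1 (h1 x y) (h2 x y) = x \<and> k2 (h1 x y) (h2 x y) = y \<and> g (h1 x y) (h2 x y) = f x y"
    and "\<And>u v. u \<in> C \<Longrightarrow> v \<in> D u \<Longrightarrow> k1 u v \<in> A \<and> k2 u v \<in> B (k1 u v)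
      \<and> h1 (k1 u v) (k2 u v) = u \<and> h2 (k1 u v) (k2 u v) = v"
  shows "(\<Sum>x\<in>A. \<Sum>y\<in>B x. f x y) = (\<Sum>u\<in>C. \<Sum>v\<in>D u. g u v)"
proof -
  have "(\<Sum>x\<in>A. \<Sum>y\<in>B x. f x y) = (\<Sum>(x, y)\<in>Sigma A B. f x y)"
    using assms by (intro sum.Sigma) auto
  also have "\<dots> = (\<Sum>(u, v)\<in>Sigma C D. g u v)"
    by (rule sum.reindex_bij_witness[of _ "\<lambda>(u, v). (k1 u v, k2 u v)" "\<lambda>(x, y). (h1 x y, h2 x y)"])
      (use assms(5,6) in auto)
  also have "\<dots> = (\<Sum>u\<in>C. \<Sum>v\<in>D u. g u v)"
    using assms by (intro sum.Sigma[symmetric]) auto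
  finally show ?thesis .
qed

lemma sum_triangle_swap:
  fixes f :: "nat \<Rightarrow> nat \<Rightarrow> 'a::comm_monoid_add"
  shows "(\<Sum>k\<in>{1..j}. \<Sum>s\<le>j - k. f k s) = (\<Sum>s\<le>j. \<Sum>k\<in>{1..j - s}. f k s)"
  by (rule sum2_reindex[of _ _ _ _ "\<lambda>k s. s" "\<lambda>k s. k" "\<lambda>k s. s" "\<lambda>k s. k"]) auto

lemma sum_triangle_diag:
  fixes f :: "nat \<Rightarrow> nat \<Rightarrow> 'a::comm_monoid_add"
  shows "(\<Sum>k\<in>{1..j}. \<Sum>s\<le>j - k. f k s) = (\<Sum>t\<le>j. \<Sum>s<t. f (t - s) s)"
  by (rule sum2_reindex[of _ _ _ _ "\<lambda>k s. k + s" "\<lambda>k s. s" "\<lambda>t s. t - s" "\<lambda>t s. s"]) auto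

text \<open>The coefficients of exp (sum over k > 0 of L(k) x^k / k): the recursion is the Euler
  operator x d/dx applied to this exponential. In this form it fits the inductions over exponentials
  of modes.\<close>

definition ctr_seq :: "(nat \<Rightarrow> complex) \<Rightarrow> (nat \<Rightarrow> complex) \<Rightarrow> bool" where
  "ctr_seq L c \<longleftrightarrow> c 0 = 1 \<and> (\<forall>s. of_nat s * c s = (\<Sum>k<s. L (s - k) * c k))"

definition extz :: "(nat \<Rightarrow> complex) \<Rightarrow> int \<Rightarrow> complex" where
  "extz c s = (if s \<ge> 0 then c (nat s) else 0)"

text \<open>Integer indices with value 0 below zero let shifts by contracted degrees run past the
  end of a series without case distinctions.\<close>

definition ez :: "(nat \<Rightarrow> 'g falg) \<Rightarrow> int \<Rightarrow> 'g falg" where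
  "ez y i = (if i \<ge> 0 then exp_coeff y (nat i) else 0)"

lemma ez_nat: "ez y (int i) = exp_coeff y i"
  by (simp add: ez_def)

lemma ez_neg: "i < 0 \<Longrightarrow> ez y i = 0"
  by (simp add: ez_def)

lemma osc_exp_eq: "osc_exp a b m M = (\<Sum>j\<le>M. ez a (m + int j) * exp_coeff b j)"
  unfolding osc_exp_def ez_def by (rule sum.cong) auto

section \<open>Formal exponentials of mutually commuting coefficients\<close>

abbreviation pw :: "(nat \<Rightarrow> 'g falg) \<Rightarrow> nat \<Rightarrow> nat \<Rightarrow> 'g falg" where
  "pw y r m \<equiv> fps_nth (Abs_fps (\<lambda>n. if n = 0 then 0 else y n) ^ r) m"

lemma pw_Suc: "pw y (Suc r) m = (\<Sum>k\<in>{1..m}. y k * pw y r (m - k))"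
proof -
  have "pw y (Suc r) m = (\<Sum>k\<in>{0..m}. (if k = 0 then 0 else y k) * pw y r (m - k))"
    by (simp add: fps_mult_nth)
  also have "\<dots> = (\<Sum>k\<in>{1..m}. y k * pw y r (m - k))"
    by (rule sum.mono_neutral_cong_right) auto
  finally show ?thesis .
qed

lemma pw_0_sum: "(\<Sum>k\<in>{1..m}. g k * pw y 0 (m - k)) = (if m = 0 then 0 else g m)"
proof -
  have "(\<Sum>k\<in>{1..m}. g k * pw y 0 (m - k)) = (\<Sum>k\<in>{1..m}. if k = m then g m else 0)"
    by (intro sum.cong) auto
  then show ?thesis by simp
qed

lemma pw_zero: "m < r \<Longrightarrow> pw y r m = 0"
proof (induction r arbitrary: m)
  case (Suc r)
  then show ?case by (auto simp: pw_Suc simp del: power_Suc intro!: sum.neutral)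
qed simp

lemma exp_coeff_0 [simp]: "exp_coeff y 0 = 1"
  by (simp add: exp_coeff_def)

context filtered_presentation
begin

text \<open>Commutation is asked modulo the relations and for positive indices, as
  \<open>exp_coeff\<close> discards the coefficient with index 0.\<close>

definition commuting :: "(nat \<Rightarrow> 'g falg) \<Rightarrow> (nat \<Rightarrow> 'g falg) \<Rightarrow> bool" where
  "commuting y z \<longleftrightarrow> (\<forall>k>0. \<forall>l>0. y k * z l \<approx> z l * y k)"

text \<open>The equation t f' = (t y') f for f = exp(y). In characteristic zero it determines f up
  to the relations, which makes it a criterion for recognising exponentials.\<close>

definition exp_rec :: "(nat \<Rightarrow> 'g falg) \<Rightarrow> (nat \<Rightarrow> 'g falg) \<Rightarrow> bool" where
  "exp_rec y f \<longleftrightarrow> f 0 \<approx> 1 \<and>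
     (\<forall>m. cst (of_nat m) * f m \<approx> (\<Sum>k\<in>{1..m}. cst (of_nat k) * (y k * f (m - k))))"

lemma exp_rec_unique:
  assumes "exp_rec y f" "exp_rec y g"
  shows "f m \<approx> g m"
proof (induction m rule: less_induct)
  case (less m)
  show ?case
  proof (cases "m = 0")
    case True
    then show ?thesis using assms cg_trans cg_sym unfolding exp_rec_def by blast
  next
    case False
    have "cst (of_nat m) * f m \<approx> (\<Sum>k\<in>{1..m}. cst (of_nat k) * (y k * f (m - k)))"
      using assms(1) by (simp add: exp_rec_def)
    also have "\<dots> \<approx> (\<Sum>k\<in>{1..m}. cst (of_nat k) * (y k * g (m - k)))"
      by (intro cg_sum cg_lmult less.IH) auto
    also have "\<dots> \<approx> cst (of_nat m) * g m"
      using assms(2) cg_sym by (simp add: exp_rec_def)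
    finally show ?thesis by (rule cg_cst_cancel) (use False in auto)
  qed
qed

text \<open>For D = t d/dt this is D(Y^(r+1)) = (r+1) (DY) Y^r, obtained from Y^(r+1) = Y Y^r by the
  Leibniz rule. Commuting coefficients are needed to move the differentiated factor to the
  front.\<close>

lemma pw_deriv:
  assumes "commuting y y"
  shows "cst (of_nat m) * pw y (Suc r) m
    \<approx> cst (of_nat (Suc r)) * (\<Sum>k\<in>{1..m}. cst (of_nat k) * (y k * pw y r (m - k)))"
proof (induction r arbitrary: m)
  case 0
  have "(if m = 0 then 0 else cst (of_nat m) * y m) = cst (of_nat m) * (if m = 0 then 0 else y m)"
    by simp
  then show ?case
    unfolding pw_Suc pw_0_sum mult.assoc[symmetric] by (simp only: of_nat_Suc of_nat_0 add_0_right cst_1 mult_1 cg_refl)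
next
  case (Suc r)
  let ?D = "\<lambda>m. \<Sum>k\<in>{1..m}. cst (of_nat k) * (y k * pw y r (m - k))"
  have Suc_mult: "x + cst (of_nat (Suc r)) * x = cst (of_nat (Suc (Suc r))) * x" for x :: "'g falg"
    unfolding of_nat_Suc[of "Suc r"] cst_add cst_1 distrib_right by simp
  have "cst (of_nat m) * pw y (Suc (Suc r)) m
      = (\<Sum>k\<in>{1..m}. cst (of_nat k) * (y k * pw y (Suc r) (m - k))
          + y k * (cst (of_nat (m - k)) * pw y (Suc r) (m - k)))"
  proof -
    have "cst (of_nat m) * (y k * x) = cst (of_nat k) * (y k * x) + y k * (cst (of_nat (m - k)) * x)"
      if "k \<in> {1..m}" for k x
      using that by (simp add: cst_comm_assoc[of "y k"] distrib_right[symmetric] cst_add[symmetric] of_nat_diff)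
    then show ?thesis
      unfolding pw_Suc[of y "Suc r"] sum_distrib_left by (intro sum.cong) auto
  qed
  also have "\<dots> = (\<Sum>k\<in>{1..m}. cst (of_nat k) * (y k * pw y (Suc r) (m - k)))
      + (\<Sum>k\<in>{1..m}. y k * (cst (of_nat (m - k)) * pw y (Suc r) (m - k)))"
    by (rule sum.distrib)
  also have "\<dots> \<approx> (\<Sum>k\<in>{1..m}. cst (of_nat k) * (y k * pw y (Suc r) (m - k)))
      + (\<Sum>k\<in>{1..m}. y k * (cst (of_nat (Suc r)) * ?D (m - k)))"
    by (intro cg_add cg_refl cg_sum cg_lmult Suc.IH)
  also have "(\<Sum>k\<in>{1..m}. y k * (cst (of_nat (Suc r)) * ?D (m - k)))
      = cst (of_nat (Suc r)) * (\<Sum>k\<in>{1..m}. \<Sum>l\<in>{1..m - k}.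
          cst (of_nat l) * (y k * y l * pw y r (m - k - l)))"
    unfolding sum_distrib_left by (simp only: cst_comm_assoc[of "y _"] mult.assoc)
  also have "(\<Sum>k\<in>{1..m}. cst (of_nat k) * (y k * pw y (Suc r) (m - k))) + \<dots>
      \<approx> (\<Sum>k\<in>{1..m}. cst (of_nat k) * (y k * pw y (Suc r) (m - k)))
       + cst (of_nat (Suc r)) * (\<Sum>k\<in>{1..m}. \<Sum>l\<in>{1..m - k}.
          cst (of_nat l) * (y l * y k * pw y r (m - k - l)))"
    using assms unfolding commuting_def
    by (intro cg_add cg_refl cg_sum cg_lmult cg_rmult) auto
  also have "(\<Sum>k\<in>{1..m}. \<Sum>l\<in>{1..m - k}. cst (of_nat l) * (y l * y k * pw y r (m - k - l)))
      = (\<Sum>l\<in>{1..m}. \<Sum>k\<in>{1..m - l}. cst (of_nat l) * (y l * y k * pw y r (m - k - l)))"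
    by (rule sum2_reindex[of _ _ _ _ "\<lambda>k l. l" "\<lambda>k l. k" "\<lambda>l k. k" "\<lambda>l k. l"]) auto
  also have "\<dots> = (\<Sum>l\<in>{1..m}. cst (of_nat l) * (y l * pw y (Suc r) (m - l)))"
    by (intro sum.cong refl)
      (simp add: pw_Suc sum_distrib_left mult.assoc add.commute del: power_Suc)
  also have "(\<Sum>k\<in>{1..m}. cst (of_nat k) * (y k * pw y (Suc r) (m - k)))
      + cst (of_nat (Suc r)) * (\<Sum>l\<in>{1..m}. cst (of_nat l) * (y l * pw y (Suc r) (m - l)))
    = cst (of_nat (Suc (Suc r))) * (\<Sum>k\<in>{1..m}. cst (of_nat k) * (y k * pw y (Suc r) (m - k)))"
    by (rule Suc_mult)
  finally show ?case .
qed

lemma exp_rec_exp_coeff: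
  assumes "commuting y y"
  shows "exp_rec y (exp_coeff y)"
  unfolding exp_rec_def
proof (intro conjI allI)
  fix m
  show "cst (of_nat m) * exp_coeff y m
    \<approx> (\<Sum>k\<in>{1..m}. cst (of_nat k) * (y k * exp_coeff y (m - k)))"
  proof (cases "m = 0")
    case False
    have "cst (of_nat m) * exp_coeff y m
        = (\<Sum>r\<in>{..m}. cst (1 / fact r) * (cst (of_nat m) * pw y r m))"
      unfolding exp_coeff_def sum_distrib_left by (intro sum.cong refl cst_comm_assoc)
    also have "\<dots> = (\<Sum>r\<in>{1..m}. cst (1 / fact r) * (cst (of_nat m) * pw y r m))"
      using False by (intro sum.mono_neutral_right) (auto simp: not_less_eq_eq Suc_le_eq)
    also have "\<dots> = (\<Sum>r<m. cst (1 / fact (Suc r)) * (cst (of_nat m) * pw y (Suc r) m))"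
      by (rule sum.reindex_bij_witness[of _ Suc "\<lambda>r. r - 1"]) auto
    also have "\<dots> \<approx> (\<Sum>r<m. cst (1 / fact (Suc r)) * (cst (of_nat (Suc r)) *
        (\<Sum>k\<in>{1..m}. cst (of_nat k) * (y k * pw y r (m - k)))))"
      by (intro cg_sum cg_lmult pw_deriv assms)
    also have "\<dots> = (\<Sum>r<m. cst (1 / fact r) *
        (\<Sum>k\<in>{1..m}. cst (of_nat k) * (y k * pw y r (m - k))))"
    proof (intro sum.cong refl)
      fix r x
      have "1 / fact (Suc r) * of_nat (Suc r) = (1 / fact r :: complex)"
        by (simp add: divide_simps del: of_nat_Suc)
      then show "cst (1 / fact (Suc r)) * (cst (of_nat (Suc r)) * x) = cst (1 / fact r) * x"
        for x :: "'g falg"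
        by (metis cst_mult mult.assoc)
    qed
    also have "\<dots> = (\<Sum>k\<in>{1..m}. \<Sum>r<m. cst (of_nat k) * (y k * (cst (1 / fact r) * pw y r (m - k))))"
      unfolding sum_distrib_left
      by (subst sum.swap, intro sum.cong refl) (simp only: cst_comm_assoc[of "cst _"] cst_comm_assoc[of "y _"])
    also have "\<dots> = (\<Sum>k\<in>{1..m}. cst (of_nat k) * (y k * exp_coeff y (m - k)))"
    proof (intro sum.cong refl)
      fix k assume k: "k \<in> {1..m}"
      \<comment> \<open>The bounds r < m and r <= m - k give the same sum: Y has no constant term,
        so Y^r starts at t^r.\<close>
      have "(\<Sum>r<m. cst (1 / fact r) * pw y r (m - k)) = exp_coeff y (m - k)"
        unfolding exp_coeff_def
        by (rule sum.mono_neutral_right) (use k in \<open>auto simp: pw_zero\<close>)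
      then show "(\<Sum>r<m. cst (of_nat k) * (y k * (cst (1 / fact r) * pw y r (m - k))))
          = cst (of_nat k) * (y k * exp_coeff y (m - k))"
        by (simp add: sum_distrib_left[symmetric])
    qed
    finally show ?thesis .
  qed simp
qed simp

lemma pw_commute:
  assumes "\<And>k. k > 0 \<Longrightarrow> z * y k \<approx> y k * z"
  shows "z * pw y r m \<approx> pw y r m * z"
proof (induction r arbitrary: m)
  case (Suc r)
  have "z * (y k * pw y r (m - k)) \<approx> y k * pw y r (m - k) * z" if "k \<in> {1..m}" for k
  proof -
    have "z * (y k * pw y r (m - k)) = z * y k * pw y r (m - k)" by (simp add: mult.assoc)
    also have "\<dots> \<approx> y k * z * pw y r (m - k)" using that by (intro cg_rmult assms) auto
    also have "\<dots> = y k * (z * pw y r (m - k))" by (simp add: mult.assoc)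
    also have "\<dots> \<approx> y k * (pw y r (m - k) * z)" by (intro cg_lmult Suc.IH)
    finally show ?thesis by (simp add: mult.assoc)
  qed
  then show ?case
    unfolding pw_Suc sum_distrib_left sum_distrib_right by (intro cg_sum) auto
qed auto

lemma exp_coeff_commute:
  assumes "\<And>k. k > 0 \<Longrightarrow> z * y k \<approx> y k * z"
  shows "z * exp_coeff y m \<approx> exp_coeff y m * z"
  unfolding exp_coeff_def sum_distrib_left sum_distrib_right
proof (intro cg_sum)
  fix r
  have "z * (cst (1 / fact r) * pw y r m) = cst (1 / fact r) * (z * pw y r m)"
    by (rule cst_comm_assoc)
  also have "\<dots> \<approx> cst (1 / fact r) * (pw y r m * z)"
    by (intro cg_lmult pw_commute assms)
  finally show "z * (cst (1 / fact r) * pw y r m) \<approx> cst (1 / fact r) * pw y r m * z"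
    by (simp add: mult.assoc)
qed

lemma ez_commute: "(\<And>k. k > 0 \<Longrightarrow> z * y k \<approx> y k * z) \<Longrightarrow> z * ez y i \<approx> ez y i * z"
  by (simp add: ez_def exp_coeff_commute)

lemma ez_ez_commute:
  assumes "commuting y z"
  shows "ez y i * ez z j \<approx> ez z j * ez y i"
  using assms unfolding commuting_def
  by (intro ez_commute cg_sym[OF ez_commute]) (auto intro: cg_sym)

text \<open>If the exponent vanishes modulo the relations, the exponential reduces to 1. Applied to
  the creators of psi^+ and to the annihilators of psi^-, this makes the two currents
  one-sided.\<close>

lemma exp_coeff_II:
  assumes "\<And>k. k > 0 \<Longrightarrow> y k \<in> II" "m > 0"
  shows "exp_coeff y m \<in> II"
proof -
  have pw: "pw y r m \<in> II" if r: "r > 0" for r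
  proof -
    obtain r' where r': "r = Suc r'" using r gr0_implies_Suc by blast
    have "(\<Sum>k\<in>{1..m}. y k * pw y r' (m - k)) \<approx> (\<Sum>k\<in>{1..m}. 0)"
      using assms by (intro cg_sum) (auto simp: cg_0_iff intro!: rel_ideal_rmult)
    then show ?thesis unfolding r' pw_Suc by (simp add: cg_0_iff)
  qed
  have "(\<Sum>r\<le>m. cst (1 / fact r) * pw y r m) \<approx> (\<Sum>r\<le>m. 0)"
  proof (intro cg_sum)
    fix r show "cst (1 / fact r) * pw y r m \<approx> 0"
      using pw[of r] assms(2) by (cases "r = 0") (auto simp: cg_0_iff rel_ideal_lmult)
  qed
  then show ?thesis by (simp add: exp_coeff_def cg_0_iff)
qed

lemma ez_rec:
  assumes "commuting y y"
  shows "cst (of_int i) * ez y i \<approx> (\<Sum>k\<in>{1..nat i}. cst (of_nat k) * (y k * ez y (i - int k)))"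
proof (cases "i \<ge> 0")
  case True
  then obtain m where m: "i = int m" using nonneg_int_cases by blast
  have "(\<Sum>k\<in>{1..m}. cst (of_nat k) * (y k * ez y (i - int k)))
      = (\<Sum>k\<in>{1..m}. cst (of_nat k) * (y k * exp_coeff y (m - k)))"
    by (intro sum.cong) (auto simp: m ez_def nat_diff_distrib)
  then show ?thesis
    using exp_rec_exp_coeff[OF assms] by (simp add: m ez_nat exp_rec_def)
qed (simp add: ez_def)

end

text \<open>The coefficient of z^m w^n in d(w/z) times the normally ordered product of the
  exponentials (a, b) at z and (a', b') at w, cut off at annihilation degree M in each variable. For
  fixed j and l the range of s is exactly where both creator indices are nonnegative, so d may be
  infinite in both directions, like a delta function.\<close>

definition Wp :: "(nat \<Rightarrow> 'g falg) \<Rightarrow> (nat \<Rightarrow> 'g falg) \<Rightarrow> (nat \<Rightarrow> 'g falg) \<Rightarrow> (nat \<Rightarrow> 'g falg)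
    \<Rightarrow> (int \<Rightarrow> complex) \<Rightarrow> int \<Rightarrow> int \<Rightarrow> nat \<Rightarrow> 'g falg" where
  "Wp a b a' b' d m n M = (\<Sum>j\<le>M. \<Sum>l\<le>M. \<Sum>s\<in>{- m - int j..n + int l}. cst (d s) *
     (ez a (m + s + int j) * ez a' (n - s + int l) * exp_coeff b j * exp_coeff b' l))"

lemma Wp_add: "Wp a b a' b' (\<lambda>s. d s + e s) m n M = Wp a b a' b' d m n M + Wp a b a' b' e m n M"
  by (simp add: Wp_def cst_add distrib_right sum.distrib)

lemma Wp_cmult: "Wp a b a' b' (\<lambda>s. c * d s) m n M = cst c * Wp a b a' b' d m n M"
  by (simp add: Wp_def cst_mult sum_distrib_left mult.assoc)

lemma Wp_diff: "Wp a b a' b' (\<lambda>s. d s - e s) m n M = Wp a b a' b' d m n M - Wp a b a' b' e m n M"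
  by (simp add: Wp_def cst_diff left_diff_distrib sum_subtractf)

lemma Wp_sum: "Wp a b a' b' (\<lambda>s. \<Sum>x\<in>A. d x s) m n M = (\<Sum>x\<in>A. Wp a b a' b' (d x) m n M)"
proof (induction A rule: infinite_finite_induct)
  case (insert x A)
  then show ?case by (simp add: Wp_add)
qed (simp_all add: Wp_def)

text \<open>Multiplying d by (w/z)^k only shifts exponents; this is how prefactors such as z - q^2 w
  are absorbed in the series.\<close>

lemma Wp_shift: "Wp a b a' b' (\<lambda>s. d (s - k)) m n = Wp a b a' b' d (m + k) (n - k)"
proof
  fix M
  show "Wp a b a' b' (\<lambda>s. d (s - k)) m n M = Wp a b a' b' d (m + k) (n - k) M"
    unfolding Wp_def
    by (intro sum.cong refl sum.reindex_bij_witness[of _ "\<lambda>s. s + k" "\<lambda>s. s - k"])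
      (auto simp: algebra_simps)
qed

lemma exp_coeff_scale:
  fixes y :: "nat \<Rightarrow> 'g falg"
  shows "exp_coeff (\<lambda>k. cst (r ^ k) * y k) m = cst (r ^ m) * exp_coeff y m"
proof -
  have "pw (\<lambda>k. cst (r ^ k) * y k) p m = cst (r ^ m) * pw y p m" for p m
  proof (induction p arbitrary: m)
    case (Suc p)
    have "cst (r ^ k) * y k * (cst (r ^ (m - k)) * x) = cst (r ^ m) * (y k * x)"
      if "k \<in> {1..m}" for k and x :: "'g falg"
    proof -
      have "cst (r ^ k) * y k * (cst (r ^ (m - k)) * x) = cst (r ^ k) * (y k * (cst (r ^ (m - k)) * x))"
        by (simp only: mult.assoc)
      also have "\<dots> = cst (r ^ k * r ^ (m - k)) * (y k * x)"
        by (simp only: cst_comm_assoc[of "y k"] cst_mult mult.assoc)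
      finally show ?thesis using that by (simp add: power_add[symmetric])
    qed
    then show ?case unfolding pw_Suc Suc.IH sum_distrib_left by (intro sum.cong) auto
  qed auto
  then show ?thesis
    unfolding exp_coeff_def sum_distrib_left
    by (intro sum.cong refl) (metis cst_comm_assoc)
qed

context filtered_presentation
begin

text \<open>Normal ordering is symmetric because creators commute with creators and annihilators
  with annihilators. Exchanging z and w turns d(w/z) into d(z/w), hence the reflected index.\<close>

lemma Wp_swap:
  assumes "commuting a a'" "commuting b b'"
  shows "Wp a' b' a b d n m M \<approx> Wp a b a' b' (\<lambda>s. d (- s)) m n M"
proof -
  have "Wp a' b' a b d n m M = (\<Sum>l\<le>M. \<Sum>j\<le>M. \<Sum>s\<in>{- n - int j..m + int l}. cst (d s) *
     (ez a' (n + s + int j) * ez a (m - s + int l) * exp_coeff b' j * exp_coeff b l))"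
    unfolding Wp_def by (rule sum.swap)
  also have "\<dots> = (\<Sum>l\<le>M. \<Sum>j\<le>M. \<Sum>s\<in>{- m - int l..n + int j}. cst (d (- s)) *
     (ez a' (n - s + int j) * ez a (m + s + int l) * exp_coeff b' j * exp_coeff b l))"
    by (intro sum.cong refl sum.reindex_bij_witness[of _ uminus uminus])
      (auto simp: algebra_simps)
  also have "\<dots> \<approx> Wp a b a' b' (\<lambda>s. d (- s)) m n M"
    unfolding Wp_def
  proof (intro cg_sum cg_lmult)
    fix l j s
    have "commuting b' b" using assms(2) cg_sym by (auto simp: commuting_def)
    then have b: "exp_coeff b' j * exp_coeff b l \<approx> exp_coeff b l * exp_coeff b' j"
      using ez_ez_commute[of b' b "int j" "int l"] by (simp add: ez_nat)
    have a: "ez a' x * ez a y \<approx> ez a y * ez a' x" for x y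
      using cg_sym[OF ez_ez_commute[OF assms(1)]] .
    show "ez a' (n - s + int j) * ez a (m + s + int l) * exp_coeff b' j * exp_coeff b l
      \<approx> ez a (m + s + int l) * ez a' (n - s + int j) * exp_coeff b l * exp_coeff b' j"
      using cg_mult[OF a b, of "n - s + int j" "m + s + int l"] by (simp add: mult.assoc)
  qed
  finally show ?thesis .
qed

lemma Wp_II:
  assumes "\<And>s j l. - m - int j \<le> s \<Longrightarrow> s \<le> n + int l \<Longrightarrow> d s \<noteq> 0 \<Longrightarrow>
    ez a (m + s + int j) * ez a' (n - s + int l) * exp_coeff b j * exp_coeff b' l \<in> II"
  shows "Wp a b a' b' d m n M \<in> II"
proof -
  have "Wp a b a' b' d m n M \<approx> (\<Sum>j\<le>M. \<Sum>l\<le>M. \<Sum>s\<in>{- m - int j..n + int l}. 0)"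
    unfolding Wp_def
  proof (intro cg_sum)
    fix j l s assume "s \<in> {- m - int j..n + int l}"
    then show "cst (d s) * (ez a (m + s + int j) * ez a' (n - s + int l) * exp_coeff b j * exp_coeff b' l) \<approx> 0"
      using assms[of j s l] by (cases "d s = 0") (auto simp: cg_0_iff intro: rel_ideal_lmult)
  qed
  then show ?thesis by (simp add: cg_0_iff)
qed

text \<open>Without creators at z only the powers z^(m+s) with m + s <= 0 survive in that factor, so
  the values of d above -m do not matter. The next two lemmas are the analogues for missing
  annihilators at z and at w.\<close>

lemma Wp_II_left_annihilating:
  assumes "\<And>k. k > 0 \<Longrightarrow> a k \<in> II" "\<And>s. s \<le> - m \<Longrightarrow> d s = 0"
  shows "Wp a b a' b' d m n M \<in> II"
proof (rule Wp_II)
  fix s j l assume *: "- m - int j \<le> s" "d s \<noteq> 0"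
  then have "s > - m" using assms(2) not_less by blast
  then have "exp_coeff a (nat (m + s + int j)) \<in> II" by (intro exp_coeff_II assms) auto
  then show "ez a (m + s + int j) * ez a' (n - s + int l) * exp_coeff b j * exp_coeff b' l \<in> II"
    by (auto simp: ez_def intro!: rel_ideal_rmult)
qed

lemma Wp_II_left_creating:
  assumes "\<And>k. k > 0 \<Longrightarrow> b k \<in> II" "\<And>s. s \<ge> - m \<Longrightarrow> d s = 0"
  shows "Wp a b a' b' d m n M \<in> II"
proof (rule Wp_II)
  fix s j l assume *: "- m - int j \<le> s" "d s \<noteq> 0"
  then have "s < - m" using assms(2) not_less by blast
  then have "exp_coeff b j \<in> II" using * by (intro exp_coeff_II assms) auto
  then show "ez a (m + s + int j) * ez a' (n - s + int l) * exp_coeff b j * exp_coeff b' l \<in> II"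
    by (intro rel_ideal_rmult rel_ideal_lmult)
qed

lemma Wp_II_right_creating:
  assumes "\<And>k. k > 0 \<Longrightarrow> b' k \<in> II" "\<And>s. s \<le> n \<Longrightarrow> d s = 0"
  shows "Wp a b a' b' d m n M \<in> II"
proof (rule Wp_II)
  fix s j l assume *: "s \<le> n + int l" "d s \<noteq> 0"
  then have "s > n" using assms(2) not_less by blast
  then have "exp_coeff b' l \<in> II" using * by (intro exp_coeff_II assms) auto
  then show "ez a (m + s + int j) * ez a' (n - s + int l) * exp_coeff b j * exp_coeff b' l \<in> II"
    by (intro rel_ideal_lmult)
qed

text \<open>Both commutation rules with an exponential of creators follow by comparing the Euler operator
  applied to the two sides.\<close>

lemma mode_ez:
  assumes cc: "commuting a a"
    and br: "\<And>k. k > 0 \<Longrightarrow> z * a k \<approx> a k * z + cst (if k = n then g else 0)"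
    and n: "n > 0"
  shows "z * ez a i \<approx> ez a i * z + cst g * ez a (i - int n)"
proof (induction "nat i" arbitrary: i rule: less_induct)
  case less
  consider "i < 0" | "i = 0" | "i > 0" by linarith
  then show ?case
  proof cases
    case 3
    have "cst (of_int i) * (z * ez a i) = z * (cst (of_int i) * ez a i)"
      by (rule cst_comm_assoc[symmetric])
    also have "\<dots> \<approx> z * (\<Sum>k\<in>{1..nat i}. cst (of_nat k) * (a k * ez a (i - int k)))"
      by (intro cg_lmult ez_rec cc)
    also have "\<dots> = (\<Sum>k\<in>{1..nat i}. cst (of_nat k) * (z * a k * ez a (i - int k)))"
      unfolding sum_distrib_left by (simp only: cst_comm_assoc[of z] mult.assoc)
    also have "\<dots> \<approx> (\<Sum>k\<in>{1..nat i}. cst (of_nat k) *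
        ((a k * z + cst (if k = n then g else 0)) * ez a (i - int k)))"
      by (intro cg_sum cg_lmult cg_rmult br) auto
    also have "\<dots> = (\<Sum>k\<in>{1..nat i}. cst (of_nat k) * (a k * (z * ez a (i - int k)))
        + cst (if k = n then of_nat n * g else 0) * ez a (i - int k))"
      by (intro sum.cong refl) (auto simp: distrib_left distrib_right mult.assoc cst_mult)
    also have "\<dots> \<approx> (\<Sum>k\<in>{1..nat i}. cst (of_nat k) *
          (a k * (ez a (i - int k) * z + cst g * ez a (i - int k - int n)))
        + cst (if k = n then of_nat n * g else 0) * ez a (i - int k))"
      by (intro cg_sum cg_add cg_refl cg_lmult less.hyps) auto
    also have "\<dots> = (\<Sum>k\<in>{1..nat i}. cst (of_nat k) * (a k * ez a (i - int k))) * z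
        + (cst g * (\<Sum>k\<in>{1..nat i}. cst (of_nat k) * (a k * ez a (i - int n - int k)))
        + (\<Sum>k\<in>{1..nat i}. cst (if k = n then of_nat n * g else 0) * ez a (i - int k)))"
    proof -
      have "a k * (cst g * x) = cst g * (a k * x)" "cst (of_nat k) * (cst g * x) = cst g * (cst (of_nat k) * x)"
        for k x by (rule cst_comm_assoc)+
      moreover have "i - int k - int n = i - int n - int k" for k by simp
      ultimately show ?thesis
        by (simp only: sum.distrib sum_distrib_left sum_distrib_right distrib_left mult.assoc add.assoc)
    qed
    also have "(\<Sum>k\<in>{1..nat i}. cst (if k = n then of_nat n * g else 0) * ez a (i - int k))
        = cst (of_nat n * g) * ez a (i - int n)"
    proof -
      have "(\<Sum>k\<in>{1..nat i}. cst (if k = n then of_nat n * g else 0) * ez a (i - int k))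
        = (\<Sum>k\<in>{1..nat i}. if k = n then cst (of_nat n * g) * ez a (i - int n) else 0)"
        by (intro sum.cong) auto
      also have "\<dots> = cst (of_nat n * g) * ez a (i - int n)"
        \<comment> \<open>If \<open>n > i\<close>, the index \<open>n\<close> is outside the range
          of summation, but then \<open>i - n\<close> is negative and \<open>ez\<close>
          vanishes.\<close>
        using n by (auto simp: ez_def)
      finally show ?thesis .
    qed
    also have "(\<Sum>k\<in>{1..nat i}. cst (of_nat k) * (a k * ez a (i - int n - int k)))
        = (\<Sum>k\<in>{1..nat (i - int n)}. cst (of_nat k) * (a k * ez a (i - int n - int k)))"
      by (rule sum.mono_neutral_right) (auto simp: ez_def)
    also have "(\<Sum>k\<in>{1..nat i}. cst (of_nat k) * (a k * ez a (i - int k))) * z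
        + (cst g * \<dots> + cst (of_nat n * g) * ez a (i - int n))
      \<approx> (cst (of_int i) * ez a i) * z
        + (cst g * (cst (of_int (i - int n)) * ez a (i - int n)) + cst (of_nat n * g) * ez a (i - int n))"
      by (intro cg_add cg_refl cg_rmult cg_lmult cg_sym[OF ez_rec] cc)
    also have "\<dots> = cst (of_int i) * (ez a i * z + cst g * ez a (i - int n))"
      by (simp add: mult.assoc distrib_left)
        (simp add: mult.assoc[symmetric] cst_mult[symmetric] distrib_right[symmetric] cst_add[symmetric] algebra_simps)
    finally show ?thesis by (rule cg_cst_cancel) (use 3 in auto)
  qed (use n in \<open>auto simp: ez_def\<close>)
qed

lemma exp_ez:
  assumes aa: "commuting a a" and bb: "commuting b b"
    and br: "\<And>k l. k > 0 \<Longrightarrow> l > 0 \<Longrightarrow> b k * a l \<approx> a l * b k + cst (if l = k then g k else 0)"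
    and c: "ctr_seq (\<lambda>k. of_nat k * g k) c"
  shows "exp_coeff b j * ez a i \<approx> (\<Sum>s\<le>j. cst (c s) * (ez a (i - int s) * exp_coeff b (j - s)))"
proof (induction j rule: less_induct)
  case (less j)
  have c0: "c 0 = 1" and cS: "of_nat s * c s = (\<Sum>k<s. of_nat (s - k) * g (s - k) * c k)" for s
    using c by (auto simp: ctr_seq_def)
  show ?case
  proof (cases "j = 0")
    case False
    have rec: "cst (of_nat j) * exp_coeff b j \<approx> (\<Sum>k\<in>{1..j}. cst (of_nat k) * (b k * exp_coeff b (j - k)))" for j
      using exp_rec_exp_coeff[OF bb] by (simp add: exp_rec_def)
    have "cst (of_nat j) * (exp_coeff b j * ez a i) = cst (of_nat j) * exp_coeff b j * ez a i"
      by (simp add: mult.assoc)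
    also have "\<dots> \<approx> (\<Sum>k\<in>{1..j}. cst (of_nat k) * (b k * exp_coeff b (j - k))) * ez a i"
      by (intro cg_rmult rec)
    also have "\<dots> = (\<Sum>k\<in>{1..j}. cst (of_nat k) * (b k * (exp_coeff b (j - k) * ez a i)))"
      by (simp add: sum_distrib_right mult.assoc)
    also have "\<dots> \<approx> (\<Sum>k\<in>{1..j}. cst (of_nat k) * (b k *
        (\<Sum>s\<le>j - k. cst (c s) * (ez a (i - int s) * exp_coeff b (j - k - s)))))"
      by (intro cg_sum cg_lmult less.IH) auto
    also have "\<dots> = (\<Sum>k\<in>{1..j}. \<Sum>s\<le>j - k. cst (of_nat k * c s) *
        (b k * ez a (i - int s) * exp_coeff b (j - k - s)))"
      by (simp add: sum_distrib_left cst_comm_assoc[of "b _"] cst_mult mult.assoc)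
    also have "\<dots> \<approx> (\<Sum>k\<in>{1..j}. \<Sum>s\<le>j - k. cst (of_nat k * c s) *
        ((ez a (i - int s) * b k + cst (g k) * ez a (i - int s - int k)) * exp_coeff b (j - k - s)))"
      by (intro cg_sum cg_lmult cg_rmult mode_ez aa br) auto
    also have "\<dots> = (\<Sum>k\<in>{1..j}. \<Sum>s\<le>j - k. cst (of_nat k * c s) *
          (ez a (i - int s) * b k * exp_coeff b (j - k - s)))
       + (\<Sum>k\<in>{1..j}. \<Sum>s\<le>j - k. cst (of_nat k * g k * c s) *
          (ez a (i - int s - int k) * exp_coeff b (j - k - s)))"
    proof -
      have g: "cst (of_nat k * (g k * c s)) = cst (of_nat k * c s) * cst (g k)" for k s
        by (simp add: cst_mult[symmetric] ac_simps)
      show ?thesis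
        by (simp only: sum.distrib distrib_left distrib_right mult.assoc g)
    qed
    also have "(\<Sum>k\<in>{1..j}. \<Sum>s\<le>j - k. cst (of_nat k * c s) *
          (ez a (i - int s) * b k * exp_coeff b (j - k - s)))
      = (\<Sum>s\<le>j. cst (c s) * (ez a (i - int s) *
          (\<Sum>k\<in>{1..j - s}. cst (of_nat k) * (b k * exp_coeff b (j - s - k)))))"
    proof -
      have g: "cst (of_nat k * c s) = cst (c s) * cst (of_nat k)" for k s
        by (simp add: cst_mult[symmetric] ac_simps)
      show ?thesis
        unfolding sum_triangle_swap sum_distrib_left
        by (simp only: cst_comm_assoc[of "ez a _"] mult.assoc g diff_commute)
    qed
    also have "(\<Sum>k\<in>{1..j}. \<Sum>s\<le>j - k. cst (of_nat k * g k * c s) *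
          (ez a (i - int s - int k) * exp_coeff b (j - k - s)))
      = (\<Sum>t\<le>j. \<Sum>s<t. cst (of_nat (t - s) * g (t - s) * c s) *
          (ez a (i - int t) * exp_coeff b (j - t)))"
      unfolding sum_triangle_diag by (intro sum.cong refl) (auto simp: of_nat_diff)
    \<comment> \<open>Here the recursion of \<open>c\<close> enters: the terms with one more
      contraction, grouped by the total contracted degree t, add up to t c(t). With the weight j - t
      of the remaining annihilators this gives the factor j.\<close>
    also have "\<dots> = (\<Sum>t\<le>j. cst (of_nat t * c t) * (ez a (i - int t) * exp_coeff b (j - t)))"
      by (simp add: cS cst_sum sum_distrib_right)
    also have "(\<Sum>s\<le>j. cst (c s) * (ez a (i - int s) *
          (\<Sum>k\<in>{1..j - s}. cst (of_nat k) * (b k * exp_coeff b (j - s - k))))) + \<dots>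
      \<approx> (\<Sum>s\<le>j. cst (c s) * (ez a (i - int s) * (cst (of_nat (j - s)) * exp_coeff b (j - s)))) + \<dots>"
      by (intro cg_add cg_refl cg_sum cg_lmult cg_sym[OF rec])
    also have "\<dots> = cst (of_nat j) * (\<Sum>s\<le>j. cst (c s) * (ez a (i - int s) * exp_coeff b (j - s)))"
      unfolding sum_distrib_left sum.distrib[symmetric]
    proof (intro sum.cong refl)
      fix s assume s: "s \<in> {..j}"
      have "c s * of_nat (j - s) + of_nat s * c s = of_nat j * c s"
        using s by (simp add: of_nat_diff algebra_simps)
      then show "cst (c s) * (ez a (i - int s) * (cst (of_nat (j - s)) * exp_coeff b (j - s)))
          + cst (of_nat s * c s) * (ez a (i - int s) * exp_coeff b (j - s))
        = cst (of_nat j) * (cst (c s) * (ez a (i - int s) * exp_coeff b (j - s)))"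
        unfolding cst_comm_assoc[of "ez a _"]
        by (simp add: mult.assoc[symmetric] cst_mult[symmetric] distrib_right[symmetric] cst_add[symmetric])
    qed
    finally show ?thesis by (rule cg_cst_cancel) (use False in auto)
  qed (simp add: c0)
qed

text \<open>The product of the two exponentials satisfies the recursion that characterises the
  exponential of the sum: by the Leibniz rule the Euler operator falls on one factor at a time, and
  coefficients of y can be moved past those of x.\<close>

lemma exp_coeff_plus:
  assumes "commuting x x" "commuting y y" "commuting x y"
  shows "exp_coeff (\<lambda>k. x k + y k) m \<approx> (\<Sum>i\<le>m. exp_coeff x i * exp_coeff y (m - i))"
proof (rule exp_rec_unique)
  have "commuting (\<lambda>k. x k + y k) (\<lambda>k. x k + y k)"
    unfolding commuting_def
  proof (intro allI impI)
    fix k l :: nat assume "k > 0" "l > 0"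
    then have "(x k * x l + x k * y l) + (y k * x l + y k * y l)
        \<approx> (x l * x k + y l * x k) + (x l * y k + y l * y k)"
      using assms unfolding commuting_def by (intro cg_add) (auto intro: cg_sym)
    then show "(x k + y k) * (x l + y l) \<approx> (x l + y l) * (x k + y k)"
      by (simp add: algebra_simps)
  qed
  then show "exp_rec (\<lambda>k. x k + y k) (exp_coeff (\<lambda>k. x k + y k))" by (rule exp_rec_exp_coeff)
  let ?f = "\<lambda>m. \<Sum>i\<le>m. exp_coeff x i * exp_coeff y (m - i)"
  have rec: "cst (of_nat m) * exp_coeff x m \<approx> (\<Sum>k\<in>{1..m}. cst (of_nat k) * (x k * exp_coeff x (m - k)))"
    "cst (of_nat m) * exp_coeff y m \<approx> (\<Sum>k\<in>{1..m}. cst (of_nat k) * (y k * exp_coeff y (m - k)))" for m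
    using assms exp_rec_exp_coeff by (auto simp: exp_rec_def)
  have com: "exp_coeff x i * y k \<approx> y k * exp_coeff x i" if "k > 0" for i k
    using assms(3) that unfolding commuting_def
    by (intro cg_sym[OF exp_coeff_commute]) (auto intro: cg_sym)
  show "exp_rec (\<lambda>k. x k + y k) ?f"
    unfolding exp_rec_def
  proof (intro conjI allI)
    fix m
    have "cst (of_nat m) * ?f m = (\<Sum>i\<le>m. cst (of_nat i) * exp_coeff x i * exp_coeff y (m - i))
        + (\<Sum>i\<le>m. exp_coeff x i * (cst (of_nat (m - i)) * exp_coeff y (m - i)))"
      unfolding sum_distrib_left sum.distrib[symmetric]
      by (intro sum.cong refl)
        (simp add: cst_comm_assoc[of "exp_coeff x _"] mult.assoc distrib_right[symmetric]
          cst_add[symmetric] of_nat_add[symmetric] del: of_nat_add)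
    also have "\<dots> \<approx> (\<Sum>i\<le>m. (\<Sum>k\<in>{1..i}. cst (of_nat k) * (x k * exp_coeff x (i - k))) * exp_coeff y (m - i))
        + (\<Sum>i\<le>m. exp_coeff x i * (\<Sum>k\<in>{1..m - i}. cst (of_nat k) * (y k * exp_coeff y (m - i - k))))"
      by (intro cg_add cg_sum cg_rmult cg_lmult rec)
    also have "(\<Sum>i\<le>m. (\<Sum>k\<in>{1..i}. cst (of_nat k) * (x k * exp_coeff x (i - k))) * exp_coeff y (m - i))
        = (\<Sum>k\<in>{1..m}. cst (of_nat k) * (x k * ?f (m - k)))"
      unfolding sum_distrib_left sum_distrib_right
      by (rule sum2_reindex[of _ _ _ _ "\<lambda>i k. k" "\<lambda>i k. i - k" "\<lambda>k i. k + i" "\<lambda>k i. k"])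
        (auto simp: mult.assoc)
    also have "(\<Sum>i\<le>m. exp_coeff x i * (\<Sum>k\<in>{1..m - i}. cst (of_nat k) * (y k * exp_coeff y (m - i - k))))
        = (\<Sum>i\<le>m. \<Sum>k\<in>{1..m - i}. cst (of_nat k) * (exp_coeff x i * y k * exp_coeff y (m - i - k)))"
      unfolding sum_distrib_left by (simp only: cst_comm_assoc[of "exp_coeff x _"] mult.assoc)
    also have "(\<Sum>k\<in>{1..m}. cst (of_nat k) * (x k * ?f (m - k))) + \<dots>
        \<approx> (\<Sum>k\<in>{1..m}. cst (of_nat k) * (x k * ?f (m - k)))
         + (\<Sum>i\<le>m. \<Sum>k\<in>{1..m - i}. cst (of_nat k) * (y k * exp_coeff x i * exp_coeff y (m - i - k)))"
      by (intro cg_add cg_refl cg_sum cg_lmult cg_rmult com) auto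
    also have "(\<Sum>i\<le>m. \<Sum>k\<in>{1..m - i}. cst (of_nat k) * (y k * exp_coeff x i * exp_coeff y (m - i - k)))
        = (\<Sum>k\<in>{1..m}. cst (of_nat k) * (y k * ?f (m - k)))"
      unfolding sum_distrib_left
      by (rule sum2_reindex[of _ _ _ _ "\<lambda>i k. k" "\<lambda>i k. i" "\<lambda>k i. i" "\<lambda>k i. k"])
        (auto simp: mult.assoc add.commute)
    finally show "cst (of_nat m) * ?f m \<approx> (\<Sum>k\<in>{1..m}. cst (of_nat k) * ((x k + y k) * ?f (m - k)))"
      by (simp add: distrib_left distrib_right sum.distrib)
  qed simp
qed

end

section \<open>Products of vertex operators\<close>

text \<open>A combination of modes of one common index k over the vertices. The exponents of vertex
  operators and of screening currents have such coefficients, so brackets are computed once for this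
  shape.\<close>

definition lin :: "('v aq_gen \<Rightarrow> 'g falg) \<Rightarrow> ('v \<times> complex) list \<Rightarrow> int \<Rightarrow> 'g falg" where
  "lin emb u k = (\<Sum>(i, c)\<leftarrow>u. cst c * emb (Osc i k))"

lemma lin_Nil [simp]: "lin emb [] k = 0"
  by (simp add: lin_def)

lemma lin_Cons [simp]: "lin emb ((i, c) # u) k = cst c * emb (Osc i k) + lin emb u k"
  by (simp add: lin_def)

text \<open>Only inclusions of relations and neighbourhoods are assumed, and the embedding is a
  parameter: the quotient by the central elements and the zero mode extension are both
  instances.\<close>

locale osc_presentation = filtered_presentation rels nbh
  for rels :: "'g falg set" and nbh +
  fixes q :: complex and Q :: "'v quiver" and emb :: "'v aq_gen \<Rightarrow> 'g falg"
  assumes aq_rels: "aq_rels q Q emb \<subseteq> rels"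
    and aq_nbh: "\<And>N. aq_nbh emb N \<subseteq> nbh N"
    and q_nz: "q \<noteq> 0"
begin

definition creation :: "(nat \<Rightarrow> 'g falg) \<Rightarrow> bool" where
  "creation a \<longleftrightarrow> (\<forall>k>0. \<exists>u. a k = lin emb u (- int k))"

definition annihilation :: "(nat \<Rightarrow> 'g falg) \<Rightarrow> bool" where
  "annihilation b \<longleftrightarrow> (\<forall>k>0. \<exists>u. b k = lin emb u (int k))"

lemma osc_bracket:
  assumes "n > 0"
  shows "emb (Osc i n) * emb (Osc j m) \<approx> emb (Osc j m) * emb (Osc i n)
    + cst (if n + m = 0 then Cmat_pow (nat n) q Q i j / of_int n else 0)"
proof -
  have "emb (Osc i n) * emb (Osc j m) - emb (Osc j m) * emb (Osc i n)
      - cst (if n + m = 0 then Cmat_pow (nat n) q Q i j / of_int n else 0) \<in> aq_rels q Q emb"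
    unfolding aq_rels_def using assms by blast
  then show ?thesis
    using aq_rels by (intro cg_rel) (auto simp: algebra_simps)
qed

lemma osc_bracket_neg:
  assumes "n < 0" "m < 0"
  shows "emb (Osc i n) * emb (Osc j m) \<approx> emb (Osc j m) * emb (Osc i n)"
proof -
  have "emb (Osc i n) * emb (Osc j m) - emb (Osc j m) * emb (Osc i n) \<in> aq_rels q Q emb"
    unfolding aq_rels_def using assms by blast
  then show ?thesis using aq_rels by (intro cg_rel) auto
qed

lemma lin_commute_gen:
  assumes "\<And>i. z * emb (Osc i k) \<approx> emb (Osc i k) * z"
  shows "z * lin emb u k \<approx> lin emb u k * z"
proof (induction u)
  case (Cons p u)
  obtain i c where p: "p = (i, c)" by (cases p)
  have "cst c * (z * emb (Osc i k)) + z * lin emb u k \<approx> cst c * (emb (Osc i k) * z) + lin emb u k * z"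
    by (intro cg_add cg_lmult assms Cons)
  then show ?case by (simp add: p distrib_left distrib_right cst_comm_assoc[of z] mult.assoc)
qed simp

lemma lin_commute:
  assumes "k > 0 \<and> l > 0 \<or> k < 0 \<and> l < 0"
  shows "lin emb u k * lin emb v l \<approx> lin emb v l * lin emb u k"
proof (intro lin_commute_gen cg_sym[OF lin_commute_gen])
  fix i j
  show "emb (Osc i l) * emb (Osc j k) \<approx> emb (Osc j k) * emb (Osc i l)"
    using assms osc_bracket[of l i j k] osc_bracket_neg[of l k i j] by auto
qed

lemma creation_commuting: "creation a \<Longrightarrow> creation a' \<Longrightarrow> commuting a a'"
  unfolding commuting_def creation_def
proof (intro allI impI)
  fix k l :: nat
  assume "\<forall>k>0. \<exists>u. a k = lin emb u (- int k)" "\<forall>k>0. \<exists>u. a' k = lin emb u (- int k)" "k > 0" "l > 0"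
  then obtain u v where "a k = lin emb u (- int k)" "a' l = lin emb v (- int l)" by meson
  then show "a k * a' l \<approx> a' l * a k" using \<open>k > 0\<close> \<open>l > 0\<close> by (simp add: lin_commute)
qed

lemma annihilation_commuting: "annihilation b \<Longrightarrow> annihilation b' \<Longrightarrow> commuting b b'"
  unfolding commuting_def annihilation_def
proof (intro allI impI)
  fix k l :: nat
  assume "\<forall>k>0. \<exists>u. b k = lin emb u (int k)" "\<forall>k>0. \<exists>u. b' k = lin emb u (int k)" "k > 0" "l > 0"
  then obtain u v where "b k = lin emb u (int k)" "b' l = lin emb v (int l)" by meson
  then show "b k * b' l \<approx> b' l * b k" using \<open>k > 0\<close> \<open>l > 0\<close> by (simp add: lin_commute)
qed

lemma lin_bracket:
  assumes "k > 0"
  shows "lin emb u (int k) * lin emb v (- int l) \<approx> lin emb v (- int l) * lin emb u (int k)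
    + cst (if l = k then (\<Sum>(i, c)\<leftarrow>u. \<Sum>(j, d)\<leftarrow>v. c * d * Cmat_pow k q Q i j) / of_nat k else 0)"
proof -
  have single: "emb (Osc i (int k)) * lin emb v (- int l) \<approx> lin emb v (- int l) * emb (Osc i (int k))
    + cst (if l = k then (\<Sum>(j, d)\<leftarrow>v. d * Cmat_pow k q Q i j) / of_nat k else 0)" for i
  proof (induction v)
    case (Cons p v)
    obtain j d where p: "p = (j, d)" by (cases p)
    have "emb (Osc i (int k)) * lin emb (p # v) (- int l)
        = cst d * (emb (Osc i (int k)) * emb (Osc j (- int l))) + emb (Osc i (int k)) * lin emb v (- int l)"
      by (simp add: p distrib_left cst_comm_assoc)
    also have "\<dots> \<approx> cst d * (emb (Osc j (- int l)) * emb (Osc i (int k))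
          + cst (if int k + - int l = 0 then Cmat_pow (nat (int k)) q Q i j / of_int (int k) else 0))
        + (lin emb v (- int l) * emb (Osc i (int k))
          + cst (if l = k then (\<Sum>(j, d)\<leftarrow>v. d * Cmat_pow k q Q i j) / of_nat k else 0))"
      using assms by (intro cg_add cg_lmult osc_bracket Cons) auto
    also have "\<dots> = lin emb (p # v) (- int l) * emb (Osc i (int k))
      + cst (if l = k then (\<Sum>(j, d)\<leftarrow>p # v. d * Cmat_pow k q Q i j) / of_nat k else 0)"
      by (auto simp: p distrib_left distrib_right mult.assoc add_divide_distrib cst_add cst_mult[symmetric])
    finally show ?case .
  qed simp
  show ?thesis
  proof (induction u)
    case (Cons p u)
    obtain i c where p: "p = (i, c)" by (cases p)
    have "lin emb (p # u) (int k) * lin emb v (- int l)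
        = cst c * (emb (Osc i (int k)) * lin emb v (- int l)) + lin emb u (int k) * lin emb v (- int l)"
      by (simp add: p distrib_right mult.assoc)
    also have "\<dots> \<approx> cst c * (lin emb v (- int l) * emb (Osc i (int k))
          + cst (if l = k then (\<Sum>(j, d)\<leftarrow>v. d * Cmat_pow k q Q i j) / of_nat k else 0))
        + (lin emb v (- int l) * lin emb u (int k)
          + cst (if l = k then (\<Sum>(i, c)\<leftarrow>u. \<Sum>(j, d)\<leftarrow>v. c * d * Cmat_pow k q Q i j) / of_nat k else 0))"
      by (intro cg_add cg_lmult single Cons)
    also have "\<dots> = lin emb v (- int l) * lin emb (p # u) (int k)
      + cst (if l = k then (\<Sum>(i, c)\<leftarrow>p # u. \<Sum>(j, d)\<leftarrow>v. c * d * Cmat_pow k q Q i j) / of_nat k else 0)"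
    proof -
      have "c * (\<Sum>(j, d)\<leftarrow>v. d * Cmat_pow k q Q i j) = (\<Sum>(j, d)\<leftarrow>v. c * d * Cmat_pow k q Q i j)"
        by (induction v) (auto simp: algebra_simps)
      then show ?thesis
        by (auto simp: p distrib_left cst_comm_assoc add_divide_distrib cst_add cst_mult[symmetric])
    qed
    finally show ?case .
  qed simp
qed

text \<open>Membership in a left ideal ignores what stands to the left: a product of annihilators
  would only be known to lie in the ideal of its last factor. Testing x against all monomials of
  degree K makes degrees additive.\<close>

definition degG :: "nat \<Rightarrow> 'g falg \<Rightarrow> bool" where
  "degG N x \<longleftrightarrow> (\<forall>K. \<forall>y\<in>aq_nbh emb K. y * x \<in> LL (K + N))"

lemma degG_LL: "degG N x \<Longrightarrow> x \<in> LL N"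
proof -
  assume "degG N x"
  moreover have "1 \<in> aq_nbh emb 0" unfolding aq_nbh_def by (auto intro!: exI[of _ "[]"])
  ultimately have "1 * x \<in> LL (0 + N)" unfolding degG_def by blast
  then show ?thesis by simp
qed

lemma degG_1: "degG 0 1"
  by (auto simp: degG_def intro: nbhL_nbh subsetD[OF aq_nbh])

lemma degG_0 [simp]: "degG N 0"
  by (simp add: degG_def)

lemma degG_add: "degG N x \<Longrightarrow> degG N y \<Longrightarrow> degG N (x + y)"
  by (auto simp: degG_def distrib_left intro: nbhL_add)

lemma degG_cst: "degG N x \<Longrightarrow> degG N (cst c * x)"
  by (auto simp: degG_def cst_comm_assoc intro: nbhL_lmult)

lemma degG_sum: "(\<And>i. i \<in> A \<Longrightarrow> degG N (f i)) \<Longrightarrow> degG N (sum f A)"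
  by (induction A rule: infinite_finite_induct) (auto intro: degG_add)

lemma degG_osc:
  assumes "degG N x" "k > 0"
  shows "degG (N + k) (emb (Osc i (int k)) * x)"
  unfolding degG_def
proof (intro allI ballI)
  fix K y assume "y \<in> aq_nbh emb K"
  then obtain ps where ps: "y = prod_list (map (\<lambda>(i, n). emb (Osc i n)) ps)"
    "\<forall>(i, n)\<in>set ps. n > 0" "(\<Sum>(i, n)\<leftarrow>ps. n) \<ge> int K"
    unfolding aq_nbh_def by blast
  have "y * emb (Osc i (int k)) = prod_list (map (\<lambda>(i, n). emb (Osc i n)) (ps @ [(i, int k)]))"
    by (simp add: ps(1))
  moreover have "\<forall>(i, n)\<in>set (ps @ [(i, int k)]). n > 0" using ps(2) assms(2) by auto
  moreover have "(\<Sum>(i, n)\<leftarrow>ps @ [(i, int k)]. n) \<ge> int (K + k)" using ps(3) by simp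
  ultimately have "y * emb (Osc i (int k)) \<in> aq_nbh emb (K + k)" unfolding aq_nbh_def by blast
  then have "y * emb (Osc i (int k)) * x \<in> LL (K + k + N)" using assms(1) unfolding degG_def by blast
  then show "y * (emb (Osc i (int k)) * x) \<in> LL (K + (N + k))" by (simp add: mult.assoc ac_simps)
qed

lemma degG_lin: "degG N x \<Longrightarrow> k > 0 \<Longrightarrow> degG (N + k) (lin emb u (int k) * x)"
  by (induction u) (auto simp: distrib_right mult.assoc intro!: degG_add degG_cst degG_osc)

lemma degG_exp_coeff:
  assumes "annihilation b" "degG N x"
  shows "degG (j + N) (exp_coeff b j * x)"
proof -
  have "degG (j + N) (pw b r j * x)" for r j
  proof (induction r arbitrary: j)
    case (Suc r)
    have "degG (j + N) (b k * pw b r (j - k) * x)" if k: "k \<in> {1..j}" for k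
    proof -
      obtain u where "b k = lin emb u (int k)" using assms(1) k unfolding annihilation_def
        by (metis One_nat_def Suc_le_eq atLeastAtMost_iff)
      then show ?thesis
        using degG_lin[OF Suc.IH[of "j - k"], of k u] k by (simp add: mult.assoc)
    qed
    then show ?case unfolding pw_Suc sum_distrib_right by (rule degG_sum)
  qed (use assms in auto)
  then show ?thesis
    unfolding exp_coeff_def sum_distrib_right mult.assoc by (intro degG_sum degG_cst)
qed

lemma exp_coeff_LL2:
  assumes "annihilation b" "annihilation b'" "N \<le> j + l"
  shows "x * exp_coeff b j * exp_coeff b' l \<in> LL N"
proof -
  have "degG (j + (l + 0)) (exp_coeff b j * (exp_coeff b' l * 1))"
    using degG_exp_coeff[OF assms(1) degG_exp_coeff[OF assms(2) degG_1]] .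
  then have "exp_coeff b j * exp_coeff b' l \<in> LL (j + l)" using degG_LL by fastforce
  then show ?thesis using LL_antimono[OF assms(3)] by (auto simp: mult.assoc intro: nbhL_lmult)
qed

lemma exp_coeff_LL:
  assumes "annihilation b" "N \<le> j"
  shows "x * exp_coeff b j \<in> LL N"
  using exp_coeff_LL2[OF assms(1,1), of N j 0 x] assms(2) by simp

lemma cauchy_partial_sums:
  fixes f :: "nat \<Rightarrow> 'g falg"
  assumes "\<And>N j. N \<le> j \<Longrightarrow> f j \<in> LL N"
  shows "cauchy (\<lambda>M. \<Sum>j\<le>M. f j)"
  unfolding cauchy_def
proof (intro allI exI[of _ "N" for N] impI)
  fix N m n :: nat assume mn: "N \<le> m" "N \<le> n"
  have part: "(\<Sum>j\<le>m. f j) - (\<Sum>j\<le>N. f j) \<in> LL N" if "N \<le> m" for m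
  proof -
    have "(\<Sum>j\<le>m. f j) - (\<Sum>j\<le>N. f j) = (\<Sum>j\<in>{..m} - {..N}. f j)"
      using that by (intro sum_diff[symmetric]) auto
    moreover have "\<dots> \<in> LL N" by (intro LL_sum assms) auto
    ultimately show ?thesis by simp
  qed
  show "(\<Sum>j\<le>m. f j) - (\<Sum>j\<le>n. f j) \<in> LL N"
    using nbhL_diff[OF part[OF mn(1)] part[OF mn(2)]] by simp
qed

lemma cauchy_osc_exp: "annihilation b \<Longrightarrow> cauchy (osc_exp a b m)"
  unfolding osc_exp_eq[abs_def] by (intro cauchy_partial_sums exp_coeff_LL)

text \<open>Moving the annihilators at z past the creators at w by \<open>exp_ez\<close> produces
  the contraction series. The identity holds only in the limit, because the left side truncates the
  annihilation degree before contraction and \<open>Wp\<close> the degree that remains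
  afterwards.\<close>

lemma osc_product:
  assumes a: "creation a" "creation a'" and b: "annihilation b" "annihilation b'"
    and br: "\<And>k l. k > 0 \<Longrightarrow> l > 0 \<Longrightarrow> b k * a' l \<approx> a' l * b k + cst (if l = k then g k else 0)"
    and c: "ctr_seq (\<lambda>k. of_nat k * g k) c"
  shows "(\<lambda>M. osc_exp a b m M * osc_exp a' b' n M) \<sim> Wp a b a' b' (extz c) m n"
proof -
  define t where "t s j l = cst (c s) * (ez a (m + int s + int j) * ez a' (n - int s + int l)
      * exp_coeff b j * exp_coeff b' l)" for s j l
  have prod: "osc_exp a b m M * osc_exp a' b' n M \<approx> (\<Sum>j\<le>M. \<Sum>l\<le>M. \<Sum>s\<le>j. t s (j - s) l)" for M
  proof -
    have "osc_exp a b m M * osc_exp a' b' n M = (\<Sum>j\<le>M. \<Sum>l\<le>M.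
        ez a (m + int j) * ((exp_coeff b j * ez a' (n + int l)) * exp_coeff b' l))"
      by (simp add: osc_exp_eq sum_product mult.assoc)
    also have "\<dots> \<approx> (\<Sum>j\<le>M. \<Sum>l\<le>M. ez a (m + int j) *
        ((\<Sum>s\<le>j. cst (c s) * (ez a' (n + int l - int s) * exp_coeff b (j - s))) * exp_coeff b' l))"
      by (intro cg_sum cg_lmult cg_rmult
          exp_ez[OF creation_commuting[OF a(2,2)] annihilation_commuting[OF b(1,1)] br c])
    also have "\<dots> = (\<Sum>j\<le>M. \<Sum>l\<le>M. \<Sum>s\<le>j. t s (j - s) l)"
      unfolding sum_distrib_left sum_distrib_right t_def
      by (intro sum.cong refl)
        (simp add: mult.assoc cst_comm_assoc[of "ez a _"] of_nat_diff algebra_simps)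
    finally show ?thesis .
  qed
  \<comment> \<open>The range of s is replaced by 0..R, which no longer depends on j and l: negative
    s are removed by \<open>extz\<close>, and for the added values of s a creator index is
    negative.\<close>
  have W: "Wp a b a' b' (extz c) m n M = (\<Sum>j\<le>M. \<Sum>l\<le>M. \<Sum>s\<le>R. t s j l)" if "n + int M \<le> int R" for M R
    unfolding Wp_def
  proof (intro sum.cong refl)
    fix j l assume "l \<in> {..M}"
    let ?u = "\<lambda>s. cst (extz c s) *
      (ez a (m + s + int j) * ez a' (n - s + int l) * exp_coeff b j * exp_coeff b' l)"
    have "(\<Sum>s\<in>{- m - int j..n + int l}. ?u s) = (\<Sum>s\<in>{- m - int j..n + int l} \<union> int ` {..R}. ?u s)"
      by (rule sum.mono_neutral_left) (auto simp: ez_def)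
    also have "\<dots> = (\<Sum>s\<in>int ` {..R}. ?u s)"
    proof (rule sum.mono_neutral_right)
      show "\<forall>s\<in>{- m - int j..n + int l} \<union> int ` {..R} - int ` {..R}. ?u s = 0"
      proof
        fix s assume s: "s \<in> {- m - int j..n + int l} \<union> int ` {..R} - int ` {..R}"
        have "s < 0"
        proof (rule ccontr)
          assume "\<not> s < 0"
          then obtain s' where "s = int s'" by (metis nonneg_int_cases not_less)
          then show False using s that \<open>l \<in> {..M}\<close> by auto
        qed
        then show "?u s = 0" by (simp add: extz_def)
      qed
    qed auto
    also have "\<dots> = (\<Sum>s\<le>R. t s j l)"
      by (subst sum.reindex) (auto simp: t_def extz_def)
    finally show "(\<Sum>s\<in>{- m - int j..n + int l}. ?u s) = (\<Sum>s\<le>R. t s j l)" .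
  qed
  have "null (\<lambda>M. (\<Sum>j\<le>M. \<Sum>l\<le>M. \<Sum>s\<le>j. t s (j - s) l) - Wp a b a' b' (extz c) m n M)"
    unfolding null_def
  proof (intro allI)
    fix N
    have "(\<Sum>j\<le>M. \<Sum>l\<le>M. \<Sum>s\<le>j. t s (j - s) l) - Wp a b a' b' (extz c) m n M \<in> LL N"
      if M: "M \<ge> 2 * N + nat \<bar>n\<bar>" for M
    proof -
      define R where "R = M + nat \<bar>n\<bar>"
      have "(\<Sum>j\<le>M. \<Sum>l\<le>M. \<Sum>s\<le>j. t s (j - s) l) = (\<Sum>l\<le>M. \<Sum>j\<le>M. \<Sum>s\<le>j. t s (j - s) l)"
        by (rule sum.swap)
      also have "\<dots> = (\<Sum>l\<le>M. \<Sum>j\<le>M. \<Sum>s\<le>M - j. t s j l)"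
        by (intro sum.cong refl
            sum2_reindex[of _ _ _ _ "\<lambda>j s. j - s" "\<lambda>j s. s" "\<lambda>j s. j + s" "\<lambda>j s. s"]) auto
      finally have 1: "(\<Sum>j\<le>M. \<Sum>l\<le>M. \<Sum>s\<le>j. t s (j - s) l) = (\<Sum>l\<le>M. \<Sum>j\<le>M. \<Sum>s\<le>M - j. t s j l)" .
      have 2: "Wp a b a' b' (extz c) m n M = (\<Sum>l\<le>M. \<Sum>j\<le>M. \<Sum>s\<le>R. t s j l)"
        by (subst W[of M R], simp add: R_def, rule sum.swap)
      have "(\<Sum>s\<le>R. t s j l) - (\<Sum>s\<le>M - j. t s j l) \<in> LL N" if "j \<le> M" for j l
      proof -
        \<comment> \<open>The two truncations differ by terms with s > M - j. Either annihilators of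
          total degree at least N remain, or j + l < N and the bound on M forces s > n + l, so that
          the creator coefficient at w is zero.\<close>
        have "t s j l \<in> LL N" if s: "s \<in> {..R} - {..M - j}" for s
        proof (cases "N \<le> j + l")
          case True
          show ?thesis unfolding t_def by (intro nbhL_lmult exp_coeff_LL2[OF b True])
        next
          case False
          then have "n - int s + int l < 0" using s M by auto
          then show ?thesis by (simp add: t_def ez_neg)
        qed
        moreover have "(\<Sum>s\<le>R. t s j l) - (\<Sum>s\<le>M - j. t s j l) = (\<Sum>s\<in>{..R} - {..M - j}. t s j l)"
          by (intro sum_diff[symmetric]) (auto simp: R_def)
        ultimately show ?thesis using LL_sum by metis
      qed
      then have "(\<Sum>l\<le>M. \<Sum>j\<le>M. (\<Sum>s\<le>R. t s j l) - (\<Sum>s\<le>M - j. t s j l)) \<in> LL N"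
        by (intro LL_sum) auto
      then have "- (\<Sum>l\<le>M. \<Sum>j\<le>M. (\<Sum>s\<le>R. t s j l) - (\<Sum>s\<le>M - j. t s j l)) \<in> LL N"
        by (rule nbhL_uminus)
      then show ?thesis unfolding 1 2 by (simp add: sum_subtractf)
    qed
    then show "\<exists>M. \<forall>M'\<ge>M. (\<Sum>j\<le>M'. \<Sum>l\<le>M'. \<Sum>s\<le>j. t s (j - s) l) - Wp a b a' b' (extz c) m n M' \<in> LL N"
      by blast
  qed
  then have "(\<lambda>M. \<Sum>j\<le>M. \<Sum>l\<le>M. \<Sum>s\<le>j. t s (j - s) l) \<sim> Wp a b a' b' (extz c) m n"
    by (simp add: sim_def)
  from sim_trans[OF sim_I[OF prod] this] show ?thesis .
qed

text \<open>The series with coefficients r^s is delta(r w/z), which sets z = r w and fuses the two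
  exponentials into one in w alone. Shifting the summation index by m gives the factor
  r^(-m).\<close>

lemma Wp_merge:
  assumes a: "creation a" "creation a'" and b: "annihilation b" "annihilation b'" and r: "r \<noteq> 0"
  shows "Wp a b a' b' (\<lambda>s. r powi s) m n
    \<sim> (\<lambda>M. cst (r powi (- m)) * osc_exp (\<lambda>k. cst (r ^ k) * a k + a' k) (\<lambda>k. cst (1 / r ^ k) * b k + b' k) (m + n) M)"
    (is "_ \<sim> (\<lambda>M. _ * osc_exp ?a ?b _ M)")
proof -
  have aa: "commuting a a" "commuting a' a'" "commuting a a'"
    and bb: "commuting b b" "commuting b' b'" "commuting b b'"
    using a b by (auto intro: creation_commuting annihilation_commuting)
  have scaled: "commuting (\<lambda>k. cst (x k) * y k) (\<lambda>k. cst (x k) * y k)" if "commuting y y" for x y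
  proof -
    have *: "cst u * p * (cst v * p') = cst (u * v) * (p * p')" for u v p p'
      by (simp only: mult.assoc cst_comm_assoc[of p] cst_mult)
    show ?thesis
      unfolding commuting_def *
    proof (intro allI impI)
      fix k l :: nat assume "k > 0" "l > 0"
      then have "cst (x k * x l) * (y k * y l) \<approx> cst (x k * x l) * (y l * y k)"
        using that unfolding commuting_def by (intro cg_lmult) auto
      then show "cst (x k * x l) * (y k * y l) \<approx> cst (x l * x k) * (y l * y k)"
        by (simp only: mult.commute[of "x k"])
    qed
  qed
  have scaled2: "commuting (\<lambda>k. cst (x k) * y k) y'" if "commuting y y'" for x y y'
    using that unfolding commuting_def mult.assoc by (auto simp: cst_comm_assoc[of "y' _"] intro: cg_lmult)
  have mea: "ez ?a p \<approx> (\<Sum>i\<in>{0..p}. cst (r powi i) * (ez a i * ez a' (p - i)))" for p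
  proof (cases "p \<ge> 0")
    case True
    then obtain p' where p: "p = int p'" using nonneg_int_cases by blast
    have "ez ?a p \<approx> (\<Sum>i\<le>p'. exp_coeff (\<lambda>k. cst (r ^ k) * a k) i * exp_coeff a' (p' - i))"
      unfolding p ez_nat by (intro exp_coeff_plus scaled scaled2 aa)
    also have "\<dots> = (\<Sum>i\<in>{0..p}. cst (r powi i) * (ez a i * ez a' (p - i)))"
      by (rule sum.reindex_bij_witness[of _ nat int])
        (auto simp: p exp_coeff_scale mult.assoc ez_def nat_diff_distrib)
    finally show ?thesis .
  qed (simp add: ez_neg)
  have meb: "exp_coeff ?b p \<approx> (\<Sum>j\<le>p. cst (1 / r ^ j) * (exp_coeff b j * exp_coeff b' (p - j)))" for p
  proof -
    have "exp_coeff ?b p = exp_coeff (\<lambda>k. cst ((1 / r) ^ k) * b k + b' k) p"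
      by (simp add: power_one_over)
    also have "\<dots> \<approx> (\<Sum>i\<le>p. exp_coeff (\<lambda>k. cst ((1 / r) ^ k) * b k) i * exp_coeff b' (p - i))"
      by (intro exp_coeff_plus scaled scaled2 bb)
    finally show ?thesis unfolding exp_coeff_scale unfolding power_one_over mult.assoc .
  qed
  define t where "t p j = cst (r powi (- m)) * (ez ?a (m + n + int p) * (cst (1 / r ^ j) * (exp_coeff b j * exp_coeff b' (p - j))))"
    for p j
  have inner: "(\<Sum>s\<in>{- m - int j..n + int l}. cst (r powi s) *
      (ez a (m + s + int j) * ez a' (n - s + int l) * exp_coeff b j * exp_coeff b' l))
    = cst (r powi (- m)) * (
      (\<Sum>i\<in>{0..m + n + int (j + l)}. cst (r powi i) * (ez a i * ez a' (m + n + int (j + l) - i)))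
      * (cst (1 / r ^ j) * (exp_coeff b j * exp_coeff b' l)))" for j l
    unfolding sum_distrib_left sum_distrib_right
  proof (rule sum.reindex_bij_witness[of _ "\<lambda>i. i - m - int j" "\<lambda>s. m + s + int j"])
    fix s
    have X: "m + n + int (j + l) - (m + s + int j) = n - s + int l" by simp
    have "r powi s = r powi (- m + ((m + s + int j) + (- int j)))" by simp
    also have "\<dots> = r powi (- m) * (r powi (m + s + int j) * (1 / r ^ j))"
      unfolding power_int_add[OF disjI1[OF r]] power_int_minus[of _ "int j"] power_int_of_nat
      by (simp add: field_simps)
    finally have E: "cst (r powi s) = cst (r powi (- m)) * (cst (r powi (m + s + int j)) * cst (1 / r ^ j))"
      by (metis cst_mult)
    show "cst (r powi (- m)) * (cst (r powi (m + s + int j)) *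
        (ez a (m + s + int j) * ez a' (m + n + int (j + l) - (m + s + int j))) *
        (cst (1 / r ^ j) * (exp_coeff b j * exp_coeff b' l))) =
      cst (r powi s) * (ez a (m + s + int j) * ez a' (n - s + int l) * exp_coeff b j * exp_coeff b' l)"
      by (simp only: E X mult.assoc cst_comm_assoc[of "ez _ _"])
  qed auto
  have "Wp a b a' b' (\<lambda>s. r powi s) m n M \<approx> (\<Sum>j\<le>M. \<Sum>l\<le>M. t (j + l) j)" for M
    unfolding Wp_def inner t_def add_diff_cancel_left'
    by (intro cg_sum cg_lmult cg_rmult cg_sym[OF mea])
  then have 1: "Wp a b a' b' (\<lambda>s. r powi s) m n \<sim> (\<lambda>M. \<Sum>j\<le>M. \<Sum>l\<le>M. t (j + l) j)"
    by (rule sim_I)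
  have "cst (r powi (- m)) * osc_exp ?a ?b (m + n) M \<approx> (\<Sum>p\<le>M. \<Sum>j\<le>p. t p j)" for M
    unfolding osc_exp_eq t_def sum_distrib_left[symmetric] by (intro cg_lmult cg_sum meb)
  then have 2: "(\<lambda>M. cst (r powi (- m)) * osc_exp ?a ?b (m + n) M) \<sim> (\<lambda>M. \<Sum>p\<le>M. \<Sum>j\<le>p. t p j)"
    by (rule sim_I)
  \<comment> \<open>A square of annihilation degrees is compared with the triangle j + l <= M; the
    terms in between have total degree above M.\<close>
  have "null (\<lambda>M. (\<Sum>j\<le>M. \<Sum>l\<le>M. t (j + l) j) - (\<Sum>p\<le>M. \<Sum>j\<le>p. t p j))"
    unfolding null_def
  proof (intro allI exI[of _ "N" for N] impI)
    fix N M :: nat assume M: "N \<le> M"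
    have "(\<Sum>p\<le>M. \<Sum>j\<le>p. t p j) = (\<Sum>j\<le>M. \<Sum>l\<le>M - j. t (j + l) j)"
      by (rule sum2_reindex[of _ _ _ _ "\<lambda>p j. j" "\<lambda>p j. p - j" "\<lambda>j l. j + l" "\<lambda>j l. j"]) auto
    then have "(\<Sum>j\<le>M. \<Sum>l\<le>M. t (j + l) j) - (\<Sum>p\<le>M. \<Sum>j\<le>p. t p j)
        = (\<Sum>j\<le>M. (\<Sum>l\<le>M. t (j + l) j) - (\<Sum>l\<le>M - j. t (j + l) j))"
      by (simp add: sum_subtractf)
    also have "\<dots> = (\<Sum>j\<le>M. \<Sum>l\<in>{..M} - {..M - j}. t (j + l) j)"
      by (intro sum.cong refl sum_diff[symmetric]) auto
    also have "\<dots> \<in> LL N"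
    proof (intro LL_sum)
      fix j l assume "l \<in> {..M} - {..M - j}"
      then have "N \<le> j + l" using M by auto
      from exp_coeff_LL2[OF b this, of 1] have "exp_coeff b j * exp_coeff b' l \<in> LL N" by simp
      then show "t (j + l) j \<in> LL N" unfolding t_def by (simp add: nbhL_lmult)
    qed
    finally show "(\<Sum>j\<le>M. \<Sum>l\<le>M. t (j + l) j) - (\<Sum>p\<le>M. \<Sum>j\<le>p. t p j) \<in> LL N" .
  qed
  then have "(\<lambda>M. \<Sum>j\<le>M. \<Sum>l\<le>M. t (j + l) j) \<sim> (\<lambda>M. \<Sum>p\<le>M. \<Sum>j\<le>p. t p j)"
    by (simp add: sim_def)
  from sim_trans[OF sim_trans[OF 1 this] sim_sym[OF 2]] show ?thesis .
qed

end

lemma cst_cst: "cst c * (cst d * x) = cst (c * d) * x"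
  by (simp add: cst_mult mult.assoc)

section \<open>Scalar contraction series\<close>

lemma ctr_seq_cong: "ctr_seq L c \<Longrightarrow> (\<And>k. k > 0 \<Longrightarrow> L k = L' k) \<Longrightarrow> ctr_seq L' c"
  unfolding ctr_seq_def by auto

text \<open>The Taylor coefficients of $(1 - \alpha x) / (1 - \beta x)$.\<close>

definition ratio :: "complex \<Rightarrow> complex \<Rightarrow> nat \<Rightarrow> complex" where
  "ratio \<alpha> \<beta> s = (if s = 0 then 1 else (\<beta> - \<alpha>) * \<beta> ^ (s - 1))"

lemma ratio_fps: "Abs_fps (ratio \<alpha> \<beta>) * (1 - fps_const \<beta> * fps_X) = 1 - fps_const \<alpha> * fps_X"
proof (rule fps_ext)
  fix n
  have eq: "Abs_fps (ratio \<alpha> \<beta>) * (1 - fps_const \<beta> * fps_X)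
      = Abs_fps (ratio \<alpha> \<beta>) - fps_const \<beta> * (fps_X * Abs_fps (ratio \<alpha> \<beta>))"
    by (simp add: algebra_simps)
  consider "n = 0" | "n = 1" | k where "n = Suc (Suc k)"
    by (metis One_nat_def not0_implies_Suc)
  then show "fps_nth (Abs_fps (ratio \<alpha> \<beta>) * (1 - fps_const \<beta> * fps_X)) n
      = fps_nth (1 - fps_const \<alpha> * fps_X) n"
    unfolding eq by cases (auto simp: ratio_def)
qed

text \<open>The recursion as the logarithmic derivative equation c' = c (sum of L(k+1) x^k); in this
  form it is visible that products of contractions belong to sums of the L.\<close>

lemma ctr_seq_fps:
  "ctr_seq L c \<longleftrightarrow> c 0 = 1 \<and> fps_deriv (Abs_fps c) = Abs_fps c * Abs_fps (\<lambda>k. L (Suc k))"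
proof -
  have "fps_nth (Abs_fps c * Abs_fps (\<lambda>k. L (Suc k))) n = (\<Sum>k<Suc n. L (Suc n - k) * c k)" for n
    unfolding fps_mult_nth atLeast0AtMost lessThan_Suc_atMost
    by (intro sum.cong) (auto simp: Suc_diff_le)
  moreover have "(\<forall>s. of_nat s * c s = (\<Sum>k<s. L (s - k) * c k))
    \<longleftrightarrow> (\<forall>n. of_nat (Suc n) * c (Suc n) = (\<Sum>k<Suc n. L (Suc n - k) * c k))"
  proof (intro iffI allI)
    fix s assume "\<forall>n. of_nat (Suc n) * c (Suc n) = (\<Sum>k<Suc n. L (Suc n - k) * c k)"
    then show "of_nat s * c s = (\<Sum>k<s. L (s - k) * c k)" by (cases s) auto
  qed blast
  ultimately show ?thesis by (simp add: ctr_seq_def fps_eq_iff add.commute)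
qed

lemma ctr_seq_mult:
  assumes "ctr_seq L c" "ctr_seq L' c'"
  shows "ctr_seq (\<lambda>k. L k + L' k) (fps_nth (Abs_fps c * Abs_fps c'))"
proof -
  have *: "Abs_fps (\<lambda>k. L (Suc k) + L' (Suc k)) = Abs_fps (\<lambda>k. L (Suc k)) + Abs_fps (\<lambda>k. L' (Suc k))"
    by (rule fps_ext) simp
  show ?thesis
    using assms unfolding ctr_seq_fps fps_nth_inverse * by (simp add: algebra_simps)
qed

text \<open>log ((1 - \<alpha> x)/(1 - \<beta> x)) = sum of (\<beta>^k - \<alpha>^k) x^k / k. The
  geometric series and the linear polynomial are treated separately and then multiplied.\<close>

lemma ctr_seq_ratio: "ctr_seq (\<lambda>k. \<beta> ^ k - \<alpha> ^ k) (ratio \<alpha> \<beta>)"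
proof -
  have pos: "ctr_seq (\<lambda>k. \<beta> ^ k) (\<lambda>k. \<beta> ^ k)"
    unfolding ctr_seq_def by (auto simp: power_add[symmetric])
  let ?c = "\<lambda>k :: nat. if k = 0 then 1 else if k = 1 then - \<alpha> else 0"
  have neg: "ctr_seq (\<lambda>k. - (\<alpha> ^ k)) ?c"
    unfolding ctr_seq_def
  proof (intro conjI allI)
    fix s
    show "of_nat s * ?c s = (\<Sum>k<s. - (\<alpha> ^ (s - k)) * ?c k)"
    proof (cases "s \<le> 1")
      case False
      then have "(\<Sum>k<s. - (\<alpha> ^ (s - k)) * ?c k) = (\<Sum>k\<in>{0, 1}. - (\<alpha> ^ (s - k)) * ?c k)"
        by (intro sum.mono_neutral_right) auto
      also have "\<dots> = 0" using False by (cases s) auto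
      finally show ?thesis using False by simp
    next
      case True
      then have "s = 0 \<or> s = 1" by auto
      then show ?thesis by auto
    qed
  qed simp
  have "fps_nth (Abs_fps (\<lambda>k. \<beta> ^ k) * Abs_fps ?c) n = ratio \<alpha> \<beta> n" for n
  proof (cases n)
    case (Suc n')
    have "fps_nth (Abs_fps ?c * Abs_fps (\<lambda>k. \<beta> ^ k)) n = (\<Sum>k\<in>{0, 1}. ?c k * \<beta> ^ (n - k))"
      unfolding fps_mult_nth using Suc by (intro sum.mono_neutral_cong_right) auto
    then show ?thesis using Suc by (simp add: ratio_def mult.commute algebra_simps)
  qed (simp add: ratio_def)
  then have "fps_nth (Abs_fps (\<lambda>k. \<beta> ^ k) * Abs_fps ?c) = ratio \<alpha> \<beta>" by blast
  then show ?thesis using ctr_seq_mult[OF pos neg] by simp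
qed

text \<open>Multiplication by 1 - \<beta> x clears the denominator and leaves 1 - \<alpha> x. All
  integers s are covered, so the rule applies to shifted and reflected series.\<close>

lemma extz_ratio_step:
  "extz (ratio \<alpha> \<beta>) s - \<beta> * extz (ratio \<alpha> \<beta>) (s - 1) = (if s = 0 then 1 else if s = 1 then - \<alpha> else 0)"
proof -
  consider "s < 0" | "s = 0" | "s = 1" | "s > 1" by linarith
  then show ?thesis
  proof cases
    case 4
    define k where "k = nat (s - 2)"
    then have "s = int (Suc (Suc k))" using 4 by simp
    then show ?thesis by (simp add: extz_def ratio_def nat_add_distrib nat_diff_distrib)
  qed (auto simp: extz_def ratio_def)
qed

text \<open>For A^2 = \<beta>/\<alpha> both terms expand the same rational function A (1 - \<alpha>
  x)/(1 - \<beta> x), at x = 0 and at x = infinity. Their difference is supported at the pole, hence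
  a multiple of delta(\<beta> x); the multiple is read off at s = 0.\<close>

lemma extz_ratio_two_sided:
  assumes "\<alpha> \<noteq> 0" "\<beta> \<noteq> 0" "A * A = \<beta> / \<alpha>"
  shows "A * extz (ratio \<alpha> \<beta>) s - 1 / A * extz (ratio (1 / \<alpha>) (1 / \<beta>)) (- s) = (A - 1 / A) * \<beta> powi s"
proof -
  have A: "A \<noteq> 0" using assms by auto
  have \<alpha>: "\<alpha> = \<beta> / (A * A)" using assms by (auto simp: field_simps)
  consider "s = 0" | k where "s = int (Suc k)" | k where "s = - int (Suc k)"
    by (metis int_cases negative_zless not0_implies_Suc of_nat_0)
  then show ?thesis
  proof cases
    case 2
    then have e: "extz (ratio \<alpha> \<beta>) s = (\<beta> - \<alpha>) * \<beta> ^ k" "extz (ratio (1 / \<alpha>) (1 / \<beta>)) (- s) = 0"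
      "\<beta> powi s = \<beta> ^ Suc k"
      by (auto simp: extz_def ratio_def nat_add_distrib simp del: of_nat_Suc power_Suc simp flip: power_int_of_nat)
    show ?thesis unfolding e using A assms(2) by (simp add: \<alpha> field_simps)
  next
    case 3
    then have e: "extz (ratio \<alpha> \<beta>) s = 0" "extz (ratio (1 / \<alpha>) (1 / \<beta>)) (- s) = (1 / \<beta> - 1 / \<alpha>) / \<beta> ^ k"
      "\<beta> powi s = 1 / \<beta> ^ Suc k"
      by (auto simp: extz_def ratio_def power_int_minus power_one_over power_inverse divide_inverse simp del: of_nat_Suc power_Suc)
    show ?thesis unfolding e using A assms(2) by (simp add: \<alpha> field_simps)
  qed (auto simp: extz_def ratio_def)
qed

section \<open>Normally ordered zero modes\<close>

lemma eps_antisym: "eps Q i j = - eps Q j i"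
  by (simp add: eps_def)

definition epsl :: "'v quiver \<Rightarrow> 'v list \<Rightarrow> 'v list \<Rightarrow> int" where
  "epsl Q is js = (\<Sum>i\<leftarrow>is. \<Sum>j\<leftarrow>js. eps Q i j)"

lemma epsl_simps [simp]: "epsl Q [] js = 0" "epsl Q (i # is) js = (\<Sum>j\<leftarrow>js. eps Q i j) + epsl Q is js"
  by (simp_all add: epsl_def)

lemma epsl_Nil_right [simp]: "epsl Q is [] = 0"
  by (induction "is") auto

lemma epsl_Cons_right: "epsl Q is (j # js) = epsl Q is [j] + epsl Q is js"
  by (induction "is") auto

lemma epsl_antisym: "epsl Q js is = - epsl Q is js"
proof (induction js)
  case (Cons j js)
  have "(\<Sum>i\<leftarrow>is. eps Q j i) = - epsl Q is [j]"
    by (induction "is") (auto simp: eps_antisym[of Q j])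
  then show ?case using Cons epsl_Cons_right[of Q "is" j js] by simp
qed simp

context osc_presentation
begin

abbreviation XX :: "'v \<Rightarrow> 'g falg" where "XX i \<equiv> emb (X i)"
abbreviation zm :: "'v list \<Rightarrow> 'g falg" where "zm \<equiv> zero_mode q Q emb"

lemma zm_mult: "zm is * zm js = cst (q powi epsl Q is js) * zm (is @ js)"
proof (induction "is")
  case (Cons i "is")
  have "zm (i # is) * zm js = cst (q powi (- (\<Sum>j\<leftarrow>is. eps Q i j))) * (XX i * (zm is * zm js))"
    by (simp add: mult.assoc)
  also have "\<dots> = cst (q powi (- (\<Sum>j\<leftarrow>is. eps Q i j)) * q powi epsl Q is js) * (XX i * zm (is @ js))"
    by (simp only: Cons cst_comm_assoc[of "XX i"] cst_mult mult.assoc)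
  also have "q powi (- (\<Sum>j\<leftarrow>is. eps Q i j)) * q powi epsl Q is js
      = q powi (epsl Q (i # is) js) * q powi (- (\<Sum>j\<leftarrow>is @ js. eps Q i j))"
    unfolding power_int_add[OF disjI1[OF q_nz], symmetric] by simp
  finally show ?case by (simp add: cst_mult mult.assoc)
qed simp

lemma X_swap: "XX i * XX j \<approx> cst (q powi (2 * eps Q i j)) * (XX j * XX i)"
proof -
  have "XX i * XX j - cst (q powi (2 * eps Q i j)) * XX j * XX i \<in> aq_rels q Q emb"
    unfolding aq_rels_def by blast
  then show ?thesis using aq_rels by (intro cg_rel) (auto simp: mult.assoc)
qed

text \<open>The exponent -epsilon in \<open>zero_mode\<close> cancels half of the exponent in X_i
  X_j = q^(2 epsilon) X_j X_i: the exchange factor is split evenly between the two orders, so the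
  ordered product does not depend on the order.\<close>

lemma zm_move: "zm (ys @ i # zs) \<approx> zm (i # ys @ zs)"
proof (induction ys)
  case (Cons y ys)
  let ?e = "\<lambda>i is. \<Sum>j\<leftarrow>is. eps Q i j"
  have "zm ((y # ys) @ i # zs) \<approx> cst (q powi (- ?e y (ys @ i # zs))) * XX y * zm (i # ys @ zs)"
    unfolding append_Cons zero_mode.simps by (intro cg_lmult) (use Cons in simp)
  also have "\<dots> = cst (q powi (- ?e y (ys @ i # zs)) * q powi (- ?e i (ys @ zs))) * (XX y * XX i * zm (ys @ zs))"
    by (simp only: zero_mode.simps mult.assoc cst_comm_assoc[of "XX _"] cst_mult)
  also have "\<dots> \<approx> cst (q powi (- ?e y (ys @ i # zs)) * q powi (- ?e i (ys @ zs))) *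
      (cst (q powi (2 * eps Q y i)) * (XX i * XX y) * zm (ys @ zs))"
    by (intro cg_lmult cg_rmult X_swap)
  also have "\<dots> = cst (q powi (- ?e y (ys @ i # zs)) * q powi (- ?e i (ys @ zs)) * q powi (2 * eps Q y i))
      * (XX i * XX y * zm (ys @ zs))"
    by (simp only: mult.assoc cst_mult)
  also have "q powi (- ?e y (ys @ i # zs)) * q powi (- ?e i (ys @ zs)) * q powi (2 * eps Q y i)
      = q powi (- ?e i (y # ys @ zs)) * q powi (- ?e y (ys @ zs))"
    unfolding power_int_add[OF disjI1[OF q_nz], symmetric]
    by (rule arg_cong[of _ _ "power_int q"]) (simp add: eps_antisym[of Q i y])
  also have "cst \<dots> * (XX i * XX y * zm (ys @ zs)) = zm (i # (y # ys) @ zs)"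
    by (simp only: append_Cons zero_mode.simps mult.assoc cst_comm_assoc[of "XX _"] cst_mult)
  finally show ?case .
qed simp

lemma zm_perm: "mset is = mset js \<Longrightarrow> zm is \<approx> zm js"
proof (induction "is" arbitrary: js)
  case (Cons i "is")
  then have "i \<in> set js" by (metis list.set_intros(1) set_mset_mset)
  then obtain ys zs where js: "js = ys @ i # zs" by (meson split_list)
  then have "zm is \<approx> zm (ys @ zs)" "mset is = mset (ys @ zs)" using Cons by auto
  then have "zm (i # is) \<approx> zm (i # ys @ zs)"
    unfolding zero_mode.simps by (metis cg_lmult mset_map sum_mset_sum_list)
  also have "\<dots> \<approx> zm js" unfolding js by (rule cg_sym[OF zm_move])
  finally show ?case .
qed simp

lemma X_osc: "XX i * emb (Osc j n) \<approx> emb (Osc j n) * XX i"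
proof -
  have "XX i * emb (Osc j n) - emb (Osc j n) * XX i \<in> aq_rels q Q emb"
    unfolding aq_rels_def by blast
  then show ?thesis using aq_rels by (intro cg_rel) auto
qed

lemma commutes_mult:
  assumes "x * z \<approx> z * x" "y * z \<approx> z * y"
  shows "x * y * z \<approx> z * (x * y)"
proof -
  have "x * y * z = x * (y * z)" by (simp add: mult.assoc)
  also have "\<dots> \<approx> x * (z * y)" by (intro cg_lmult assms)
  also have "\<dots> = x * z * y" by (simp add: mult.assoc)
  also have "\<dots> \<approx> z * x * y" by (intro cg_rmult assms)
  finally show ?thesis by (simp add: mult.assoc)
qed

lemma zm_osc: "zm is * emb (Osc j n) \<approx> emb (Osc j n) * zm is"
proof (induction "is")
  case (Cons i "is")
  show ?case unfolding zero_mode.simps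
    by (intro commutes_mult Cons X_osc) (simp add: cst_comm)
qed simp

lemma osc_exp_commute:
  assumes z: "\<And>j n. z * emb (Osc j n) \<approx> emb (Osc j n) * z" and "creation a" "annihilation b"
  shows "z * osc_exp a b m M \<approx> osc_exp a b m M * z"
proof -
  have a: "z * a k \<approx> a k * z" if k: "k > 0" for k
  proof -
    obtain u where "a k = lin emb u (- int k)" using assms(2) k unfolding creation_def by blast
    then show ?thesis by (simp add: lin_commute_gen z)
  qed
  have b: "z * b k \<approx> b k * z" if k: "k > 0" for k
  proof -
    obtain u where "b k = lin emb u (int k)" using assms(3) k unfolding annihilation_def by blast
    then show ?thesis by (simp add: lin_commute_gen z)
  qed
  have "ez a i * exp_coeff b j * z \<approx> z * (ez a i * exp_coeff b j)" for i j
    by (intro commutes_mult cg_sym[OF ez_commute] cg_sym[OF exp_coeff_commute] a b)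
  then show ?thesis
    unfolding osc_exp_eq sum_distrib_left sum_distrib_right by (intro cg_sum) (rule cg_sym)
qed

section \<open>Vertex operators and their quadratic relations\<close>

abbreviation crea :: "('v \<times> complex) list \<Rightarrow> nat \<Rightarrow> 'g falg" where
  "crea ps \<equiv> \<lambda>k. \<Sum>(i, c)\<leftarrow>ps. cst (c ^ k) * emb (Osc i (- int k))"
abbreviation anni :: "('v \<times> complex) list \<Rightarrow> nat \<Rightarrow> 'g falg" where
  "anni ps \<equiv> \<lambda>k. \<Sum>(i, c)\<leftarrow>ps. cst (1 / c ^ k) * emb (Osc i (int k))"
abbreviation VV :: "('v \<times> complex) list \<Rightarrow> int \<Rightarrow> nat \<Rightarrow> 'g falg" where
  "VV \<equiv> nord q Q emb"

lemma crea_lin: "crea ps k = lin emb (map (\<lambda>(i, c). (i, c ^ k)) ps) (- int k)"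
  by (induction ps) auto

lemma anni_lin: "anni ps k = lin emb (map (\<lambda>(i, c). (i, 1 / c ^ k)) ps) (int k)"
  by (induction ps) auto

lemma creation_crea: "creation (crea ps)" and annihilation_anni: "annihilation (anni ps)"
  unfolding creation_def annihilation_def crea_lin anni_lin by blast+

lemma cauchy_nord: "cauchy (VV ps m)"
  unfolding nord_def[abs_def] by (intro cauchy_mult cauchy_const cauchy_osc_exp annihilation_anni)

text \<open>The contraction of the vertex operator of \<open>ps\<close> at z with that of
  \<open>ps'\<close> at w, as a series in w/z. A pair (i, u), (j, v) contributes (v/u)^k because
  annihilators carry (u z)^(-k) and creators (v w)^k; the 1/k of the bracket is part of
  \<open>ctr_seq\<close>.\<close>

definition contr :: "('v \<times> complex) list \<Rightarrow> ('v \<times> complex) list \<Rightarrow> (nat \<Rightarrow> complex) \<Rightarrow> bool" where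
  "contr ps ps' c \<longleftrightarrow>
     ctr_seq (\<lambda>k. \<Sum>(i, u)\<leftarrow>ps. \<Sum>(j, v)\<leftarrow>ps'. (v / u) ^ k * Cmat_pow k q Q i j) c"

abbreviation Wn where "Wn ps ps' \<equiv> Wp (crea ps) (anni ps) (crea ps') (anni ps')"
abbreviation ee where "ee ps ps' \<equiv> epsl Q (map fst ps) (map fst ps')"
abbreviation ZZ where "ZZ ps \<equiv> zm (map fst ps)"

lemma crea_anni_bracket:
  assumes "k > 0"
  shows "anni ps k * crea ps' l \<approx> crea ps' l * anni ps k
    + cst (if l = k then (\<Sum>(i, u)\<leftarrow>ps. \<Sum>(j, v)\<leftarrow>ps'. (v / u) ^ k * Cmat_pow k q Q i j) / of_nat k else 0)"
proof -
  have inner: "(\<Sum>(j, d)\<leftarrow>map (\<lambda>(i, c). (i, c ^ k)) ps'. u * d * Cmat_pow k q Q i j)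
      = (\<Sum>(j, v)\<leftarrow>ps'. u * v ^ k * Cmat_pow k q Q i j)" for u i
    by (induction ps') auto
  have "(\<Sum>(i, c)\<leftarrow>map (\<lambda>(i, c). (i, 1 / c ^ k)) ps. \<Sum>(j, d)\<leftarrow>map (\<lambda>(i, c). (i, c ^ k)) ps'. c * d * Cmat_pow k q Q i j)
    = (\<Sum>(i, u)\<leftarrow>ps. \<Sum>(j, v)\<leftarrow>ps'. (v / u) ^ k * Cmat_pow k q Q i j)"
    unfolding inner by (induction ps) (auto simp: power_divide)
  then show ?thesis
    using lin_bracket[OF assms, of "map (\<lambda>(i, c). (i, 1 / c ^ k)) ps" "map (\<lambda>(i, c). (i, c ^ l)) ps'" l]
    unfolding crea_lin anni_lin by (cases "l = k") auto
qed

lemma nord_product: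
  assumes "contr ps ps' c"
  shows "(\<lambda>M. VV ps m M * VV ps' n M) \<sim>
    (\<lambda>M. cst (q powi ee ps ps') * (ZZ (ps @ ps') * Wn ps ps' (extz c) m n M))"
proof -
  let ?O = "osc_exp (crea ps) (anni ps) m" and ?O' = "osc_exp (crea ps') (anni ps') n"
  have "VV ps m M * VV ps' n M \<approx> cst (q powi ee ps ps') * (ZZ (ps @ ps') * (?O M * ?O' M))" for M
  proof -
    have "VV ps m M * VV ps' n M = ZZ ps * (?O M * ZZ ps' * ?O' M)"
      by (simp add: nord_def mult.assoc)
    also have "\<dots> \<approx> ZZ ps * (ZZ ps' * ?O M * ?O' M)"
      by (intro cg_lmult cg_rmult cg_sym[OF osc_exp_commute] zm_osc creation_crea annihilation_anni)
    also have "\<dots> = ZZ ps * ZZ ps' * (?O M * ?O' M)" by (simp add: mult.assoc)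
    finally show ?thesis by (simp add: zm_mult mult.assoc)
  qed
  then have "(\<lambda>M. VV ps m M * VV ps' n M) \<sim>
      (\<lambda>M. cst (q powi ee ps ps') * (ZZ (ps @ ps') * (?O M * ?O' M)))" by (rule sim_I)
  also have "\<dots> \<sim> (\<lambda>M. cst (q powi ee ps ps') * (ZZ (ps @ ps') * Wn ps ps' (extz c) m n M))"
  proof (intro sim_lmult osc_product creation_crea annihilation_anni)
    show "ctr_seq (\<lambda>k. of_nat k * ((\<Sum>(i, u)\<leftarrow>ps. \<Sum>(j, v)\<leftarrow>ps'. (v / u) ^ k * Cmat_pow k q Q i j) / of_nat k)) c"
      by (rule ctr_seq_cong[OF assms[unfolded contr_def]]) simp
  qed (rule crea_anni_bracket)
  finally show ?thesis .
qed

text \<open>The reversed product is expressed through the same normally ordered operator as the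
  product in \<open>nord_product\<close>, with the contraction now a series in z/w; antisymmetry of
  epsilon inverts the power of q.\<close>

lemma nord_product_swap:
  assumes "contr ps' ps c"
  shows "(\<lambda>M. VV ps' n M * VV ps m M) \<sim>
    (\<lambda>M. cst (1 / q powi ee ps ps') * (ZZ (ps @ ps') * Wn ps ps' (\<lambda>s. extz c (- s)) m n M))"
proof -
  note nord_product[OF assms, of n m]
  also have "(\<lambda>M. cst (q powi ee ps' ps) * (ZZ (ps' @ ps) * Wn ps' ps (extz c) n m M)) \<sim>
    (\<lambda>M. cst (q powi ee ps' ps) * (ZZ (ps @ ps') * Wn ps ps' (\<lambda>s. extz c (- s)) m n M))"
    by (intro sim_I cg_lmult cg_mult zm_perm Wp_swap creation_commuting creation_crea
        annihilation_commuting annihilation_anni) simp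
  also have "q powi ee ps' ps = 1 / q powi ee ps ps'"
    by (simp add: epsl_antisym[of Q "map fst ps'"] power_int_minus divide_inverse)
  finally show ?thesis .
qed

text \<open>Any bilinear combination of modes, in either order, is one \<open>Wn\<close> whose
  scalar series is the same combination of shifted contractions. So a relation between currents
  follows from an identity of complex coefficients; \<open>exchange\<close>,
  \<open>commutator\<close> and \<open>reorder\<close> are the three cases that occur.\<close>

lemma nord_quadratic:
  assumes c: "contr ps ps' c" "contr ps' ps c'"
  shows "(\<lambda>M. (\<Sum>x\<in>A. cst (g x) * (VV ps (m + \<sigma> x) M * VV ps' (n - \<sigma> x) M))
      - (\<Sum>y\<in>B. cst (g' y) * (VV ps' (n - \<tau> y) M * VV ps (m + \<tau> y) M)))
    \<sim> (\<lambda>M. ZZ (ps @ ps') * Wn ps ps' (\<lambda>s. q powi ee ps ps' * (\<Sum>x\<in>A. g x * extz c (s - \<sigma> x))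
        - 1 / q powi ee ps ps' * (\<Sum>y\<in>B. g' y * extz c' (\<tau> y - s))) m n M)"
proof -
  let ?A = "q powi ee ps ps'" and ?Z = "ZZ (ps @ ps')"
  have "(\<lambda>M. (\<Sum>x\<in>A. cst (g x) * (VV ps (m + \<sigma> x) M * VV ps' (n - \<sigma> x) M))
      - (\<Sum>y\<in>B. cst (g' y) * (VV ps' (n - \<tau> y) M * VV ps (m + \<tau> y) M)))
    \<sim> (\<lambda>M. (\<Sum>x\<in>A. cst (g x) * (cst ?A * (?Z * Wn ps ps' (extz c) (m + \<sigma> x) (n - \<sigma> x) M)))
      - (\<Sum>y\<in>B. cst (g' y) * (cst (1 / ?A) * (?Z * Wn ps ps' (\<lambda>s. extz c' (- s)) (m + \<tau> y) (n - \<tau> y) M))))"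
    by (intro sim_diff sim_sum sim_lmult nord_product nord_product_swap c)
  also have "\<dots> = (\<lambda>M. ?Z * Wn ps ps' (\<lambda>s. (\<Sum>x\<in>A. ?A * (g x * extz c (s - \<sigma> x)))
        - (\<Sum>y\<in>B. 1 / ?A * (g' y * extz c' (- (s - \<tau> y))))) m n M)"
  proof
    fix M
    have 1: "cst a * (cst b * (?Z * w)) = ?Z * (cst b * (cst a * w))" for a b w
    proof -
      have "cst a * (cst b * (?Z * w)) = cst b * (cst a * (?Z * w))" by (rule cst_comm_assoc)
      then show ?thesis by (simp only: cst_comm_assoc[of ?Z])
    qed
    show "(\<Sum>x\<in>A. cst (g x) * (cst ?A * (?Z * Wn ps ps' (extz c) (m + \<sigma> x) (n - \<sigma> x) M)))
      - (\<Sum>y\<in>B. cst (g' y) * (cst (1 / ?A) * (?Z * Wn ps ps' (\<lambda>s. extz c' (- s)) (m + \<tau> y) (n - \<tau> y) M)))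
      = ?Z * Wn ps ps' (\<lambda>s. (\<Sum>x\<in>A. ?A * (g x * extz c (s - \<sigma> x)))
        - (\<Sum>y\<in>B. 1 / ?A * (g' y * extz c' (- (s - \<tau> y))))) m n M"
      unfolding 1 Wp_diff Wp_sum Wp_cmult
        Wp_shift[of _ _ _ _ "extz c", symmetric] Wp_shift[of _ _ _ _ "\<lambda>s. extz c' (- s)", symmetric]
      by (simp only: sum_distrib_left right_diff_distrib)
  qed
  finally show ?thesis by (simp only: sum_distrib_left minus_diff_eq)
qed

lemma Wn_null: "(\<And>M. Wn ps ps' d m n M \<in> II) \<Longrightarrow> null (\<lambda>M. z * Wn ps ps' d m n M)"
  by (intro null_lmult null_I)

text \<open>Multiplication by the linear factor clears the common pole of the two contractions, so
  only the exponents s = 0 and s = 1 are left. The two conditions on A are the vanishing of these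
  coefficients: A = \<alpha>'/A and A \<alpha> = 1/A.\<close>

lemma exchange:
  assumes c: "contr ps ps' (ratio \<alpha> \<beta>)" "contr ps' ps (ratio \<alpha>' \<beta>)"
    and A: "A = q powi ee ps ps'" "A * A = \<alpha>'" "A * A * \<alpha> = 1"
  shows "(\<lambda>M. (VV ps (m - 1) M * VV ps' n M - cst \<beta> * (VV ps m M * VV ps' (n - 1) M)))
    \<sim> (\<lambda>M. cst \<beta> * (VV ps' n M * VV ps (m - 1) M) - VV ps' (n - 1) M * VV ps m M)"
proof -
  let ?g = "\<lambda>x :: nat. if x = 0 then 1 else - \<beta>" and ?g' = "\<lambda>y :: nat. if y = 0 then \<beta> else - 1"
  have A0: "A \<noteq> 0" using A(1) q_nz by simp
  have d: "A * (\<Sum>x\<in>{0, 1}. ?g x * extz (ratio \<alpha> \<beta>) (s - int x))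
      - 1 / A * (\<Sum>y\<in>{0, 1}. ?g' y * extz (ratio \<alpha>' \<beta>) (int y - s)) = 0" for s
  proof -
    have "A * (\<Sum>x\<in>{0, 1}. ?g x * extz (ratio \<alpha> \<beta>) (s - int x))
      - 1 / A * (\<Sum>y\<in>{0, 1}. ?g' y * extz (ratio \<alpha>' \<beta>) (int y - s))
      = A * (extz (ratio \<alpha> \<beta>) s - \<beta> * extz (ratio \<alpha> \<beta>) (s - 1))
      + 1 / A * (extz (ratio \<alpha>' \<beta>) (1 - s) - \<beta> * extz (ratio \<alpha>' \<beta>) (1 - s - 1))"
      using A0 by (simp add: field_simps)
    also have "\<dots> = 0"
      unfolding extz_ratio_step using A(2,3) A0 by (auto simp: field_simps)
    finally show ?thesis .
  qed
  have "(\<lambda>M. (\<Sum>x\<in>{0, 1}. cst (?g x) * (VV ps (m - 1 + int x) M * VV ps' (n - int x) M))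
      - (\<Sum>y\<in>{0, 1}. cst (?g' y) * (VV ps' (n - int y) M * VV ps (m - 1 + int y) M)))
    \<sim> (\<lambda>M. ZZ (ps @ ps') * Wn ps ps' (\<lambda>s. 0) (m - 1) n M)"
    using nord_quadratic[OF c, where A = "{0, 1 :: nat}" and B = "{0, 1 :: nat}" and g = ?g and g' = ?g'
        and \<sigma> = int and \<tau> = int and m = "m - 1" and n = n]
    unfolding A(1)[symmetric] d .
  then show ?thesis
    by (simp add: Wp_def sim_0_iff) (simp add: sim_def cst_uminus algebra_simps)
qed

text \<open>The two contractions expand one rational function in opposite domains, so the bracket is
  a delta function at its pole. \<open>Wp_merge\<close> evaluates the normally ordered product
  there, which multiplies the points of \<open>ps\<close> by \<beta>.\<close>

lemma commutator:
  assumes c: "contr ps ps' (ratio \<alpha> \<beta>)" "contr ps' ps (ratio (1 / \<alpha>) (1 / \<beta>))"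
    and A: "A = q powi ee ps ps'" "A * A = \<beta> / \<alpha>" and nz: "\<alpha> \<noteq> 0" "\<beta> \<noteq> 0"
  shows "(\<lambda>M. VV ps m M * VV ps' n M - VV ps' n M * VV ps m M)
    \<sim> (\<lambda>M. cst ((A - 1 / A) * \<beta> powi (- m)) * VV (map (\<lambda>(i, u). (i, \<beta> * u)) ps @ ps') (m + n) M)"
proof -
  let ?qs = "map (\<lambda>(i, u). (i, \<beta> * u)) ps @ ps'"
  have "(\<lambda>M. VV ps m M * VV ps' n M - VV ps' n M * VV ps m M)
    \<sim> (\<lambda>M. ZZ (ps @ ps') * Wn ps ps' (\<lambda>s. (A - 1 / A) * \<beta> powi s) m n M)"
    using nord_quadratic[OF c, where A = "{()}" and B = "{()}" and g = "\<lambda>_. 1" and g' = "\<lambda>_. 1"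
        and \<sigma> = "\<lambda>_. 0" and \<tau> = "\<lambda>_. 0" and m = m and n = n]
      extz_ratio_two_sided[OF nz A(2)]
    unfolding A(1)[symmetric] by simp
  also have "\<dots> = (\<lambda>M. cst (A - 1 / A) * (ZZ (ps @ ps') * Wn ps ps' (\<lambda>s. \<beta> powi s) m n M))"
    by (simp only: Wp_cmult cst_comm_assoc[of "ZZ _"])
  also have "\<dots> \<sim> (\<lambda>M. cst (A - 1 / A) * (ZZ (ps @ ps') * (cst (\<beta> powi (- m)) *
      osc_exp (\<lambda>k. cst (\<beta> ^ k) * crea ps k + crea ps' k) (\<lambda>k. cst (1 / \<beta> ^ k) * anni ps k + anni ps' k) (m + n) M)))"
    by (intro sim_lmult Wp_merge creation_crea annihilation_anni nz)
  also have "\<dots> = (\<lambda>M. cst ((A - 1 / A) * \<beta> powi (- m)) * VV ?qs (m + n) M)"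
  proof
    fix M
    have "crea ?qs k = cst (\<beta> ^ k) * crea ps k + crea ps' k"
      "anni ?qs k = cst (1 / \<beta> ^ k) * anni ps k + anni ps' k" for k
      by (induction ps) (auto simp: power_mult_distrib distrib_left add.assoc cst_cst)
    moreover have "map fst ?qs = map fst (ps @ ps')" by (induction ps) auto
    ultimately show "cst (A - 1 / A) * (ZZ (ps @ ps') * (cst (\<beta> powi (- m)) *
        osc_exp (\<lambda>k. cst (\<beta> ^ k) * crea ps k + crea ps' k) (\<lambda>k. cst (1 / \<beta> ^ k) * anni ps k + anni ps' k) (m + n) M))
      = cst ((A - 1 / A) * \<beta> powi (- m)) * VV ?qs (m + n) M"
      by (simp only: nord_def cst_mult mult.assoc cst_comm_assoc[of "ZZ _"] cst_comm_assoc[of "zm _"])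
  qed
  finally show ?thesis .
qed

text \<open>The scalar identity \<open>eq\<close> is asked only for exponents in S; the other terms
  are removed by the missing creators or annihilators. The factor A A is the full cost of exchanging
  the zero modes.\<close>

lemma reorder:
  assumes c: "contr ps ps' c" "contr ps' ps c'" and A: "A = q powi ee ps ps'"
    and supp: "(\<forall>k>0. crea ps k \<in> II) \<and> S = {..- m} \<or> (\<forall>k>0. anni ps k \<in> II) \<and> S = {- m..}
      \<or> (\<forall>k>0. anni ps' k \<in> II) \<and> S = {..n}"
    and eq: "\<And>s. s \<in> S \<Longrightarrow> A * A * extz c s = (\<Sum>y\<in>B. g y * extz c' (\<tau> y - s))"
  shows "(\<lambda>M. VV ps m M * VV ps' n M) \<sim> (\<lambda>M. \<Sum>y\<in>B. cst (g y) * (VV ps' (n - \<tau> y) M * VV ps (m + \<tau> y) M))"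
proof -
  have A0: "A \<noteq> 0" using A q_nz by simp
  define d where "d s = A * extz c s - 1 / A * (\<Sum>y\<in>B. g y * extz c' (\<tau> y - s))" for s
  have d0: "d s = 0" if "s \<in> S" for s
    unfolding d_def eq[OF that, symmetric] using A0 by simp
  have "(\<lambda>M. VV ps m M * VV ps' n M - (\<Sum>y\<in>B. cst (g y) * (VV ps' (n - \<tau> y) M * VV ps (m + \<tau> y) M)))
    \<sim> (\<lambda>M. ZZ (ps @ ps') * Wn ps ps' d m n M)"
    using nord_quadratic[OF c, where A = "{()}" and B = B and g = "\<lambda>_. 1" and g' = g
        and \<sigma> = "\<lambda>_. 0" and \<tau> = \<tau> and m = m and n = n]
    unfolding A(1)[symmetric] by (simp add: d_def[abs_def])
  moreover have "Wn ps ps' d m n M \<in> II" for M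
    using supp
  proof (elim disjE conjE)
    assume "\<forall>k>0. crea ps k \<in> II" "S = {..- m}"
    then show ?thesis using d0 by (intro Wp_II_left_annihilating) auto
  next
    assume "\<forall>k>0. anni ps k \<in> II" "S = {- m..}"
    then show ?thesis using d0 by (intro Wp_II_left_creating) auto
  next
    assume "\<forall>k>0. anni ps' k \<in> II" "S = {..n}"
    then show ?thesis using d0 by (intro Wp_II_right_creating) auto
  qed
  then have "(\<lambda>M. ZZ (ps @ ps') * Wn ps ps' d m n M) \<sim> (\<lambda>M. 0)"
    unfolding sim_0_iff by (rule Wn_null)
  ultimately have "(\<lambda>M. VV ps m M * VV ps' n M - (\<Sum>y\<in>B. cst (g y) * (VV ps' (n - \<tau> y) M * VV ps (m + \<tau> y) M))) \<sim> (\<lambda>M. 0)"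
    by (rule sim_trans)
  then show ?thesis unfolding sim_0_iff sim_def .
qed

lemma rescale_nord: "rescale r (VV ps) m M = VV (map (\<lambda>(i, u). (i, r * u)) ps) m M" if "r \<noteq> 0"
proof -
  let ?qs = "map (\<lambda>(i, u). (i, r * u)) ps"
  have a: "crea ?qs = (\<lambda>k. cst (r ^ k) * crea ps k)"
    by (rule ext, induction ps) (auto simp: power_mult_distrib distrib_left cst_cst)
  have b: "anni ?qs = (\<lambda>k. cst ((1 / r) ^ k) * anni ps k)"
    by (rule ext, induction ps) (auto simp: power_mult_distrib power_one_over distrib_left cst_cst)
  have fst: "map fst ?qs = map fst ps" by (induction ps) auto
  have "osc_exp (crea ?qs) (anni ?qs) m M = cst (r powi m) * osc_exp (crea ps) (anni ps) m M"
    unfolding osc_exp_eq sum_distrib_left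
  proof (intro sum.cong refl)
    fix j
    show "ez (crea ?qs) (m + int j) * exp_coeff (anni ?qs) j
      = cst (r powi m) * (ez (crea ps) (m + int j) * exp_coeff (anni ps) j)"
    proof (cases "m + int j \<ge> 0")
      case True
      have "r powi m = r powi (m + int j) * (1 / r) ^ j"
        using that by (simp add: power_int_add power_one_over)
      also have "r powi (m + int j) = r ^ nat (m + int j)"
        using True by (simp add: power_int_def)
      finally have *: "cst (r powi m) = cst (r ^ nat (m + int j)) * cst ((1 / r) ^ j)"
        by (simp only: cst_mult)
      show ?thesis
        unfolding a b * using True
        by (simp only: ez_def if_True exp_coeff_scale mult.assoc cst_comm_assoc[of "exp_coeff _ _"])
    qed (simp add: ez_neg)
  qed
  then show ?thesis by (simp only: rescale_def nord_def fst cst_comm_assoc)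
qed

lemma nord_zero:
  "(\<forall>k>0. crea ps k \<in> II) \<Longrightarrow> m > 0 \<Longrightarrow> VV ps m M \<in> II"
  "(\<forall>k>0. anni ps k \<in> II) \<Longrightarrow> m < 0 \<Longrightarrow> VV ps m M \<in> II"
proof -
  assume "\<forall>k>0. crea ps k \<in> II" "m > 0"
  then have "ez (crea ps) (m + int j) \<in> II" for j
    by (auto simp: ez_def intro!: exp_coeff_II)
  then have "(\<Sum>j\<le>M. ez (crea ps) (m + int j) * exp_coeff (anni ps) j) \<approx> (\<Sum>j\<le>M. 0)"
    by (intro cg_sum) (auto simp: cg_0_iff intro: rel_ideal_rmult)
  then show "VV ps m M \<in> II"
    by (auto simp: nord_def osc_exp_eq cg_0_iff intro: rel_ideal_lmult)
next
  assume *: "\<forall>k>0. anni ps k \<in> II" "m < 0"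
  have "ez (crea ps) (m + int j) * exp_coeff (anni ps) j \<in> II" for j
  proof (cases "j = 0")
    case False
    then show ?thesis using * by (intro rel_ideal_lmult exp_coeff_II) auto
  qed (use * in \<open>simp add: ez_neg\<close>)
  then have "(\<Sum>j\<le>M. ez (crea ps) (m + int j) * exp_coeff (anni ps) j) \<approx> (\<Sum>j\<le>M. 0)"
    by (intro cg_sum) (auto simp: cg_0_iff)
  then show "VV ps m M \<in> II"
    by (auto simp: nord_def osc_exp_eq cg_0_iff intro: rel_ideal_lmult)
qed

end

section \<open>Contractions for the quiver\<close>

lemma eps_QI:
  "eps (QI q1 q2 q3) V0 V0 = 0" "eps (QI q1 q2 q3) V0 V1 = 1" "eps (QI q1 q2 q3) V0 V2 = - 1" "eps (QI q1 q2 q3) V0 V3 = 0"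
  "eps (QI q1 q2 q3) V1 V0 = - 1" "eps (QI q1 q2 q3) V1 V1 = 0" "eps (QI q1 q2 q3) V1 V2 = 0" "eps (QI q1 q2 q3) V1 V3 = 1"
  "eps (QI q1 q2 q3) V2 V0 = 1" "eps (QI q1 q2 q3) V2 V1 = 0" "eps (QI q1 q2 q3) V2 V2 = 0" "eps (QI q1 q2 q3) V2 V3 = - 1"
  "eps (QI q1 q2 q3) V3 V0 = 0" "eps (QI q1 q2 q3) V3 V1 = - 1" "eps (QI q1 q2 q3) V3 V2 = 1" "eps (QI q1 q2 q3) V3 V3 = 0"
  by (simp_all add: eps_def labels_def QI_def)

locale qi_presentation = osc_presentation rels nbh q "QI q1 q2 q3" emb
  for rels :: "'g falg set" and nbh q q1 q2 q3 and emb :: "vertex aq_gen \<Rightarrow> 'g falg" +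
  assumes q2: "q2 = q ^ 2" and q1: "q1 = 1 / (q ^ 2 * q3)" and q3: "q3 \<noteq> 0"
begin

text \<open>Eliminating q1 and q2 makes every entry p - 1/p times a Laurent polynomial in p = q^k
  and t = q3^k, so all later sums of entries are compared as expressions in two variables.\<close>

lemma Cmat_pow_QI:
  fixes k :: nat
  defines "p \<equiv> q ^ k" and "t \<equiv> q3 ^ k"
  shows "Cmat_pow k q (QI q1 q2 q3) V0 V0 = (p - 1 / p) * p"
    "Cmat_pow k q (QI q1 q2 q3) V0 V1 = (p - 1 / p) / p"
    "Cmat_pow k q (QI q1 q2 q3) V0 V2 = - (p - 1 / p) / p"
    "Cmat_pow k q (QI q1 q2 q3) V0 V3 = 0"
    "Cmat_pow k q (QI q1 q2 q3) V1 V0 = - (p - 1 / p) * p"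
    "Cmat_pow k q (QI q1 q2 q3) V1 V1 = (p - 1 / p) * (p - 1 / p)"
    "Cmat_pow k q (QI q1 q2 q3) V1 V2 = (p - 1 / p) * (1 / p - 1 / (p * t))"
    "Cmat_pow k q (QI q1 q2 q3) V1 V3 = (p - 1 / p) / (p * t)"
    "Cmat_pow k q (QI q1 q2 q3) V2 V0 = (p - 1 / p) * p"
    "Cmat_pow k q (QI q1 q2 q3) V2 V1 = (p - 1 / p) * (p * t - p)"
    "Cmat_pow k q (QI q1 q2 q3) V2 V2 = (p - 1 / p) * (p - 1 / p)"
    "Cmat_pow k q (QI q1 q2 q3) V2 V3 = - (p - 1 / p) * p"
    "Cmat_pow k q (QI q1 q2 q3) V3 V0 = 0"
    "Cmat_pow k q (QI q1 q2 q3) V3 V1 = - (p - 1 / p) * (p * t)"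
    "Cmat_pow k q (QI q1 q2 q3) V3 V2 = (p - 1 / p) / p"
    "Cmat_pow k q (QI q1 q2 q3) V3 V3 = - (p - 1 / p) / p"
proof -
  have "p \<noteq> 0" "t \<noteq> 0" using q_nz q3 by (auto simp: p_def t_def)
  moreover have "(1 / q2) ^ k = 1 / (p * p)" "q1 ^ k = 1 / (p * p * t)"
    by (simp_all add: q2 q1 p_def t_def power_divide power_mult_distrib power2_eq_square)
  ultimately show "Cmat_pow k q (QI q1 q2 q3) V0 V0 = (p - 1 / p) * p"
    "Cmat_pow k q (QI q1 q2 q3) V0 V1 = (p - 1 / p) / p"
    "Cmat_pow k q (QI q1 q2 q3) V0 V2 = - (p - 1 / p) / p"
    "Cmat_pow k q (QI q1 q2 q3) V0 V3 = 0"
    "Cmat_pow k q (QI q1 q2 q3) V1 V0 = - (p - 1 / p) * p"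
    "Cmat_pow k q (QI q1 q2 q3) V1 V1 = (p - 1 / p) * (p - 1 / p)"
    "Cmat_pow k q (QI q1 q2 q3) V1 V2 = (p - 1 / p) * (1 / p - 1 / (p * t))"
    "Cmat_pow k q (QI q1 q2 q3) V1 V3 = (p - 1 / p) / (p * t)"
    "Cmat_pow k q (QI q1 q2 q3) V2 V0 = (p - 1 / p) * p"
    "Cmat_pow k q (QI q1 q2 q3) V2 V1 = (p - 1 / p) * (p * t - p)"
    "Cmat_pow k q (QI q1 q2 q3) V2 V2 = (p - 1 / p) * (p - 1 / p)"
    "Cmat_pow k q (QI q1 q2 q3) V2 V3 = - (p - 1 / p) * p"
    "Cmat_pow k q (QI q1 q2 q3) V3 V0 = 0"
    "Cmat_pow k q (QI q1 q2 q3) V3 V1 = - (p - 1 / p) * (p * t)"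
    "Cmat_pow k q (QI q1 q2 q3) V3 V2 = (p - 1 / p) / p"
    "Cmat_pow k q (QI q1 q2 q3) V3 V3 = - (p - 1 / p) / p"
    by (simp_all add: Cmat_pow_def Cmat_def cmat_def labels_def QI_def p_def[symmetric] t_def[symmetric])
      (simp_all add: field_simps)
qed

lemma contrI:
  assumes "\<And>k. k > 0 \<Longrightarrow> (\<Sum>(i, u)\<leftarrow>ps. \<Sum>(j, v)\<leftarrow>ps'. (v / u) ^ k * Cmat_pow k q (QI q1 q2 q3) i j) = \<beta> ^ k - \<alpha> ^ k"
  shows "contr ps ps' (ratio \<alpha> \<beta>)"
  unfolding contr_def by (rule ctr_seq_cong[OF ctr_seq_ratio]) (simp add: assms)

lemmas contr_expand = list.map sum_list.Cons sum_list.Nil prod.case Cmat_pow_QI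

lemmas contr_simps = power_mult_distrib power_divide q2

text \<open>\<open>e0\<close>, \<open>e1\<close> are the two terms of E and \<open>f0\<close>,
  \<open>f1\<close> those of F, at the argument u z. \<open>pp\<close> and \<open>pm\<close> are
  named after psi^+ and psi^-, hence \<open>pp\<close> runs along the path P_- and \<open>pm\<close>
  along P_+.\<close>

abbreviation "e0 u \<equiv> [(V0, u)]"
abbreviation "e1 u \<equiv> [(V0, u), (V1, u)]"
abbreviation "f0 u \<equiv> [(V3, u)]"
abbreviation "f1 u \<equiv> [(V3, u), (V2, u)]"
abbreviation "pm u \<equiv> [(V0, u), (V1, u), (V3, q3 * u)]"
abbreviation "pp u \<equiv> [(V3, u), (V2, u), (V0, u / q2)]"

context
  fixes u v :: complex
  assumes u: "u \<noteq> 0" and v: "v \<noteq> 0"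
begin

text \<open>In each sum the entries of C^[k] collapse to a difference of two k-th powers. A trivial
  contraction is kept in the form \<alpha> = \<beta> = q^2 v/u, so that all four pairs share one
  \<beta> as \<open>exchange_sum\<close> requires.\<close>

lemma contr_EE:
  "contr (e0 u) (e0 v) (ratio (v / u) (q ^ 2 * v / u))"
  "contr (e0 u) (e1 v) (ratio (v / (q ^ 2 * u)) (q ^ 2 * v / u))"
  "contr (e1 u) (e0 v) (ratio (q ^ 2 * v / u) (q ^ 2 * v / u))"
  "contr (e1 u) (e1 v) (ratio (v / u) (q ^ 2 * v / u))"
  by (rule contrI, simp only: contr_expand, use u v q_nz q3 in \<open>simp add: contr_simps field_simps power2_eq_square\<close>)+

lemma contr_FF:
  "contr (f0 u) (f0 v) (ratio (v / u) (v / (q ^ 2 * u)))"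
  "contr (f0 u) (f1 v) (ratio (v / (q ^ 2 * u)) (v / (q ^ 2 * u)))"
  "contr (f1 u) (f0 v) (ratio (q ^ 2 * v / u) (v / (q ^ 2 * u)))"
  "contr (f1 u) (f1 v) (ratio (v / u) (v / (q ^ 2 * u)))"
  by (rule contrI, simp only: contr_expand, use u v q_nz q3 in \<open>simp add: contr_simps field_simps power2_eq_square\<close>)+

text \<open>Vertices 0 and 3 are not joined, and for \<open>e1\<close> with \<open>f1\<close> the
  two arrows between 1 and 2 cancel the contributions of 0 with 2 and of 1 with 3. So two of the
  four brackets in [E, F] vanish.\<close>

lemma contr_EF:
  "contr (e0 u) (f0 v) (ratio 1 1)"
  "contr (e0 u) (f1 v) (ratio (v / u) (v / (q ^ 2 * u)))"
  "contr (e1 u) (f0 v) (ratio (v / (q ^ 2 * q3 * u)) (v / (q3 * u)))"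
  "contr (e1 u) (f1 v) (ratio 1 1)"
  by (rule contrI, simp only: contr_expand, use u v q_nz q3 in \<open>simp add: contr_simps field_simps power2_eq_square\<close>)+

lemma contr_FE:
  "contr (f0 u) (e0 v) (ratio 1 1)"
  "contr (f1 u) (e0 v) (ratio (v / u) (q ^ 2 * v / u))"
  "contr (f0 u) (e1 v) (ratio (q ^ 2 * q3 * v / u) (q3 * v / u))"
  "contr (f1 u) (e1 v) (ratio 1 1)"
  by (rule contrI, simp only: contr_expand, use u v q_nz q3 in \<open>simp add: contr_simps field_simps power2_eq_square\<close>)+

lemma contr_pp:
  "contr (pp u) (e0 v) (ratio (v / u) (q ^ 4 * v / u))" "contr (e0 u) (pp v) (ratio 1 1)"
  "contr (pp u) (e1 v) (ratio (v / u) (q ^ 4 * v / u))" "contr (e1 u) (pp v) (ratio 1 1)"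
  "contr (pp u) (f0 v) (ratio (q ^ 2 * v / u) (v / (q ^ 2 * u)))" "contr (f0 u) (pp v) (ratio 1 1)"
  "contr (pp u) (f1 v) (ratio (q ^ 2 * v / u) (v / (q ^ 2 * u)))" "contr (f1 u) (pp v) (ratio 1 1)"
  "contr (pp u) (pp v) (ratio 1 1)"
  by (rule contrI, simp only: contr_expand, use u v q_nz q3 in \<open>simp add: contr_simps field_simps power2_eq_square power4_eq_xxxx\<close>)+

lemma contr_pm:
  "contr (pm u) (e0 v) (ratio 1 1)" "contr (e0 u) (pm v) (ratio (v / (q ^ 2 * u)) (q ^ 2 * v / u))"
  "contr (pm u) (e1 v) (ratio 1 1)" "contr (e1 u) (pm v) (ratio (v / (q ^ 2 * u)) (q ^ 2 * v / u))"
  "contr (pm u) (f0 v) (ratio 1 1)" "contr (f0 u) (pm v) (ratio (q ^ 2 * q3 * v / u) (q3 * v / (q ^ 2 * u)))"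
  "contr (pm u) (f1 v) (ratio 1 1)" "contr (f1 u) (pm v) (ratio (q ^ 2 * q3 * v / u) (q3 * v / (q ^ 2 * u)))"
  "contr (pm u) (pm v) (ratio 1 1)" "contr (pm u) (pp v) (ratio 1 1)"
  by (rule contrI, simp only: contr_expand, use u v q_nz q3 in \<open>simp add: contr_simps field_simps power2_eq_square power4_eq_xxxx\<close>)+

text \<open>The logarithm is a sum of two differences of powers, corresponding to the two factors G
  in the relation between psi^+ and psi^-.\<close>

lemma contr_pp_pm:
  "contr (pp u) (pm v) (fps_nth (Abs_fps (ratio (v / u) (q ^ 4 * v / u))
    * Abs_fps (ratio (q ^ 2 * q3 * v / u) (q3 * v / (q ^ 2 * u)))))"
  unfolding contr_def
  by (rule ctr_seq_cong[OF ctr_seq_mult[OF ctr_seq_ratio ctr_seq_ratio]], simp only: contr_expand)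
    (use u v q_nz q3 in \<open>simp add: contr_simps field_simps power2_eq_square power4_eq_xxxx\<close>)

end

end

section \<open>The relations of the quantum affine algebra\<close>

lemma ratio_scale: "t ^ j * ratio \<alpha> \<beta> j = ratio (t * \<alpha>) (t * \<beta>) j"
  by (cases j) (auto simp: ratio_def power_mult_distrib algebra_simps)

lemma ratio_inverse: "Abs_fps (ratio \<alpha> \<beta>) * Abs_fps (ratio \<beta> \<alpha>) = 1"
proof -
  let ?f = "Abs_fps (ratio \<alpha> \<beta>)" and ?g = "Abs_fps (ratio \<beta> \<alpha>)"
  let ?a = "1 - fps_const \<alpha> * fps_X" and ?b = "1 - fps_const \<beta> * fps_X"
  have "(?f * ?g) * (?a * ?b) = (?f * ?b) * (?g * ?a)" by (simp only: ac_simps)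
  also have "\<dots> = 1 * (?a * ?b)" by (simp only: ratio_fps mult_1)
  finally have "(?f * ?g - 1) * (?a * ?b) = 0" by (simp only: left_diff_distrib diff_self)
  moreover have "fps_nth (?a * ?b) 0 \<noteq> 0" by simp
  then have "?a * ?b \<noteq> 0" by (metis fps_zero_nth)
  ultimately show ?thesis by auto
qed

lemma ratio_one: "ratio x x s = (if s = 0 then 1 else 0)"
  by (simp add: ratio_def)

definition gP :: "complex \<Rightarrow> nat \<Rightarrow> complex" where
  "gP q j = q ^ 2 * ratio (1 / q ^ 2) (q ^ 2) j"

definition gN :: "complex \<Rightarrow> nat \<Rightarrow> complex" where
  "gN q j = 1 / q ^ 2 * ratio (q ^ 2) (1 / q ^ 2) j"

lemma fps_eq_divideI:
  fixes f g u :: "complex fps"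
  assumes "g * u = f" "fps_nth u 0 \<noteq> 0"
  shows "f / u = g"
  using assms by (metis fps_divide_unit fps_inverse_mult mult.assoc inverse_mult_eq_1' mult_1_right)

text \<open>G(x) G(1/x) = 1, so the expansion at zero is the inverse of the expansion at infinity,
  and all four series reduce to \<open>gP\<close> and \<open>gN\<close>.\<close>

lemma G_coeffs:
  assumes "q \<noteq> 0"
  shows "fps_nth (G_infty q) j = gP q j" "fps_nth (inverse (G_infty q)) j = gN q j"
    "fps_nth (G_zero q) j = gN q j" "fps_nth (inverse (G_zero q)) j = gP q j"
proof -
  let ?a = "1 / q ^ 2" and ?b = "q ^ 2"
  have P: "G_infty q = fps_const ?b * Abs_fps (ratio ?a ?b)"
    unfolding G_infty_def
  proof (rule fps_eq_divideI)
    have "fps_const ?b * Abs_fps (ratio ?a ?b) * (1 - fps_const ?b * fps_X)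
        = fps_const ?b * (1 - fps_const ?a * fps_X)"
      by (simp only: mult.assoc ratio_fps)
    also have "\<dots> = fps_const ?b - fps_const (?b * ?a) * fps_X"
      by (simp only: right_diff_distrib mult_1_right mult.assoc[symmetric] fps_const_mult)
    finally show "fps_const ?b * Abs_fps (ratio ?a ?b) * (1 - fps_const ?b * fps_X) = fps_const ?b - fps_X"
      using assms by simp
  qed simp
  have N: "G_zero q = fps_const ?a * Abs_fps (ratio ?b ?a)"
    unfolding G_zero_def
  proof (rule fps_eq_divideI)
    have X: "fps_X - fps_const ?b = - fps_const ?b * (1 - fps_const ?a * fps_X)"
    proof -
      have "fps_const ?b * (fps_const ?a * fps_X) = fps_X"
        using assms by (simp add: mult.assoc[symmetric])
      then show ?thesis by (simp only: right_diff_distrib mult_1_right mult_minus_left) simp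
    qed
    have "fps_const ?a * Abs_fps (ratio ?b ?a) * (fps_X - fps_const ?b)
        = - fps_const ?a * fps_const ?b * (Abs_fps (ratio ?b ?a) * (1 - fps_const ?a * fps_X))"
      unfolding X by (simp only: ac_simps mult_minus_left mult_minus_right)
    also have "\<dots> = - (fps_const (?a * ?b) * (1 - fps_const ?b * fps_X))"
      unfolding ratio_fps fps_const_mult[symmetric] by (simp only: mult_minus_left mult.assoc)
    finally show "fps_const ?a * Abs_fps (ratio ?b ?a) * (fps_X - fps_const ?b) = fps_const ?b * fps_X - 1"
      using assms by simp
  qed (use assms in simp)
  have PN: "G_infty q * G_zero q = 1"
  proof -
    have "G_infty q * G_zero q = fps_const (?b * ?a) * (Abs_fps (ratio ?a ?b) * Abs_fps (ratio ?b ?a))"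
      unfolding P N fps_const_mult[symmetric] by (simp only: ac_simps)
    then show ?thesis using assms by (simp add: ratio_inverse)
  qed
  have "inverse (G_infty q) = G_zero q" "inverse (G_zero q) = G_infty q"
    using PN by (metis fps_inverse_unique mult.commute)+
  then show "fps_nth (G_infty q) j = gP q j" "fps_nth (inverse (G_infty q)) j = gN q j"
    "fps_nth (G_zero q) j = gN q j" "fps_nth (inverse (G_zero q)) j = gP q j"
    unfolding P N by (simp_all add: gP_def gN_def)
qed

section \<open>Relations for sums of vertex operators and for one-sided currents\<close>

context osc_presentation
begin

lemma nord_perm:
  assumes "mset ps = mset ps'"
  shows "VV ps m M \<approx> VV ps' m M"
proof -
  have s: "(\<Sum>x\<leftarrow>ps. f x) = (\<Sum>x\<leftarrow>ps'. f x)" for f :: "'v \<times> complex \<Rightarrow> 'g falg"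
    using assms by (metis mset_map sum_mset_sum_list)
  have "mset (map fst ps) = mset (map fst ps')" using assms by simp
  then show ?thesis unfolding nord_def s by (intro cg_rmult zm_perm)
qed

lemma sim_mult: "f \<sim> f' \<Longrightarrow> g \<sim> g' \<Longrightarrow> cauchy g' \<Longrightarrow> (\<lambda>n. f n * g n) \<sim> (\<lambda>n. f' n * g' n)"
  using sim_trans[OF sim_lmult[of g g' f] sim_rmult[of f f' g']] .

text \<open>The quadratic relation is bilinear and passes from the four pairs of summands to the
  sum. This needs the same \<beta> for all pairs, while \<alpha> and \<alpha>' may vary.\<close>

lemma exchange_sum:
  assumes "\<And>a b. a \<in> {p, p'} \<Longrightarrow> b \<in> {p, p'} \<Longrightarrow>
      \<exists>\<alpha> \<alpha>'. contr a b (ratio \<alpha> \<beta>) \<and> contr b a (ratio \<alpha>' \<beta>)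
        \<and> q powi ee a b * q powi ee a b = \<alpha>' \<and> q powi ee a b * q powi ee a b * \<alpha> = 1"
    and C: "\<And>m M. C m M = cst d * (VV p m M + VV p' m M)"
  shows "(\<lambda>M. C (m - 1) M * C n M - cst \<beta> * (C m M * C (n - 1) M))
    \<sim> (\<lambda>M. cst \<beta> * (C n M * C (m - 1) M) - C (n - 1) M * C m M)"
proof -
  have ex: "(\<lambda>M. VV a (m - 1) M * VV b n M - cst \<beta> * (VV a m M * VV b (n - 1) M))
      \<sim> (\<lambda>M. cst \<beta> * (VV b n M * VV a (m - 1) M) - VV b (n - 1) M * VV a m M)"
    if "a \<in> {p, p'}" "b \<in> {p, p'}" for a b
    using assms(1)[OF that] exchange[OF _ _ refl] by blast
  let ?S = "\<lambda>m M. VV p m M + VV p' m M"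
  have "(\<lambda>M. ?S (m - 1) M * ?S n M - cst \<beta> * (?S m M * ?S (n - 1) M))
    \<sim> (\<lambda>M. cst \<beta> * (?S n M * ?S (m - 1) M) - ?S (n - 1) M * ?S m M)"
    using sim_add[OF sim_add[OF ex[of p p] ex[of p p']] sim_add[OF ex[of p' p] ex[of p' p']]]
    by (simp add: sim_def algebra_simps)
  then have "(\<lambda>M. cst (d * d) * (?S (m - 1) M * ?S n M - cst \<beta> * (?S m M * ?S (n - 1) M)))
    \<sim> (\<lambda>M. cst (d * d) * (cst \<beta> * (?S n M * ?S (m - 1) M) - ?S (n - 1) M * ?S m M))"
    by (rule sim_lmult)
  moreover have "cst d * x * (cst d * y) = cst (d * d) * (x * y)"
    "cst (d * d) * (cst \<beta> * x) = cst \<beta> * (cst (d * d) * x)" for x y :: "'g falg"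
    by (simp only: mult.assoc cst_comm_assoc[of x] cst_mult) (rule cst_comm_assoc)
  ultimately show ?thesis by (simp only: C right_diff_distrib)
qed

text \<open>Without creators in \<open>ps\<close> only exponents s <= -m count. The reversed product
  has trivial contraction, so the exchange coefficients are those of \<open>c\<close> itself, times
  A^2; the sum stops at j = -m, where the modes of \<open>ps\<close> end.\<close>

lemma reorder_annihilating:
  assumes c: "contr ps ps' c" "contr ps' ps (ratio 1 1)" and A: "A = q powi ee ps ps'"
    and an: "\<forall>k>0. crea ps k \<in> II" and g: "\<And>j. A * A * c j = g j"
  shows "(\<lambda>M. VV ps m M * VV ps' n M)
    \<sim> (\<lambda>M. \<Sum>j\<le>nat (- m). cst (g j) * (VV ps' (n - int j) M * VV ps (m + int j) M))"
proof (rule reorder[OF c A])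
  fix s assume s: "s \<in> {..- m}"
  have "(\<Sum>y\<le>nat (- m). g y * extz (ratio 1 1) (int y - s)) = (\<Sum>y\<le>nat (- m). if y = nat s then (if s \<ge> 0 then g y else 0) else 0)"
    by (intro sum.cong refl) (auto simp: extz_def ratio_one)
  also have "\<dots> = A * A * extz c s"
    using s by (auto simp: extz_def g)
  finally show "A * A * extz c s = (\<Sum>y\<le>nat (- m). g y * extz (ratio 1 1) (int y - s))" by simp
qed (use an in auto)

text \<open>Now the contraction sits in the reversed product, so the exchange coefficients form A^2
  times the inverse power series of \<open>c\<close> instead of \<open>c\<close>.\<close>

lemma reorder_creating:
  assumes c: "contr ps ps' (ratio 1 1)" "contr ps' ps c" and A: "A = q powi ee ps ps'"
    and an: "\<forall>k>0. anni ps k \<in> II" and g: "Abs_fps g * Abs_fps c = fps_const (A * A)"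
  shows "(\<lambda>M. VV ps m M * VV ps' n M)
    \<sim> (\<lambda>M. \<Sum>j\<le>nat m. cst (g j) * (VV ps' (n + int j) M * VV ps (m - int j) M))"
proof -
  have "(\<lambda>M. VV ps m M * VV ps' n M)
    \<sim> (\<lambda>M. \<Sum>j\<le>nat m. cst (g j) * (VV ps' (n - (- int j)) M * VV ps (m + (- int j)) M))"
  proof (rule reorder[OF c A])
    fix s assume s: "s \<in> {- m..}"
    show "A * A * extz (ratio 1 1) s = (\<Sum>y\<le>nat m. g y * extz c (- int y - s))"
    proof (cases "s > 0")
      case True
      then have "extz c (- int y - s) = 0" "extz (ratio 1 1) s = 0" for y
        by (auto simp: extz_def ratio_def)
      then show ?thesis by simp
    next
      case False
      define t where "t = nat (- s)"
      have t: "s = - int t" using False by (simp add: t_def)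
      have "(\<Sum>y\<le>nat m. g y * extz c (- int y - s)) = (\<Sum>y\<le>t. g y * c (t - y))"
        by (rule sum.mono_neutral_cong_right) (use s in \<open>auto simp: t extz_def nat_diff_distrib'\<close>)
      also have "\<dots> = fps_nth (Abs_fps g * Abs_fps c) t" by (simp add: fps_mult_nth atLeast0AtMost)
      also have "\<dots> = A * A * extz (ratio 1 1) s" by (simp add: g t extz_def ratio_one)
      finally show ?thesis by simp
    qed
  qed (use an in auto)
  then show ?thesis by simp
qed

lemma reorder_sum:
  assumes "\<And>a. a \<in> {p, p'} \<Longrightarrow> (\<lambda>M. VV ps m M * VV a n M)
      \<sim> (\<lambda>M. \<Sum>y\<in>B. cst (g y) * (VV a (n - \<tau> y) M * VV ps (m + \<tau> y) M))"
    and C: "\<And>m M. C m M = cst d * (VV p m M + VV p' m M)"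
  shows "(\<lambda>M. VV ps m M * C n M) \<sim> (\<lambda>M. \<Sum>y\<in>B. cst (g y) * (C (n - \<tau> y) M * VV ps (m + \<tau> y) M))"
proof -
  have "(\<lambda>M. cst d * (VV ps m M * VV p n M + VV ps m M * VV p' n M))
    \<sim> (\<lambda>M. cst d * ((\<Sum>y\<in>B. cst (g y) * (VV p (n - \<tau> y) M * VV ps (m + \<tau> y) M))
        + (\<Sum>y\<in>B. cst (g y) * (VV p' (n - \<tau> y) M * VV ps (m + \<tau> y) M))))"
    by (intro sim_lmult sim_add assms(1)) auto
  moreover have "cst d * (VV ps m M * VV p n M + VV ps m M * VV p' n M) = VV ps m M * C n M" for M
    by (simp only: C cst_comm_assoc[of "VV _ _ _"] distrib_left)
  moreover have "cst d * ((\<Sum>y\<in>B. cst (g y) * (VV p (n - \<tau> y) M * VV ps (m + \<tau> y) M))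
        + (\<Sum>y\<in>B. cst (g y) * (VV p' (n - \<tau> y) M * VV ps (m + \<tau> y) M)))
      = (\<Sum>y\<in>B. cst (g y) * (C (n - \<tau> y) M * VV ps (m + \<tau> y) M))" for M
    unfolding C sum.distrib[symmetric] sum_distrib_left
    by (intro sum.cong refl)
      (simp only: mult.assoc distrib_left distrib_right cst_comm_assoc[of "cst d"])
  ultimately show ?thesis by simp
qed

lemma nord_const_annihilating:
  assumes "\<forall>k>0. crea ps k \<in> II"
  shows "VV ps 0 M \<approx> ZZ ps"
proof -
  have "(\<Sum>j\<le>M. ez (crea ps) (0 + int j) * exp_coeff (anni ps) j) \<approx> (\<Sum>j\<le>M. if j = 0 then 1 else 0)"
  proof (intro cg_sum)
    fix j show "ez (crea ps) (0 + int j) * exp_coeff (anni ps) j \<approx> (if j = 0 then 1 else 0)"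
      using assms exp_coeff_II[of "crea ps" j]
      by (auto simp: ez_nat cg_0_iff intro: rel_ideal_rmult)
  qed
  then show ?thesis unfolding nord_def osc_exp_eq using cg_lmult[of _ 1 "ZZ ps"] by simp
qed

lemma nord_const_creating:
  assumes "\<forall>k>0. anni ps k \<in> II"
  shows "VV ps 0 M \<approx> ZZ ps"
proof -
  have "(\<Sum>j\<le>M. ez (crea ps) (0 + int j) * exp_coeff (anni ps) j) \<approx> (\<Sum>j\<le>M. if j = 0 then 1 else 0)"
  proof (intro cg_sum)
    fix j show "ez (crea ps) (0 + int j) * exp_coeff (anni ps) j \<approx> (if j = 0 then 1 else 0)"
      using assms exp_coeff_II[of "anni ps" j]
      by (auto simp: ez_def cg_0_iff intro: rel_ideal_lmult)
  qed
  then show ?thesis unfolding nord_def osc_exp_eq using cg_lmult[of _ 1 "ZZ ps"] by simp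
qed

end

section \<open>The free field currents at q^k = h^2\<close>

locale qi_level = qi_presentation rels nbh q q1 q2 q3 emb
  for rels :: "'g falg set" and nbh q q1 q2 q3 and emb :: "vertex aq_gen \<Rightarrow> 'g falg" +
  fixes h :: complex
  assumes h: "h \<noteq> 0" and level: "q3 = q ^ 2 * h ^ 4" and q_sq: "q ^ 2 \<noteq> 1"
    and central_osc: "central_osc_rels q2 q3 emb \<subseteq> rels"
    and central_zm: "central_zero_mode q (QI q1 q2 q3) emb - 1 \<in> rels"
begin

text \<open>The central oscillator relations say that Psi[P_-] has no creators and Psi[P_+] no
  annihilators; here and in \<open>anni_pm\<close> they are rescaled to the argument u z.\<close>

lemma crea_pp: "u \<noteq> 0 \<Longrightarrow> \<forall>k>0. crea (pp u) k \<in> II"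
proof (intro allI impI)
  fix k :: nat assume u: "u \<noteq> 0" and k: "k > 0"
  have "emb (Osc V3 (- int k)) + emb (Osc V2 (- int k)) + cst (q2 powi (- int k)) * emb (Osc V0 (- int k)) \<in> II"
    using central_osc k unfolding central_osc_rels_def by (intro rel_idealI) (auto intro!: exI[of _ "int k"])
  then have "cst (u ^ k) * (emb (Osc V3 (- int k)) + emb (Osc V2 (- int k)) + cst (q2 powi (- int k)) * emb (Osc V0 (- int k))) \<in> II"
    by (rule rel_ideal_lmult)
  then show "crea (pp u) k \<in> II"
    by (simp add: distrib_left cst_cst add.assoc power_int_minus divide_inverse power_mult_distrib power_inverse)
qed

lemma anni_pm: "u \<noteq> 0 \<Longrightarrow> \<forall>k>0. anni (pm u) k \<in> II"
proof (intro allI impI)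
  fix k :: nat assume u: "u \<noteq> 0" and k: "k > 0"
  have "emb (Osc V0 (int k)) + emb (Osc V1 (int k)) + cst (q3 powi (- int k)) * emb (Osc V3 (int k)) \<in> II"
    using central_osc k unfolding central_osc_rels_def by (intro rel_idealI) (auto intro!: exI[of _ "int k"])
  then have "cst (1 / u ^ k) * (emb (Osc V0 (int k)) + emb (Osc V1 (int k)) + cst (q3 powi (- int k)) * emb (Osc V3 (int k))) \<in> II"
    by (rule rel_ideal_lmult)
  then show "anni (pm u) k \<in> II"
    by (simp add: distrib_left cst_cst add.assoc power_mult_distrib power_int_minus divide_inverse mult.commute)
qed

text \<open>The rescalings q^(2+k), q^(2+k/2) and q^(-k/2) of the free field currents are absorbed
  into the arguments of the vertex operators, with h = q^(k/2).\<close>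

definition cE :: "int \<Rightarrow> nat \<Rightarrow> 'g falg" where
  "cE m M = cst (1 / (q - 1 / q)) * (VV (e0 1) m M + VV (e1 1) m M)"
definition cF :: "int \<Rightarrow> nat \<Rightarrow> 'g falg" where
  "cF m M = - (cst (1 / (q - 1 / q)) * (VV (f0 (q ^ 2 * h ^ 2)) m M + VV (f1 (q ^ 2 * h ^ 2)) m M))"
definition cP :: "int \<Rightarrow> nat \<Rightarrow> 'g falg" where "cP = VV (pp (q ^ 2 * h))"
definition cM :: "int \<Rightarrow> nat \<Rightarrow> 'g falg" where "cM = VV (pm (1 / h))"

lemma cauchy_currents: "cauchy (cE m)" "cauchy (cF m)" "cauchy (cP m)" "cauchy (cM m)"
  unfolding cE_def[abs_def] cF_def[abs_def] cP_def cM_def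
  by (intro cauchy_uminus cauchy_mult cauchy_add cauchy_const cauchy_nord)+

lemma ee_EE: "ee (e0 u) (e0 v) = 0" "ee (e0 u) (e1 v) = 1" "ee (e1 u) (e0 v) = - 1" "ee (e1 u) (e1 v) = 0"
  "ee (f0 u) (f0 v) = 0" "ee (f0 u) (f1 v) = 1" "ee (f1 u) (f0 v) = - 1" "ee (f1 u) (f1 v) = 0"
  "ee (e0 u) (f0 v) = 0" "ee (e0 u) (f1 v) = - 1" "ee (e1 u) (f0 v) = 1" "ee (e1 u) (f1 v) = 0"
  "ee (pp u) (e0 v) = 1" "ee (pp u) (e1 v) = 1" "ee (pp u) (f0 v) = - 1" "ee (pp u) (f1 v) = - 1"
  "ee (pm u) (e0 v) = - 1" "ee (pm u) (e1 v) = - 1" "ee (pm u) (f0 v) = 1" "ee (pm u) (f1 v) = 1"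
  "ee (pp u) (pp v) = 0" "ee (pm u) (pm v) = 0" "ee (pp u) (pm v) = 0"
  by (simp_all add: eps_QI)

lemma contr_cong: "contr ps ps' (ratio \<alpha> \<beta>) \<Longrightarrow> \<alpha> = \<alpha>' \<Longrightarrow> \<beta> = \<beta>' \<Longrightarrow> contr ps ps' (ratio \<alpha>' \<beta>')"
  by simp

lemma rel_EE: "(\<lambda>M. cE (m - 1) M * cE n M - cst (q ^ 2) * (cE m M * cE (n - 1) M))
    \<sim> (\<lambda>M. cst (q ^ 2) * (cE n M * cE (m - 1) M) - cE (n - 1) M * cE m M)"
proof (rule exchange_sum)
  note ct = contr_EE[of 1 1, simplified]
  fix a b :: "(vertex \<times> complex) list" assume "a \<in> {e0 1, e1 1}" "b \<in> {e0 1, e1 1}"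
  then show "\<exists>\<alpha> \<alpha>'. contr a b (ratio \<alpha> (q ^ 2)) \<and> contr b a (ratio \<alpha>' (q ^ 2))
      \<and> q powi ee a b * q powi ee a b = \<alpha>' \<and> q powi ee a b * q powi ee a b * \<alpha> = 1"
    using q_nz by (elim insertE emptyE; simp only: ee_EE)
      (rule exI conjI ct | simp add: power_int_minus field_simps power2_eq_square)+
qed (rule cE_def)

lemma rel_FF: "(\<lambda>M. cF (m - 1) M * cF n M - cst (1 / q ^ 2) * (cF m M * cF (n - 1) M))
    \<sim> (\<lambda>M. cst (1 / q ^ 2) * (cF n M * cF (m - 1) M) - cF (n - 1) M * cF m M)"
proof (rule exchange_sum)
  let ?r = "q ^ 2 * h ^ 2"
  have r: "?r \<noteq> 0" using q_nz h by simp
  have ct: "contr (f0 ?r) (f0 ?r) (ratio 1 (1 / q ^ 2))"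
    "contr (f0 ?r) (f1 ?r) (ratio (1 / q ^ 2) (1 / q ^ 2))"
    "contr (f1 ?r) (f0 ?r) (ratio (q ^ 2) (1 / q ^ 2))"
    "contr (f1 ?r) (f1 ?r) (ratio 1 (1 / q ^ 2))"
    by (rule contr_cong[OF contr_FF(1)[OF r r]] contr_cong[OF contr_FF(2)[OF r r]]
        contr_cong[OF contr_FF(3)[OF r r]] contr_cong[OF contr_FF(4)[OF r r]];
        use r in \<open>simp add: field_simps power2_eq_square power4_eq_xxxx\<close>)+
  fix a b :: "(vertex \<times> complex) list" assume "a \<in> {f0 ?r, f1 ?r}" "b \<in> {f0 ?r, f1 ?r}"
  then show "\<exists>\<alpha> \<alpha>'. contr a b (ratio \<alpha> (1 / q ^ 2)) \<and> contr b a (ratio \<alpha>' (1 / q ^ 2))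
      \<and> q powi ee a b * q powi ee a b = \<alpha>' \<and> q powi ee a b * q powi ee a b * \<alpha> = 1"
    using q_nz by (elim insertE emptyE; simp only: ee_EE)
      (rule exI conjI ct | simp add: power_int_minus field_simps power2_eq_square)+
next
  show "cF m M = cst (- (1 / (q - 1 / q))) * (VV (f0 (q ^ 2 * h ^ 2)) m M + VV (f1 (q ^ 2 * h ^ 2)) m M)" for m M
    by (simp only: cF_def cst_uminus minus_mult_left)
qed

text \<open>The pairs \<open>e0\<close>, \<open>f0\<close> and \<open>e1\<close>, \<open>f1\<close>
  commute. Each mixed pair gives a delta function, at z = h^2 w for \<open>e0\<close> with
  \<open>f1\<close> and at z = w/h^2 for \<open>e1\<close> with \<open>f0\<close>, and there its
  three vertex factors form a complete path.\<close>

lemma rel_EF: "(\<lambda>M. cst (q - 1 / q) * (cE m M * cF n M - cF n M * cE m M))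
    \<sim> (\<lambda>M. cst (h powi (- 2 * m) * h powi (m + n)) * cP (m + n) M
        - cst (h powi (2 * m) * h powi (- (m + n))) * cM (m + n) M)"
proof -
  let ?r = "q ^ 2 * h ^ 2" and ?dd = "q - 1 / q"
  have r: "?r \<noteq> 0" using q_nz h by simp
  have dd: "?dd \<noteq> 0" using q_sq q_nz by (auto simp: field_simps power2_eq_square)
  let ?br = "\<lambda>a b M. VV a m M * VV b n M - VV b n M * VV a m M"
  have z: "?br (e0 1) (f0 ?r) \<sim> (\<lambda>M. 0)" "?br (e1 1) (f1 ?r) \<sim> (\<lambda>M. 0)"
    using commutator[of "e0 1" "f0 ?r" 1 1 1 m n] commutator[of "e1 1" "f1 ?r" 1 1 1 m n]
      contr_EF(1,4)[of 1 ?r] contr_FE(1,4)[of ?r 1] r by (simp_all add: eps_QI)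
  have p: "?br (e0 1) (f1 ?r) \<sim> (\<lambda>M. - (cst (?dd * (h powi (- 2 * m) * h powi (m + n))) * cP (m + n) M))"
  proof -
    have "?br (e0 1) (f1 ?r) \<sim> (\<lambda>M. cst ((1 / q - 1 / (1 / q)) * (h ^ 2) powi (- m)) *
        VV (map (\<lambda>(i, u). (i, h ^ 2 * u)) (e0 1) @ f1 ?r) (m + n) M)"
    proof (rule commutator)
      show "contr (e0 1) (f1 ?r) (ratio ?r (h ^ 2))" "contr (f1 ?r) (e0 1) (ratio (1 / ?r) (1 / h ^ 2))"
        using r q_nz h
        by (auto intro!: contr_cong[OF contr_EF(2)] contr_cong[OF contr_FE(2)] simp: field_simps)
    qed (use q_nz h in \<open>simp_all add: eps_QI field_simps power2_eq_square\<close>)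
    also have "\<dots> \<sim> (\<lambda>M. cst ((1 / q - 1 / (1 / q)) * (h ^ 2) powi (- m)) *
        rescale h (VV (pp (q ^ 2 * h))) (m + n) M)"
    proof (intro sim_lmult sim_I)
      fix M
      \<comment> \<open>At z = h^2 w the arguments are q^2 h^2 for the vertices 3, 2 and h^2 for 0:
        the path P_- at h times the argument stored in \<open>cP\<close>. The vertices come in
        another order, hence \<open>nord_perm\<close>.\<close>
      have "h * (q ^ 2 * h) = ?r" "h * (q ^ 2 * h / q2) = h ^ 2"
        using q_nz by (simp_all add: q2 power2_eq_square)
      then show "VV (map (\<lambda>(i, u). (i, h ^ 2 * u)) (e0 1) @ f1 ?r) (m + n) M
          \<approx> rescale h (VV (pp (q ^ 2 * h))) (m + n) M"
        unfolding rescale_nord[OF h]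
        by (intro nord_perm) (simp only: list.map prod.case append.simps mult_1_right mset.simps add_mset_commute)
    qed
    also have "\<dots> = (\<lambda>M. - (cst (?dd * (h powi (- 2 * m) * h powi (m + n))) * cP (m + n) M))"
    proof
      fix M
      \<comment> \<open>Here A = 1/q, so A - 1/A is the negative of q - 1/q; together with the sign
        in the definition of F the psi^+ term becomes positive.\<close>
      have "(1 / q - 1 / (1 / q)) * (h ^ 2) powi (- m) = - (?dd * h powi (- 2 * m))"
        using power_int_mult[of h 2 "- m"] by (simp add: algebra_simps)
      then show "cst ((1 / q - 1 / (1 / q)) * (h ^ 2) powi (- m)) * rescale h (VV (pp (q ^ 2 * h))) (m + n) M
        = - (cst (?dd * (h powi (- 2 * m) * h powi (m + n))) * cP (m + n) M)"
        by (simp only: rescale_def cP_def cst_cst minus_mult_left cst_uminus[symmetric] mult.assoc)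
    qed
    finally show ?thesis .
  qed
  have k: "?br (e1 1) (f0 ?r) \<sim> (\<lambda>M. cst (?dd * (h powi (2 * m) * h powi (- (m + n)))) * cM (m + n) M)"
  proof -
    have "?br (e1 1) (f0 ?r) \<sim> (\<lambda>M. cst ((q - 1 / q) * (1 / h ^ 2) powi (- m)) *
        VV (map (\<lambda>(i, u). (i, 1 / h ^ 2 * u)) (e1 1) @ f0 ?r) (m + n) M)"
    proof (rule commutator)
      \<comment> \<open>The pole lies at q^2 h^2 / q3, and the level q3 = q^2 h^4 turns this into
        1/h^2, as delta(q^k z/w) requires.\<close>
      show "contr (e1 1) (f0 ?r) (ratio (1 / (q ^ 2 * h ^ 2)) (1 / h ^ 2))"
        "contr (f0 ?r) (e1 1) (ratio (1 / (1 / (q ^ 2 * h ^ 2))) (1 / (1 / h ^ 2)))"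
        by (rule contr_cong[OF contr_EF(3)[OF _ r]] contr_cong[OF contr_FE(3)[OF r]];
            use r q_nz h in \<open>simp add: field_simps level power2_eq_square power4_eq_xxxx\<close>)+
    qed (use q_nz h in \<open>simp_all add: eps_QI field_simps power2_eq_square\<close>)
    also have "\<dots> = (\<lambda>M. cst ((q - 1 / q) * (1 / h ^ 2) powi (- m)) *
        rescale (1 / h) (VV (pm (1 / h))) (m + n) M)"
    proof -
      have "map (\<lambda>(i, u). (i, 1 / h * u)) (pm (1 / h)) = map (\<lambda>(i, u). (i, 1 / h ^ 2 * u)) (e1 1) @ f0 ?r"
        using h by (simp add: level power2_eq_square power4_eq_xxxx)
      moreover have nz: "1 / h \<noteq> 0" using h by simp
      ultimately show ?thesis unfolding rescale_nord[OF nz] by presburger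
    qed
    also have "\<dots> = (\<lambda>M. cst (?dd * (h powi (2 * m) * h powi (- (m + n)))) * cM (m + n) M)"
    proof
      fix M
      have inv: "(1 / x) powi k = x powi (- k)" for x :: complex and k
        by (simp only: inverse_eq_divide[symmetric] power_int_inverse power_int_minus)
      have "(1 / h ^ 2) powi (- m) = h powi (2 * m)" "(1 / h) powi (m + n) = h powi (- (m + n))"
        unfolding inv using power_int_mult[of h 2 m] by simp_all
      then show "cst ((q - 1 / q) * (1 / h ^ 2) powi (- m)) * rescale (1 / h) (VV (pm (1 / h))) (m + n) M
        = cst (?dd * (h powi (2 * m) * h powi (- (m + n)))) * cM (m + n) M"
        by (simp only: rescale_def cM_def cst_cst mult.assoc)
    qed
    finally show ?thesis .
  qed
  have "(\<lambda>M. cst (q - 1 / q) * (cE m M * cF n M - cF n M * cE m M))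
      = (\<lambda>M. cst (- (1 / ?dd)) * ((?br (e0 1) (f0 ?r) M + ?br (e1 1) (f1 ?r) M)
          + (?br (e0 1) (f1 ?r) M + ?br (e1 1) (f0 ?r) M)))"
  proof
    fix M
    let ?S = "VV (e0 1) m M + VV (e1 1) m M" and ?T = "VV (f0 ?r) n M + VV (f1 ?r) n M"
    have 1: "cst a * x * (- (cst a * y)) = - (cst (a * a) * (x * y))"
      "- (cst a * x) * (cst a * y) = - (cst (a * a) * (x * y))" for a and x y :: "'g falg"
      by (simp_all only: mult.assoc cst_comm_assoc[of x] cst_mult mult_minus_left mult_minus_right)
    have "cst (q - 1 / q) * (cE m M * cF n M - cF n M * cE m M)
        = cst (- (?dd * (1 / ?dd * (1 / ?dd)))) * (?S * ?T - ?T * ?S)"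
      unfolding cE_def cF_def 1
      by (simp only: cst_uminus cst_mult right_diff_distrib mult.assoc mult_minus_left mult_minus_right)
    also have "- (?dd * (1 / ?dd * (1 / ?dd))) = - (1 / ?dd)" using dd by simp
    also have "?S * ?T - ?T * ?S = (?br (e0 1) (f0 ?r) M + ?br (e1 1) (f1 ?r) M)
          + (?br (e0 1) (f1 ?r) M + ?br (e1 1) (f0 ?r) M)"
      by (simp only: distrib_left distrib_right) simp
    finally show "cst (q - 1 / q) * (cE m M * cF n M - cF n M * cE m M)
      = cst (- (1 / ?dd)) * ((?br (e0 1) (f0 ?r) M + ?br (e1 1) (f1 ?r) M)
          + (?br (e0 1) (f1 ?r) M + ?br (e1 1) (f0 ?r) M))" .
  qed
  also have "\<dots> \<sim> (\<lambda>M. cst (- (1 / ?dd)) * ((0 + 0)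
          + (- (cst (?dd * (h powi (- 2 * m) * h powi (m + n))) * cP (m + n) M)
            + cst (?dd * (h powi (2 * m) * h powi (- (m + n)))) * cM (m + n) M)))"
    by (intro sim_lmult sim_add z p k)
  also have "\<dots> = (\<lambda>M. cst (h powi (- 2 * m) * h powi (m + n)) * cP (m + n) M
        - cst (h powi (2 * m) * h powi (- (m + n))) * cM (m + n) M)"
  proof
    fix M
    have 1: "cst (- (1 / ?dd)) * (cst (?dd * a) * x) = - (cst a * x)" for a and x :: "'g falg"
      using dd by (simp add: cst_cst cst_uminus)
    show "cst (- (1 / ?dd)) * ((0 + 0)
          + (- (cst (?dd * (h powi (- 2 * m) * h powi (m + n))) * cP (m + n) M)
            + cst (?dd * (h powi (2 * m) * h powi (- (m + n)))) * cM (m + n) M))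
      = cst (h powi (- 2 * m) * h powi (m + n)) * cP (m + n) M
        - cst (h powi (2 * m) * h powi (- (m + n))) * cM (m + n) M"
      unfolding distrib_left mult_minus_right 1 by simp
  qed
  finally show ?thesis .
qed

lemma gP_scale: "gP q j * t ^ j = q ^ 2 * ratio (t / q ^ 2) (t * q ^ 2) j"
  and gN_scale: "gN q j * t ^ j = 1 / q ^ 2 * ratio (t * q ^ 2) (t / q ^ 2) j"
  using ratio_scale[of t j "1 / q ^ 2" "q ^ 2"] ratio_scale[of t j "q ^ 2" "1 / q ^ 2"]
  by (simp_all add: gP_def gN_def mult.assoc mult.commute mult.left_commute)

text \<open>With u = q^2 h the parameters 1/u and q^4/u of the contraction are q^(-2)/h and q^2/h,
  those of G at infinity with argument rescaled by q^(k/2); the zero modes give A^2 = q^2, the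
  leading coefficient of G. The next three relations match in the same way.\<close>

lemma rel_PE: "(\<lambda>M. cP m M * cE n M) \<sim> (\<lambda>M. \<Sum>j\<le>nat (- m).
    cst (gP q j * (1 / h) ^ j) * (cE (n - int j) M * cP (m + int j) M))"
  unfolding cP_def
proof (rule reorder_sum[OF _ cE_def])
  fix a :: "(vertex \<times> complex) list" assume a: "a \<in> {e0 1, e1 1}"
  let ?u = "q ^ 2 * h"
  have u: "?u \<noteq> 0" using q_nz h by simp
  show "(\<lambda>M. VV (pp ?u) m M * VV a n M) \<sim> (\<lambda>M. \<Sum>j\<le>nat (- m).
      cst (gP q j * (1 / h) ^ j) * (VV a (n - int j) M * VV (pp ?u) (m + int j) M))"
  proof (rule reorder_annihilating)
    show "contr (pp ?u) a (ratio (1 / ?u) (q ^ 4 * 1 / ?u))" "contr a (pp ?u) (ratio 1 1)"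
      "q = q powi ee (pp ?u) a"
      using a contr_pp(1,3)[OF u, of 1] contr_pp(2,4)[OF _ u, of 1] by (auto simp: eps_QI inverse_eq_divide)
    show "q * q * ratio (1 / ?u) (q ^ 4 * 1 / ?u) j = gP q j * (1 / h) ^ j" for j
      unfolding gP_scale using q_nz h by (simp add: power2_eq_square power4_eq_xxxx field_simps)
  qed (rule crea_pp[OF u])
qed

lemma rel_PF: "(\<lambda>M. cP m M * cF n M) \<sim> (\<lambda>M. \<Sum>j\<le>nat (- m).
    cst (gN q j * h ^ j) * (cF (n - int j) M * cP (m + int j) M))"
  unfolding cP_def
proof (rule reorder_sum)
  show "cF m M = cst (- (1 / (q - 1 / q))) * (VV (f0 (q ^ 2 * h ^ 2)) m M + VV (f1 (q ^ 2 * h ^ 2)) m M)" for m M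
    by (simp only: cF_def cst_uminus minus_mult_left)
  let ?u = "q ^ 2 * h" and ?r = "q ^ 2 * h ^ 2"
  fix a :: "(vertex \<times> complex) list" assume a: "a \<in> {f0 ?r, f1 ?r}"
  have u: "?u \<noteq> 0" and r: "?r \<noteq> 0" using q_nz h by auto
  show "(\<lambda>M. VV (pp ?u) m M * VV a n M) \<sim> (\<lambda>M. \<Sum>j\<le>nat (- m).
      cst (gN q j * h ^ j) * (VV a (n - int j) M * VV (pp ?u) (m + int j) M))"
  proof (rule reorder_annihilating)
    show "contr (pp ?u) a (ratio (q ^ 2 * ?r / ?u) (?r / (q ^ 2 * ?u)))" "contr a (pp ?u) (ratio 1 1)"
      "1 / q = q powi ee (pp ?u) a"
      using a contr_pp(5,7)[OF u r] contr_pp(6,8)[OF r u] by (auto simp: eps_QI inverse_eq_divide)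
    show "1 / q * (1 / q) * ratio (q ^ 2 * ?r / ?u) (?r / (q ^ 2 * ?u)) j = gN q j * h ^ j" for j
      unfolding gN_scale using q_nz h by (simp add: power2_eq_square field_simps)
  qed (rule crea_pp[OF u])
qed

lemma rel_ME: "(\<lambda>M. cM m M * cE n M) \<sim> (\<lambda>M. \<Sum>j\<le>nat m.
    cst (gN q j * (1 / h) ^ j) * (cE (n + int j) M * cM (m - int j) M))"
proof -
  let ?u = "1 / h"
  have u: "?u \<noteq> 0" using h by simp
  have "(\<lambda>M. cM m M * cE n M) \<sim> (\<lambda>M. \<Sum>j\<le>nat m.
      cst (gN q j * (1 / h) ^ j) * (cE (n - (- int j)) M * cM (m + (- int j)) M))"
    unfolding cM_def
  proof (rule reorder_sum[OF _ cE_def])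
    fix a :: "(vertex \<times> complex) list" assume a: "a \<in> {e0 1, e1 1}"
    have "(\<lambda>M. VV (pm ?u) m M * VV a n M) \<sim> (\<lambda>M. \<Sum>j\<le>nat m.
        cst (gN q j * (1 / h) ^ j) * (VV a (n + int j) M * VV (pm ?u) (m - int j) M))"
    proof (rule reorder_creating)
      show "contr (pm ?u) a (ratio 1 1)" "contr a (pm ?u) (ratio (?u / q ^ 2) (?u * q ^ 2))"
        "1 / q = q powi ee (pm ?u) a"
        using a contr_pm(1,3)[OF u, of 1] contr_pm(2,4)[OF _ u, of 1] by (auto simp: eps_QI inverse_eq_divide mult.commute)
      have "Abs_fps (\<lambda>j. gN q j * ?u ^ j) = fps_const (1 / q ^ 2) * Abs_fps (ratio (?u * q ^ 2) (?u / q ^ 2))"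
        by (rule fps_ext) (simp add: gN_scale)
      then show "Abs_fps (\<lambda>j. gN q j * ?u ^ j) * Abs_fps (ratio (?u / q ^ 2) (?u * q ^ 2)) = fps_const (1 / q * (1 / q))"
        by (simp only: mult.assoc ratio_inverse) (simp add: power2_eq_square)
    qed (rule anni_pm[OF u])
    then show "(\<lambda>M. VV (pm ?u) m M * VV a n M) \<sim> (\<lambda>M. \<Sum>j\<le>nat m.
        cst (gN q j * (1 / h) ^ j) * (VV a (n - - int j) M * VV (pm ?u) (m + - int j) M))"
      by simp
  qed
  then show ?thesis by simp
qed

lemma rel_MF: "(\<lambda>M. cM m M * cF n M) \<sim> (\<lambda>M. \<Sum>j\<le>nat m.
    cst (gP q j * h ^ j) * (cF (n + int j) M * cM (m - int j) M))"
proof -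
  let ?u = "1 / h" and ?r = "q ^ 2 * h ^ 2"
  have u: "?u \<noteq> 0" and r: "?r \<noteq> 0" using q_nz h by auto
  have "(\<lambda>M. cM m M * cF n M) \<sim> (\<lambda>M. \<Sum>j\<le>nat m.
      cst (gP q j * h ^ j) * (cF (n - (- int j)) M * cM (m + (- int j)) M))"
    unfolding cM_def
  proof (rule reorder_sum)
    show "cF m M = cst (- (1 / (q - 1 / q))) * (VV (f0 ?r) m M + VV (f1 ?r) m M)" for m M
      by (simp only: cF_def cst_uminus minus_mult_left)
    fix a :: "(vertex \<times> complex) list" assume a: "a \<in> {f0 ?r, f1 ?r}"
    have "(\<lambda>M. VV (pm ?u) m M * VV a n M) \<sim> (\<lambda>M. \<Sum>j\<le>nat m.
        cst (gP q j * h ^ j) * (VV a (n + int j) M * VV (pm ?u) (m - int j) M))"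
    proof (rule reorder_creating)
      have e: "q ^ 2 * q3 * ?u / ?r = h * q ^ 2" "q3 * ?u / (q ^ 2 * ?r) = h / q ^ 2"
        using q_nz h by (simp_all add: level power2_eq_square power4_eq_xxxx field_simps)
      show "contr (pm ?u) a (ratio 1 1)" "contr a (pm ?u) (ratio (h * q ^ 2) (h / q ^ 2))"
        "q = q powi ee (pm ?u) a"
        using a contr_pm(5,7)[OF u r] contr_pm(6,8)[OF r u, unfolded e] by (auto simp: eps_QI inverse_eq_divide)
      have "Abs_fps (\<lambda>j. gP q j * h ^ j) = fps_const (q ^ 2) * Abs_fps (ratio (h / q ^ 2) (h * q ^ 2))"
        by (rule fps_ext) (simp add: gP_scale)
      then show "Abs_fps (\<lambda>j. gP q j * h ^ j) * Abs_fps (ratio (h * q ^ 2) (h / q ^ 2)) = fps_const (q * q)"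
        by (simp only: mult.assoc ratio_inverse) (simp add: power2_eq_square)
    qed (rule anni_pm[OF u])
    then show "(\<lambda>M. VV (pm ?u) m M * VV a n M) \<sim> (\<lambda>M. \<Sum>j\<le>nat m.
        cst (gP q j * h ^ j) * (VV a (n - - int j) M * VV (pm ?u) (m + - int j) M))"
      by simp
  qed
  then show ?thesis by simp
qed

lemma rel_PP: "(\<lambda>M. cP m M * cP n M) \<sim> (\<lambda>M. cP n M * cP m M)"
proof -
  have u: "q ^ 2 * h \<noteq> 0" using q_nz h by simp
  from commutator[of "pp (q ^ 2 * h)" "pp (q ^ 2 * h)" 1 1 1 m n] contr_pp(9)[OF u u]
  show ?thesis unfolding cP_def by (simp add: eps_QI) (simp add: sim_def)
qed

lemma rel_MM: "(\<lambda>M. cM m M * cM n M) \<sim> (\<lambda>M. cM n M * cM m M)"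
proof -
  have u: "1 / h \<noteq> 0" using h by simp
  from commutator[of "pm (1 / h)" "pm (1 / h)" 1 1 1 m n] contr_pm(9)[OF u u]
  show ?thesis unfolding cM_def by (simp add: eps_QI) (simp add: sim_def)
qed

text \<open>The contraction factors into two series of G type, so reordering produces a double sum.
  It may be cut at n in both indices because psi^- has no modes of negative power.\<close>

lemma rel_PM: "(\<lambda>M. cP m M * cM n M) \<sim> (\<lambda>M. \<Sum>(i, j)\<in>{..nat n} \<times> {..nat n}.
    cst (gP q i * (1 / h ^ 2) ^ i * (gN q j * (h ^ 2) ^ j))
      * (cM (n - int i - int j) M * cP (m + int i + int j) M))"
proof -
  let ?u = "q ^ 2 * h" and ?v = "1 / h"
  have u: "?u \<noteq> 0" and v: "?v \<noteq> 0" using q_nz h by auto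
  let ?g = "\<lambda>(i, j). gP q i * (1 / h ^ 2) ^ i * (gN q j * (h ^ 2) ^ j)"
  let ?a = "Abs_fps (\<lambda>i. gP q i * (1 / h ^ 2) ^ i)" and ?b = "Abs_fps (\<lambda>j. gN q j * (h ^ 2) ^ j)"
  have ab: "?a = fps_const (q ^ 2) * Abs_fps (ratio (?v / ?u) (q ^ 4 * ?v / ?u))"
    "?b = fps_const (1 / q ^ 2) * Abs_fps (ratio (q ^ 2 * q3 * ?v / ?u) (q3 * ?v / (q ^ 2 * ?u)))"
  proof -
    have e: "?v / ?u = 1 / h ^ 2 / q ^ 2" "q ^ 4 * ?v / ?u = 1 / h ^ 2 * q ^ 2"
      "q ^ 2 * q3 * ?v / ?u = h ^ 2 * q ^ 2" "q3 * ?v / (q ^ 2 * ?u) = h ^ 2 / q ^ 2"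
      using q_nz h by (simp_all add: level power2_eq_square power4_eq_xxxx field_simps)
    show "?a = fps_const (q ^ 2) * Abs_fps (ratio (?v / ?u) (q ^ 4 * ?v / ?u))"
      "?b = fps_const (1 / q ^ 2) * Abs_fps (ratio (q ^ 2 * q3 * ?v / ?u) (q3 * ?v / (q ^ 2 * ?u)))"
      unfolding e by (rule fps_ext, simp only: fps_nth_Abs_fps gP_scale gN_scale fps_mult_left_const_nth)+
  qed
  have c: "contr (pp ?u) (pm ?v) (fps_nth (?a * ?b))"
  proof -
    have "?a * ?b = fps_const (q ^ 2 * (1 / q ^ 2)) * (Abs_fps (ratio (?v / ?u) (q ^ 4 * ?v / ?u))
        * Abs_fps (ratio (q ^ 2 * q3 * ?v / ?u) (q3 * ?v / (q ^ 2 * ?u))))"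
      unfolding ab fps_const_mult[symmetric] by (simp only: ac_simps)
    then show ?thesis using contr_pp_pm[OF u v] q_nz by simp
  qed
  have "(\<lambda>M. VV (pp ?u) m M * VV (pm ?v) n M) \<sim> (\<lambda>M. \<Sum>y\<in>{..nat n} \<times> {..nat n}.
    cst (?g y) * (VV (pm ?v) (n - (int (fst y) + int (snd y))) M * VV (pp ?u) (m + (int (fst y) + int (snd y))) M))"
  proof (rule reorder[OF c contr_pm(10)[OF v u]])
    show "1 = q powi ee (pp ?u) (pm ?v)" by (simp add: eps_QI)
    show "(\<forall>k>0. crea (pp ?u) k \<in> II) \<and> {..n} = {..- m} \<or> (\<forall>k>0. anni (pp ?u) k \<in> II) \<and> {..n} = {- m..}
      \<or> (\<forall>k>0. anni (pm ?v) k \<in> II) \<and> {..n} = {..n}" using anni_pm[OF v] by blast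
    fix s assume s: "s \<in> {..n}"
    show "1 * 1 * extz (fps_nth (?a * ?b)) s
        = (\<Sum>y\<in>{..nat n} \<times> {..nat n}. ?g y * extz (ratio 1 1) (int (fst y) + int (snd y) - s))"
    proof (cases "s \<ge> 0")
      case True
      then obtain t where t: "s = int t" using nonneg_int_cases by blast
      \<comment> \<open>The reversed product has trivial contraction, so only the pairs with i + j =
        t contribute; as t <= n they all lie in the square.\<close>
      have "(\<Sum>y\<in>{..nat n} \<times> {..nat n}. ?g y * extz (ratio 1 1) (int (fst y) + int (snd y) - s))
          = (\<Sum>y\<in>(\<lambda>i. (i, t - i)) ` {..t}. ?g y)"
        using s by (intro sum.mono_neutral_cong_right) (auto simp: t extz_def ratio_one image_iff)
      also have "\<dots> = (\<Sum>i\<le>t. ?g (i, t - i))" by (subst sum.reindex) (auto simp: inj_on_def)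
      also have "\<dots> = fps_nth (?a * ?b) t" by (simp add: fps_mult_nth atLeast0AtMost)
      finally show ?thesis by (simp add: t extz_def)
    next
      case False
      have "extz (ratio 1 1) (int i + int j - s) = 0" for i j
        using False by (auto simp: extz_def ratio_one)
      then show ?thesis using False by (simp add: extz_def)
    qed
  qed
  then show ?thesis
    unfolding cP_def cM_def by (simp only: case_prod_unfold diff_diff_eq add.assoc)
qed

text \<open>The constant terms of the one-sided currents are their zero modes. Epsilon between the
  two vertex lists sums to 0, so in either order the product is :X_0^2 X_1 X_2 X_3^2: without a
  power of q.\<close>

lemma rel_const: "(\<lambda>M. cP 0 M * cM 0 M) \<sim> (\<lambda>M. 1)" "(\<lambda>M. cM 0 M * cP 0 M) \<sim> (\<lambda>M. 1)"
proof -
  let ?p = "pp (q ^ 2 * h)" and ?m = "pm (1 / h)"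
  have P: "cP 0 M \<approx> ZZ ?p" for M
    unfolding cP_def by (intro nord_const_annihilating crea_pp) (use q_nz h in simp)
  have M: "cM 0 M \<approx> ZZ ?m" for M
    unfolding cM_def by (intro nord_const_creating anni_pm) (use h in simp)
  have one: "zm [V0, V0, V1, V2, V3, V3] \<approx> 1"
    using central_zm by (intro cg_rel) (simp add: central_zero_mode_def)
  have "ZZ ?p * ZZ ?m = zm (map fst ?p @ map fst ?m)"
    unfolding zm_mult by (simp add: eps_QI)
  also have "\<dots> \<approx> zm [V0, V0, V1, V2, V3, V3]" by (rule zm_perm) simp
  finally have 1: "ZZ ?p * ZZ ?m \<approx> 1" using cg_trans[OF _ one] by blast
  have "ZZ ?m * ZZ ?p = zm (map fst ?m @ map fst ?p)"
    unfolding zm_mult by (simp add: eps_QI)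
  also have "\<dots> \<approx> zm [V0, V0, V1, V2, V3, V3]" by (rule zm_perm) simp
  finally have 2: "ZZ ?m * ZZ ?p \<approx> 1" using cg_trans[OF _ one] by blast
  show "(\<lambda>M. cP 0 M * cM 0 M) \<sim> (\<lambda>M. 1)" "(\<lambda>M. cM 0 M * cP 0 M) \<sim> (\<lambda>M. 1)"
    by (intro sim_I cg_trans[OF cg_mult[OF P M] 1] cg_trans[OF cg_mult[OF M P] 2])+
qed

lemma currents_zero: "m > 0 \<Longrightarrow> cP m \<sim> (\<lambda>M. 0)" "m < 0 \<Longrightarrow> cM m \<sim> (\<lambda>M. 0)"
proof -
  have u: "q ^ 2 * h \<noteq> 0" "1 / h \<noteq> 0" using q_nz h by auto
  show "m > 0 \<Longrightarrow> cP m \<sim> (\<lambda>M. 0)" "m < 0 \<Longrightarrow> cM m \<sim> (\<lambda>M. 0)"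
    using nord_zero(1)[OF crea_pp[OF u(1)]] nord_zero(2)[OF anni_pm[OF u(2)]]
    by (auto simp: cP_def cM_def cg_0_iff intro!: sim_I)
qed

end

section \<open>Evaluation homomorphisms\<close>

definition ev :: "('g \<Rightarrow> 'h falg) \<Rightarrow> 'g falg \<Rightarrow> 'h falg" where
  "ev f x = (\<Sum>w\<in>Poly_Mapping.keys x. cst (Poly_Mapping.lookup x w) * prod_list (map f (letters w)))"

lemma ev_superset:
  assumes "finite S" "Poly_Mapping.keys x \<subseteq> S"
  shows "ev f x = (\<Sum>w\<in>S. cst (Poly_Mapping.lookup x w) * prod_list (map f (letters w)))"
  unfolding ev_def using assms by (intro sum.mono_neutral_left) (auto simp: in_keys_iff)

lemma ev_add: "ev f (x + y) = ev f x + ev f y"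
proof -
  let ?S = "Poly_Mapping.keys x \<union> Poly_Mapping.keys y"
  have "Poly_Mapping.keys (x + y) \<subseteq> ?S" by (rule keys_add)
  then show ?thesis
    by (simp add: ev_superset[of ?S] lookup_add cst_add distrib_right sum.distrib)
qed

lemma ev_single: "ev f (Poly_Mapping.single w c) = cst c * prod_list (map f (letters w))"
  by (cases "c = 0") (simp_all add: ev_def)

text \<open>Unlike \<open>falg_induct\<close> this reduces to multiples of single words, on which
  \<open>ev\<close> and products can be computed directly.\<close>

lemma falg_additive_induct:
  fixes x :: "'g falg"
  assumes "\<And>w c. P (Poly_Mapping.single w c)" "\<And>x y. P x \<Longrightarrow> P y \<Longrightarrow> P (x + y)"
  shows "P x"
proof -
  have fin: "P (\<Sum>w\<in>A. Poly_Mapping.single w (f w))" if "finite A" for A f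
    using that by (induction A) (use assms assms(1)[of 0 0] in auto)
  have "x = (\<Sum>w\<in>Poly_Mapping.keys x. Poly_Mapping.single w (Poly_Mapping.lookup x w))"
    by (rule poly_mapping_eqI) (simp add: lookup_sum lookup_single when_def in_keys_iff sum.delta)
  then show ?thesis using fin[OF finite_keys] by metis
qed

lemma ev_mult: "ev f (x * y) = ev f x * ev f y"
proof (induction x rule: falg_additive_induct)
  case (1 w c)
  show ?case
  proof (induction y rule: falg_additive_induct)
    case (1 v d)
    show ?case
      by (simp add: mult_single ev_single plus_word_def cst_mult mult.assoc cst_comm_assoc[of "prod_list _"])
  qed (simp add: distrib_left ev_add)
qed (simp add: distrib_right ev_add)

lemma ev_cst [simp]: "ev f (cst c) = cst c"
  by (simp add: cst_def[of c] ev_single zero_word_def)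

lemma ev_gen [simp]: "ev f (gen g) = f g"
  by (simp add: gen_def ev_single)

lemma ev_1 [simp]: "ev f 1 = 1" and ev_0 [simp]: "ev f 0 = 0"
  using ev_cst[of f 1] ev_cst[of f 0] by simp_all

lemma ev_uminus: "ev f (- x) = - ev f x"
  using ev_add[of f x "- x"] by (simp add: eq_neg_iff_add_eq_0 add.commute)

lemma ev_diff: "ev f (x - y) = ev f x - ev f y"
  using ev_add[of f x "- y"] by (simp add: ev_uminus)

lemma ev_sum: "ev f (\<Sum>i\<in>A. x i) = (\<Sum>i\<in>A. ev f (x i))"
  by (induction A rule: infinite_finite_induct) (simp_all add: ev_add)

lemma ev_power: "ev f (x ^ n) = ev f x ^ n"
  by (induction n) (simp_all add: ev_mult)

lemmas ev_simps = ev_add ev_mult ev_uminus ev_diff ev_sum ev_power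

text \<open>Images are sequences, evaluated separately at each truncation N, and a relation is sent
  to a null sequence rather than to zero. Evaluated elements are Cauchy, so null sequences absorb
  them on both sides; hence the whole ideal becomes null and the map descends.\<close>

lemma (in filtered_presentation) presented_hom:
  fixes img :: "nat \<Rightarrow> 'h \<Rightarrow> 'g falg"
  assumes img: "\<And>g. cauchy (\<lambda>N. img N g)" and S: "\<And>r. r \<in> S \<Longrightarrow> null (\<lambda>N. ev (img N) r)"
  shows "\<exists>\<phi> \<in> ring_hom (presented S) AA. \<forall>a. \<phi> (pcls S a) = ccl (\<lambda>N. ev (img N) a)"
proof -
  have c: "cauchy (\<lambda>N. ev (img N) a)" for a
    by (induction a rule: falg_induct) (auto simp: ev_simps intro: img cauchy_add cauchy_mult)
  have I: "rel_ideal S \<subseteq> {a. null (\<lambda>N. ev (img N) a)}"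
    by (rule rel_ideal_minimal) (auto simp: ev_simps intro: S null_add null_lmult null_rmult c)
  define \<phi> where "\<phi> C = ccl (\<lambda>N. ev (img N) (SOME a. pcls S a = C))" for C
  have \<phi>: "\<phi> (pcls S a) = ccl (\<lambda>N. ev (img N) a)" for a
  proof -
    define b where "b = (SOME b. pcls S b = pcls S a)"
    have "pcls S b = pcls S a" unfolding b_def by (rule someI) simp
    then have "null (\<lambda>N. ev (img N) (b - a))" using I by (auto simp: pcls_eq_iff)
    then show ?thesis unfolding \<phi>_def b_def[symmetric] by (intro ccl_eqI c) (simp add: ev_diff)
  qed
  have "\<phi> \<in> ring_hom (presented S) AA"
    by (rule ring_hom_memI)
      (auto simp: carrier_presented presented_simps \<phi> ev_simps ccl_mult ccl_add ccl_one c ccl_carrier)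
  then show ?thesis using \<phi> by blast
qed

section \<open>The images of the generators satisfy the defining relations\<close>

context qi_level
begin

definition img :: "nat \<Rightarrow> uq_gen \<Rightarrow> 'g falg" where
  "img N g = (case g of E i \<Rightarrow> cE (- i) N | F i \<Rightarrow> cF (- i) N | PsiP n \<Rightarrow> cP (- int n) N
     | PsiM n \<Rightarrow> cM (int n) N | Kh \<Rightarrow> cst h | KhInv \<Rightarrow> cst (1 / h))"

text \<open>\<open>uq_current\<close> is literally 0 for psi^+ and psi^- in the wrong powers,
  whereas \<open>cP\<close> and \<open>cM\<close> vanish there only modulo the relations.
  \<open>dP\<close> and \<open>dM\<close> bridge the gap.\<close>

definition dP :: "int \<Rightarrow> nat \<Rightarrow> 'g falg" where "dP m N = (if m \<le> 0 then cP m N else 0)"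
definition dM :: "int \<Rightarrow> nat \<Rightarrow> 'g falg" where "dM m N = (if m \<ge> 0 then cM m N else 0)"

lemma dP_sim: "dP m \<sim> cP m" and dM_sim: "dM m \<sim> cM m"
  using sim_sym[OF currents_zero(1)[of m]] sim_sym[OF currents_zero(2)[of m]]
  by (cases "m \<le> 0"; cases "m \<ge> 0"; simp add: dP_def[abs_def] dM_def[abs_def])+

lemma cauchy_dP: "cauchy (dP m)" and cauchy_dM: "cauchy (dM m)"
  using cauchy_sim[OF dP_sim] cauchy_sim[OF dM_sim] cauchy_currents by blast+

lemma cauchy_img: "cauchy (\<lambda>N. img N g)"
  by (cases g) (simp_all add: img_def cauchy_currents)

lemma ev_current:
  "ev (img N) (uq_current CurE m) = cE m N" "ev (img N) (uq_current CurF m) = cF m N"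
  "ev (img N) (uq_current CurPsiP m) = dP m N" "ev (img N) (uq_current CurPsiM m) = dM m N"
  by (simp_all add: img_def dP_def dM_def)

lemma ev_Kpow: "ev (img N) (Kpow i) = cst (h powi i)"
  by (simp add: Kpow_def ev_power img_def cst_power power_int_def power_one_over inverse_eq_divide)

lemmas rel_simps = ev_simps ev_current ev_Kpow ev_cst ev_gen ev_1 G_coeffs[OF q_nz]

lemma powi_minus_nat: "h powi (- int j) = (1 / h) ^ j"
  by (simp add: power_int_minus power_one_over inverse_eq_divide)

lemma null_simD: "f \<sim> g \<Longrightarrow> null (\<lambda>N. f N - g N)"
  by (simp add: sim_def)

lemma dP_reorder:
  assumes "(\<lambda>M. cP m M * C n M) \<sim> (\<lambda>M. \<Sum>j\<le>K. cst (g j) * (C (n - int j) M * cP (m + int j) M))"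
    and "\<And>n. cauchy (C n)"
  shows "(\<lambda>M. dP m M * C n M) \<sim> (\<lambda>M. \<Sum>j\<le>K. cst (g j) * (C (n - int j) M * dP (m + int j) M))"
proof -
  have "(\<lambda>M. dP m M * C n M) \<sim> (\<lambda>M. cP m M * C n M)" by (intro sim_rmult dP_sim assms)
  also note assms(1)
  also have "(\<lambda>M. \<Sum>j\<le>K. cst (g j) * (C (n - int j) M * cP (m + int j) M))
      \<sim> (\<lambda>M. \<Sum>j\<le>K. cst (g j) * (C (n - int j) M * dP (m + int j) M))"
    by (intro sim_sum sim_lmult sim_sym[OF dP_sim])
  finally show ?thesis .
qed

lemma dM_reorder:
  assumes "(\<lambda>M. cM m M * C n M) \<sim> (\<lambda>M. \<Sum>j\<le>K. cst (g j) * (C (n + int j) M * cM (m - int j) M))"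
    and "\<And>n. cauchy (C n)"
  shows "(\<lambda>M. dM m M * C n M) \<sim> (\<lambda>M. \<Sum>j\<le>K. cst (g j) * (C (n + int j) M * dM (m - int j) M))"
proof -
  have "(\<lambda>M. dM m M * C n M) \<sim> (\<lambda>M. cM m M * C n M)" by (intro sim_rmult dM_sim assms)
  also note assms(1)
  also have "(\<lambda>M. \<Sum>j\<le>K. cst (g j) * (C (n + int j) M * cM (m - int j) M))
      \<sim> (\<lambda>M. \<Sum>j\<le>K. cst (g j) * (C (n + int j) M * dM (m - int j) M))"
    by (intro sim_sum sim_lmult sim_sym[OF dM_sim])
  finally show ?thesis .
qed

lemma null_uq_rels:
  assumes "r \<in> uq_rels q"
  shows "null (\<lambda>N. ev (img N) r)"
proof -
  let ?E = "uq_current CurE" and ?F = "uq_current CurF"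
  let ?psip = "uq_current CurPsiP" and ?psim = "uq_current CurPsiM"
  have K: "null (\<lambda>N. ev (img N) (gen Kh * gen KhInv - 1))" "null (\<lambda>N. ev (img N) (gen KhInv * gen Kh - 1))"
    using h by (simp_all add: rel_simps img_def cst_mult[symmetric])
  have Kc: "null (\<lambda>N. ev (img N) (gen Kh * gen g - gen g * gen Kh))" for g
    by (simp add: rel_simps) (simp add: img_def cst_comm)
  have PP: "null (\<lambda>N. ev (img N) (?psip m * ?psip n - ?psip n * ?psip m))" for m n
  proof -
    have "(\<lambda>M. dP m M * dP n M) \<sim> (\<lambda>M. cP m M * cP n M)" for m n
      by (intro sim_mult dP_sim cauchy_currents)
    from sim_trans[OF sim_trans[OF this rel_PP] sim_sym[OF this]]
    show ?thesis unfolding rel_simps by (rule null_simD)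
  qed
  have MM: "null (\<lambda>N. ev (img N) (?psim m * ?psim n - ?psim n * ?psim m))" for m n
  proof -
    have "(\<lambda>M. dM m M * dM n M) \<sim> (\<lambda>M. cM m M * cM n M)" for m n
      by (intro sim_mult dM_sim cauchy_currents)
    from sim_trans[OF sim_trans[OF this rel_MM] sim_sym[OF this]]
    show ?thesis unfolding rel_simps by (rule null_simD)
  qed
  have PM: "null (\<lambda>N. ev (img N) (?psip m * ?psim n
      - (\<Sum>i\<le>nat n. \<Sum>j\<le>nat n. cst (fps_nth (G_infty q) i) * Kpow (- 2 * int i)
          * cst (fps_nth (inverse (G_infty q)) j) * Kpow (2 * int j)
          * ?psim (n - int i - int j) * ?psip (m + int i + int j))))" for m n
  proof -
    have "(\<lambda>M. dP m M * dM n M) \<sim> (\<lambda>M. cP m M * cM n M)"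
      by (intro sim_mult dP_sim dM_sim cauchy_currents)
    also note rel_PM
    also have "(\<lambda>M. \<Sum>(i, j)\<in>{..nat n} \<times> {..nat n}.
        cst (gP q i * (1 / h ^ 2) ^ i * (gN q j * (h ^ 2) ^ j))
          * (cM (n - int i - int j) M * cP (m + int i + int j) M))
      \<sim> (\<lambda>M. \<Sum>(i, j)\<in>{..nat n} \<times> {..nat n}.
        cst (gP q i * (1 / h ^ 2) ^ i * (gN q j * (h ^ 2) ^ j))
          * (dM (n - int i - int j) M * dP (m + int i + int j) M))"
      unfolding case_prod_unfold
      by (intro sim_sum sim_lmult sim_sym[OF sim_mult] dP_sim dM_sim cauchy_currents)
    also have "\<dots> = (\<lambda>M. \<Sum>i\<le>nat n. \<Sum>j\<le>nat n. cst (gP q i) * cst (h powi (- 2 * int i))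
        * cst (gN q j) * cst (h powi (2 * int j)) * dM (n - int i - int j) M * dP (m + int i + int j) M)"
    proof -
      have "h powi (- 2 * int i) = (1 / h ^ 2) ^ i" "h powi (2 * int j) = (h ^ 2) ^ j" for i j
        using powi_minus_nat[of "2 * i"] power_int_of_nat[of h "2 * j"]
        by (simp_all add: power_mult power_one_over)
      then show ?thesis
        unfolding sum.cartesian_product[symmetric] by (simp only: cst_mult mult.assoc)
    qed
    finally show ?thesis unfolding rel_simps by (rule null_simD)
  qed
  have P0: "null (\<lambda>N. ev (img N) (?psip 0 * ?psim 0 - 1))" "null (\<lambda>N. ev (img N) (?psim 0 * ?psip 0 - 1))"
    using rel_const[THEN null_simD] unfolding rel_simps by (simp_all add: dP_def dM_def)
  have PE: "null (\<lambda>N. ev (img N) (?psip m * ?E n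
      - (\<Sum>j\<le>nat (- m). cst (fps_nth (G_infty q) j) * Kpow (- int j) * ?E (n - int j) * ?psip (m + int j))))" for m n
    using dP_reorder[OF rel_PE cauchy_currents(1), THEN null_simD, of m n]
    unfolding rel_simps powi_minus_nat cst_mult mult.assoc .
  have ME: "null (\<lambda>N. ev (img N) (?psim m * ?E n
      - (\<Sum>j\<le>nat m. cst (fps_nth (G_zero q) j) * Kpow (- int j) * ?E (n + int j) * ?psim (m - int j))))" for m n
    using dM_reorder[OF rel_ME cauchy_currents(1), THEN null_simD, of m n]
    unfolding rel_simps powi_minus_nat cst_mult mult.assoc .
  have PF: "null (\<lambda>N. ev (img N) (?psip m * ?F n
      - (\<Sum>j\<le>nat (- m). cst (fps_nth (inverse (G_infty q)) j) * Kpow (int j) * ?F (n - int j) * ?psip (m + int j))))" for m n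
    using dP_reorder[OF rel_PF cauchy_currents(2), THEN null_simD, of m n]
    unfolding rel_simps power_int_of_nat cst_mult mult.assoc .
  have MF: "null (\<lambda>N. ev (img N) (?psim m * ?F n
      - (\<Sum>j\<le>nat m. cst (fps_nth (inverse (G_zero q)) j) * Kpow (int j) * ?F (n + int j) * ?psim (m - int j))))" for m n
    using dM_reorder[OF rel_MF cauchy_currents(2), THEN null_simD, of m n]
    unfolding rel_simps power_int_of_nat cst_mult mult.assoc .
  have EE: "null (\<lambda>N. ev (img N) ((?E (m - 1) * ?E n - cst (q^2) * ?E m * ?E (n - 1))
          - (cst (q^2) * ?E n * ?E (m - 1) - ?E (n - 1) * ?E m)))" for m n
    using rel_EE[THEN null_simD, of m n] unfolding rel_simps mult.assoc .
  have FF: "null (\<lambda>N. ev (img N) ((?F (m - 1) * ?F n - cst (1 / q^2) * ?F m * ?F (n - 1))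
          - (cst (1 / q^2) * ?F n * ?F (m - 1) - ?F (n - 1) * ?F m)))" for m n
    using rel_FF[THEN null_simD, of m n] unfolding rel_simps mult.assoc .
  have EF: "null (\<lambda>N. ev (img N) (cst (q - 1 / q) * (?E m * ?F n - ?F n * ?E m)
          - (Kpow (- 2 * m) * Kpow (m + n) * ?psip (m + n)
             - Kpow (2 * m) * Kpow (- (m + n)) * ?psim (m + n))))" for m n
  proof -
    note rel_EF[of m n]
    also have "(\<lambda>M. cst (h powi (- 2 * m) * h powi (m + n)) * cP (m + n) M
        - cst (h powi (2 * m) * h powi (- (m + n))) * cM (m + n) M)
      \<sim> (\<lambda>M. cst (h powi (- 2 * m) * h powi (m + n)) * dP (m + n) M
        - cst (h powi (2 * m) * h powi (- (m + n))) * dM (m + n) M)"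
      by (intro sim_diff sim_lmult sim_sym[OF dP_sim] sim_sym[OF dM_sim])
    finally show ?thesis unfolding rel_simps cst_mult mult.assoc by (rule null_simD)
  qed
  show ?thesis
    using assms[unfolded uq_rels_def Let_def]
    by - (elim UnE CollectE exE conjE insertE emptyE; hypsubst;
        rule K Kc PP MM PM P0 PE ME PF MF EE FF EF)
qed

lemma free_field_eq:
  "free_field VV q2 q3 q h cur m N =
     (case cur of CurE \<Rightarrow> cE m N | CurF \<Rightarrow> cF m N | CurPsiP \<Rightarrow> cP m N | CurPsiM \<Rightarrow> cM m N)"
proof -
  have r: "q ^ 2 * h ^ 2 \<noteq> 0" "1 / h \<noteq> 0" "q ^ 2 * h \<noteq> 0" using q_nz h by auto
  have resc: "rescale c (\<lambda>m N. A m N + B m N) m N = rescale c A m N + rescale c B m N"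
    for c m N and A B :: "int \<Rightarrow> nat \<Rightarrow> 'g falg"
    by (simp add: rescale_def distrib_left)
  have S: "Sigma_path VV (path_plus q3) = (\<lambda>m N. VV (e0 1) m N + VV (e1 1) m N)"
    "Sigma_path VV (path_minus q2) = (\<lambda>m N. VV (f0 1) m N + VV (f1 1) m N)"
    by (rule ext, rule ext, simp add: Sigma_path_def path_plus_def path_minus_def path_points_def numeral_2_eq_2)+
  have P: "Psi_path VV (path_plus q3) = VV (pm 1)" "Psi_path VV (path_minus q2) = VV (pp 1)"
    by (simp_all add: Psi_path_def path_plus_def path_minus_def path_points_def)
  show ?thesis
    by (cases cur)
      (simp_all add: S P resc rescale_nord[OF r(1)] rescale_nord[OF r(2)] rescale_nord[OF r(3)]
        cE_def cF_def cP_def cM_def)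
qed

lemma current_hom:
  "\<exists>\<phi> \<in> ring_hom (presented (uq_rels q)) AA.
     (\<forall>c. \<phi> (pcls (uq_rels q) (cst c)) = ccl (\<lambda>N. cst c))
   \<and> \<phi> (pcls (uq_rels q) (gen Kh)) = ccl (\<lambda>N. cst h)
   \<and> (\<forall>cur m. \<phi> (pcls (uq_rels q) (uq_current cur m)) = ccl (free_field VV q2 q3 q h cur m))"
proof -
  obtain \<phi> where \<phi>: "\<phi> \<in> ring_hom (presented (uq_rels q)) AA"
    "\<And>a. \<phi> (pcls (uq_rels q) a) = ccl (\<lambda>N. ev (img N) a)"
    using presented_hom[OF cauchy_img null_uq_rels] by blast
  have "ccl (\<lambda>N. ev (img N) (uq_current cur m)) = ccl (free_field VV q2 q3 q h cur m)" for cur m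
  proof (cases cur)
    case CurPsiP
    then show ?thesis
      using ccl_eqI[OF cauchy_dP cauchy_currents(3) null_simD[OF dP_sim]]
      by (simp only: ev_current free_field_eq[abs_def] current_name.case)
  next
    case CurPsiM
    then show ?thesis
      using ccl_eqI[OF cauchy_dM cauchy_currents(4) null_simD[OF dM_sim]]
      by (simp only: ev_current free_field_eq[abs_def] current_name.case)
  qed (simp_all only: ev_current free_field_eq[abs_def] current_name.case)
  moreover have "img N Kh = cst h" for N by (simp add: img_def)
  ultimately show ?thesis using \<phi> by (intro bexI[of _ \<phi>]) auto
qed

end

section \<open>Continuity of right multiplication\<close>

lemma nbhL_antimono:
  assumes "nbh' N' \<subseteq> nbh N"
  shows "nbhL S nbh' N' \<subseteq> nbhL S nbh N"
  using assms by (intro nbhL_minimal) (auto intro: nbhL_nbh nbhL_I nbhL_add nbhL_lmult)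

lemma (in presentation_cong) nbhL_cong: "a \<approx> b \<Longrightarrow> b \<in> nbhL rels nbh N \<Longrightarrow> a \<in> nbhL rels nbh N"
  using nbhL_add[OF nbhL_I[of "a - b" rels nbh N], of b] by (simp add: cg_def)

text \<open>The oscillator calculus above presupposes a filtered presentation. What is needed to
  establish continuity is therefore derived here from the relations alone.\<close>

locale aq_cong = presentation_cong rels
  for rels :: "'g falg set" +
  fixes q :: complex and Q :: "'v quiver" and emb :: "'v aq_gen \<Rightarrow> 'g falg"
  assumes aq_rels: "aq_rels q Q emb \<subseteq> rels"
begin

abbreviation mon :: "('v \<times> int) list \<Rightarrow> 'g falg" where
  "mon ps \<equiv> prod_list (map (\<lambda>(i, n). emb (Osc i n)) ps)"

abbreviation LQ :: "nat \<Rightarrow> 'g falg set" where "LQ \<equiv> nbhL rels (aq_nbh emb)"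

lemma aq_nbh_mono: "N \<le> N' \<Longrightarrow> aq_nbh emb N' \<subseteq> aq_nbh emb N"
  by (auto simp: aq_nbh_def)

lemma LQ_antimono: "N \<le> N' \<Longrightarrow> LQ N' \<subseteq> LQ N"
  by (intro nbhL_antimono aq_nbh_mono)

lemma mon_aq_nbh: "(\<forall>(i, n)\<in>set ps. n > 0) \<Longrightarrow> int N \<le> (\<Sum>(i, n)\<leftarrow>ps. n) \<Longrightarrow> mon ps \<in> aq_nbh emb N"
  unfolding aq_nbh_def by blast

lemma LQ_osc:
  assumes "a \<in> LQ K" "r > 0"
  shows "a * emb (Osc i (int r)) \<in> LQ (K + r)"
proof -
  have "LQ K \<subseteq> {a. a * emb (Osc i (int r)) \<in> LQ (K + r)}"
  proof (rule nbhL_minimal)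
    show "aq_nbh emb K \<subseteq> {a. a * emb (Osc i (int r)) \<in> LQ (K + r)}"
    proof
      fix y assume "y \<in> aq_nbh emb K"
      then obtain ps where ps: "y = mon ps" "\<forall>(i, n)\<in>set ps. n > 0" "int K \<le> (\<Sum>(i, n)\<leftarrow>ps. n)"
        unfolding aq_nbh_def by blast
      have "mon (ps @ [(i, int r)]) \<in> aq_nbh emb (K + r)"
        by (rule mon_aq_nbh) (use ps assms(2) in auto)
      then show "y \<in> {a. a * emb (Osc i (int r)) \<in> LQ (K + r)}"
        by (auto simp: ps(1) intro: nbhL_nbh)
    qed
  qed (auto simp: distrib_right mult.assoc intro: nbhL_I rel_ideal_rmult nbhL_add nbhL_lmult)
  then show ?thesis using assms(1) by auto
qed

lemma mon_commute:
  assumes z: "\<And>i n. z * emb (Osc i n) \<approx> emb (Osc i n) * z"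
  shows "mon ps * z \<approx> z * mon ps"
proof (induction ps)
  case (Cons p ps)
  obtain i n where p: "p = (i, n)" by (cases p)
  have "mon (p # ps) * z = emb (Osc i n) * (mon ps * z)" by (simp add: p mult.assoc)
  also have "\<dots> \<approx> emb (Osc i n) * (z * mon ps)" by (intro cg_lmult Cons)
  also have "\<dots> = emb (Osc i n) * z * mon ps" by (simp add: mult.assoc)
  also have "\<dots> \<approx> z * emb (Osc i n) * mon ps" by (intro cg_rmult cg_sym[OF z])
  finally show ?case by (simp add: p mult.assoc)
qed simp

lemma aq_nbh_commuting:
  assumes "\<And>i n. z * emb (Osc i n) \<approx> emb (Osc i n) * z" "y \<in> aq_nbh emb N"
  shows "y * z \<in> LQ N"
proof -
  obtain ps where "y = mon ps" using assms(2) unfolding aq_nbh_def by blast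
  then have "y * z \<approx> z * y" using mon_commute[OF assms(1)] by simp
  then show ?thesis using nbhL_lmult[OF nbhL_nbh[of y "aq_nbh emb" N]] assms(2) nbhL_cong by blast
qed

lemma X_osc_commute: "emb (X i) * emb (Osc j n) \<approx> emb (Osc j n) * emb (X i)"
proof -
  have "emb (X i) * emb (Osc j n) - emb (Osc j n) * emb (X i) \<in> aq_rels q Q emb"
    unfolding aq_rels_def by blast
  then show ?thesis using aq_rels by (intro cg_rel) auto
qed

lemma X_Xinv: "emb (X i) * emb (Xinv i) \<approx> 1" "emb (Xinv i) * emb (X i) \<approx> 1"
proof -
  have "emb (X i) * emb (Xinv i) - 1 \<in> aq_rels q Q emb" "emb (Xinv i) * emb (X i) - 1 \<in> aq_rels q Q emb"
    unfolding aq_rels_def by blast+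
  then show "emb (X i) * emb (Xinv i) \<approx> 1" "emb (Xinv i) * emb (X i) \<approx> 1"
    using aq_rels by (auto intro: cg_rel)
qed

text \<open>Multiplication by the inverse on both sides; it transfers commutation rules of X_j and
  of e^(q-hat) to their inverses.\<close>

lemma intertwine_inverse:
  assumes "x * x' \<approx> 1" "x' * x \<approx> 1" "a * x \<approx> x * b"
  shows "b * x' \<approx> x' * a"
proof -
  have "b * x' = 1 * (b * x')" by simp
  also have "\<dots> \<approx> (x' * x) * (b * x')" by (intro cg_rmult cg_sym[OF assms(2)])
  also have "\<dots> = x' * (x * b) * x'" by (simp add: mult.assoc)
  also have "\<dots> \<approx> x' * (a * x) * x'" by (intro cg_rmult cg_lmult cg_sym[OF assms(3)])
  also have "\<dots> = x' * a * (x * x')" by (simp add: mult.assoc)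
  also have "\<dots> \<approx> x' * a * 1" by (intro cg_lmult assms)
  finally show ?thesis by simp
qed

lemma Xinv_osc_commute: "emb (Xinv i) * emb (Osc j n) \<approx> emb (Osc j n) * emb (Xinv i)"
  by (rule cg_sym, rule intertwine_inverse[OF X_Xinv cg_sym[OF X_osc_commute]])

text \<open>A creator of degree k contracts with an annihilator of the same degree, so a monomial
  loses degree at most k. The induction peels off the last mode, because what stands on the right
  decides membership in a left ideal.\<close>

lemma mon_osc_neg:
  assumes "\<forall>(i, n)\<in>set ps. n > 0" "int (K + k) \<le> (\<Sum>(i, n)\<leftarrow>ps. n)" "k > 0"
  shows "mon ps * emb (Osc j (- int k)) - emb (Osc j (- int k)) * mon ps \<in> LQ K"
  using assms
proof (induction ps arbitrary: K rule: rev_induct)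
  case (snoc p ps)
  obtain i r where p: "p = (i, r)" by (cases p)
  let ?O = "emb (Osc j (- int k))" and ?o = "emb (Osc i r)"
  define d where "d = (\<Sum>(i, n)\<leftarrow>ps. n)"
  have r: "r > 0" and pos: "\<forall>(i, n)\<in>set ps. n > 0" and deg: "int (K + k) \<le> d + r"
    using snoc.prems by (auto simp: p d_def)
  have "?o * ?O - ?O * ?o - cst (if r + - int k = 0 then Cmat_pow (nat r) q Q i j / of_int r else 0)
      \<in> aq_rels q Q emb"
    unfolding aq_rels_def using r by blast
  then have br: "?o * ?O - ?O * ?o \<approx> cst (if r = int k then Cmat_pow (nat r) q Q i j / of_int r else 0)"
    using aq_rels by (intro cg_rel) auto
  have 1: "mon ps * (?o * ?O - ?O * ?o) \<in> LQ K"
  proof (cases "r = int k")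
    case True
    then have "mon ps \<in> LQ K" using pos deg by (intro nbhL_nbh mon_aq_nbh) (auto simp: d_def)
    then have "mon ps * cst c \<in> LQ K" for c unfolding cst_comm[of "mon ps"] by (rule nbhL_lmult)
    with cg_lmult[OF br, of "mon ps"] show ?thesis by (rule nbhL_cong)
  next
    case False
    then show ?thesis using cg_lmult[OF br, of "mon ps"] by (auto simp: cg_0_iff intro: nbhL_I)
  qed
  have 2: "(mon ps * ?O - ?O * mon ps) * ?o \<in> LQ K"
  proof (cases "d \<ge> int k")
    case True
    then have "mon ps * ?O - ?O * mon ps \<in> LQ (nat d - k)"
      using snoc.IH[OF pos, of "nat d - k"] snoc.prems(3) by (simp add: d_def[symmetric] of_nat_diff)
    then have "(mon ps * ?O - ?O * mon ps) * emb (Osc i (int (nat r))) \<in> LQ (nat d - k + nat r)"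
      using r by (intro LQ_osc) auto
    moreover have "K \<le> nat d - k + nat r" using deg True r by linarith
    ultimately show ?thesis using LQ_antimono r by auto
  next
    case False
    \<comment> \<open>The preceding modes have degree below k, too little for the induction
      hypothesis; but then r > K, and the last mode alone lies in the neighbourhood.\<close>
    then have "mon [(i, r)] \<in> aq_nbh emb K" using deg r by (intro mon_aq_nbh) auto
    then show ?thesis by (intro nbhL_lmult nbhL_nbh) simp
  qed
  have "mon (ps @ [p]) * ?O - ?O * mon (ps @ [p])
      = mon ps * (?o * ?O - ?O * ?o) + (mon ps * ?O - ?O * mon ps) * ?o"
    by (simp add: p algebra_simps)
  then show ?case using nbhL_add[OF 1 2] by simp
qed simp

text \<open>Zero modes commute with the oscillators and annihilators raise the degree; a creator of
  degree k lowers it by at most k, so K = N + k suffices.\<close>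

lemma aq_nbh_cont: "\<exists>K. \<forall>a\<in>aq_nbh emb K. a * emb g \<in> LQ N"
proof -
  consider i where "g = X i" | i where "g = Xinv i" | j n where "g = Osc j n" by (cases g)
  then show ?thesis
  proof cases
    case 3
    consider "n > 0" | "n = 0" | "n < 0" by linarith
    then show ?thesis
    proof cases
      case 1
      then have "a * emb g \<in> LQ (N + nat n)" if "a \<in> aq_nbh emb N" for a
        using LQ_osc[OF nbhL_nbh[of a "aq_nbh emb" N rels], of "nat n" j] 3 that by simp
      then show ?thesis using LQ_antimono[of N "N + nat n"] by auto
    next
      case 2
      have "emb (Osc j 0) \<in> aq_rels q Q emb" unfolding aq_rels_def by blast
      then have "emb g \<in> LQ N" using aq_rels 2 3 by (auto intro!: nbhL_I rel_idealI)
      then show ?thesis using nbhL_lmult by blast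
    next
      case neg: 3
      define k where "k = nat (- n)"
      have k: "n = - int k" "k > 0" using neg by (auto simp: k_def)
      have "a * emb g \<in> LQ N" if "a \<in> aq_nbh emb (N + k)" for a
      proof -
        obtain ps where ps: "a = mon ps" "\<forall>(i, n)\<in>set ps. n > 0" "int (N + k) \<le> (\<Sum>(i, n)\<leftarrow>ps. n)"
          using \<open>a \<in> aq_nbh emb (N + k)\<close> unfolding aq_nbh_def by blast
        have "a \<in> LQ N" unfolding ps(1) using ps by (intro nbhL_nbh mon_aq_nbh) auto
        then have "(mon ps * emb g - emb g * mon ps) + emb g * a \<in> LQ N"
          using mon_osc_neg[OF ps(2,3) k(2), of j] unfolding 3 k(1) by (intro nbhL_add nbhL_lmult)
        then show ?thesis by (simp add: ps(1))
      qed
      then show ?thesis by blast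
    qed
  qed (auto intro!: exI[of _ N] aq_nbh_commuting X_osc_commute Xinv_osc_commute)
qed

end

lemma filtered_I:
  "filtered_presentation (I_rels q1 q2 q3 q) (aq_nbh gen)"
proof (rule cont_from_gens)
  interpret aq_cong "I_rels q1 q2 q3 q" q "QI q1 q2 q3" gen
    by standard (auto simp: I_rels_def)
  show "aq_nbh gen (Suc N) \<subseteq> aq_nbh (gen :: vertex aq_gen \<Rightarrow> _) N" for N by (rule aq_nbh_mono) simp
  show "\<exists>K. \<forall>a\<in>aq_nbh gen K. a * gen g \<in> nbhL (I_rels q1 q2 q3 q) (aq_nbh gen) N" for g N
    by (rule aq_nbh_cont)
qed

lemma free_field_realization:
  assumes "q \<noteq> 0" "q2 = q ^ 2" "q1 = 1 / (q ^ 2 * q3)" "q3 \<noteq> 0" "h \<noteq> 0" "q3 = q ^ 2 * h ^ 4" "q ^ 2 \<noteq> 1"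
  shows "\<exists>\<phi>. is_free_field_realization q1 q2 q3 q h \<phi>"
proof -
  interpret filtered_presentation "I_rels q1 q2 q3 q" "aq_nbh gen" by (rule filtered_I)
  interpret qi_level "I_rels q1 q2 q3 q" "aq_nbh gen" q q1 q2 q3 gen h
    by unfold_locales (use assms in \<open>auto simp: I_rels_def\<close>)
  show ?thesis
    using current_hom unfolding is_free_field_realization_def alg_I_def cls_I_def by blast
qed

section \<open>The zero mode extension\<close>

locale ext_cong = aq_cong rels q Q "\<lambda>g. gen (Base g)"
  for rels :: "'v ext_gen falg set" and q Q +
  fixes k :: 'v
  assumes ext_rels: "ext_rels q Q k \<subseteq> rels"
begin

abbreviation Jp :: "int \<Rightarrow> 'v ext_gen falg" where "Jp a \<equiv> gen (PJ a)"
abbreviation Pp :: "int \<Rightarrow> 'v ext_gen falg" where "Pp l \<equiv> gen (PP l)"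
abbreviation Ei :: "'v ext_gen falg" where "Ei \<equiv> gen Eqinv"

lemma ext_rel: "a - b \<in> ext_rels q Q k \<Longrightarrow> a \<approx> b"
  using ext_rels by (intro cg_rel) auto

lemma Eq_inv: "gen Eq * Ei \<approx> 1" "Ei * gen Eq \<approx> 1"
  by (rule ext_rel, simp add: ext_rels_def)+

lemma Eq_osc: "gen Eq * ext_emb (Osc i n) \<approx> ext_emb (Osc i n) * gen Eq"
  by (rule ext_rel, unfold ext_rels_def, blast)

lemma Ei_osc: "Ei * ext_emb (Osc i n) \<approx> ext_emb (Osc i n) * Ei"
  by (rule cg_sym, rule intertwine_inverse[OF Eq_inv cg_sym[OF Eq_osc]])

lemma X_Eq: "j \<noteq> k \<Longrightarrow> ext_emb (X j) * gen Eq \<approx> gen Eq * (cst (shift_const q Q k j) * ext_emb (X j))"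
proof -
  assume "j \<noteq> k"
  then have "ext_emb (X j) * gen Eq \<approx> cst (shift_const q Q k j) * gen Eq * ext_emb (X j)"
    by (intro ext_rel) (unfold ext_rels_def, blast)
  then show ?thesis by (simp only: cst_comm_assoc[of "gen Eq"] mult.assoc)
qed

lemma X_Ei:
  assumes "j \<noteq> k" "shift_const q Q k j \<noteq> 0"
  shows "ext_emb (X j) * Ei \<approx> cst (1 / shift_const q Q k j) * (Ei * ext_emb (X j))"
proof -
  have "cst (1 / shift_const q Q k j) * (cst (shift_const q Q k j) * ext_emb (X j) * Ei)
      \<approx> cst (1 / shift_const q Q k j) * (Ei * ext_emb (X j))"
    by (intro cg_lmult intertwine_inverse[OF Eq_inv X_Eq] assms)
  then show ?thesis using assms(2) by (simp add: mult.assoc cst_cst)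
qed

lemma Jp_Jp: "Jp a * Jp b \<approx> (if a = b then Jp a else 0)"
  by (rule ext_rel, unfold ext_rels_def, blast)

lemma Xk_Jp: "ext_emb (X k) * Jp a \<approx> - (cst (q powi (- a)) * Jp a)"
proof (rule ext_rel)
  show "ext_emb (X k) * Jp a - - (cst (q powi (- a)) * Jp a) \<in> ext_rels q Q k"
    unfolding diff_minus_eq_add ext_rels_def by blast
qed

lemma Jp_Eq: "Jp (a + 2) * gen Eq \<approx> gen Eq * Jp a"
  by (rule ext_rel, unfold ext_rels_def, blast)

lemma Jp_Ei: "Jp a * Ei \<approx> Ei * Jp (a + 2)"
  by (rule intertwine_inverse[OF Eq_inv Jp_Eq])

lemma Jp_X: "Jp (a + 2 * eps Q j k) * ext_emb (X j) \<approx> ext_emb (X j) * Jp a"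
proof (rule ext_rel)
  show "Jp (a + 2 * eps Q j k) * ext_emb (X j) - ext_emb (X j) * Jp a \<in> ext_rels q Q k"
    unfolding ext_rels_def by blast
qed

lemma Jp_Xinv: "Jp a * ext_emb (Xinv j) \<approx> ext_emb (Xinv j) * Jp (a + 2 * eps Q j k)"
  by (rule intertwine_inverse[OF X_Xinv Jp_X])

lemma Jp_osc: "Jp a * ext_emb (Osc i n) \<approx> ext_emb (Osc i n) * Jp a"
  by (rule ext_rel, unfold ext_rels_def, blast)

lemma Pp_Pp: "Pp l * Pp r \<approx> (if l = r then Pp l else 0)"
  by (rule ext_rel, unfold ext_rels_def, blast)

lemma Pp_Eq: "Pp (l + 1) * gen Eq \<approx> gen Eq * Pp l"
  by (rule ext_rel, unfold ext_rels_def, blast)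

lemma Pp_Ei: "Pp l * Ei \<approx> Ei * Pp (l + 1)"
  by (rule intertwine_inverse[OF Eq_inv Pp_Eq])

lemma Pp_emb: "Pp l * ext_emb g \<approx> ext_emb g * Pp l"
  by (rule ext_rel, unfold ext_rels_def, blast)

lemma Pp_Jp: "Pp l * Jp a \<approx> Jp a * Pp l"
  by (rule ext_rel, unfold ext_rels_def, blast)

abbreviation LE :: "nat \<Rightarrow> 'v ext_gen falg set" where "LE \<equiv> nbhL rels ext_nbh"

lemma LQ_LE: "LQ N \<subseteq> LE N"
  by (rule nbhL_antimono) (auto simp: ext_nbh_def)

lemma orthogonal_commute:
  assumes "\<And>a b. P a * P b \<approx> (if a = b then P a else 0)"
  shows "P a * P b \<approx> P b * P (a :: int)"
  using assms[of a b] cg_sym[OF assms[of b a]] cg_trans by (cases "a = b") auto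

lemma idempotents_sum:
  assumes orth: "\<And>a b. P a * P b \<approx> (if a = b then P a else 0)" and "finite A"
  shows "P b * (\<Sum>a\<in>A. P a) \<approx> (if b \<in> A then P b else 0)"
proof -
  have "P b * (\<Sum>a\<in>A. P a) \<approx> (\<Sum>a\<in>A. if b = a then P b else 0)"
    unfolding sum_distrib_left by (intro cg_sum orth)
  then show ?thesis using assms(2) by simp
qed

text \<open>By orthogonality P_b = P_b (1 - sum of P_a over |a| <= N) as soon as |b| > N, and the
  second factor is small.\<close>

lemma idempotent_far:
  assumes orth: "\<And>a b. P a * P b \<approx> (if a = b then P a else 0)"
    and nb: "1 - (\<Sum>a\<in>{- int N..int N}. P a) \<in> L N" and lm: "\<And>x y. x \<in> L N \<Longrightarrow> y * x \<in> L N"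
    and cong: "\<And>x y. x \<approx> y \<Longrightarrow> y \<in> L N \<Longrightarrow> x \<in> L N" and b: "b \<notin> {- int N..int N}"
  shows "P b \<in> L N"
proof -
  have "P b * (\<Sum>a\<in>{- int N..int N}. P a) \<approx> 0"
    using idempotents_sum[of P "{- int N..int N}" b, OF orth] by (simp only: b if_False finite_atLeastAtMost_int)
  then have "P b - 0 \<approx> P b - P b * (\<Sum>a\<in>{- int N..int N}. P a)"
    by (intro cg_diff cg_refl cg_sym[of _ 0])
  then show ?thesis using lm[OF nb, of "P b"] cong by (simp add: right_diff_distrib)
qed

text \<open>Moving x to the left shifts the interval of idempotents by d. The shifted interval still
  contains [-N, N], and each additional idempotent is small by
  \<open>idempotent_far\<close>.\<close>

lemma idempotents_cont:
  assumes orth: "\<And>a b. P a * P b \<approx> (if a = b then P a else 0)"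
    and nb: "\<And>N. 1 - (\<Sum>a\<in>{- int N..int N}. P a) \<in> LE N"
    and shift: "\<And>a. P a * x \<approx> x * P (a + d)" and M: "M \<ge> N + nat \<bar>d\<bar>"
  shows "(1 - (\<Sum>a\<in>{- int M..int M}. P a)) * x \<in> LE N"
proof -
  let ?A = "{- int N..int N}" and ?B = "{- int M + d..int M + d}"
  have far: "P b \<in> LE N" if "b \<notin> ?A" for b
    by (rule idempotent_far[where P = P and L = LE and N = N, OF orth nb _ _ that]) (auto intro: nbhL_lmult nbhL_cong)
  have "(1 - (\<Sum>a\<in>{- int M..int M}. P a)) * x = x - (\<Sum>a\<in>{- int M..int M}. P a * x)"
    by (simp add: left_diff_distrib sum_distrib_right)
  also have "\<dots> \<approx> x - (\<Sum>a\<in>{- int M..int M}. x * P (a + d))"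
    by (intro cg_diff cg_refl cg_sum shift)
  also have "(\<Sum>a\<in>{- int M..int M}. x * P (a + d)) = (\<Sum>b\<in>?B. x * P b)"
    by (rule sum.reindex_bij_witness[of _ "\<lambda>b. b - d" "\<lambda>a. a + d"]) auto
  also have "\<dots> = (\<Sum>b\<in>?B - ?A. x * P b) + (\<Sum>b\<in>?A. x * P b)"
    using M by (intro sum.subset_diff) auto
  also have "x - \<dots> = x * (1 - (\<Sum>b\<in>?A. P b)) - (\<Sum>b\<in>?B - ?A. x * P b)"
    by (simp add: right_diff_distrib sum_distrib_left)
  finally have *: "(1 - (\<Sum>a\<in>{- int M..int M}. P a)) * x
      \<approx> x * (1 - (\<Sum>b\<in>?A. P b)) - (\<Sum>b\<in>?B - ?A. x * P b)" .
  have "(\<Sum>b\<in>B. x * P b) \<in> LE N" if "B \<subseteq> - ?A" "finite B" for B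
    using that(2,1) by (induction B) (auto intro!: nbhL_add nbhL_lmult far)
  then have "(\<Sum>b\<in>?B - ?A. x * P b) \<in> LE N" by auto
  then show ?thesis using nbhL_cong[OF *] nbhL_diff nbhL_lmult nb by blast
qed

lemma PJ_LE: "1 - (\<Sum>a\<in>{- int N..int N}. Jp a) \<in> LE N"
  and PP_LE: "1 - (\<Sum>l\<in>{- int N..int N}. Pp l) \<in> LE N"
  by (rule nbhL_nbh, auto simp: ext_nbh_def)+

text \<open>Every generator shifts the eigenvalues of J and of P by fixed amounts, so
  \<open>idempotents_cont\<close> handles the two new kinds of neighbourhood generators; the
  monomials in the modes are handled by \<open>aq_nbh_cont\<close> or by commutation.\<close>

lemma filtered_ext: "filtered_presentation rels ext_nbh"
proof (rule cont_from_gens)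
  show "ext_nbh (Suc N) \<subseteq> (ext_nbh N :: 'v ext_gen falg set)" for N
    using aq_nbh_mono[of N "Suc N"] by (fastforce simp: ext_nbh_def)
  fix g :: "'v ext_gen" and N
  have "\<exists>K. \<forall>a\<in>aq_nbh (\<lambda>g. gen (Base g)) K. a * gen g \<in> LE N"
  proof (cases g)
    case (Base b)
    then show ?thesis using aq_nbh_cont[of b N] LQ_LE by blast
  next
    case Eq
    then show ?thesis using aq_nbh_commuting[OF Eq_osc] LQ_LE by blast
  next
    case Eqinv
    then show ?thesis using aq_nbh_commuting[OF Ei_osc] LQ_LE by blast
  next
    case (PJ a)
    then show ?thesis using aq_nbh_commuting[OF Jp_osc] LQ_LE by blast
  next
    case (PP l)
    then show ?thesis using aq_nbh_commuting[OF Pp_emb] LQ_LE by blast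
  qed
  then obtain K where K: "\<And>a. a \<in> aq_nbh (\<lambda>g. gen (Base g)) K \<Longrightarrow> a * gen g \<in> LE N" by blast
  have "\<exists>d. \<forall>a. Jp a * gen g \<approx> gen g * Jp (a + d)"
  proof (cases g)
    case (Base b)
    show ?thesis
    proof (cases b)
      case (X j)
      then show ?thesis using Jp_X[of "a - 2 * eps Q j k" j for a] Base
        by (intro exI[of _ "- 2 * eps Q j k"]) simp
    next
      case (Xinv j)
      then show ?thesis using Jp_Xinv Base by blast
    next
      case (Osc i n)
      then show ?thesis using Jp_osc Base by (intro exI[of _ 0]) simp
    qed
  next
    case Eq
    then show ?thesis using Jp_Eq[of "a - 2" for a] by (intro exI[of _ "- 2"]) simp
  next
    case Eqinv
    then show ?thesis using Jp_Ei by blast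
  next
    case (PJ b)
    have "Jp a * Jp b \<approx> Jp b * Jp a" for a by (rule orthogonal_commute[OF Jp_Jp])
    then show ?thesis using PJ by (intro exI[of _ 0]) simp
  next
    case (PP l)
    then show ?thesis using cg_sym[OF Pp_Jp] by (intro exI[of _ 0]) simp
  qed
  then obtain d where d: "\<And>a. Jp a * gen g \<approx> gen g * Jp (a + d)" by blast
  have "\<exists>d. \<forall>a. Pp a * gen g \<approx> gen g * Pp (a + d)"
  proof (cases g)
    case (Base b)
    then show ?thesis using Pp_emb by (intro exI[of _ 0]) simp
  next
    case Eq
    then show ?thesis using Pp_Eq[of "a - 1" for a] by (intro exI[of _ "- 1"]) simp
  next
    case Eqinv
    then show ?thesis using Pp_Ei by blast
  next
    case (PJ b)
    then show ?thesis using Pp_Jp by (intro exI[of _ 0]) simp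
  next
    case (PP b)
    have "Pp a * Pp b \<approx> Pp b * Pp a" for a by (rule orthogonal_commute[OF Pp_Pp])
    then show ?thesis using PP by (intro exI[of _ 0]) simp
  qed
  then obtain d' where d': "\<And>a. Pp a * gen g \<approx> gen g * Pp (a + d')" by blast
  show "\<exists>K. \<forall>a\<in>ext_nbh K. a * gen g \<in> LE N"
  proof (intro exI ballI)
    let ?K = "max K (N + nat \<bar>d\<bar> + nat \<bar>d'\<bar>)"
    fix a assume "a \<in> (ext_nbh ?K :: 'v ext_gen falg set)"
    then consider "a \<in> aq_nbh (\<lambda>g. gen (Base g)) ?K"
      | M where "M \<ge> ?K" "a = 1 - (\<Sum>a\<in>{- int M..int M}. Jp a)"
      | M where "M \<ge> ?K" "a = 1 - (\<Sum>a\<in>{- int M..int M}. Pp a)"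
      unfolding ext_nbh_def by blast
    then show "a * gen g \<in> LE N"
    proof cases
      case 1
      then show ?thesis using K aq_nbh_mono[of K ?K] by auto
    next
      case 2
      then show ?thesis using idempotents_cont[of Jp, OF Jp_Jp PJ_LE d] by simp
    next
      case 3
      then show ?thesis using idempotents_cont[of Pp, OF Pp_Pp PP_LE d'] by simp
    qed
  qed
qed

end

section \<open>Commutation with a screening charge\<close>

locale screening_presentation =
  osc_presentation rels ext_nbh q Q "\<lambda>g. gen (Base g)" + ext_cong rels q Q k
  for rels :: "'v ext_gen falg set" and q Q k +
  assumes shift_nz: "\<And>j. j \<noteq> k \<Longrightarrow> shift_const q Q k j \<noteq> 0"
    and q_generic: "\<And>n. n > 0 \<Longrightarrow> q ^ n - 1 / q ^ n \<noteq> 0"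
begin

notation sim (infix \<open>\<sim>\<close> 50)

lemma sim_eventually:
  assumes "\<And>M. M \<ge> M0 \<Longrightarrow> f M \<approx> g M"
  shows "f \<sim> g"
  unfolding sim_def null_def using assms nbhL_I unfolding cg_def by blast

text \<open>For given N the part of y outside finitely many joint eigenspaces lies in the left ideal
  whatever y is, so nullness can be tested on one eigenspace of J and P at a time, where the charge
  is a single mode.\<close>

lemma null_local:
  assumes "\<And>a l. null (\<lambda>M. y M * Jp a * Pp l)"
  shows "null y"
  unfolding null_def
proof
  fix N
  let ?A = "{- int N..int N}"
  have "null (\<lambda>M. \<Sum>a\<in>?A. \<Sum>l\<in>?A. y M * Jp a * Pp l)" by (intro null_sum assms)
  then obtain M0 where M0: "\<And>M. M \<ge> M0 \<Longrightarrow> (\<Sum>a\<in>?A. \<Sum>l\<in>?A. y M * Jp a * Pp l) \<in> LL N"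
    unfolding null_def by meson
  have "y M \<in> LL N" if "M \<ge> M0" for M
  proof -
    have "y M = y M * (1 - (\<Sum>a\<in>?A. Jp a)) + (\<Sum>a\<in>?A. y M * Jp a)"
      by (simp add: right_diff_distrib sum_distrib_left)
    also have "(\<Sum>a\<in>?A. y M * Jp a) = (\<Sum>a\<in>?A. y M * Jp a * (1 - (\<Sum>l\<in>?A. Pp l)))
        + (\<Sum>a\<in>?A. \<Sum>l\<in>?A. y M * Jp a * Pp l)"
      by (simp add: right_diff_distrib sum_distrib_left sum_subtractf)
    finally have *: "y M = y M * (1 - (\<Sum>a\<in>?A. Jp a)) + ((\<Sum>a\<in>?A. y M * Jp a * (1 - (\<Sum>l\<in>?A. Pp l)))
        + (\<Sum>a\<in>?A. \<Sum>l\<in>?A. y M * Jp a * Pp l))" .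
    show ?thesis
      by (subst *) (intro nbhL_add nbhL_lmult LL_sum PJ_LE PP_LE M0 that)
  qed
  then show "\<exists>M. \<forall>n\<ge>M. y n \<in> LL N" by blast
qed

section \<open>Normal forms on joint eigenspaces of J and P\<close>

definition sa :: "nat \<Rightarrow> 'v ext_gen falg" where
  "sa n = cst (1 / (q ^ n - 1 / q ^ n)) * ext_emb (Osc k (- int n))"
definition sb :: "nat \<Rightarrow> 'v ext_gen falg" where
  "sb n = - (cst (1 / (q ^ n - 1 / q ^ n)) * ext_emb (Osc k (int n)))"

abbreviation OS :: "int \<Rightarrow> nat \<Rightarrow> 'v ext_gen falg" where "OS \<equiv> osc_exp sa sb"
abbreviation SS :: "nat \<Rightarrow> 'v ext_gen falg" where "SS \<equiv> screening q k"
abbreviation FF :: "('v \<times> complex) list \<Rightarrow> int \<Rightarrow> nat \<Rightarrow> 'v ext_gen falg" where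
  "FF \<equiv> nord_ext q Q k"
text \<open>On the eigenspace P = l the factors (c z)^(epsilon P) of the extended currents multiply
  to kap^l z^(l EE).\<close>

abbreviation kap :: "('v \<times> complex) list \<Rightarrow> complex" where
  "kap ps \<equiv> prod_list (map (\<lambda>(i, c). c powi eps Q i k) ps)"
abbreviation es :: "'v list \<Rightarrow> int" where "es is \<equiv> (\<Sum>i\<leftarrow>is. eps Q i k)"
abbreviation EE :: "('v \<times> complex) list \<Rightarrow> int" where "EE ps \<equiv> es (map fst ps)"
abbreviation OV :: "('v \<times> complex) list \<Rightarrow> int \<Rightarrow> nat \<Rightarrow> 'v ext_gen falg" where
  "OV ps \<equiv> osc_exp (crea ps) (anni ps)"

text \<open>The constant of the vertex \<open>k\<close> itself records $X_k e^{\hat q} = q^{-2} e^{\hat q} X_k$.\<close>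

definition shc :: "'v \<Rightarrow> complex" where
  "shc i = (if i = k then 1 / q ^ 2 else shift_const q Q k i)"

abbreviation CC :: "('v \<times> complex) list \<Rightarrow> complex" where "CC ps \<equiv> prod_list (map shc (map fst ps))"

lemma sa_lin: "sa n = lin (\<lambda>g. gen (Base g)) [(k, 1 / (q ^ n - 1 / q ^ n))] (- int n)"
  and sb_lin: "sb n = lin (\<lambda>g. gen (Base g)) [(k, - (1 / (q ^ n - 1 / q ^ n)))] (int n)"
  by (simp_all add: sa_def sb_def cst_uminus)

lemma creation_sa: "creation sa" and annihilation_sb: "annihilation sb"
  unfolding creation_def annihilation_def sa_lin sb_lin by blast+

lemma OS_commute: "(\<And>i n. z * ext_emb (Osc i n) \<approx> ext_emb (Osc i n) * z) \<Longrightarrow> z * OS n M \<approx> OS n M * z"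
  by (rule osc_exp_commute[OF _ creation_sa annihilation_sb])

lemma oo_commute: "(\<And>i n. z * ext_emb (Osc i n) \<approx> ext_emb (Osc i n) * z) \<Longrightarrow> z * OV ps n M \<approx> OV ps n M * z"
  by (rule osc_exp_commute[OF _ creation_crea annihilation_anni])

lemma Ei_Jp_osc: "Ei * Jp a * ext_emb (Osc i n) \<approx> ext_emb (Osc i n) * (Ei * Jp a)"
  by (intro commutes_mult Ei_osc Jp_osc)

lemma Jp_zm: "Jp (a + 2 * es is) * zm is \<approx> zm is * Jp a"
proof (induction "is" arbitrary: a)
  case (Cons i "is")
  let ?c = "cst (q powi (- (\<Sum>j\<leftarrow>is. eps Q i j)))"
  have "Jp (a + 2 * es (i # is)) * zm (i # is)
      = ?c * (Jp ((a + 2 * es is) + 2 * eps Q i k) * ext_emb (X i) * zm is)"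
    by (simp add: mult.assoc cst_comm_assoc[of "Jp _"] algebra_simps)
  also have "\<dots> \<approx> ?c * (ext_emb (X i) * Jp (a + 2 * es is) * zm is)"
    by (intro cg_lmult cg_rmult Jp_X)
  also have "\<dots> = ?c * (ext_emb (X i) * (Jp (a + 2 * es is) * zm is))" by (simp add: mult.assoc)
  also have "\<dots> \<approx> ?c * (ext_emb (X i) * (zm is * Jp a))" by (intro cg_lmult Cons)
  finally show ?case by (simp add: mult.assoc)
qed simp

lemma Pp_zm: "Pp l * zm is \<approx> zm is * Pp l"
proof (induction "is")
  case (Cons i "is")
  have "zm (i # is) * Pp l \<approx> Pp l * zm (i # is)"
    unfolding zero_mode.simps
    by (intro commutes_mult cg_sym[OF Pp_emb] cg_sym[OF Cons] cg_eq) (simp add: cst_comm)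
  then show ?case by (rule cg_sym)
qed simp

lemma Pp_VV: "Pp l * VV ps m M \<approx> VV ps m M * Pp l"
  unfolding nord_def
  by (rule cg_sym, intro commutes_mult cg_sym[OF Pp_zm] cg_sym[OF oo_commute] Pp_emb)

text \<open>For i = k the rule comes from X_k being a scalar on each eigenspace of J: e^(-q-hat)
  shifts J by one, which multiplies that scalar by q^2. This is why an idempotent stays in the
  statement.\<close>

lemma X_Ei_Jp: "ext_emb (X i) * Ei * Jp b \<approx> cst (1 / shc i) * (Ei * ext_emb (X i) * Jp b)"
proof (cases "i = k")
  case False
  then have "ext_emb (X i) * Ei \<approx> cst (1 / shc i) * (Ei * ext_emb (X i))"
    using X_Ei[OF False shift_nz[OF False]] by (simp add: shc_def)
  from cg_rmult[OF this, of "Jp b"] show ?thesis by (simp add: mult.assoc)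
next
  case True
  have "ext_emb (X k) * Ei * Jp b = ext_emb (X k) * (Ei * Jp ((b - 2) + 2))" by (simp add: mult.assoc)
  also have "\<dots> \<approx> ext_emb (X k) * (Jp (b - 2) * Ei)" by (intro cg_lmult cg_sym[OF Jp_Ei])
  also have "\<dots> = ext_emb (X k) * Jp (b - 2) * Ei" by (simp add: mult.assoc)
  also have "\<dots> \<approx> - (cst (q powi (- (b - 2))) * Jp (b - 2)) * Ei" by (intro cg_rmult Xk_Jp)
  also have "\<dots> = cst (- (q powi (- (b - 2)))) * (Jp (b - 2) * Ei)" by (simp add: cst_uminus mult.assoc)
  also have "\<dots> \<approx> cst (- (q powi (- (b - 2)))) * (Ei * Jp ((b - 2) + 2))" by (intro cg_lmult Jp_Ei)
  also have "\<dots> = cst (1 / shc k) * (Ei * - (cst (q powi (- b)) * Jp b))"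
  proof -
    have "q powi (- (b - 2)) = q ^ 2 * q powi (- b)"
      using q_nz power_int_add[of q 2 "- b"] by simp
    then show ?thesis by (simp add: shc_def cst_comm_assoc[of Ei] cst_cst cst_uminus)
  qed
  also have "\<dots> \<approx> cst (1 / shc k) * (Ei * (ext_emb (X k) * Jp b))"
    by (intro cg_lmult cg_sym[OF Xk_Jp])
  finally show ?thesis using True by (simp add: mult.assoc)
qed

lemma zm_Ei_Jp: "zm is * Ei * Jp a \<approx> cst (1 / prod_list (map shc is)) * (Ei * zm is * Jp a)"
proof (induction "is")
  case (Cons i "is")
  let ?c = "cst (q powi (- (\<Sum>j\<leftarrow>is. eps Q i j)))" and ?C = "prod_list (map shc is)"
  have "zm (i # is) * Ei * Jp a = ?c * (ext_emb (X i) * (zm is * Ei * Jp a))" by (simp add: mult.assoc)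
  also have "\<dots> \<approx> ?c * (ext_emb (X i) * (cst (1 / ?C) * (Ei * zm is * Jp a)))"
    by (intro cg_lmult Cons)
  also have "\<dots> = cst (1 / ?C) * (?c * (ext_emb (X i) * Ei * (zm is * Jp a)))"
    by (simp only: mult.assoc cst_comm_assoc[of "ext_emb _"] cst_comm_assoc[of ?c])
  \<comment> \<open>\<open>X_Ei_Jp\<close> needs an idempotent directly behind e^(-q-hat), so
    \<open>Jp a\<close> is carried to the left of the remaining zero modes with shifted index, and
    back afterwards.\<close>
  also have "\<dots> \<approx> cst (1 / ?C) * (?c * (ext_emb (X i) * Ei * (Jp (a + 2 * es is) * zm is)))"
    by (intro cg_lmult cg_sym[OF Jp_zm])
  also have "\<dots> = cst (1 / ?C) * (?c * (ext_emb (X i) * Ei * Jp (a + 2 * es is) * zm is))"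
    by (simp only: mult.assoc)
  also have "\<dots> \<approx> cst (1 / ?C) * (?c * (cst (1 / shc i) * (Ei * ext_emb (X i) * Jp (a + 2 * es is)) * zm is))"
    by (intro cg_lmult cg_rmult X_Ei_Jp)
  also have "\<dots> = cst (1 / ?C) * (?c * (cst (1 / shc i) * (Ei * ext_emb (X i) * (Jp (a + 2 * es is) * zm is))))"
    by (simp only: mult.assoc)
  also have "\<dots> \<approx> cst (1 / ?C) * (?c * (cst (1 / shc i) * (Ei * ext_emb (X i) * (zm is * Jp a))))"
    by (intro cg_lmult Jp_zm)
  also have "\<dots> = cst (1 / prod_list (map shc (i # is))) * (Ei * zm (i # is) * Jp a)"
    by (simp only: zero_mode.simps mult.assoc cst_comm_assoc[of Ei])
      (simp add: cst_cst mult_ac)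
  finally show ?case .
qed simp

text \<open>On the eigenspace J = a/2 a single summand of the charge is left. For even a the
  screening current has only half-integral powers of z there, and the charge is zero.\<close>

lemma SS_Jp:
  assumes "a \<in> {- int M..int M}"
  shows "SS M * Jp a \<approx> (if odd a then Ei * Jp a * OS ((a - 1) div 2) M else 0)"
proof -
  have S: "SS M = (\<Sum>b\<in>{- int M..int M}. if odd b then Ei * Jp b * OS ((b - 1) div 2) M else 0)"
    unfolding screening_def Psi_star_def sa_def[abs_def] sb_def[abs_def] by (intro sum.cong) auto
  have t: "Ei * Jp b * OS n M * Jp a \<approx> (if b = a then Ei * Jp a * OS n M else 0)" for b n
  proof -
    have "Ei * Jp b * OS n M * Jp a = Ei * Jp b * (OS n M * Jp a)" by (simp only: mult.assoc)
    also have "\<dots> \<approx> Ei * Jp b * (Jp a * OS n M)" by (intro cg_lmult cg_sym[OF OS_commute] Jp_osc)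
    also have "\<dots> = Ei * (Jp b * Jp a) * OS n M" by (simp only: mult.assoc)
    also have "\<dots> \<approx> Ei * (if b = a then Jp b else 0) * OS n M" by (intro cg_lmult cg_rmult Jp_Jp)
    finally show ?thesis by (auto split: if_splits)
  qed
  have "(if odd b then Ei * Jp b * OS ((b - 1) div 2) M else 0) * Jp a
      \<approx> (if b = a then (if odd a then Ei * Jp a * OS ((a - 1) div 2) M else 0) else 0)" for b
    using t[of b "(b - 1) div 2"] by (cases "b = a"; cases "odd b") auto
  then have "SS M * Jp a \<approx> (\<Sum>b\<in>{- int M..int M}. if b = a then (if odd a then Ei * Jp a * OS ((a - 1) div 2) M else 0) else 0)"
    unfolding S sum_distrib_right by (intro cg_sum)
  then show ?thesis using assms by simp
qed

lemma FF_Pp: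
  assumes "l \<in> {- int M..int M}"
  shows "FF ps m M * Pp l \<approx> cst (kap ps powi l) * (Pp l * VV ps (m - l * EE ps) M)"
proof -
  have E: "(\<Sum>(i, c)\<leftarrow>ps. eps Q i k) = EE ps"
    by (induction ps) auto
  have t: "cst c * Pp r * V * Pp l \<approx> (if r = l then cst c * (Pp l * V) else 0)"
    if V: "Pp l * V \<approx> V * Pp l" for c r V
  proof -
    have "cst c * Pp r * V * Pp l = cst c * (Pp r * (V * Pp l))" by (simp only: mult.assoc)
    also have "\<dots> \<approx> cst c * (Pp r * (Pp l * V))" by (intro cg_lmult cg_sym[OF V])
    also have "\<dots> = cst c * (Pp r * Pp l * V)" by (simp only: mult.assoc)
    also have "\<dots> \<approx> cst c * ((if r = l then Pp r else 0) * V)" by (intro cg_lmult cg_rmult Pp_Pp)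
    finally show ?thesis by (auto split: if_splits)
  qed
  have "FF ps m M * Pp l \<approx> (\<Sum>r\<in>{- int M..int M}. if r = l then cst (kap ps powi r) * (Pp l * VV ps (m - r * EE ps) M) else 0)"
    unfolding nord_ext_def E sum_distrib_right by (intro cg_sum t Pp_VV)
  then show ?thesis using assms by simp
qed

lemma Ei_Jp_OS_Pp: "Ei * Jp a * OS n M * Pp l \<approx> Pp (l - 1) * (Ei * Jp a * OS n M)"
proof -
  have "Ei * Jp a * OS n M * Pp l = Ei * Jp a * (OS n M * Pp l)" by (simp only: mult.assoc)
  also have "\<dots> \<approx> Ei * Jp a * (Pp l * OS n M)" by (intro cg_lmult cg_sym[OF OS_commute] Pp_emb)
  also have "\<dots> = Ei * (Jp a * Pp l) * OS n M" by (simp only: mult.assoc)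
  also have "\<dots> \<approx> Ei * (Pp l * Jp a) * OS n M" by (intro cg_lmult cg_rmult cg_sym[OF Pp_Jp])
  also have "\<dots> = Ei * Pp ((l - 1) + 1) * (Jp a * OS n M)" by (simp add: mult.assoc)
  also have "\<dots> \<approx> Pp (l - 1) * Ei * (Jp a * OS n M)" by (intro cg_rmult cg_sym[OF Pp_Ei])
  finally show ?thesis by (simp only: mult.assoc)
qed

text \<open>Both orders are brought to the same prefix, followed by oscillators. Here e^(-q-hat)
  acts first and the current sees P = l - 1; in \<open>SS_FF\<close> the current sees P = l, and the
  charge meets the eigenvalue of J shifted by EE.\<close>

lemma FF_SS:
  assumes r: "a \<in> {- int M..int M}" "l - 1 \<in> {- int M..int M}"
  shows "FF ps m M * SS M * Jp a * Pp l \<approx> (if odd a then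
    cst (kap ps powi (l - 1) / CC ps) * (Pp (l - 1) * Ei * ZZ ps * Jp a *
      (OV ps (m - (l - 1) * EE ps) M * OS ((a - 1) div 2) M)) else 0)"
proof -
  let ?o = "OV ps (m - (l - 1) * EE ps) M" and ?O = "OS ((a - 1) div 2) M" and ?k = "kap ps powi (l - 1)"
  have "FF ps m M * SS M * Jp a * Pp l = FF ps m M * (SS M * Jp a) * Pp l" by (simp only: mult.assoc)
  also have "\<dots> \<approx> FF ps m M * (if odd a then Ei * Jp a * ?O else 0) * Pp l"
    by (intro cg_lmult cg_rmult SS_Jp r)
  finally have 1: "FF ps m M * SS M * Jp a * Pp l \<approx> FF ps m M * (if odd a then Ei * Jp a * ?O else 0) * Pp l" .
  show ?thesis
  proof (cases "odd a")
    case True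
    then have "FF ps m M * SS M * Jp a * Pp l \<approx> FF ps m M * (Ei * Jp a * ?O) * Pp l" using 1 by simp
    also have "\<dots> = FF ps m M * (Ei * Jp a * ?O * Pp l)" by (simp only: mult.assoc)
    also have "\<dots> \<approx> FF ps m M * (Pp (l - 1) * (Ei * Jp a * ?O))" by (intro cg_lmult Ei_Jp_OS_Pp)
    also have "\<dots> = FF ps m M * Pp (l - 1) * (Ei * Jp a * ?O)" by (simp only: mult.assoc)
    also have "\<dots> \<approx> cst ?k * (Pp (l - 1) * VV ps (m - (l - 1) * EE ps) M) * (Ei * Jp a * ?O)"
      by (intro cg_rmult FF_Pp r)
    also have "\<dots> = cst ?k * (Pp (l - 1) * ZZ ps * (?o * (Ei * Jp a)) * ?O)"
      by (simp only: nord_def mult.assoc)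
    also have "\<dots> \<approx> cst ?k * (Pp (l - 1) * ZZ ps * ((Ei * Jp a) * ?o) * ?O)"
      by (intro cg_lmult cg_rmult cg_sym[OF oo_commute] Ei_Jp_osc)
    also have "\<dots> = cst ?k * (Pp (l - 1) * (ZZ ps * Ei * Jp a) * (?o * ?O))" by (simp only: mult.assoc)
    also have "\<dots> \<approx> cst ?k * (Pp (l - 1) * (cst (1 / CC ps) * (Ei * ZZ ps * Jp a)) * (?o * ?O))"
      by (intro cg_lmult cg_rmult zm_Ei_Jp)
    also have "\<dots> = cst (?k / CC ps) * (Pp (l - 1) * Ei * ZZ ps * Jp a * (?o * ?O))"
      by (simp only: mult.assoc cst_comm_assoc[of "Pp _"]) (simp add: cst_cst)
    finally show ?thesis using True by simp
  qed (use 1 in simp)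
qed

lemma SS_FF:
  assumes r: "a + 2 * EE ps \<in> {- int M..int M}" "l \<in> {- int M..int M}"
  shows "SS M * FF ps m M * Jp a * Pp l \<approx> (if odd a then
    cst (kap ps powi l) * (Pp (l - 1) * Ei * ZZ ps * Jp a *
      (OS ((a - 1) div 2 + EE ps) M * OV ps (m - l * EE ps) M)) else 0)"
proof -
  let ?a = "a + 2 * EE ps"
  let ?o = "OV ps (m - l * EE ps) M" and ?O = "OS ((a - 1) div 2 + EE ps) M" and ?k = "kap ps powi l"
  have n: "(b + 2 * e - 1) div 2 = (b - 1) div 2 + e" for b e :: int by presburger
  have SJ: "SS M * Jp ?a \<approx> (if odd ?a then Ei * Jp ?a * ?O else 0)"
    using SS_Jp[OF r(1)] unfolding n .
  have "SS M * FF ps m M * Jp a * Pp l = SS M * (FF ps m M * (Jp a * Pp l))" by (simp only: mult.assoc)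
  also have "\<dots> \<approx> SS M * (FF ps m M * (Pp l * Jp a))" by (intro cg_lmult cg_sym[OF Pp_Jp])
  also have "\<dots> = SS M * (FF ps m M * Pp l * Jp a)" by (simp only: mult.assoc)
  also have "\<dots> \<approx> SS M * (cst ?k * (Pp l * VV ps (m - l * EE ps) M) * Jp a)"
    by (intro cg_lmult cg_rmult FF_Pp r)
  also have "\<dots> = cst ?k * (SS M * (Pp l * (ZZ ps * (?o * Jp a))))"
    by (simp only: nord_def mult.assoc cst_comm_assoc[of "SS M"])
  also have "\<dots> \<approx> cst ?k * (SS M * (Pp l * (ZZ ps * (Jp a * ?o))))"
    by (intro cg_lmult cg_sym[OF oo_commute] Jp_osc)
  also have "\<dots> = cst ?k * (SS M * (Pp l * (ZZ ps * Jp a) * ?o))" by (simp only: mult.assoc)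
  also have "\<dots> \<approx> cst ?k * (SS M * (Pp l * (Jp ?a * ZZ ps) * ?o))"
    by (intro cg_lmult cg_rmult cg_sym[OF Jp_zm])
  also have "\<dots> = cst ?k * (SS M * ((Pp l * Jp ?a) * (ZZ ps * ?o)))" by (simp only: mult.assoc)
  also have "\<dots> \<approx> cst ?k * (SS M * ((Jp ?a * Pp l) * (ZZ ps * ?o)))"
    by (intro cg_lmult cg_rmult Pp_Jp)
  also have "\<dots> = cst ?k * ((SS M * Jp ?a) * (Pp l * (ZZ ps * ?o)))" by (simp only: mult.assoc)
  also have "\<dots> \<approx> cst ?k * ((if odd ?a then Ei * Jp ?a * ?O else 0) * (Pp l * (ZZ ps * ?o)))"
    by (intro cg_lmult cg_rmult SJ)
  finally have 1: "SS M * FF ps m M * Jp a * Pp l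
    \<approx> cst ?k * ((if odd ?a then Ei * Jp ?a * ?O else 0) * (Pp l * (ZZ ps * ?o)))" .
  show ?thesis
  proof (cases "odd a")
    case True
    then have "SS M * FF ps m M * Jp a * Pp l \<approx> cst ?k * ((Ei * Jp ?a * ?O) * (Pp l * (ZZ ps * ?o)))"
      using 1 by simp
    also have "\<dots> = cst ?k * ((Ei * Jp ?a * ?O * Pp l) * (ZZ ps * ?o))" by (simp only: mult.assoc)
    also have "\<dots> \<approx> cst ?k * ((Pp (l - 1) * (Ei * Jp ?a * ?O)) * (ZZ ps * ?o))"
      by (intro cg_lmult cg_rmult Ei_Jp_OS_Pp)
    also have "\<dots> = cst ?k * (Pp (l - 1) * Ei * Jp ?a * (?O * ZZ ps) * ?o)" by (simp only: mult.assoc)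
    also have "\<dots> \<approx> cst ?k * (Pp (l - 1) * Ei * Jp ?a * (ZZ ps * ?O) * ?o)"
      by (intro cg_lmult cg_rmult cg_sym[OF OS_commute] zm_osc)
    also have "\<dots> = cst ?k * (Pp (l - 1) * Ei * (Jp ?a * ZZ ps) * (?O * ?o))" by (simp only: mult.assoc)
    also have "\<dots> \<approx> cst ?k * (Pp (l - 1) * Ei * (ZZ ps * Jp a) * (?O * ?o))"
      by (intro cg_lmult cg_rmult Jp_zm)
    finally show ?thesis using True by (simp add: mult.assoc)
  qed (use 1 in simp)
qed

text \<open>Contraction of the current at z with the screening current at w, \<open>contrS\<close>
  in this order and \<open>contrT\<close> in the opposite one. Denominator and sign are those in the
  exponents of the screening current, whose annihilators enter with a minus sign.\<close>

definition contrS :: "('v \<times> complex) list \<Rightarrow> (nat \<Rightarrow> complex) \<Rightarrow> bool" where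
  "contrS ps c \<longleftrightarrow> ctr_seq (\<lambda>n. (\<Sum>(i, u)\<leftarrow>ps. Cmat_pow n q Q i k / u ^ n) / (q ^ n - 1 / q ^ n)) c"

definition contrT :: "('v \<times> complex) list \<Rightarrow> (nat \<Rightarrow> complex) \<Rightarrow> bool" where
  "contrT ps c \<longleftrightarrow> ctr_seq (\<lambda>n. - (\<Sum>(i, u)\<leftarrow>ps. u ^ n * Cmat_pow n q Q k i) / (q ^ n - 1 / q ^ n)) c"

abbreviation WS where "WS ps \<equiv> Wp (crea ps) (anni ps) sa sb"

lemma oo_OS:
  assumes "contrS ps c"
  shows "(\<lambda>M. OV ps m M * OS n M) \<sim> WS ps (extz c) m n"
proof (rule osc_product[OF creation_crea creation_sa annihilation_anni annihilation_sb])
  let ?g = "\<lambda>n. (\<Sum>(i, u)\<leftarrow>ps. Cmat_pow n q Q i k / u ^ n) / (q ^ n - 1 / q ^ n) / of_nat n"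
  show "ctr_seq (\<lambda>n. of_nat n * ?g n) c"
    by (rule ctr_seq_cong[OF assms[unfolded contrS_def]]) simp
  fix r s :: nat assume "r > 0"
  have "(\<Sum>(i, c)\<leftarrow>map (\<lambda>(i, c). (i, 1 / c ^ r)) ps. \<Sum>(j, d)\<leftarrow>[(k, 1 / (q ^ r - 1 / q ^ r))]. c * d * Cmat_pow r q Q i j)
      = (\<Sum>(i, u)\<leftarrow>ps. Cmat_pow r q Q i k / u ^ r) / (q ^ r - 1 / q ^ r)"
    by (induction ps) (auto simp: add_divide_distrib)
  then show "anni ps r * sa s \<approx> sa s * anni ps r + cst (if s = r then ?g r else 0)"
    using lin_bracket[OF \<open>r > 0\<close>, of "map (\<lambda>(i, c). (i, 1 / c ^ r)) ps" "[(k, 1 / (q ^ s - 1 / q ^ s))]" s]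
    unfolding anni_lin sa_lin by (cases "s = r") auto
qed

lemma OS_oo:
  assumes "contrT ps c"
  shows "(\<lambda>M. OS n M * OV ps m M) \<sim> WS ps (\<lambda>s. extz c (- s)) m n"
proof -
  have "(\<lambda>M. OS n M * OV ps m M) \<sim> Wp sa sb (crea ps) (anni ps) (extz c) n m"
  proof (rule osc_product[OF creation_sa creation_crea annihilation_sb annihilation_anni])
    let ?g = "\<lambda>n. - (\<Sum>(i, u)\<leftarrow>ps. u ^ n * Cmat_pow n q Q k i) / (q ^ n - 1 / q ^ n) / of_nat n"
    show "ctr_seq (\<lambda>n. of_nat n * ?g n) c"
      by (rule ctr_seq_cong[OF assms[unfolded contrT_def]]) simp
    fix r s :: nat assume "r > 0"
    have "(\<Sum>(j, d)\<leftarrow>map (\<lambda>(i, c). (i, c ^ r)) ps. - (1 / x) * d * Cmat_pow r q Q k j)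
        = - (\<Sum>(i, u)\<leftarrow>ps. u ^ r * Cmat_pow r q Q k i) / x" for x
      by (induction ps) (auto simp: add_divide_distrib diff_divide_distrib)
    then show "sb r * crea ps s \<approx> crea ps s * sb r + cst (if s = r then ?g r else 0)"
      using lin_bracket[OF \<open>r > 0\<close>, of "[(k, - (1 / (q ^ r - 1 / q ^ r)))]" "map (\<lambda>(i, c). (i, c ^ s)) ps" s]
      unfolding crea_lin sb_lin by (cases "s = r") auto
  qed
  also have "\<dots> \<sim> WS ps (\<lambda>s. extz c (- s)) m n"
    by (intro sim_I Wp_swap creation_commuting annihilation_commuting creation_crea creation_sa
        annihilation_anni annihilation_sb)
  finally show ?thesis .
qed

text \<open>With \<sigma> = 1 for anticommutators and -1 for commutators, the bracket has the scalar
  series c(x)/CC + \<sigma> kap x^(-EE) c'(1/x), where x = w/z. The factor 1/CC comes from moving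
  e^(-q-hat) past the zero modes, kap from the different values of P, and x^(-EE) from the shifts of
  P and J.\<close>

lemma screening_local:
  assumes c: "contrS ps c" "contrT ps c'" and kap: "kap ps \<noteq> 0"
  shows "(\<lambda>M. (FF ps m M * SS M + cst \<sigma> * (SS M * FF ps m M)) * Jp a * Pp l)
    \<sim> (\<lambda>M. if odd a then Pp (l - 1) * Ei * ZZ ps * Jp a * (cst (kap ps powi (l - 1)) *
        WS ps (\<lambda>s. 1 / CC ps * extz c s + \<sigma> * kap ps * extz c' (- s - EE ps)) (m - (l - 1) * EE ps) ((a - 1) div 2) M) else 0)"
proof -
  let ?m = "m - (l - 1) * EE ps" and ?n = "(a - 1) div 2" and ?k = "kap ps powi (l - 1)"
  let ?Z = "Pp (l - 1) * Ei * ZZ ps * Jp a"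
  have dist: "(x + cst \<sigma> * y) * z * w = x * z * w + cst \<sigma> * (y * z * w)" for x y z w :: "'v ext_gen falg"
    by (simp only: distrib_right mult.assoc)
  have "(\<lambda>M. (FF ps m M * SS M + cst \<sigma> * (SS M * FF ps m M)) * Jp a * Pp l)
    \<sim> (\<lambda>M. (if odd a then cst (?k / CC ps) * (?Z * (OV ps ?m M * OS ?n M)) else 0)
        + cst \<sigma> * (if odd a then cst (kap ps powi l) * (?Z * (OS (?n + EE ps) M * OV ps (m - l * EE ps) M)) else 0))"
    unfolding dist
  proof (rule sim_eventually, intro cg_add cg_lmult FF_SS SS_FF)
    fix M assume "nat (\<bar>a\<bar> + 2 * \<bar>EE ps\<bar> + \<bar>l\<bar> + 1) \<le> M"
    then show "a \<in> {- int M..int M}" "l - 1 \<in> {- int M..int M}" "a + 2 * EE ps \<in> {- int M..int M}"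
      "l \<in> {- int M..int M}" by auto
  qed
  also have "\<dots> \<sim> (\<lambda>M. if odd a then ?Z * (cst ?k *
        WS ps (\<lambda>s. 1 / CC ps * extz c s + \<sigma> * kap ps * extz c' (- s - EE ps)) ?m ?n M) else 0)"
  proof (cases "odd a")
    case True
    have "(\<lambda>M. cst (?k / CC ps) * (?Z * (OV ps ?m M * OS ?n M))
        + cst \<sigma> * (cst (kap ps powi l) * (?Z * (OS (?n + EE ps) M * OV ps (m - l * EE ps) M))))
      \<sim> (\<lambda>M. cst (?k / CC ps) * (?Z * WS ps (extz c) ?m ?n M)
        + cst \<sigma> * (cst (kap ps powi l) * (?Z * WS ps (\<lambda>s. extz c' (- s)) (m - l * EE ps) (?n + EE ps) M)))"
      by (intro sim_add sim_lmult oo_OS OS_oo c)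
    also have "\<dots> = (\<lambda>M. ?Z * (cst ?k *
        WS ps (\<lambda>s. 1 / CC ps * extz c s + \<sigma> * kap ps * extz c' (- s - EE ps)) ?m ?n M))"
    proof
      fix M
      have sh: "WS ps (\<lambda>s. extz c' (- s)) (m - l * EE ps) (?n + EE ps) = WS ps (\<lambda>s. extz c' (- s - EE ps)) ?m ?n"
      proof -
        have "m - l * EE ps = ?m + (- EE ps)" "?n + EE ps = ?n - (- EE ps)" "\<And>s. - (s - - EE ps) = - s - EE ps"
          by (simp_all add: algebra_simps)
        then show ?thesis by (simp only: Wp_shift[symmetric])
      qed
      have kl: "kap ps powi l = ?k * kap ps"
        using power_int_add_1[of "kap ps" "l - 1"] kap by simp
      have R: "cst (?k / CC ps) = cst ?k * cst (1 / CC ps)" "cst \<sigma> * (cst (kap ps powi l) * x) = cst ?k * (cst (\<sigma> * kap ps) * x)"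
        for x by (simp_all add: kl cst_cst cst_mult[symmetric] mult_ac)
      show "cst (?k / CC ps) * (?Z * WS ps (extz c) ?m ?n M)
        + cst \<sigma> * (cst (kap ps powi l) * (?Z * WS ps (\<lambda>s. extz c' (- s)) (m - l * EE ps) (?n + EE ps) M))
        = ?Z * (cst ?k *
        WS ps (\<lambda>s. 1 / CC ps * extz c s + \<sigma> * kap ps * extz c' (- s - EE ps)) ?m ?n M)"
        unfolding sh Wp_add Wp_cmult R
        by (simp only: distrib_left cst_comm_assoc[of ?Z] mult.assoc[of "cst ?k"])
    qed
    finally show ?thesis using True by simp
  qed simp
  finally show ?thesis .
qed

lemma screening_single:
  assumes c: "contrS ps c" "contrT ps c'" and kap: "kap ps \<noteq> 0"
    and z: "\<And>s. 1 / CC ps * extz c s + \<sigma> * kap ps * extz c' (- s - EE ps) = 0"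
  shows "null (\<lambda>M. FF ps m M * SS M + cst \<sigma> * (SS M * FF ps m M))"
proof (rule null_local)
  fix a l
  show "null (\<lambda>M. (FF ps m M * SS M + cst \<sigma> * (SS M * FF ps m M)) * Jp a * Pp l)"
    using screening_local[OF c kap, of m \<sigma> a l] unfolding z
    by (simp add: Wp_def sim_0_iff cong: if_cong)
qed

section \<open>Convergence of the extended currents and of the charge\<close>

lemma osc_exp_step:
  assumes "annihilation b" "N \<le> M"
  shows "osc_exp a b m M - osc_exp a b m N \<in> LL N"
proof -
  have "osc_exp a b m M - osc_exp a b m N = (\<Sum>j\<in>{..M} - {..N}. ez a (m + int j) * exp_coeff b j)"
    unfolding osc_exp_eq using assms(2) by (intro sum_diff[symmetric]) auto
  also have "\<dots> \<in> LL N" by (intro LL_sum exp_coeff_LL assms) auto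
  finally show ?thesis .
qed

text \<open>Both the range of idempotents and the truncation of each summand grow with M;
  \<open>far\<close> controls the first and \<open>step\<close> the second.\<close>

lemma cauchy_symmetric_sum:
  fixes g :: "int \<Rightarrow> nat \<Rightarrow> 'v ext_gen falg"
  assumes far: "\<And>a N M. a \<notin> {- int N..int N} \<Longrightarrow> g a M \<in> LL N"
    and step: "\<And>a N M. N \<le> M \<Longrightarrow> g a M - g a N \<in> LL N"
  shows "cauchy (\<lambda>M. \<Sum>a\<in>{- int M..int M}. g a M)"
  unfolding cauchy_def
proof (intro allI exI[of _ "N" for N] impI)
  fix N m n :: nat assume mn: "N \<le> m" "N \<le> n"
  let ?f = "\<lambda>M. \<Sum>a\<in>{- int M..int M}. g a M"
  have part: "?f M - ?f N \<in> LL N" if "N \<le> M" for M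
  proof -
    have "?f M = (\<Sum>a\<in>{- int M..int M} - {- int N..int N}. g a M) + (\<Sum>a\<in>{- int N..int N}. g a M)"
      using that by (intro sum.subset_diff) auto
    then have "?f M - ?f N = (\<Sum>a\<in>{- int M..int M} - {- int N..int N}. g a M) + (\<Sum>a\<in>{- int N..int N}. g a M - g a N)"
      by (simp add: sum_subtractf)
    also have "\<dots> \<in> LL N" by (intro nbhL_add LL_sum far step that) auto
    finally show ?thesis .
  qed
  show "?f m - ?f n \<in> LL N" using nbhL_diff[OF part[OF mn(1)] part[OF mn(2)]] by simp
qed

lemma Jp_far: "a \<notin> {- int N..int N} \<Longrightarrow> Jp a \<in> LL N"
  by (rule idempotent_far[where P = Jp and L = LL and N = N, OF Jp_Jp PJ_LE])
    (auto intro: nbhL_lmult nbhL_cong)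

lemma Pp_far: "a \<notin> {- int N..int N} \<Longrightarrow> Pp a \<in> LL N"
  by (rule idempotent_far[where P = Pp and L = LL and N = N, OF Pp_Pp PP_LE])
    (auto intro: nbhL_lmult nbhL_cong)

lemma cauchy_FF: "cauchy (FF ps m)"
  unfolding nord_ext_def
proof (rule cauchy_symmetric_sum)
  fix l N M
  let ?c = "cst (kap ps powi l)" and ?m = "m - l * (\<Sum>(i, c)\<leftarrow>ps. eps Q i k)"
  show "?c * Pp l * VV ps ?m M \<in> LL N" if "l \<notin> {- int N..int N}"
  proof -
    have "?c * Pp l * VV ps ?m M = ?c * (Pp l * VV ps ?m M)" by (simp only: mult.assoc)
    also have "\<dots> \<approx> ?c * (VV ps ?m M * Pp l)" by (intro cg_lmult Pp_VV)
    finally show ?thesis by (rule nbhL_cong) (intro nbhL_lmult Pp_far that)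
  qed
  show "?c * Pp l * VV ps ?m M - ?c * Pp l * VV ps ?m N \<in> LL N" if "N \<le> M"
    unfolding nord_def right_diff_distrib[symmetric]
    by (intro nbhL_lmult osc_exp_step annihilation_anni that)
qed

lemma cauchy_SS: "cauchy SS"
proof -
  have S: "SS = (\<lambda>M. \<Sum>b\<in>{- int M..int M}. if odd b then Ei * Jp b * OS ((b - 1) div 2) M else 0)"
    unfolding screening_def Psi_star_def sa_def[abs_def] sb_def[abs_def]
    by (rule ext, intro sum.cong) auto
  show ?thesis
    unfolding S
  proof (rule cauchy_symmetric_sum)
    fix b N M
    show "(if odd b then Ei * Jp b * OS ((b - 1) div 2) M else 0) \<in> LL N" if "b \<notin> {- int N..int N}"
    proof -
      have "Ei * Jp b * OS ((b - 1) div 2) M = Ei * (Jp b * OS ((b - 1) div 2) M)" by (simp only: mult.assoc)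
      also have "\<dots> \<approx> Ei * (OS ((b - 1) div 2) M * Jp b)" by (intro cg_lmult OS_commute Jp_osc)
      finally have "Ei * Jp b * OS ((b - 1) div 2) M \<in> LL N"
        by (rule nbhL_cong) (intro nbhL_lmult Jp_far that)
      then show ?thesis by simp
    qed
    show "(if odd b then Ei * Jp b * OS ((b - 1) div 2) M else 0)
        - (if odd b then Ei * Jp b * OS ((b - 1) div 2) N else 0) \<in> LL N" if "N \<le> M"
      using nbhL_lmult[OF osc_exp_step[OF annihilation_sb that], of "Ei * Jp b" sa "(b - 1) div 2"]
      by (simp add: right_diff_distrib)
  qed
qed

lemma exp_coeff_cong:
  fixes y z :: "nat \<Rightarrow> 'v ext_gen falg"
  assumes "\<And>k. k > 0 \<Longrightarrow> y k = z k"
  shows "exp_coeff y m = exp_coeff z m"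
proof -
  have "Abs_fps (\<lambda>n. if n = 0 then 0 else y n) = Abs_fps (\<lambda>n. if n = 0 then 0 else z n)"
    by (rule fps_ext) (simp add: assms)
  then show ?thesis by (simp only: exp_coeff_def)
qed

lemma osc_exp_scale:
  assumes "r \<noteq> 0" "\<And>k. k > 0 \<Longrightarrow> a' k = cst (r ^ k) * a k" "\<And>k. k > 0 \<Longrightarrow> b' k = cst ((1 / r) ^ k) * b k"
  shows "osc_exp a' b' m M = cst (r powi m) * (osc_exp a b m M :: 'v ext_gen falg)"
  unfolding osc_exp_eq sum_distrib_left
proof (intro sum.cong refl)
  fix j
  have ea: "exp_coeff a' i = cst (r ^ i) * exp_coeff a i" for i
    using exp_coeff_cong[of a' "\<lambda>k. cst (r ^ k) * a k" i] assms(2) by (simp add: exp_coeff_scale)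
  have eb: "exp_coeff b' i = cst ((1 / r) ^ i) * exp_coeff b i" for i
    using exp_coeff_cong[of b' "\<lambda>k. cst ((1 / r) ^ k) * b k" i] assms(3) exp_coeff_scale by metis
  show "ez a' (m + int j) * exp_coeff b' j = cst (r powi m) * (ez a (m + int j) * exp_coeff b j)"
  proof (cases "m + int j \<ge> 0")
    case True
    have "r powi m = r powi (m + int j) * (1 / r) ^ j"
      using assms(1) by (simp add: power_int_add power_one_over)
    also have "r powi (m + int j) = r ^ nat (m + int j)"
      using True by (simp add: power_int_def)
    finally have *: "cst (r powi m) = cst (r ^ nat (m + int j)) * cst ((1 / r) ^ j)"
      by (simp only: cst_mult)
    show ?thesis
      unfolding ez_def ea eb * using True
      by (simp only: if_True mult.assoc cst_comm_assoc[of "exp_coeff _ _"])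
  qed (simp add: ez_neg)
qed

text \<open>Here the two anticommutators are delta functions supported at $w = qz$ and at $w = q^{-1}z$;
  they cancel because $:X_k(z)\Psi^*_k(q^{-1}z):$ is proportional to $\Psi^*_k(qz)$.\<close>

lemma screening_pair:
  assumes j: "j \<noteq> k" "eps Q j k = 1" "shift_const q Q k j = q"
    and c1: "contrS [(j, 1)] (ratio 0 (1 / q))" "contrT [(j, 1)] (ratio 0 q)"
    and c2: "contrS [(j, 1), (k, 1)] (ratio 0 q)" "contrT [(j, 1), (k, 1)] (ratio 0 (1 / q))"
  shows "null (\<lambda>M. (FF [(j, 1)] m M + FF [(j, 1), (k, 1)] m M) * SS M
      + SS M * (FF [(j, 1)] m M + FF [(j, 1), (k, 1)] m M))"
proof (rule null_local)
  let ?p = "[(j, 1 :: complex)]" and ?p' = "[(j, 1 :: complex), (k, 1)]"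
  fix a l :: int
  define m' n where "m' = m - (l - 1)" and "n = (a - 1) div 2"
  have ekk: "eps Q k k = 0" by (simp add: eps_def)
  have ext: "extz (ratio 0 b) s = (if s \<ge> 0 then b powi s else 0)" for b s
  proof (cases "s \<ge> 0")
    case True
    then obtain t where "s = int t" using nonneg_int_cases by blast
    moreover have "ratio 0 b t = b ^ t" by (cases t) (simp_all add: ratio_def)
    ultimately show ?thesis by (simp add: extz_def)
  qed (simp add: extz_def)
  have inv: "(1 / q) powi s = q powi (- s)" for s
    by (simp only: inverse_eq_divide[symmetric] power_int_inverse power_int_minus)
  \<comment> \<open>One-sided geometric series in x and in 1/x. As EE = 1, the second one starts at
    s = -1, so the two meet without overlap and form a full delta function; likewise in
    \<open>d2\<close>.\<close>
  have d1: "extz (ratio 0 (1 / q)) s / q + extz (ratio 0 q) (- s - 1) = (1 / q) powi s / q" for s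
    using power_int_add[of q "- s" "- 1"] q_nz
    by (auto simp: ext inv power_int_minus[of q 1] inverse_eq_divide)
  have d2: "q * extz (ratio 0 q) s + extz (ratio 0 (1 / q)) (- s - 1) = q * q powi s" for s
    using power_int_add[of q 1 s] q_nz by (auto simp: ext inv)
  note loc = screening_local[OF c1, where \<sigma> = 1 and m = m and a = a and l = l]
    screening_local[OF c2, where \<sigma> = 1 and m = m and a = a and l = l]
  have l1: "(\<lambda>M. (FF ?p m M * SS M + SS M * FF ?p m M) * Jp a * Pp l)
      \<sim> (\<lambda>M. if odd a then Pp (l - 1) * Ei * ZZ ?p * Jp a * (cst (1 / q) * WS ?p (\<lambda>s. (1 / q) powi s) m' n M) else 0)"
    using loc(1) unfolding Wp_cmult[symmetric] m'_def n_def
    by (simp add: j shc_def ekk d1 cong: if_cong)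
  have l2: "(\<lambda>M. (FF ?p' m M * SS M + SS M * FF ?p' m M) * Jp a * Pp l)
      \<sim> (\<lambda>M. if odd a then Pp (l - 1) * Ei * ZZ ?p' * Jp a * (cst q * WS ?p' (\<lambda>s. q powi s) m' n M) else 0)"
    using loc(2) q_nz unfolding Wp_cmult[symmetric] m'_def n_def
    by (simp add: j shc_def ekk d2 power2_eq_square cong: if_cong)
  let ?A = "\<lambda>i. cst ((1 / q) ^ i) * crea ?p i + sa i" and ?B = "\<lambda>i. cst (1 / (1 / q) ^ i) * anni ?p i + sb i"
  let ?A' = "\<lambda>i. cst (q ^ i) * crea ?p' i + sa i" and ?B' = "\<lambda>i. cst (1 / q ^ i) * anni ?p' i + sb i"
  \<comment> \<open>Writing S for the screening current, the oscillators of :X_j(qw) X_k(qw) S(w):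
    are those of :X_j(w/q) S(w): at q^2 w, because q^i + 1/(q^i - q^(-i)) = q^(2i)/(q^i -
    q^(-i)).\<close>
  have merge: "osc_exp ?A' ?B' r M = cst ((q ^ 2) powi r) * osc_exp ?A ?B r M" for r M
  proof (rule osc_exp_scale)
    fix i :: nat assume i: "i > 0"
    let ?P = "q ^ i"
    have P: "?P \<noteq> 0" "?P * ?P - 1 \<noteq> 0" using q_nz q_generic[OF i] by (auto simp: field_simps)
    have e1: "?P + 1 / (?P - 1 / ?P) = ?P ^ 2 / (?P - 1 / ?P)"
      using P q_generic[OF i] by (simp add: divide_simps power2_eq_square)
    have e2: "1 / ?P - 1 / (?P - 1 / ?P) = - (1 / ?P ^ 2 / (?P - 1 / ?P))"
      using P q_generic[OF i] by (simp add: divide_simps power2_eq_square)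
    have q2: "(q ^ 2) ^ i = ?P ^ 2" by (simp add: power_mult[symmetric] mult.commute)
    have "?A' i = cst ?P * ext_emb (Osc j (- int i)) + cst (?P + 1 / (?P - 1 / ?P)) * ext_emb (Osc k (- int i))"
      by (simp add: sa_def distrib_left cst_add distrib_right add.assoc)
    also have "\<dots> = cst ((q ^ 2) ^ i) * ?A i"
      unfolding e1 q2 using P by (simp add: sa_def distrib_left cst_cst power_one_over power2_eq_square)
    finally show "?A' i = cst ((q ^ 2) ^ i) * ?A i" .
    have "?B' i = cst (1 / ?P) * ext_emb (Osc j (int i)) + cst (1 / ?P - 1 / (?P - 1 / ?P)) * ext_emb (Osc k (int i))"
      by (simp add: sb_def distrib_left cst_diff left_diff_distrib)
    also have "\<dots> = cst ((1 / q ^ 2) ^ i) * ?B i"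
      unfolding e2 power_one_over q2 using P
      by (simp add: sb_def distrib_left right_diff_distrib cst_cst cst_uminus power_one_over power2_eq_square)
    finally show "?B' i = cst ((1 / q ^ 2) ^ i) * ?B i" .
  qed (use q_nz in simp)
  show "null (\<lambda>M. ((FF ?p m M + FF ?p' m M) * SS M + SS M * (FF ?p m M + FF ?p' m M)) * Jp a * Pp l)"
  proof (cases "odd a")
    case False
    then show ?thesis using sim_add[OF l1 l2] by (simp add: sim_0_iff algebra_simps)
  next
    case True
    then have a: "a = 2 * n + 1" by (simp add: n_def)
    let ?Y = "Pp (l - 1) * Ei * ext_emb (X j) * Jp a" and ?O = "osc_exp ?A ?B (m' + n)"
    have Z1: "Pp (l - 1) * Ei * ZZ ?p * Jp a = ?Y" by (simp add: mult.assoc)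
    \<comment> \<open>On \<open>Jp a\<close> the zero mode X_k is the scalar -q^(-a), and normal
      ordering with X_j costs another 1/q. The minus sign is the one that makes the two delta terms
      cancel.\<close>
    have Z2: "Pp (l - 1) * Ei * ZZ ?p' * Jp a \<approx> cst (- (q powi (- 1 - a))) * ?Y"
    proof -
      have "Pp (l - 1) * Ei * ZZ ?p' * Jp a
          = cst (1 / q) * (Pp (l - 1) * Ei * ext_emb (X j) * (ext_emb (X k) * Jp a))"
        using j by (simp add: mult.assoc cst_comm_assoc[of "Pp _"] cst_comm_assoc[of Ei] power_int_minus inverse_eq_divide)
      also have "\<dots> \<approx> cst (1 / q) * (Pp (l - 1) * Ei * ext_emb (X j) * (- (cst (q powi (- a)) * Jp a)))"
        by (intro cg_lmult Xk_Jp)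
      also have "\<dots> = cst (- (1 / q * q powi (- a))) * ?Y"
        by (simp only: mult_minus_right cst_comm_assoc[of "Pp _"] cst_comm_assoc[of Ei] cst_comm_assoc[of "ext_emb _"]
            cst_cst cst_uminus mult_minus_left mult.assoc)
      also have "1 / q * q powi (- a) = q powi (- 1 - a)"
        using q_nz power_int_add[of q "- 1" "- a"] by (simp add: power_int_minus inverse_eq_divide)
      finally show ?thesis .
    qed
    have w1: "WS ?p (\<lambda>s. (1 / q) powi s) m' n \<sim> (\<lambda>M. cst ((1 / q) powi (- m')) * ?O M)"
      using q_nz by (intro Wp_merge creation_crea creation_sa annihilation_anni annihilation_sb) simp
    have w2: "WS ?p' (\<lambda>s. q powi s) m' n \<sim> (\<lambda>M. cst (q powi (- m')) * (cst ((q ^ 2) powi (m' + n)) * ?O M))"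
      using Wp_merge[OF creation_crea[of ?p'] creation_sa annihilation_anni[of ?p'] annihilation_sb q_nz, of m' n]
      unfolding merge .
    have "(\<lambda>M. ((FF ?p m M + FF ?p' m M) * SS M + SS M * (FF ?p m M + FF ?p' m M)) * Jp a * Pp l)
      = (\<lambda>M. (FF ?p m M * SS M + SS M * FF ?p m M) * Jp a * Pp l + (FF ?p' m M * SS M + SS M * FF ?p' m M) * Jp a * Pp l)"
      by (simp only: distrib_left distrib_right add_ac)
    also have "\<dots> \<sim> (\<lambda>M. ?Y * (cst (1 / q) * WS ?p (\<lambda>s. (1 / q) powi s) m' n M)
        + Pp (l - 1) * Ei * ZZ ?p' * Jp a * (cst q * WS ?p' (\<lambda>s. q powi s) m' n M))"
      using sim_add[OF l1 l2] True unfolding Z1 by simp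
    also have "\<dots> \<sim> (\<lambda>M. ?Y * (cst (1 / q) * WS ?p (\<lambda>s. (1 / q) powi s) m' n M)
        + cst (- (q powi (- 1 - a))) * ?Y * (cst q * WS ?p' (\<lambda>s. q powi s) m' n M))"
      by (intro sim_I cg_add cg_refl cg_rmult Z2)
    also have "\<dots> \<sim> (\<lambda>M. ?Y * (cst (1 / q) * (cst ((1 / q) powi (- m')) * ?O M))
        + cst (- (q powi (- 1 - a))) * ?Y * (cst q * (cst (q powi (- m')) * (cst ((q ^ 2) powi (m' + n)) * ?O M))))"
      by (intro sim_add sim_lmult w1 w2)
    also have "\<dots> = (\<lambda>M. 0)"
    proof
      fix M
      have "(1 / q) powi (- m') = q powi m'"
        by (simp only: inverse_eq_divide[symmetric] power_int_inverse power_int_minus inverse_inverse_eq)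
      then have 1: "1 / q * (1 / q) powi (- m') = q powi (- 1 + m')"
        using q_nz by (subst power_int_add) (auto simp: power_int_minus inverse_eq_divide)
      have "(q ^ 2) powi (m' + n) = q powi (2 * (m' + n))" using power_int_mult[of q 2 "m' + n"] by simp
      then have 2: "q powi (- 1 - a) * (q * (q powi (- m') * (q ^ 2) powi (m' + n)))
          = q powi (- 1 - a) * (q powi 1 * (q powi (- m') * q powi (2 * (m' + n))))" by simp
      also have "\<dots> = q powi (- 1 + m')"
        unfolding power_int_add[OF disjI1[OF q_nz], symmetric] by (simp add: a)
      finally have 3: "q powi (- 1 - a) * (q * (q powi (- m') * (q ^ 2) powi (m' + n))) = q powi (- 1 + m')" .
      have "?Y * (cst (1 / q) * (cst ((1 / q) powi (- m')) * ?O M)) = cst (1 / q * (1 / q) powi (- m')) * (?Y * ?O M)"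
        by (simp only: cst_cst cst_comm_assoc[of ?Y])
      moreover have "cst (- (q powi (- 1 - a))) * ?Y * (cst q * (cst (q powi (- m')) * (cst ((q ^ 2) powi (m' + n)) * ?O M)))
          = - (cst (q powi (- 1 - a) * (q * (q powi (- m') * (q ^ 2) powi (m' + n)))) * (?Y * ?O M))"
        unfolding mult.assoc[of "cst (- (q powi (- 1 - a)))"]
        by (simp only: cst_cst cst_comm_assoc[of ?Y] cst_uminus mult_minus_left)
      ultimately show "?Y * (cst (1 / q) * (cst ((1 / q) powi (- m')) * ?O M))
        + cst (- (q powi (- 1 - a))) * ?Y * (cst q * (cst (q powi (- m')) * (cst ((q ^ 2) powi (m' + n)) * ?O M))) = 0"
        unfolding 1 3 by simp
    qed
    finally show ?thesis unfolding sim_0_iff .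
  qed
qed

end

lemma free_field_expand:
  fixes V :: "(vertex \<times> complex) list \<Rightarrow> int \<Rightarrow> nat \<Rightarrow> 'g falg"
  shows "free_field V q2 q3 q h CurE m N = cst (1 / (q - 1 / q)) * (V [(V0, 1)] m N + V [(V0, 1), (V1, 1)] m N)"
    "free_field V q2 q3 q h CurF m N
      = cst (- (1 / (q - 1 / q) * (q ^ 2 * h ^ 2) powi m)) * (V [(V3, 1)] m N + V [(V3, 1), (V2, 1)] m N)"
    "free_field V q2 q3 q h CurPsiM m N = cst ((1 / h) powi m) * V [(V0, 1), (V1, 1), (V3, q3)] m N"
    "free_field V q2 q3 q h CurPsiP m N = cst ((q ^ 2 * h) powi m) * V [(V3, 1), (V2, 1), (V0, 1 / q2)] m N"
proof -
  have S: "Sigma_path V (path_plus q3) m N = V [(V0, 1)] m N + V [(V0, 1), (V1, 1)] m N"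
    "Sigma_path V (path_minus q2) m N = V [(V3, 1)] m N + V [(V3, 1), (V2, 1)] m N"
    by (simp_all add: Sigma_path_def path_plus_def path_minus_def path_points_def numeral_2_eq_2)
  have P: "Psi_path V (path_plus q3) = V [(V0, 1), (V1, 1), (V3, q3)]"
    "Psi_path V (path_minus q2) = V [(V3, 1), (V2, 1), (V0, 1 / q2)]"
    by (simp_all add: Psi_path_def path_plus_def path_minus_def path_points_def)
  show "free_field V q2 q3 q h CurE m N = cst (1 / (q - 1 / q)) * (V [(V0, 1)] m N + V [(V0, 1), (V1, 1)] m N)"
    "free_field V q2 q3 q h CurF m N
      = cst (- (1 / (q - 1 / q) * (q ^ 2 * h ^ 2) powi m)) * (V [(V3, 1)] m N + V [(V3, 1), (V2, 1)] m N)"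
    "free_field V q2 q3 q h CurPsiM m N = cst ((1 / h) powi m) * V [(V0, 1), (V1, 1), (V3, q3)] m N"
    "free_field V q2 q3 q h CurPsiP m N = cst ((q ^ 2 * h) powi m) * V [(V3, 1), (V2, 1), (V0, 1 / q2)] m N"
    by (simp_all only: free_field.simps S P rescale_def cst_cst cst_uminus mult_minus_left)
qed

context screening_presentation
begin

lemma contrS_I: "(\<And>n. n > 0 \<Longrightarrow> (\<Sum>(i, u)\<leftarrow>ps. Cmat_pow n q Q i k / u ^ n) = (q ^ n - 1 / q ^ n) * (\<beta> ^ n - \<alpha> ^ n))
    \<Longrightarrow> contrS ps (ratio \<alpha> \<beta>)"
  unfolding contrS_def using q_generic by (intro ctr_seq_cong[OF ctr_seq_ratio]) simp

lemma contrT_I: "(\<And>n. n > 0 \<Longrightarrow> - (\<Sum>(i, u)\<leftarrow>ps. u ^ n * Cmat_pow n q Q k i) = (q ^ n - 1 / q ^ n) * (\<beta> ^ n - \<alpha> ^ n))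
    \<Longrightarrow> contrT ps (ratio \<alpha> \<beta>)"
  unfolding contrT_def using q_generic by (intro ctr_seq_cong[OF ctr_seq_ratio]) simp

text \<open>With contractions 1 - c x and 1 - 1/(c x) and with EE = -1 the scalar series is (1 - c
  x)/c + x (1 - 1/(c x)) = 0.\<close>

lemma screening_anticommuting:
  assumes "contrS ps (ratio c 0)" "contrT ps (ratio (1 / c) 0)" "CC ps = c" "EE ps = - 1" "kap ps = 1" "c \<noteq> 0"
  shows "null (\<lambda>M. FF ps m M * SS M + SS M * FF ps m M)"
proof -
  have r: "extz (ratio x 0) s = (if s = 0 then 1 else if s = 1 then - x else 0)" for x s
    using extz_ratio_step[of x 0 s] by simp
  have "null (\<lambda>M. FF ps m M * SS M + cst 1 * (SS M * FF ps m M))"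
    by (rule screening_single[OF assms(1,2)]) (use assms(3-) in \<open>auto simp: r\<close>)
  then show ?thesis by simp
qed

text \<open>Nothing contracts and EE = 0, so a constant is left: 1/CC from one order against kap
  from the other.\<close>

lemma screening_commuting:
  assumes "contrS ps (ratio 1 1)" "contrT ps (ratio 1 1)" "1 / CC ps = kap ps" "EE ps = 0" "kap ps \<noteq> 0"
  shows "null (\<lambda>M. FF ps m M * SS M - SS M * FF ps m M)"
proof -
  have "null (\<lambda>M. FF ps m M * SS M + cst (- 1) * (SS M * FF ps m M))"
    by (rule screening_single[OF assms(1,2)]) (use assms(3-) in \<open>auto simp: extz_def ratio_one\<close>)
  then show ?thesis by (simp add: cst_uminus)
qed

end

section \<open>The screening charges of the two unfrozen vertices\<close>

locale qi_screening =
  screening_presentation rels q "QI q1 q2 q3" k + qi_presentation rels ext_nbh q q1 q2 q3 "\<lambda>g. gen (Base g)"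
  for rels :: "vertex ext_gen falg set" and q q1 q2 q3 k
begin

notation sim (infix \<open>\<sim>\<close> 50)

lemma shift_const_QI:
  "shift_const q (QI q1 q2 q3) V1 V0 = q" "shift_const q (QI q1 q2 q3) V1 V2 = 1 / q3"
  "shift_const q (QI q1 q2 q3) V1 V3 = q * q3" "shift_const q (QI q1 q2 q3) V2 V0 = 1 / q"
  "shift_const q (QI q1 q2 q3) V2 V1 = 1 / q3" "shift_const q (QI q1 q2 q3) V2 V3 = q"
  using q_nz q3 by (simp_all add: shift_const_def labels_def QI_def q1 q2 power2_eq_square)

lemma q2_nz: "q2 \<noteq> 0"
  using q2 q_nz by simp

text \<open>The path P_+ passes through vertex 1, so the two terms of E are treated together by
  \<open>screening_pair\<close>. P_- avoids it, and each term of F anticommutes on its own. In psi^+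
  and psi^- the contributions of the vertices 0 and 3 to epsilon cancel.\<close>

lemma screening_V1:
  assumes k: "k = V1"
  shows "null (\<lambda>M. (FF [(V0, 1)] m M + FF [(V0, 1), (V1, 1)] m M) * SS M
      + SS M * (FF [(V0, 1)] m M + FF [(V0, 1), (V1, 1)] m M))"
    "null (\<lambda>M. FF [(V3, 1)] m M * SS M + SS M * FF [(V3, 1)] m M)"
    "null (\<lambda>M. FF [(V3, 1), (V2, 1)] m M * SS M + SS M * FF [(V3, 1), (V2, 1)] m M)"
    "null (\<lambda>M. FF [(V0, 1), (V1, 1), (V3, q3)] m M * SS M - SS M * FF [(V0, 1), (V1, 1), (V3, q3)] m M)"
    "null (\<lambda>M. FF [(V3, 1), (V2, 1), (V0, 1 / q2)] m M * SS M - SS M * FF [(V3, 1), (V2, 1), (V0, 1 / q2)] m M)"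
proof -
  have shc: "shc V0 = q" "shc V1 = 1 / q ^ 2" "shc V2 = 1 / q3" "shc V3 = q * q3"
    unfolding shc_def by (simp_all add: k shift_const_QI)
  have kap: "kap [(V0, 1), (V1, 1), (V3, q3)] = 1 / q3" "kap [(V3, 1), (V2, 1), (V0, 1 / q2)] = 1 / q ^ 2"
    by (simp_all add: k eps_QI power_int_minus, simp_all add: q2 inverse_eq_divide)
  have S: "contrS [(V0, 1)] (ratio 0 (1 / q))" "contrS [(V0, 1), (V1, 1)] (ratio 0 q)"
    "contrS [(V3, 1)] (ratio (q * q3) 0)" "contrS [(V3, 1), (V2, 1)] (ratio q 0)"
    "contrS [(V0, 1), (V1, 1), (V3, q3)] (ratio 1 1)" "contrS [(V3, 1), (V2, 1), (V0, 1 / q2)] (ratio 1 1)"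
    by (rule contrS_I, simp only: contr_expand k,
        use q_nz q3 in \<open>simp add: contr_simps field_simps power2_eq_square\<close>)+
  have T: "contrT [(V0, 1)] (ratio 0 q)" "contrT [(V0, 1), (V1, 1)] (ratio 0 (1 / q))"
    "contrT [(V3, 1)] (ratio (1 / (q * q3)) 0)" "contrT [(V3, 1), (V2, 1)] (ratio (1 / q) 0)"
    "contrT [(V0, 1), (V1, 1), (V3, q3)] (ratio 1 1)" "contrT [(V3, 1), (V2, 1), (V0, 1 / q2)] (ratio 1 1)"
    by (rule contrT_I, simp only: contr_expand k,
        use q_nz q3 in \<open>simp add: contr_simps field_simps power2_eq_square\<close>)+
  have C: "CC [(V3, 1)] = q * q3" "CC [(V3, 1), (V2, 1)] = q"
    "1 / CC [(V0, 1), (V1, 1), (V3, q3)] = kap [(V0, 1), (V1, 1), (V3, q3)]"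
    "1 / CC [(V3, 1), (V2, 1), (V0, 1 / q2)] = kap [(V3, 1), (V2, 1), (V0, 1 / q2)]"
    unfolding kap using q_nz q3 by (simp_all add: shc field_simps power2_eq_square)
  show "null (\<lambda>M. (FF [(V0, 1)] m M + FF [(V0, 1), (V1, 1)] m M) * SS M
      + SS M * (FF [(V0, 1)] m M + FF [(V0, 1), (V1, 1)] m M))"
    by (subst (1 2) k[symmetric], rule screening_pair)
      (use S(1,2) T(1,2) in \<open>simp_all only: k shift_const_QI eps_QI vertex.distinct not_False_eq_True\<close>)
  show "null (\<lambda>M. FF [(V3, 1)] m M * SS M + SS M * FF [(V3, 1)] m M)"
    by (rule screening_anticommuting[where c = "q * q3"])
      (use S(3) T(3) C(1) q_nz q3 in \<open>simp_all add: k eps_QI\<close>)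
  show "null (\<lambda>M. FF [(V3, 1), (V2, 1)] m M * SS M + SS M * FF [(V3, 1), (V2, 1)] m M)"
    by (rule screening_anticommuting[where c = q])
      (use S(4) T(4) C(2) q_nz q3 in \<open>simp_all add: k eps_QI\<close>)
  show "null (\<lambda>M. FF [(V0, 1), (V1, 1), (V3, q3)] m M * SS M - SS M * FF [(V0, 1), (V1, 1), (V3, q3)] m M)"
    by (rule screening_commuting[OF S(5) T(5) C(3)])
      (use q_nz q3 q2_nz in \<open>simp_all add: k eps_QI kap\<close>)
  show "null (\<lambda>M. FF [(V3, 1), (V2, 1), (V0, 1 / q2)] m M * SS M - SS M * FF [(V3, 1), (V2, 1), (V0, 1 / q2)] m M)"
    by (rule screening_commuting[OF S(6) T(6) C(4)])
      (use q_nz q3 q2_nz in \<open>simp_all add: k eps_QI kap\<close>)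
qed

text \<open>The two paths exchange roles: now P_- passes through the screened vertex, and F is the
  current whose terms are treated as a pair.\<close>

lemma screening_V2:
  assumes k: "k = V2"
  shows "null (\<lambda>M. (FF [(V3, 1)] m M + FF [(V3, 1), (V2, 1)] m M) * SS M
      + SS M * (FF [(V3, 1)] m M + FF [(V3, 1), (V2, 1)] m M))"
    "null (\<lambda>M. FF [(V0, 1)] m M * SS M + SS M * FF [(V0, 1)] m M)"
    "null (\<lambda>M. FF [(V0, 1), (V1, 1)] m M * SS M + SS M * FF [(V0, 1), (V1, 1)] m M)"
    "null (\<lambda>M. FF [(V0, 1), (V1, 1), (V3, q3)] m M * SS M - SS M * FF [(V0, 1), (V1, 1), (V3, q3)] m M)"
    "null (\<lambda>M. FF [(V3, 1), (V2, 1), (V0, 1 / q2)] m M * SS M - SS M * FF [(V3, 1), (V2, 1), (V0, 1 / q2)] m M)"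
proof -
  have shc: "shc V0 = 1 / q" "shc V1 = 1 / q3" "shc V2 = 1 / q ^ 2" "shc V3 = q"
    unfolding shc_def by (simp_all add: k shift_const_QI)
  have kap: "kap [(V0, 1), (V1, 1), (V3, q3)] = q3" "kap [(V3, 1), (V2, 1), (V0, 1 / q2)] = q ^ 2"
    by (simp_all add: k eps_QI power_int_minus, simp_all add: q2 inverse_eq_divide)
  have S: "contrS [(V3, 1)] (ratio 0 (1 / q))" "contrS [(V3, 1), (V2, 1)] (ratio 0 q)"
    "contrS [(V0, 1)] (ratio (1 / q) 0)" "contrS [(V0, 1), (V1, 1)] (ratio (1 / (q * q3)) 0)"
    "contrS [(V0, 1), (V1, 1), (V3, q3)] (ratio 1 1)" "contrS [(V3, 1), (V2, 1), (V0, 1 / q2)] (ratio 1 1)"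
    by (rule contrS_I, simp only: contr_expand k,
        use q_nz q3 in \<open>simp add: contr_simps field_simps power2_eq_square\<close>)+
  have T: "contrT [(V3, 1)] (ratio 0 q)" "contrT [(V3, 1), (V2, 1)] (ratio 0 (1 / q))"
    "contrT [(V0, 1)] (ratio q 0)" "contrT [(V0, 1), (V1, 1)] (ratio (q * q3) 0)"
    "contrT [(V0, 1), (V1, 1), (V3, q3)] (ratio 1 1)" "contrT [(V3, 1), (V2, 1), (V0, 1 / q2)] (ratio 1 1)"
    by (rule contrT_I, simp only: contr_expand k,
        use q_nz q3 in \<open>simp add: contr_simps field_simps power2_eq_square\<close>)+
  have C: "CC [(V0, 1)] = 1 / q" "CC [(V0, 1), (V1, 1)] = 1 / (q * q3)"
    "1 / CC [(V0, 1), (V1, 1), (V3, q3)] = kap [(V0, 1), (V1, 1), (V3, q3)]"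
    "1 / CC [(V3, 1), (V2, 1), (V0, 1 / q2)] = kap [(V3, 1), (V2, 1), (V0, 1 / q2)]"
    unfolding kap using q_nz q3 by (simp_all add: shc field_simps power2_eq_square)
  show "null (\<lambda>M. (FF [(V3, 1)] m M + FF [(V3, 1), (V2, 1)] m M) * SS M
      + SS M * (FF [(V3, 1)] m M + FF [(V3, 1), (V2, 1)] m M))"
    by (subst (1 2) k[symmetric], rule screening_pair)
      (use S(1,2) T(1,2) in \<open>simp_all only: k shift_const_QI eps_QI vertex.distinct not_False_eq_True\<close>)
  show "null (\<lambda>M. FF [(V0, 1)] m M * SS M + SS M * FF [(V0, 1)] m M)"
    by (rule screening_anticommuting[where c = "1 / q"])
      (use S(3) T(3) C(1) q_nz q3 in \<open>simp_all add: k eps_QI\<close>)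
  show "null (\<lambda>M. FF [(V0, 1), (V1, 1)] m M * SS M + SS M * FF [(V0, 1), (V1, 1)] m M)"
    by (rule screening_anticommuting[where c = "1 / (q * q3)"])
      (use S(4) T(4) C(2) q_nz q3 in \<open>simp_all add: k eps_QI\<close>)
  show "null (\<lambda>M. FF [(V0, 1), (V1, 1), (V3, q3)] m M * SS M - SS M * FF [(V0, 1), (V1, 1), (V3, q3)] m M)"
    by (rule screening_commuting[OF S(5) T(5) C(3)])
      (use q_nz q3 q2_nz in \<open>simp_all add: k eps_QI kap\<close>)
  show "null (\<lambda>M. FF [(V3, 1), (V2, 1), (V0, 1 / q2)] m M * SS M - SS M * FF [(V3, 1), (V2, 1), (V0, 1 / q2)] m M)"
    by (rule screening_commuting[OF S(6) T(6) C(4)])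
      (use q_nz q3 q2_nz in \<open>simp_all add: k eps_QI kap\<close>)
qed

lemma null_anticommutator_scaled:
  assumes "null (\<lambda>M. f M * SS M + SS M * f M)"
  shows "null (\<lambda>M. cst c * f M * SS M + SS M * (cst c * f M))"
  using null_lmult[OF assms, of "\<lambda>_. cst c"] by (simp add: distrib_left cst_comm_assoc[of "SS _"] mult.assoc)

lemma null_commutator_scaled:
  assumes "null (\<lambda>M. f M * SS M - SS M * f M)"
  shows "null (\<lambda>M. cst c * f M * SS M - SS M * (cst c * f M))"
  using null_lmult[OF assms, of "\<lambda>_. cst c"] by (simp add: right_diff_distrib cst_comm_assoc[of "SS _"] mult.assoc)

lemma null_anticommutator_add:
  assumes "null (\<lambda>M. f M * SS M + SS M * f M)" "null (\<lambda>M. g M * SS M + SS M * g M)"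
  shows "null (\<lambda>M. (f M + g M) * SS M + SS M * (f M + g M))"
  using null_add[OF assms] by (simp add: algebra_simps)

lemma cauchy_free_field: "cauchy (free_field FF q2 q3 q h cur m)"
  by (cases cur; simp only: free_field_expand[abs_def];
      intro cauchy_mult cauchy_add cauchy_const cauchy_FF)

lemma free_field_screening:
  assumes "k \<in> {V1, V2}"
  shows "cur \<in> {CurE, CurF} \<Longrightarrow> null (\<lambda>M. free_field FF q2 q3 q h cur m M * SS M + SS M * free_field FF q2 q3 q h cur m M)"
    "cur \<in> {CurPsiP, CurPsiM} \<Longrightarrow> null (\<lambda>M. free_field FF q2 q3 q h cur m M * SS M - SS M * free_field FF q2 q3 q h cur m M)"
proof -
  have 1: "null (\<lambda>M. (FF [(V0, 1)] m M + FF [(V0, 1), (V1, 1)] m M) * SS M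
      + SS M * (FF [(V0, 1)] m M + FF [(V0, 1), (V1, 1)] m M))"
    "null (\<lambda>M. (FF [(V3, 1)] m M + FF [(V3, 1), (V2, 1)] m M) * SS M
      + SS M * (FF [(V3, 1)] m M + FF [(V3, 1), (V2, 1)] m M))"
    using assms screening_V1[of m] screening_V2[of m] null_anticommutator_add by blast+
  have 2: "null (\<lambda>M. FF [(V0, 1), (V1, 1), (V3, q3)] m M * SS M - SS M * FF [(V0, 1), (V1, 1), (V3, q3)] m M)"
    "null (\<lambda>M. FF [(V3, 1), (V2, 1), (V0, 1 / q2)] m M * SS M - SS M * FF [(V3, 1), (V2, 1), (V0, 1 / q2)] m M)"
    using assms screening_V1[of m] screening_V2[of m] by blast+
  show "cur \<in> {CurE, CurF} \<Longrightarrow> null (\<lambda>M. free_field FF q2 q3 q h cur m M * SS M + SS M * free_field FF q2 q3 q h cur m M)"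
    using null_anticommutator_scaled[OF 1(1)] null_anticommutator_scaled[OF 1(2)]
    by (elim insertE emptyE; simp only: free_field_expand)
  show "cur \<in> {CurPsiP, CurPsiM} \<Longrightarrow> null (\<lambda>M. free_field FF q2 q3 q h cur m M * SS M - SS M * free_field FF q2 q3 q h cur m M)"
    using null_commutator_scaled[OF 2(1)] null_commutator_scaled[OF 2(2)]
    by (elim insertE emptyE; simp only: free_field_expand)
qed

lemma ccl_screening:
  assumes "k \<in> {V1, V2}"
  shows "(\<forall>m. ccl (free_field FF q2 q3 q h cur m) \<otimes>\<^bsub>AA\<^esub> ccl SS = ccl SS \<otimes>\<^bsub>AA\<^esub> ccl (free_field FF q2 q3 q h cur m))
    \<or> (\<forall>m. ccl (free_field FF q2 q3 q h cur m) \<otimes>\<^bsub>AA\<^esub> ccl SS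
        \<oplus>\<^bsub>AA\<^esub> ccl SS \<otimes>\<^bsub>AA\<^esub> ccl (free_field FF q2 q3 q h cur m) = \<zero>\<^bsub>AA\<^esub>)"
proof -
  note c = cauchy_free_field[of h cur] cauchy_SS
  consider "cur \<in> {CurE, CurF}" | "cur \<in> {CurPsiP, CurPsiM}" by (cases cur) auto
  then show ?thesis
  proof cases
    case 1
    have "ccl (free_field FF q2 q3 q h cur m) \<otimes>\<^bsub>AA\<^esub> ccl SS
        \<oplus>\<^bsub>AA\<^esub> ccl SS \<otimes>\<^bsub>AA\<^esub> ccl (free_field FF q2 q3 q h cur m) = \<zero>\<^bsub>AA\<^esub>" for m
      unfolding ccl_mult[OF c] ccl_mult[OF c(2,1)] ccl_add[OF cauchy_mult[OF c] cauchy_mult[OF c(2,1)]] ccl_zero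
      by (rule ccl_eqI[OF cauchy_add[OF cauchy_mult[OF c] cauchy_mult[OF c(2,1)]] cauchy_const])
        (simp only: diff_0_right free_field_screening(1)[OF assms 1])
    then show ?thesis by blast
  next
    case 2
    have "ccl (free_field FF q2 q3 q h cur m) \<otimes>\<^bsub>AA\<^esub> ccl SS = ccl SS \<otimes>\<^bsub>AA\<^esub> ccl (free_field FF q2 q3 q h cur m)" for m
      unfolding ccl_mult[OF c] ccl_mult[OF c(2,1)]
      by (rule ccl_eqI[OF cauchy_mult[OF c] cauchy_mult[OF c(2,1)] free_field_screening(2)[OF assms 2]])
    then show ?thesis by blast
  qed
qed

end

lemma currents_screening:
  assumes "q \<noteq> 0" "q2 = q ^ 2" "q1 = 1 / (q ^ 2 * q3)" "q3 \<noteq> 0"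
    and "\<And>n. n > 0 \<Longrightarrow> q ^ n - 1 / q ^ n \<noteq> 0" and k: "k \<in> {V1, V2}"
  shows "commutes_with_screening q1 q2 q3 q h k cur \<or> anticommutes_with_screening q1 q2 q3 q h k cur"
proof -
  let ?R = "I_ext_rels q1 q2 q3 q k"
  have aq: "aq_rels q (QI q1 q2 q3) (\<lambda>g. gen (Base g)) \<subseteq> ?R" and ext: "ext_rels q (QI q1 q2 q3) k \<subseteq> ?R"
    unfolding I_ext_rels_def ext_rels_def by blast+
  interpret ext_cong ?R q "QI q1 q2 q3" k by unfold_locales (rule aq ext)+
  \<comment> \<open>Continuity is proved inside \<open>ext_cong\<close>, from the relations alone,
    and has to be available before the locale of screening charges can be entered.\<close>
  interpret filtered_presentation ?R ext_nbh by (rule filtered_ext)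
  have "shift_const q (QI q1 q2 q3) k j \<noteq> 0" if "j \<noteq> k" for j
    using assms that by (cases j) (auto simp: shift_const_def labels_def QI_def)
  then interpret qi_screening ?R q q1 q2 q3 k
    by unfold_locales (rule aq assms | blast | simp add: ext_nbh_def)+
  show ?thesis
    using ccl_screening[OF k, of h cur]
    unfolding commutes_with_screening_def anticommutes_with_screening_def Let_def alg_I_ext_def cls_I_ext_def .
qed

theorem proposition3p12:
  fixes q1 q2 q3 q h :: complex
  assumes nonzero: "q1 \<noteq> 0" "q2 \<noteq> 0" "q3 \<noteq> 0"
    and product: "q1 * q2 * q3 = 1"
    and generic: "\<And>a b c :: int. q1 powi a * q2 powi b * q3 powi c = 1 \<Longrightarrow> a = b \<and> b = c"
    and root: "q^2 = q2"
    and level: "(h^2)^2 = q3 / q2"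
  shows "(\<exists>\<phi>. is_free_field_realization q1 q2 q3 q h \<phi>) \<and>
    (\<forall>k\<in>{V1, V2}. \<forall>cur.
       commutes_with_screening q1 q2 q3 q h k cur \<or>
       anticommutes_with_screening q1 q2 q3 q h k cur)"
proof -
  have q: "q \<noteq> 0" and q2: "q2 = q ^ 2" using nonzero root by auto
  have q1: "q1 = 1 / (q ^ 2 * q3)" using product nonzero q2 by (simp add: field_simps)
  \<comment> \<open>q^(2n) = q2^n, and genericity for the exponents (0, n, 0) excludes the value 1;
    this keeps the denominators of the screening currents nonzero.\<close>
  have gen: "q ^ n - 1 / q ^ n \<noteq> 0" if "n > 0" for n
  proof
    assume "q ^ n - 1 / q ^ n = 0"
    then have "(q ^ n) ^ 2 = 1" using q by (simp add: field_simps power2_eq_square)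
    then have "q2 ^ n = 1" by (simp add: q2 power_mult[symmetric] mult.commute)
    then show False using generic[of 0 "int n" 0] that by simp
  qed
  have "q ^ 2 \<noteq> 1" using generic[of 0 1 0] q2 by auto
  moreover have "q3 = q ^ 2 * h ^ 4" using level nonzero q2 by (simp add: field_simps power_mult[symmetric])
  moreover have "h \<noteq> 0" using level nonzero by auto
  ultimately have "\<exists>\<phi>. is_free_field_realization q1 q2 q3 q h \<phi>"
    using free_field_realization[OF q q2 q1 nonzero(3)] by blast
  then show ?thesis using currents_screening[OF q q2 q1 nonzero(3) gen] by blast
qed

end
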